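(* In the setting below, suppose Assumptions A and B hold. For any $\alpha>1$ let $k=\alpha\sigma^{2/3}/L_F$, $\omega=\max(2\sigma^2,(16L_F^2k)^3)$ and $c=\frac{\sigma^2}{14L_Fk^3}+130L_F^4$, and set $\eta_t=k/(\omega+t\sigma^2)^{1/3}$, $\beta_t=c\eta_t^2$. Running ASCDRO for $T$ iterations and returning $\mathbf x_\tau$ with $\tau$ uniform on $\{1,\dots,T\}$ gives $$\mathbb E\big[\operatorname{dist}(0,\hat\partial\bar F(\mathbf x_\tau))^2\big]\le\mathcal O\Big(\frac{\log T}{T^{2/3}}\Big).$$
   Context: Setting. $\mathcal W\subset\mathbb R^d$ is nonempty closed convex; $\ell_1,\dots,\ell_n:\mathbb R^d\to\mathbb R$ are twice differentiable losses with $\ell_i\ge0$ on $\mathcal W$; $\lambda_0>0,\rho>0$. For $\mathbf x=(\mathbf w^\top,\lambda)^\top$, $\lambda>0$: $g_i(\mathbf x)=\exp(\ell_i(\mathbf w)/\lambda)$, $g(\mathbf x)=\frac1n\sum_ig_i(\mathbf x)$, $F(\mathbf x)=\lambda\log g(\mathbf x)+\lambda\rho$, $\nabla g_i=(\partial_{\mathbf w}g_i^\top,\partial_\lambda g_i)^\top$, and $\nabla f_\lambda(s)=\lambda/s$. Assumption A: (a) $\|\mathbf w\|\le R$ for all $\mathbf w\in\mathcal W$; (b) $\|\nabla\ell_i(\mathbf w)\|\le G$ and $|\ell_i(\mathbf w)|\le C$ on $\mathcal W$, all $i$; (c) $\|\nabla\ell_i(\mathbf w_1)-\nabla\ell_i(\mathbf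 w_2)\|\le L\|\mathbf w_1-\mathbf w_2\|$ on $\mathcal W$; (d) $F(\mathbf w_1,\lambda_1)-\min_{\mathbf w\in\mathcal W,\lambda\ge\lambda_0}F(\mathbf w,\lambda)\le\Delta<\infty$ for the initial point $\mathbf x_1=(\mathbf w_1,\lambda_1)\in\mathcal X$. $\tilde\lambda=\lambda_0+C/\rho$, $\mathcal X=\{\mathbf x:\mathbf w\in\mathcal W,\lambda_0\le\lambda\le\tilde\lambda\}$, $\Pi_{\mathcal X}$ Euclidean projection, $\delta_{\mathcal X}$ indicator of $\mathcal X$, $\bar F=F+\delta_{\mathcal X}$. Assumption B: for $i$ uniform on $\{1,\dots,n\}$ and all $\mathbf x\in\mathcal X$, $\mathbb E|g_i(\mathbf x)-g(\mathbf x)|^2\le\sigma_g^2$, $\mathbb E\|\nabla g_i(\mathbf x)-\nabla g(\mathbf x)\|^2\le\sigma_{\nabla g}^2$; $\sigma^2:=\max\{\sigma_g^2,\sigma_{\nabla g}^2\}$. $L_F=\tilde\lambda L_g^2+2L_g+\tilde\lambda L_{\nabla g}+1+\tilde\lambda$ with $L_g=e^{C/\lambda_0}(\frac G{\lambda_0}+\frac C{\lambda_0^2})$, $L_{\nabla g}=\sqrt{L_A^2+L_B^2+L_C^2+L_D^2}$, $L_A=e^{C/\lambda_0}(\frac{G^2}{\lambda_0^2}+\frac L{\lambda_0})$, $L_B=e^{C/\lambda_0}(\frac{CG}{\lambda_0^3}+\frac G{\lambda_0^2})$, $L_C=e^{C/\lambda_0}\frac{CG+\lambda_0G}{\lambda_0^3}$,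 $L_D=e^{C/\lambda_0}\frac{C^2+2\lambda_0C}{\lambda_0^4}$. Regular subgradient: $\mathbf v\in\hat\partial\Phi(\bar{\mathbf x})$ iff $\liminf_{\mathbf x\to\bar{\mathbf x}}\frac{\Phi(\mathbf x)-\Phi(\bar{\mathbf x})-\mathbf v^\top(\mathbf x-\bar{\mathbf x})}{\|\mathbf x-\bar{\mathbf x}\|}\ge0$; $\operatorname{dist}(0,S)=\inf_{\mathbf v\in S}\|\mathbf v\|$. ASCDRO (indices $i$ i.i.d. uniform on $\{1,\dots,n\}$): draw $i$, set $s_1=g_i(\mathbf x_1)$, $\mathbf v_1=\partial_{\mathbf w}g_i(\mathbf x_1)$, $u_1=\partial_\lambda g_i(\mathbf x_1)$. For $t=1,\dots,T$: $\mathbf z_t=(\nabla f_{\lambda_t}(s_t)\mathbf v_t^\top,\ \nabla f_{\lambda_t}(s_t)u_t+\log s_t+\rho)^\top$, $\mathbf x_{t+1}=\Pi_{\mathcal X}(\mathbf x_t-\eta_t\mathbf z_t)$; draw a fresh $i$ and set $\mathbf v_{t+1}=\partial_{\mathbf w}g_i(\mathbf x_{t+1})+(1-\beta_t)(\mathbf v_t-\partial_{\mathbf w}g_i(\mathbf x_t))$, $u_{t+1}=\partial_\lambda g_i(\mathbf x_{t+1})+(1-\beta_t)(u_t-\partial_\lambda g_i(\mathbf x_t))$, $s_{t+1}=g_i(\mathbf x_{t+1})+(1-\beta_t)(s_t-g_i(\mathbf x_t))$. Output $(\mathbf x_\tau,\mathbf v_\tau,u_\tau,s_\tau)$ with $\tau$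 uniform on $\{1,\dots,T\}$. The $\mathcal O(\cdot)$ hides constants independent of $T$. *)

theory Defs
  imports "HOL-Analysis.Analysis"
begin

definition grad :: "('b::real_inner \<Rightarrow> real) \<Rightarrow> 'b \<Rightarrow> 'b" where
  "grad f x = (THE v. (f has_derivative (\<lambda>h. v \<bullet> h)) (at x))"

definition gi :: "(nat \<Rightarrow> 'a::euclidean_space \<Rightarrow> real) \<Rightarrow> nat \<Rightarrow> 'a \<times> real \<Rightarrow> real" where
  "gi l i x = exp (l i (fst x) / snd x)"

definition gbar :: "nat \<Rightarrow> (nat \<Rightarrow> 'a::euclidean_space \<Rightarrow> real) \<Rightarrow> 'a \<times> real \<Rightarrow> real" where
  "gbar n l x = (\<Sum>i<n. gi l i x) / real n"

definition Fobj :: "nat \<Rightarrow> (nat \<Rightarrow> 'a::euclidean_space \<Rightarrow> real) \<Rightarrow> real \<Rightarrow> 'a \<times> real \<Rightarrow> real" where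
  "Fobj n l \<rho> x = snd x * ln (gbar n l x) + snd x * \<rho>"

definition Xset :: "'a set \<Rightarrow> real \<Rightarrow> real \<Rightarrow> ('a \<times> real) set" where
  "Xset W lam0 lamt = {x. fst x \<in> W \<and> lam0 \<le> snd x \<and> snd x \<le> lamt}"

definition lam_tilde :: "real \<Rightarrow> real \<Rightarrow> real \<Rightarrow> real" where
  "lam_tilde lam0 C \<rho> = lam0 + C / \<rho>"

definition Fbar :: "nat \<Rightarrow> (nat \<Rightarrow> 'a::euclidean_space \<Rightarrow> real) \<Rightarrow> real \<Rightarrow> ('a \<times> real) set
    \<Rightarrow> 'a \<times> real \<Rightarrow> ereal" where
  "Fbar n l \<rho> X x = (if x \<in> X then ereal (Fobj n l \<rho> x) else \<infinity>)"

definition regular_subdiff :: "('b::real_inner \<Rightarrow> ereal) \<Rightarrow> 'b \<Rightarrow> 'b set" where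
  "regular_subdiff \<Phi> xb = {v. Liminf (at xb)
      (\<lambda>x. (\<Phi> x - \<Phi> xb - ereal (v \<bullet> (x - xb))) / ereal (norm (x - xb))) \<ge> 0}"

text \<open>dist(0,S) = inf of norms (= +infinity for empty S).\<close>
definition dist0 :: "'b::real_normed_vector set \<Rightarrow> ereal" where
  "dist0 S = (INF v\<in>S. ereal (norm v))"

text \<open>ASCDRO. State number t (t = 0,1,...) is the paper's iterate t+1, i.e. the tuple
  (x_{t+1}, v_{t+1}, u_{t+1}, s_{t+1}). The index sequence idx gives the drawn indices:
  idx 0 is the initial draw, idx t (t>=1) is the fresh draw after the paper's step t.
  eta and beta are indexed as in the paper (eta t = eta_t, t >= 1).\<close>
fun ascdro :: "nat \<Rightarrow> (nat \<Rightarrow> 'a::euclidean_space \<Rightarrow> real) \<Rightarrow> real \<Rightarrow> ('a \<times> real) set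
    \<Rightarrow> (nat \<Rightarrow> real) \<Rightarrow> (nat \<Rightarrow> real) \<Rightarrow> 'a \<times> real \<Rightarrow> (nat \<Rightarrow> nat) \<Rightarrow> nat
    \<Rightarrow> ('a \<times> real) \<times> 'a \<times> real \<times> real" where
  "ascdro n l \<rho> X \<eta> \<beta> x1 idx 0 =
     (let i = idx 0 in
      (x1, fst (grad (gi l i) x1), snd (grad (gi l i) x1), gi l i x1))"
| "ascdro n l \<rho> X \<eta> \<beta> x1 idx (Suc t) =
     (let (x, v, u, s) = ascdro n l \<rho> X \<eta> \<beta> x1 idx t;
          fs = snd x / s;
          z = (fs *\<^sub>R v, fs * u + ln s + \<rho>);
          x' = closest_point X (x - \<eta> (Suc t) *\<^sub>R z);
          i = idx (Suc t);
          b = \<beta> (Suc t);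
          gx' = grad (gi l i) x';
          gx = grad (gi l i) x
      in (x', fst gx' + (1 - b) *\<^sub>R (v - fst gx),
              snd gx' + (1 - b) * (u - snd gx),
              gi l i x' + (1 - b) * (s - gi l i x)))"

text \<open>The paper's x_tau (tau >= 1) for a given index sequence.\<close>
definition ascdro_x :: "nat \<Rightarrow> (nat \<Rightarrow> 'a::euclidean_space \<Rightarrow> real) \<Rightarrow> real \<Rightarrow> ('a \<times> real) set
    \<Rightarrow> (nat \<Rightarrow> real) \<Rightarrow> (nat \<Rightarrow> real) \<Rightarrow> 'a \<times> real \<Rightarrow> (nat \<Rightarrow> nat) \<Rightarrow> nat \<Rightarrow> 'a \<times> real" where
  "ascdro_x n l \<rho> X \<eta> \<beta> x1 idx \<tau> = fst (ascdro n l \<rho> X \<eta> \<beta> x1 idx (\<tau> - 1))"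

definition L_g :: "real \<Rightarrow> real \<Rightarrow> real \<Rightarrow> real" where
  "L_g lam0 C G = exp (C / lam0) * (G / lam0 + C / lam0^2)"

definition L_ng :: "real \<Rightarrow> real \<Rightarrow> real \<Rightarrow> real \<Rightarrow> real" where
  "L_ng lam0 C G L =
     (let LA = exp (C / lam0) * (G^2 / lam0^2 + L / lam0);
          LB = exp (C / lam0) * (C * G / lam0^3 + G / lam0^2);
          LC = exp (C / lam0) * (C * G + lam0 * G) / lam0^3;
          LD = exp (C / lam0) * (C^2 + 2 * lam0 * C) / lam0^4
      in sqrt (LA^2 + LB^2 + LC^2 + LD^2))"

definition L_F :: "real \<Rightarrow> real \<Rightarrow> real \<Rightarrow> real \<Rightarrow> real \<Rightarrow> real" where
  "L_F lam0 C G L \<rho> =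
     (let lt = lam_tilde lam0 C \<rho>; Lg = L_g lam0 C G in
      lt * Lg^2 + 2 * Lg + lt * L_ng lam0 C G L + 1 + lt)"

text \<open>Expectation over i.i.d. uniform indices and uniform tau in {1..T} of
  dist(0, regular subdifferential of F-bar at x_tau)^2. The draws idx 0,...,idx (T-1)
  determine x_1,...,x_T; we average over all n^T such draw sequences.\<close>
definition expected_stationarity ::
  "nat \<Rightarrow> (nat \<Rightarrow> 'a::euclidean_space \<Rightarrow> real) \<Rightarrow> real \<Rightarrow> ('a \<times> real) set
    \<Rightarrow> (nat \<Rightarrow> real) \<Rightarrow> (nat \<Rightarrow> real) \<Rightarrow> 'a \<times> real \<Rightarrow> nat \<Rightarrow> ereal" where
  "expected_stationarity n l \<rho> X \<eta> \<beta> x1 T =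
     ereal (1 / (real n ^ T * real T)) *
     (\<Sum>xs\<in>{xs. length xs = T \<and> set xs \<subseteq> {..<n}}. \<Sum>\<tau>\<in>{1..T}.
        (dist0 (regular_subdiff (Fbar n l \<rho> X) (ascdro_x n l \<rho> X \<eta> \<beta> x1 (\<lambda>k. xs ! k) \<tau>)))^2)"

end

theory Submission
  imports Defs
begin

text \<open>
  The estimate \<open>s\<close> is never clipped, so it may become small or nonpositive, and then the search
  direction carries no information on the gradient. Let \<open>e\<close> be the scaled estimation error, with
  components \<open>lt * (q - grad g)\<close> and \<open>ws * (s - g)\<close>. As long as \<open>s > 1/2\<close> (the state is alive), the
  direction deviates from \<open>grad F\<close> by at most a multiple of \<open>norm e\<close>, and
  \<open>U = |e|^2 + 40 * N^2 * eta * F\<close> decreases in mean up to \<open>O(beta^2)\<close>. Weighting this by \<open>1 / eta^2\<close> and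
  summing by parts gives the rate, provided that the state at time \<open>t\<close> is dead with probability
  \<open>O(t^(-4/3))\<close> only.

  To bound this probability measure time by \<open>tau = (sum of beta)\<close>. In every state the mean of \<open>e\<close> contracts
  at rate \<open>beta\<close>, which brings \<open>s - g\<close> back above a negative constant with a fixed probability. From there a
  submartingale of the form \<open>1 - exp (- mu * (s - g + k))\<close> shows that the state stays alive, while \<open>e\<close> decays
  from \<open>T^(1/3)\<close> to a negative power of \<open>T\<close>, with probability at least \<open>T^(-gamma)\<close>. Here
  \<open>gamma < 1/3\<close> because the projected step moves against \<open>e\<close>, which slightly improves the survival exponent.
  Once \<open>U\<close> is that small, a fifth-moment bound keeps it small with probability \<open>1 - O(T^(-4/3))\<close>. The
  interval \<open>{T/2..T}\<close> contains about \<open>T^(1/3) / ln T\<close> disjoint blocks for such attempts, so they all fail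
  with negligible probability.
\<close>

section \<open>Averages\<close>

text \<open>Three balances fix the exponents. A dead step may raise U by a constant and the weight
  1/eta^2 is of order t^(2/3), so dead states of probability O(t^(-4/3)) contribute only T^(1/3).
  While alive, U has a noise floor of order eta; its m-th moment collects eta^m per unit of tau over
  tau-time T^(1/3), which is T^((1-m)/3), and m = 5 is the first integer that reaches T^(-4/3). In
  dead states only bounded noise against contraction at rate beta is available, so |e|^2 is of order
  1/beta, that is T^(2/3). Bringing |e|^2 down at rate 2 takes tau-time (ln T)/3, and a linear
  function of s - g loses a factor exp(-tau) in survival, that is T^(-1/3). Since the number of
  blocks is T^(1/3) up to a logarithm, this just fails, and any fixed gain in the exponent decides.
  The obstacle to the gain is the variance of one step, of order dx^2, which may dwarf beta. It is
  paid by the correlation of e with the iterate: the same movement that creates the variance lowers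
  this correlation by a multiple of dx^2 / eta.\<close>

definition avg :: "nat \<Rightarrow> (nat \<Rightarrow> real) \<Rightarrow> real" where
 "avg n f = (\<Sum>i<n. f i) / real n"

lemma avg_mono: "(\<And>i. i < n \<Longrightarrow> f i \<le> g i) \<Longrightarrow> avg n f \<le> avg n g"
 unfolding avg_def by (intro divide_right_mono sum_mono) auto

lemma avg_const [simp]: "0 < n \<Longrightarrow> avg n (\<lambda>_. c) = c"
 unfolding avg_def by simp

lemma avg_add: "avg n (\<lambda>i. f i + g i) = avg n f + avg n g"
 unfolding avg_def by (simp add: sum.distrib add_divide_distrib)

lemma avg_diff: "avg n (\<lambda>i. f i - g i) = avg n f - avg n g"
 unfolding avg_def by (simp add: sum_subtractf diff_divide_distrib)

lemma avg_cmult: "avg n (\<lambda>i. c * f i) = c * avg n f"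
 unfolding avg_def by (simp flip: sum_distrib_left)

lemma avg_nonneg: "(\<And>i. i < n \<Longrightarrow> 0 \<le> f i) \<Longrightarrow> 0 \<le> avg n f"
 unfolding avg_def by (intro divide_nonneg_nonneg sum_nonneg) auto

lemma avg_le: "0 < n \<Longrightarrow> (\<And>i. i < n \<Longrightarrow> f i \<le> c) \<Longrightarrow> avg n f \<le> c"
 using avg_mono[of n f "\<lambda>_. c"] by simp

lemma avg_ge: "0 < n \<Longrightarrow> (\<And>i. i < n \<Longrightarrow> c \<le> f i) \<Longrightarrow> c \<le> avg n f"
 using avg_mono[of n "\<lambda>_. c" f] by simp

lemma one_plus_power_le:
 fixes r :: real
 assumes "\<bar>real m * r\<bar> \<le> 1" "0 < m"
 shows "(1 + r) ^ m \<le> 1 + real m * r + (real m)\<^sup>2 * r\<^sup>2"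
proof -
 have "\<bar>r\<bar> \<le> 1"
  using assms by (simp add: abs_mult) (smt (verit) abs_ge_zero mult_le_cancel_right1 nat_less_real_le of_nat_0 of_nat_1)
 hence "0 \<le> 1 + r" by linarith
 hence "(1 + r) ^ m \<le> exp r ^ m" by (intro power_mono) (auto simp: exp_ge_add_one_self)
 also have "\<dots> = exp (real m * r)" by (simp add: exp_of_nat_mult)
 also have "\<dots> \<le> 1 + real m * r + (real m * r)\<^sup>2"
 proof (cases "0 \<le> real m * r")
  case True thus ?thesis using assms exp_bound by force
 next
  case False
  define y where "y = - (real m * r)"
  have y: "0 \<le> y" "y \<le> 1" using False assms unfolding y_def by auto
  have "exp (-y) = 1 / exp y" by (simp add: exp_minus field_simps)
  also have "\<dots> \<le> 1 / (1 + y)" using y exp_ge_add_one_self[of y] by (intro divide_left_mono) auto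
  also have "\<dots> \<le> 1 - y + y\<^sup>2" using y by (simp add: field_simps power2_eq_square)
  finally show ?thesis unfolding y_def by simp
 qed
 finally show ?thesis by (simp add: power_mult_distrib)
qed

text \<open>The bound of \<open>one_plus_power_le\<close> would give the coefficient 25. In
  \<open>U_drift5\<close> the variance has to stay below a gain of \<open>15 * N^2 * dx^2\<close>,
  which needs a coefficient close to the true value 10; hence the restriction to increments of at
  most 1/20.\<close>

lemma one_plus_power5_le:
 fixes r :: real
 assumes "\<bar>r\<bar> \<le> 1/20"
 shows "(1 + r) ^ 5 \<le> 1 + 5 * r + 11 * r\<^sup>2"
proof -
 have eq: "(1 + r) ^ 5 = 1 + 5 * r + 10 * r\<^sup>2 + r\<^sup>2 * (r * (10 + 5 * r + r\<^sup>2))"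
  by (simp add: power2_eq_square power_def numeral_eq_Suc algebra_simps)
 have "r\<^sup>2 \<le> (1/20)\<^sup>2" using assms by (metis abs_ge_zero power2_abs power_mono)
 hence "\<bar>10 + 5 * r + r\<^sup>2\<bar> \<le> 20" using assms by (simp add: power2_eq_square)
 hence "\<bar>r * (10 + 5 * r + r\<^sup>2)\<bar> \<le> (1/20) * 20" unfolding abs_mult using assms by (intro mult_mono) auto
 hence "r * (10 + 5 * r + r\<^sup>2) \<le> 1" by linarith
 hence "r\<^sup>2 * (r * (10 + 5 * r + r\<^sup>2)) \<le> r\<^sup>2 * 1" by (intro mult_left_mono) auto
 thus ?thesis using eq by linarith
qed

section \<open>The error recursion\<close>

text \<open>The drift estimates for \<open>(W + q) ^ m\<close> and \<open>uJ ^ m\<close> pass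
  through this: the m-th power is controlled by the first two moments of an increment that is small
  relative to u.\<close>

lemma avg_power_le:
 fixes u :: real
 assumes n: "0 < n" and m: "0 < m" and u: "0 < u"
  and small: "\<And>i. i < n \<Longrightarrow> real m * \<bar>u' i - u\<bar> \<le> u"
 shows "avg n (\<lambda>i. u' i ^ m) \<le> u ^ m * (1 + real m * (avg n (\<lambda>i. u' i - u) / u)
      + (real m)\<^sup>2 * (avg n (\<lambda>i. (u' i - u)\<^sup>2) / u\<^sup>2))"
proof -
 have "u' i ^ m \<le> u ^ m * (1 + real m * ((u' i - u) / u) + (real m)\<^sup>2 * ((u' i - u)\<^sup>2 / u\<^sup>2))" if "i < n" for i
 proof -
  have "u' i = u * (1 + (u' i - u) / u)" using u by (simp add: field_simps)
  hence "u' i ^ m = u ^ m * (1 + (u' i - u) / u) ^ m" by (metis power_mult_distrib)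
  also have "\<dots> \<le> u ^ m * (1 + real m * ((u' i - u) / u) + (real m)\<^sup>2 * ((u' i - u) / u)\<^sup>2)"
   using u small[OF that] m
   by (intro mult_left_mono one_plus_power_le) (auto simp: abs_mult pos_divide_le_eq)
  finally show ?thesis by (simp add: power_divide)
 qed
 hence "avg n (\<lambda>i. u' i ^ m) \<le> avg n (\<lambda>i. u ^ m * (1 + real m / u * (u' i - u) + (real m)\<^sup>2 / u\<^sup>2 * (u' i - u)\<^sup>2))"
  by (intro avg_mono) (simp add: mult.assoc)
 also have "\<dots> = u ^ m * (1 + real m * (avg n (\<lambda>i. u' i - u) / u)
      + (real m)\<^sup>2 * (avg n (\<lambda>i. (u' i - u)\<^sup>2) / u\<^sup>2))"
  by (simp only: avg_cmult avg_add avg_const[OF n]) simp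
 finally show ?thesis .
qed

lemma avg_power5_le:
 fixes u :: real
 assumes n: "0 < n" and u: "0 < u"
  and small: "\<And>i. i < n \<Longrightarrow> 20 * \<bar>u' i - u\<bar> \<le> u"
 shows "avg n (\<lambda>i. u' i ^ 5) \<le> u ^ 5 * (1 + 5 * (avg n (\<lambda>i. u' i - u) / u)
      + 11 * (avg n (\<lambda>i. (u' i - u)\<^sup>2) / u\<^sup>2))"
proof -
 have "u' i ^ 5 \<le> u ^ 5 * (1 + 5 * ((u' i - u) / u) + 11 * ((u' i - u)\<^sup>2 / u\<^sup>2))" if "i < n" for i
 proof -
  have "u' i = u * (1 + (u' i - u) / u)" using u by (simp add: field_simps)
  hence "u' i ^ 5 = u ^ 5 * (1 + (u' i - u) / u) ^ 5" by (metis power_mult_distrib)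
  also have "\<dots> \<le> u ^ 5 * (1 + 5 * ((u' i - u) / u) + 11 * ((u' i - u) / u)\<^sup>2)"
   using u small[OF that] by (intro mult_left_mono one_plus_power5_le) (auto simp: field_simps)
  finally show ?thesis by (simp add: power_divide)
 qed
 hence "avg n (\<lambda>i. u' i ^ 5) \<le> avg n (\<lambda>i. u ^ 5 * (1 + 5 / u * (u' i - u) + 11 / u\<^sup>2 * (u' i - u)\<^sup>2))"
  by (intro avg_mono) (simp add: mult.assoc)
 also have "\<dots> = u ^ 5 * (1 + 5 * (avg n (\<lambda>i. u' i - u) / u)
      + 11 * (avg n (\<lambda>i. (u' i - u)\<^sup>2) / u\<^sup>2))"
  by (simp only: avg_cmult avg_add avg_const[OF n]) simp
 finally show ?thesis .
qed

text \<open>Abstract form of the iteration: \<open>x\<close> is the iterate, \<open>e\<close> the scaled estimation error, and \<open>e \<bullet> dir = s - g\<close>. The index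
 \<open>t\<close> counts from \<open>0\<close>, so that \<open>eta t\<close> and \<open>beta t\<close> here are \<open>eta (t + 1)\<close> and \<open>beta (t + 1)\<close> of the algorithm.\<close>

locale storm =
 fixes n :: nat and X :: "'x::real_inner set" and Y :: "nat \<Rightarrow> 'x \<Rightarrow> 'h::real_inner"
  and nxt :: "nat \<Rightarrow> 'x \<times> 'h \<Rightarrow> 'x" and \<eta> \<beta> :: "nat \<Rightarrow> real" and F :: "'x \<Rightarrow> real"
  and dir :: 'h and lin :: "'x \<Rightarrow> 'h" and r :: "real \<Rightarrow> real"
  and D N B c h1 h2 h3 Flo Fhi L1 C1 c3 DJ :: real
 assumes n_pos: "0 < n"
  and diam: "\<And>x y. x \<in> X \<Longrightarrow> y \<in> X \<Longrightarrow> norm (x - y) \<le> D"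
  and nxt_in: "\<And>t x e. x \<in> X \<Longrightarrow> nxt t (x, e) \<in> X"
  and Y_lip: "\<And>i x y. i < n \<Longrightarrow> x \<in> X \<Longrightarrow> y \<in> X \<Longrightarrow> norm (Y i x - Y i y) \<le> N * norm (x - y)"
  and Y_bd: "\<And>i x. i < n \<Longrightarrow> x \<in> X \<Longrightarrow> norm (Y i x) \<le> B"
  and N_ge: "1 \<le> N" and B_nn: "0 \<le> B" and c_ge: "130 * N\<^sup>2 \<le> c"
  and h1_pos: "0 < h1" and h3_nn: "0 \<le> h3" and D_nn: "0 \<le> D"
  and eta_lo: "\<And>t. h1 * (real t + 1) powr (-1/3) \<le> \<eta> t"
  and eta_hi: "\<And>t. \<eta> t \<le> h2 * (real t + 1) powr (-1/3)"
  and eta_dec: "\<And>t. \<eta> (Suc t) \<le> \<eta> t"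
  and eta_half: "\<And>s t. t \<le> 2 * s + 1 \<Longrightarrow> \<eta> s \<le> 2 * \<eta> t"
  and eta_diff: "\<And>t. \<eta> t - \<eta> (Suc t) \<le> h3 * (\<eta> t)\<^sup>2"
  and beta_def: "\<And>t. \<beta> t = c * (\<eta> t)\<^sup>2"
  and beta_le1: "\<And>t. \<beta> t \<le> 1"
  and Flo_pos: "0 < Flo" and F_bd: "\<And>x. x \<in> X \<Longrightarrow> Flo \<le> F x \<and> F x \<le> Fhi"
  and F_lip: "\<And>x y. x \<in> X \<Longrightarrow> y \<in> X \<Longrightarrow> \<bar>F x - F y\<bar> \<le> L1 * norm (x - y)"
  and L1_nn: "0 \<le> L1" and C1_nn: "0 \<le> C1" and c3_pos: "0 < c3" and DJ_nn: "0 \<le> DJ"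
  and H1: "\<And>t x e. x \<in> X \<Longrightarrow> - 1/2 < e \<bullet> dir \<Longrightarrow>
        norm (nxt t (x, e) - x) \<le> \<eta> t * C1 * (1 + norm e)"
  and H2: "\<And>t x e. x \<in> X \<Longrightarrow> - 1/2 < e \<bullet> dir \<Longrightarrow>
        F (nxt t (x, e)) \<le> F x - 3/8 * (norm (nxt t (x, e) - x))\<^sup>2 / \<eta> t + 4 * \<eta> t * (norm e)\<^sup>2"
  and H3: "\<And>t x e. x \<in> X \<Longrightarrow> - 1/2 < e \<bullet> dir \<Longrightarrow>
        e \<bullet> (lin (nxt t (x, e)) - lin x)
         \<le> - c3 * (norm (nxt t (x, e) - x))\<^sup>2 / \<eta> t + \<eta> t * r (e \<bullet> dir)"
  and r_bd: "\<And>\<delta>. 0 < \<delta> \<Longrightarrow> \<exists>C. \<forall>y\<ge>-1/2. r y \<le> \<delta> * y\<^sup>2 + C"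
  and lin_bd: "\<And>x. x \<in> X \<Longrightarrow> norm (lin x) \<le> DJ"
  and lin_lip: "\<And>x y. x \<in> X \<Longrightarrow> y \<in> X \<Longrightarrow> norm (lin x - lin y) \<le> DJ * norm (x - y)"
begin

definition Ybar :: "'x \<Rightarrow> 'h" where "Ybar x = (1 / real n) *\<^sub>R (\<Sum>i<n. Y i x)"

definition xi :: "nat \<Rightarrow> 'x \<Rightarrow> 'x \<Rightarrow> nat \<Rightarrow> 'h" where
 "xi t x x' i = Y i x' - Ybar x' - (1 - \<beta> t) *\<^sub>R (Y i x - Ybar x)"

definition step :: "nat \<Rightarrow> 'x \<times> 'h \<Rightarrow> nat \<Rightarrow> 'x \<times> 'h" where
 "step t sg i = (nxt t sg, (1 - \<beta> t) *\<^sub>R snd sg + xi t (fst sg) (nxt t sg) i)"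

definition A :: "nat \<Rightarrow> ('x \<times> 'h \<Rightarrow> real) \<Rightarrow> 'x \<times> 'h \<Rightarrow> real" where
 "A t \<phi> sg = avg n (\<lambda>i. \<phi> (step t sg i))"

text \<open>\<open>A t\<close> integrates out the next draw and \<open>pr t k\<close> the next k
  draws from time t on. Iterated finite averages take the place of a probability space; an event
  enters as \<open>of_bool\<close>.\<close>

primrec pr :: "nat \<Rightarrow> nat \<Rightarrow> ('x \<times> 'h \<Rightarrow> real) \<Rightarrow> 'x \<times> 'h \<Rightarrow> real" where
 "pr t 0 \<phi> = \<phi>"
| "pr t (Suc k) \<phi> = A t (pr (Suc t) k \<phi>)"

definition S :: "('x \<times> 'h) set" where "S = X \<times> UNIV"

lemma step_S: "sg \<in> S \<Longrightarrow> step t sg i \<in> S"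
 unfolding S_def step_def using nxt_in by (cases sg) auto

lemma A_mono: "sg \<in> S \<Longrightarrow> (\<And>sg. sg \<in> S \<Longrightarrow> \<phi> sg \<le> \<psi> sg) \<Longrightarrow> A t \<phi> sg \<le> A t \<psi> sg"
 unfolding A_def using step_S by (intro avg_mono) auto

lemma A_const [simp]: "A t (\<lambda>_. k) sg = k"
 unfolding A_def using n_pos by simp
lemma A_add: "A t (\<lambda>sg. \<phi> sg + \<psi> sg) sg = A t \<phi> sg + A t \<psi> sg"
 unfolding A_def by (rule avg_add)
lemma A_diff: "A t (\<lambda>sg. \<phi> sg - \<psi> sg) sg = A t \<phi> sg - A t \<psi> sg"
 unfolding A_def by (rule avg_diff)
lemma A_cmult: "A t (\<lambda>sg. k * \<phi> sg) sg = k * A t \<phi> sg"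
 unfolding A_def by (rule avg_cmult)

lemma pr_mono:
 "sg \<in> S \<Longrightarrow> (\<And>sg. sg \<in> S \<Longrightarrow> \<phi> sg \<le> \<psi> sg) \<Longrightarrow> pr t k \<phi> sg \<le> pr t k \<psi> sg"
proof (induction k arbitrary: t sg)
 case (Suc k)
 show ?case unfolding pr.simps by (rule A_mono[OF Suc.prems(1)]) (use Suc in blast)
qed simp

lemma pr_const [simp]: "pr t k (\<lambda>_. a) sg = a"
 by (induction k arbitrary: t sg) (use n_pos in \<open>simp_all add: A_def\<close>)
lemma pr_add: "pr t k (\<lambda>sg. \<phi> sg + \<psi> sg) sg = pr t k \<phi> sg + pr t k \<psi> sg"
 by (induction k arbitrary: t sg) (simp_all add: A_def avg_add)
lemma pr_cmult: "pr t k (\<lambda>sg. a * \<phi> sg) sg = a * pr t k \<phi> sg"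
 by (induction k arbitrary: t sg) (simp_all add: A_def avg_cmult)
lemma pr_plus: "pr t (j + k) \<phi> sg = pr t j (pr (t + j) k \<phi>) sg"
 by (induction j arbitrary: t sg) (simp_all add: A_def)

lemma eta_pos: "0 < \<eta> t"
 using eta_lo[of t] h1_pos by (smt (verit) mult_pos_pos powr_gt_zero of_nat_0_le_iff)
lemma c_pos: "0 < c" using c_ge N_ge by (smt (verit) one_le_power)
lemma beta_pos: "0 < \<beta> t" unfolding beta_def using eta_pos[of t] c_pos by simp

lemma eta_antimono: "s \<le> t \<Longrightarrow> \<eta> t \<le> \<eta> s"
 using eta_dec by (rule lift_Suc_antimono_le)
lemma beta_antimono: "s \<le> t \<Longrightarrow> \<beta> t \<le> \<beta> s"
 unfolding beta_def using eta_antimono[of s t] eta_pos[of t] c_pos by (intro mult_left_mono power_mono) auto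

lemma xi_inner: "avg n (\<lambda>i. v \<bullet> xi t x x' i) = 0"
proof -
 have *: "(\<Sum>i<n. Y i x - Ybar x) = 0" for x
  using n_pos unfolding Ybar_def by (simp add: sum_subtractf sum_constant_scaleR)
 have "(\<Sum>i<n. xi t x x' i) = (\<Sum>i<n. Y i x' - Ybar x') - (1 - \<beta> t) *\<^sub>R (\<Sum>i<n. Y i x - Ybar x)"
  unfolding xi_def scaleR_sum_right by (simp add: sum_subtractf)
 hence "(\<Sum>i<n. xi t x x' i) = 0" using * by simp
 thus ?thesis unfolding avg_def by (simp flip: inner_sum_right)
qed

lemma Ybar_norm: "x \<in> X \<Longrightarrow> norm (Ybar x) \<le> B"
proof -
 assume x: "x \<in> X"
 have "norm (\<Sum>i<n. Y i x) \<le> (\<Sum>i<n. B)" by (intro sum_norm_le) (use x Y_bd in auto)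
 thus ?thesis unfolding Ybar_def using n_pos by (simp add: field_simps)
qed

lemma Ybar_lip: "x \<in> X \<Longrightarrow> y \<in> X \<Longrightarrow> norm (Ybar x - Ybar y) \<le> N * norm (x - y)"
proof -
 assume x: "x \<in> X" "y \<in> X"
 have "norm (\<Sum>i<n. Y i x - Y i y) \<le> (\<Sum>i<n. N * norm (x - y))"
  by (intro sum_norm_le) (use x Y_lip in auto)
 moreover have "Ybar x - Ybar y = (1 / real n) *\<^sub>R (\<Sum>i<n. Y i x - Y i y)"
  unfolding Ybar_def by (simp add: sum_subtractf scaleR_diff_right)
 ultimately show ?thesis using n_pos by (simp add: field_simps)
qed

text \<open>The fresh sample is used at both iterates, so apart from a fraction beta of the full
  noise only differences over one step remain. This is the variance reduction of the
  recursion.\<close>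

lemma xi_split: "xi t x x' i = (1 - \<beta> t) *\<^sub>R ((Y i x' - Y i x) - (Ybar x' - Ybar x)) + \<beta> t *\<^sub>R (Y i x' - Ybar x')"
 unfolding xi_def by (simp add: algebra_simps)

lemma xi_norm:
 assumes "x \<in> X" "x' \<in> X" "i < n"
 shows "norm (xi t x x' i) \<le> 2 * N * norm (x' - x) + 2 * B * \<beta> t"
proof -
 have b: "0 \<le> \<beta> t" "\<beta> t \<le> 1" using beta_pos[of t] beta_le1[of t] by auto
 have 1: "norm ((Y i x' - Y i x) - (Ybar x' - Ybar x)) \<le> 2 * N * norm (x' - x)"
  using norm_triangle_ineq4[of "Y i x' - Y i x" "Ybar x' - Ybar x"] Y_lip[OF assms(3) assms(2,1)] Ybar_lip[OF assms(2,1)] by linarith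
 have 2: "norm (Y i x' - Ybar x') \<le> 2 * B"
  using norm_triangle_ineq4[of "Y i x'" "Ybar x'"] Y_bd[OF assms(3,2)] Ybar_norm[OF assms(2)] by linarith
 have "norm (xi t x x' i) \<le> (1 - \<beta> t) * norm ((Y i x' - Y i x) - (Ybar x' - Ybar x)) + \<beta> t * norm (Y i x' - Ybar x')"
  unfolding xi_split using norm_triangle_ineq[of "(1 - \<beta> t) *\<^sub>R ((Y i x' - Y i x) - (Ybar x' - Ybar x))" "\<beta> t *\<^sub>R (Y i x' - Ybar x')"] b by simp
 also have "\<dots> \<le> 1 * (2 * N * norm (x' - x)) + \<beta> t * (2 * B)"
  using b 1 2 by (intro add_mono mult_mono) auto
 finally show ?thesis by (simp add: mult_ac)
qed

text \<open>Centering only lowers the second moment of the differences, so no constant is lost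
  there. The coefficient 5/4 must stay well below what U gains from the descent of F.\<close>

lemma xi_sq:
 assumes "x \<in> X" "x' \<in> X"
 shows "avg n (\<lambda>i. (norm (xi t x x' i))\<^sup>2) \<le> 5/4 * N\<^sup>2 * (norm (x' - x))\<^sup>2 + 20 * B\<^sup>2 * (\<beta> t)\<^sup>2"
proof -
 have b: "0 \<le> \<beta> t" "\<beta> t \<le> 1" using beta_pos[of t] beta_le1[of t] by auto
 define d where "d i = Y i x' - Y i x" for i
 define db where "db = Ybar x' - Ybar x"
 have sumd: "(\<Sum>i<n. d i) = real n *\<^sub>R db" unfolding d_def db_def Ybar_def using n_pos
  by (simp add: sum_subtractf scaleR_diff_right)
 have pt: "(norm (xi t x x' i))\<^sup>2 \<le> 5/4 * (norm (d i - db))\<^sup>2 + 20 * B\<^sup>2 * (\<beta> t)\<^sup>2" if i: "i < n" for i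
 proof -
  have 2: "norm (Y i x' - Ybar x') \<le> 2 * B"
   using norm_triangle_ineq4[of "Y i x'" "Ybar x'"] Y_bd[OF i assms(2)] Ybar_norm[OF assms(2)] by linarith
  define p q where "p = norm (d i - db)" and "q = \<beta> t * (2 * B)"
  have "norm (xi t x x' i) \<le> (1 - \<beta> t) * norm (d i - db) + \<beta> t * norm (Y i x' - Ybar x')"
   unfolding xi_split d_def db_def using norm_triangle_ineq[of "(1 - \<beta> t) *\<^sub>R ((Y i x' - Y i x) - (Ybar x' - Ybar x))" "\<beta> t *\<^sub>R (Y i x' - Ybar x')"] b by simp
  also have "\<dots> \<le> 1 * p + q" unfolding p_def q_def
   using b 2 by (intro add_mono mult_mono) auto
  finally have "(norm (xi t x x' i))\<^sup>2 \<le> (p + q)\<^sup>2" by (intro power_mono) auto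
  \<comment> \<open>Young: 2pq is at most p^2/4 + 4q^2, with the large weight on the beta
    part.\<close>
  also have "\<dots> \<le> 5/4 * p\<^sup>2 + 5 * q\<^sup>2"
   using zero_le_power2[of "p/2 - 2*q"] by (simp add: power2_eq_square algebra_simps)
  finally show ?thesis unfolding p_def q_def by (simp add: power_mult_distrib algebra_simps)
 qed
 have "(norm (d i - db))\<^sup>2 = (norm (d i))\<^sup>2 - 2 * (d i \<bullet> db) + (norm db)\<^sup>2" for i
  by (simp add: power2_norm_eq_inner inner_diff_left inner_diff_right inner_commute)
 hence "(\<Sum>i<n. (norm (d i - db))\<^sup>2) = (\<Sum>i<n. (norm (d i))\<^sup>2) - 2 * ((\<Sum>i<n. d i) \<bullet> db) + real n * (norm db)\<^sup>2"
  by (simp add: sum_subtractf sum.distrib inner_sum_left sum_distrib_left)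
 also have "\<dots> \<le> (\<Sum>i<n. (norm (d i))\<^sup>2)"
  unfolding sumd by (simp add: power2_norm_eq_inner)
 also have "\<dots> \<le> (\<Sum>i<n. N\<^sup>2 * (norm (x' - x))\<^sup>2)"
  unfolding d_def using Y_lip[OF _ assms(2,1)] by (intro sum_mono) (metis lessThan_iff norm_ge_zero power_mono power_mult_distrib)
 finally have "avg n (\<lambda>i. (norm (d i - db))\<^sup>2) \<le> N\<^sup>2 * (norm (x' - x))\<^sup>2"
  unfolding avg_def using n_pos by (simp add: field_simps)
 moreover have "avg n (\<lambda>i. (norm (xi t x x' i))\<^sup>2) \<le> avg n (\<lambda>i. 5/4 * (norm (d i - db))\<^sup>2 + 20 * B\<^sup>2 * (\<beta> t)\<^sup>2)"
  by (intro avg_mono pt)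
 moreover have "avg n (\<lambda>i. 5/4 * (norm (d i - db))\<^sup>2 + 20 * B\<^sup>2 * (\<beta> t)\<^sup>2) = 5/4 * avg n (\<lambda>i. (norm (d i - db))\<^sup>2) + 20 * B\<^sup>2 * (\<beta> t)\<^sup>2"
  by (simp only: avg_add avg_cmult avg_const[OF n_pos])
 ultimately show ?thesis by linarith
qed

section \<open>One step of the error: norm, tracked coordinate, correlation and noise\<close>

definition W :: "'x \<times> 'h \<Rightarrow> real" where "W sg = (norm (snd sg))\<^sup>2"
definition es :: "'x \<times> 'h \<Rightarrow> real" where "es sg = snd sg \<bullet> dir"
definition dx :: "nat \<Rightarrow> 'x \<times> 'h \<Rightarrow> real" where "dx t sg = norm (nxt t sg - fst sg)"
definition JJ :: "'x \<times> 'h \<Rightarrow> real" where "JJ sg = snd sg \<bullet> lin (fst sg)"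
definition xis :: "nat \<Rightarrow> 'x \<times> 'h \<Rightarrow> nat \<Rightarrow> 'h" where "xis t sg = xi t (fst sg) (nxt t sg)"
text \<open>A noise bound for every state, alive or not: the iterate moves by at most the diameter
  D.\<close>

definition B2 :: real where "B2 = 2 * N * D + 2 * B"

lemma W_nn [simp]: "0 \<le> W sg" unfolding W_def by simp
lemma dx_nn [simp]: "0 \<le> dx t sg" unfolding dx_def by simp
lemma B2_nn [simp]: "0 \<le> B2" unfolding B2_def using N_ge D_nn B_nn by simp

lemma fst_S: "sg \<in> S \<Longrightarrow> fst sg \<in> X" unfolding S_def by auto
lemma nxt_X: "sg \<in> S \<Longrightarrow> nxt t sg \<in> X" unfolding S_def using nxt_in by (cases sg) auto

lemma W_step: "W (step t sg i) - W sg = - (2 * \<beta> t - (\<beta> t)\<^sup>2) * W sg + 2 * (1 - \<beta> t) * (snd sg \<bullet> xis t sg i) + (norm (xis t sg i))\<^sup>2"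
 unfolding W_def step_def xis_def power2_norm_eq_inner
 by (simp add: inner_add_left inner_add_right inner_commute power2_eq_square algebra_simps)

lemma es_step: "es (step t sg i) = (1 - \<beta> t) * es sg + xis t sg i \<bullet> dir"
 unfolding es_def step_def xis_def by (simp add: inner_add_left)

lemma avg_xis [simp]: "avg n (\<lambda>i. v \<bullet> xis t sg i) = 0" "avg n (\<lambda>i. xis t sg i \<bullet> v) = 0"
 unfolding xis_def using xi_inner by (auto simp: inner_commute)

text \<open>Free of any condition on the state: the noise is centred whatever the step was. This is
  what makes recovery from dead states possible.\<close>

lemma A_es: "A t es sg = (1 - \<beta> t) * es sg"
 unfolding A_def es_step using n_pos by (simp add: avg_add)

lemma xis_norm: "sg \<in> S \<Longrightarrow> i < n \<Longrightarrow> norm (xis t sg i) \<le> 2 * N * dx t sg + 2 * B * \<beta> t"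
 unfolding xis_def dx_def using xi_norm[OF fst_S nxt_X] by auto

lemma dx_D: "sg \<in> S \<Longrightarrow> dx t sg \<le> D"
 unfolding dx_def using diam[OF nxt_X fst_S] by auto

lemma xis_B2: "sg \<in> S \<Longrightarrow> i < n \<Longrightarrow> norm (xis t sg i) \<le> B2"
proof -
 assume a: "sg \<in> S" "i < n"
 have "2 * N * dx t sg \<le> 2 * N * D" using dx_D[OF a(1)] N_ge by (intro mult_left_mono) auto
 moreover have "2 * B * \<beta> t \<le> 2 * B * 1" using beta_le1 B_nn by (intro mult_left_mono) auto
 ultimately show ?thesis using xis_norm[OF a, of t] unfolding B2_def by linarith
qed

lemma xis_sq: "sg \<in> S \<Longrightarrow> avg n (\<lambda>i. (norm (xis t sg i))\<^sup>2) \<le> 5/4 * N\<^sup>2 * (dx t sg)\<^sup>2 + 20 * B\<^sup>2 * (\<beta> t)\<^sup>2"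
 unfolding xis_def dx_def using xi_sq[OF fst_S nxt_X] by auto

lemma avg_W_step: "avg n (\<lambda>i. W (step t sg i) - W sg) = - (2 * \<beta> t - (\<beta> t)\<^sup>2) * W sg + avg n (\<lambda>i. (norm (xis t sg i))\<^sup>2)"
 unfolding W_step using n_pos by (simp only: avg_add avg_cmult avg_xis avg_const)

lemma norm_W: "norm (snd sg) = sqrt (W sg)" unfolding W_def by simp

lemma W_step_abs:
 assumes "sg \<in> S" "i < n"
 shows "\<bar>W (step t sg i) - W sg\<bar> \<le> 2 * \<beta> t * W sg + 2 * sqrt (W sg) * norm (xis t sg i) + (norm (xis t sg i))\<^sup>2"
proof -
 have b: "0 \<le> \<beta> t" "\<beta> t \<le> 1" using beta_pos[of t] beta_le1[of t] by auto
 have bb: "(\<beta> t)\<^sup>2 \<le> \<beta> t" using b by (simp add: power2_eq_square mult_left_le)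
 have 1: "\<bar>(2 * \<beta> t - (\<beta> t)\<^sup>2) * W sg\<bar> \<le> 2 * \<beta> t * W sg"
  using b bb by (subst abs_of_nonneg) (auto intro!: mult_right_mono mult_nonneg_nonneg)
 have "\<bar>(1 - \<beta> t) * (snd sg \<bullet> xis t sg i)\<bar> \<le> 1 * (sqrt (W sg) * norm (xis t sg i))"
  unfolding abs_mult using b Cauchy_Schwarz_ineq2[of "snd sg" "xis t sg i"] norm_W[of sg] by (intro mult_mono) auto
 moreover have "- (2 * \<beta> t - (\<beta> t)\<^sup>2) * W sg = - ((2 * \<beta> t - (\<beta> t)\<^sup>2) * W sg)"
  "2 * (1 - \<beta> t) * (snd sg \<bullet> xis t sg i) = 2 * ((1 - \<beta> t) * (snd sg \<bullet> xis t sg i))"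
  "2 * sqrt (W sg) * norm (xis t sg i) = 2 * (1 * (sqrt (W sg) * norm (xis t sg i)))" by (simp_all add: algebra_simps)
 ultimately show ?thesis using 1 zero_le_power2[of "norm (xis t sg i)"] unfolding W_step by linarith
qed

lemma sum_sq3: "\<bar>d::real\<bar> \<le> p + q + s \<Longrightarrow> d\<^sup>2 \<le> 3 * (p\<^sup>2 + q\<^sup>2 + s\<^sup>2)"
proof -
 assume "\<bar>d\<bar> \<le> p + q + s"
 hence "d\<^sup>2 \<le> (p + q + s)\<^sup>2" by (metis abs_ge_zero power2_abs power_mono)
 also have "\<dots> \<le> 3 * (p\<^sup>2 + q\<^sup>2 + s\<^sup>2)"
  using zero_le_power2[of "p - q"] zero_le_power2[of "q - s"] zero_le_power2[of "p - s"]
  by (simp add: power2_eq_square algebra_simps)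
 finally show ?thesis .
qed

text \<open>Valid in every state, since only the crude bound B2 enters. Contraction at rate beta
  beats bounded noise as soon as W exceeds \<open>26 * m * B2^2 / beta\<close>, so a moment can only
  grow by what it gains below that level.\<close>

lemma u0_drift:
 assumes sg: "sg \<in> S" and m: "0 < m" and bt: "24 * real m * \<beta> t \<le> 1" and q: "5 * (real m)\<^sup>2 * (B2\<^sup>2 + 1) \<le> q"
 shows "A t (\<lambda>sg. (W sg + q) ^ m) sg \<le> (W sg + q) ^ m
     + 13 * (real m)\<^sup>2 * B2\<^sup>2 * (26 * real m * B2\<^sup>2 / \<beta> t + q) ^ (m - 1)"
proof -
 define b w u where "b = \<beta> t" and "w = W sg" and "u = w + q"
 define u' where "u' i = W (step t sg i) + q" for i
 have b: "0 < b" "b \<le> 1" using beta_pos[of t] beta_le1[of t] unfolding b_def by auto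
 have w: "0 \<le> w" unfolding w_def by simp
 have m1: "1 \<le> real m" using m by simp
 have m2: "real m \<le> (real m)\<^sup>2" using m1 by (simp add: power2_eq_square)
 have mB: "B2\<^sup>2 \<le> (real m)\<^sup>2 * B2\<^sup>2" using m1 mult_right_mono[of 1 "(real m)\<^sup>2" "B2\<^sup>2"] by (simp add: one_le_power)
 have q1: "5 * ((real m)\<^sup>2 * B2\<^sup>2) \<le> q" "5 \<le> q"
 proof -
  have "5 * (real m)\<^sup>2 + 5 * ((real m)\<^sup>2 * B2\<^sup>2) \<le> q" using q by (simp add: algebra_simps)
  moreover have "1 \<le> (real m)\<^sup>2" using m1 by (simp add: one_le_power)
  moreover have "0 \<le> (real m)\<^sup>2 * B2\<^sup>2" by simp
  ultimately show "5 * ((real m)\<^sup>2 * B2\<^sup>2) \<le> q" "5 \<le> q" by linarith+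
 qed
 have upos: "0 < u" using w q1 unfolding u_def by linarith
 have xb: "norm (xis t sg i) \<le> B2" if "i < n" for i using xis_B2[OF sg that] .
 have dabs: "\<bar>u' i - u\<bar> \<le> 2 * b * w + 2 * sqrt w * B2 + B2\<^sup>2" if i: "i < n" for i
 proof -
  have "u' i - u = W (step t sg i) - W sg" unfolding u'_def u_def w_def by simp
  moreover have "2 * sqrt w * norm (xis t sg i) \<le> 2 * sqrt w * B2"
   using xb[OF i] w by (intro mult_left_mono) auto
  moreover have "(norm (xis t sg i))\<^sup>2 \<le> B2\<^sup>2" using xb[OF i] by (intro power_mono) auto
  ultimately show ?thesis using W_step_abs[OF sg i, of t] unfolding b_def w_def by linarith
 qed
 have small: "real m * \<bar>u' i - u\<bar> \<le> u" if i: "i < n" for i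
 proof -
  have "real m * \<bar>u' i - u\<bar> \<le> real m * (2 * b * w + 2 * sqrt w * B2 + B2\<^sup>2)"
   using dabs[OF i] m1 by (intro mult_left_mono) auto
  \<comment> \<open>The middle product is split by AM-GM into \<open>w / 4\<close> and
    \<open>4 * m^2 * B2^2\<close>; with the last term this is the origin of the 5 in the hypothesis
    on q.\<close>
  also have "\<dots> = (2 * real m * b) * w + 2 * (sqrt w / 2) * (2 * real m * B2) + real m * B2\<^sup>2" by (simp add: algebra_simps)
  also have "\<dots> \<le> (1/12) * w + ((sqrt w / 2)\<^sup>2 + (2 * real m * B2)\<^sup>2) + (real m)\<^sup>2 * B2\<^sup>2"
   using bt w m2 zero_le_power2[of "sqrt w / 2 - 2 * real m * B2"] unfolding b_def
   by (intro add_mono mult_right_mono) (auto simp: power2_eq_square algebra_simps)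
  also have "\<dots> \<le> w + 5 * ((real m)\<^sup>2 * B2\<^sup>2)" using w by (simp add: power_divide power_mult_distrib)
  finally show ?thesis unfolding u_def using q1 by linarith
 qed
 have E1: "avg n (\<lambda>i. u' i - u) \<le> - b * w + B2\<^sup>2"
 proof -
  have "avg n (\<lambda>i. u' i - u) = avg n (\<lambda>i. W (step t sg i) - W sg)" unfolding u'_def u_def w_def by simp
  also have "\<dots> \<le> - (2 * b - b\<^sup>2) * w + B2\<^sup>2" unfolding avg_W_step b_def w_def
   using xb n_pos by (intro add_mono avg_le) (auto intro: power_mono)
  also have "\<dots> \<le> - b * w + B2\<^sup>2"
   using b w mult_right_mono[of "b\<^sup>2" b w] by (simp add: power2_eq_square algebra_simps mult_left_le)
  finally show ?thesis .
 qed
 have E2: "avg n (\<lambda>i. (u' i - u)\<^sup>2) \<le> 12 * b\<^sup>2 * (w * u) + 12 * B2\<^sup>2 * u"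
 proof (rule avg_le[OF n_pos])
  fix i assume i: "i < n"
  have "(u' i - u)\<^sup>2 \<le> 3 * ((2*b*w)\<^sup>2 + (2 * sqrt w * B2)\<^sup>2 + (B2\<^sup>2)\<^sup>2)"
   by (rule sum_sq3[OF dabs[OF i]])
  also have "\<dots> = 12 * b\<^sup>2 * (w * w) + 12 * B2\<^sup>2 * w + 3 * B2\<^sup>2 * B2\<^sup>2"
   using w by (simp add: power_mult_distrib power2_eq_square algebra_simps)
  also have "\<dots> \<le> 12 * b\<^sup>2 * (w * u) + 12 * B2\<^sup>2 * w + 12 * B2\<^sup>2 * q"
   using w q1 mB unfolding u_def by (intro add_mono mult_left_mono mult_mono) auto
  finally show "(u' i - u)\<^sup>2 \<le> 12 * b\<^sup>2 * (w * u) + 12 * B2\<^sup>2 * u" unfolding u_def by (simp add: algebra_simps)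
 qed
 \<comment> \<open>Half of the contraction is sacrificed to the second-order term, which
   \<open>24 * m * beta \<le> 1\<close> permits.\<close>
 define E where "E = - (real m * b * w) / 2 + 13 * (real m)\<^sup>2 * B2\<^sup>2"
 have tot: "real m * (avg n (\<lambda>i. u' i - u) / u) + (real m)\<^sup>2 * (avg n (\<lambda>i. (u' i - u)\<^sup>2) / u\<^sup>2) \<le> E / u"
 proof -
  have "(real m)\<^sup>2 * (avg n (\<lambda>i. (u' i - u)\<^sup>2) / u\<^sup>2) \<le> (real m)\<^sup>2 * ((12 * b\<^sup>2 * (w * u) + 12 * B2\<^sup>2 * u) / u\<^sup>2)"
   using E2 by (intro mult_left_mono divide_right_mono) auto
  also have "\<dots> = (real m)\<^sup>2 * (12 * b\<^sup>2 * w + 12 * B2\<^sup>2) / u"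
   using upos by (simp add: power2_eq_square field_simps)
  finally have a: "(real m)\<^sup>2 * (avg n (\<lambda>i. (u' i - u)\<^sup>2) / u\<^sup>2) \<le> (real m)\<^sup>2 * (12 * b\<^sup>2 * w + 12 * B2\<^sup>2) / u" .
  have b': "real m * (avg n (\<lambda>i. u' i - u) / u) \<le> real m * ((- b * w + B2\<^sup>2) / u)"
   using E1 upos by (intro mult_left_mono divide_right_mono) auto
  have "real m * (- b * w + B2\<^sup>2) + (real m)\<^sup>2 * (12 * b\<^sup>2 * w + 12 * B2\<^sup>2) \<le> E"
  proof -
   have "(24 * real m * b) * (real m * b * w) \<le> 1 * (real m * b * w)"
    using bt b w m1 unfolding b_def by (intro mult_right_mono) auto
   moreover have "real m * B2\<^sup>2 \<le> (real m)\<^sup>2 * B2\<^sup>2" using m2 by (intro mult_right_mono) auto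
   ultimately show ?thesis unfolding E_def by (simp add: power2_eq_square algebra_simps)
  qed
  hence "(real m * (- b * w + B2\<^sup>2) + (real m)\<^sup>2 * (12 * b\<^sup>2 * w + 12 * B2\<^sup>2)) / u \<le> E / u"
   using upos by (intro divide_right_mono) auto
  thus ?thesis using a b' by (simp add: add_divide_distrib)
 qed
 have "A t (\<lambda>sg. (W sg + q) ^ m) sg = avg n (\<lambda>i. u' i ^ m)" unfolding A_def u'_def by simp
 also have "\<dots> \<le> u ^ m * (1 + real m * (avg n (\<lambda>i. u' i - u) / u) + (real m)\<^sup>2 * (avg n (\<lambda>i. (u' i - u)\<^sup>2) / u\<^sup>2))"
  by (rule avg_power_le[OF n_pos m upos small])
 also have "\<dots> \<le> u ^ m * (1 + E / u)" using tot upos by (intro mult_left_mono) auto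
 also have "\<dots> = u ^ m + E * u ^ (m - 1)" using upos m by (simp add: field_simps power_eq_if)
 \<comment> \<open>A nonnegative E forces \<open>w \<le> 26 * m * B2^2 / b\<close>, so u is bounded
   there; a negative E only helps.\<close>
 also have "\<dots> \<le> u ^ m + 13 * (real m)\<^sup>2 * B2\<^sup>2 * (26 * real m * B2\<^sup>2 / b + q) ^ (m - 1)"
 proof (cases "0 \<le> E")
  case True
  hence "real m * b * w \<le> real m * (26 * real m * B2\<^sup>2)" unfolding E_def by (simp add: power2_eq_square algebra_simps)
  hence "b * w \<le> 26 * real m * B2\<^sup>2" using m1 by (simp add: mult.assoc)
  hence "w \<le> 26 * real m * B2\<^sup>2 / b" using b by (simp add: field_simps)
  hence "u ^ (m - 1) \<le> (26 * real m * B2\<^sup>2 / b + q) ^ (m - 1)" unfolding u_def using w q1 by (intro power_mono) auto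
  moreover have "E \<le> 13 * (real m)\<^sup>2 * B2\<^sup>2" unfolding E_def using b w by simp
  ultimately show ?thesis using True upos by (intro add_left_mono mult_mono) auto
 next
  case False
  hence "E * u ^ (m - 1) \<le> 0" using upos by (simp add: mult_nonpos_nonneg)
  moreover have "0 \<le> 26 * real m * B2\<^sup>2 / b + q" using b q1 by simp
  ultimately show ?thesis by (smt (verit) mult_nonneg_nonneg zero_le_power zero_le_power2)
 qed
 finally show ?thesis unfolding u_def w_def b_def .
qed

end

section \<open>Lyapunov functions\<close>

lemma sum_sq6: "\<bar>d::real\<bar> \<le> p1 + p2 + p3 + p4 + p5 + p6 \<Longrightarrow>
  d\<^sup>2 \<le> 6 * (p1\<^sup>2 + p2\<^sup>2 + p3\<^sup>2 + p4\<^sup>2 + p5\<^sup>2 + p6\<^sup>2)"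
proof -
 assume "\<bar>d\<bar> \<le> p1 + p2 + p3 + p4 + p5 + p6"
 hence "d\<^sup>2 \<le> (p1 + p2 + p3 + p4 + p5 + p6)\<^sup>2" by (metis abs_ge_zero power2_abs power_mono)
 also have "\<dots> \<le> 6 * (p1\<^sup>2 + p2\<^sup>2 + p3\<^sup>2 + p4\<^sup>2 + p5\<^sup>2 + p6\<^sup>2)"
  using zero_le_power2[of "p1 - p2"] zero_le_power2[of "p1 - p3"] zero_le_power2[of "p1 - p4"]
   zero_le_power2[of "p1 - p5"] zero_le_power2[of "p1 - p6"] zero_le_power2[of "p2 - p3"]
   zero_le_power2[of "p2 - p4"] zero_le_power2[of "p2 - p5"] zero_le_power2[of "p2 - p6"]
   zero_le_power2[of "p3 - p4"] zero_le_power2[of "p3 - p5"] zero_le_power2[of "p3 - p6"]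
   zero_le_power2[of "p4 - p5"] zero_le_power2[of "p4 - p6"] zero_le_power2[of "p5 - p6"]
  by (simp add: power2_eq_square algebra_simps)
 finally show ?thesis .
qed

lemma abs_add_le: "\<bar>p::real\<bar> \<le> a \<Longrightarrow> \<bar>q\<bar> \<le> b \<Longrightarrow> \<bar>p + q\<bar> \<le> a + b"
 by linarith

text \<open>Lets the many conditions that the step size be small be read off from limits at zero,
  without explicit constants.\<close>

lemma small_at_zero:
 fixes f :: "real \<Rightarrow> real"
 assumes "(f \<longlongrightarrow> 0) (at_right 0)" "0 < d"
 shows "\<exists>e0>0. \<forall>x. 0 < x \<and> x \<le> e0 \<longrightarrow> f x \<le> d"
proof -
 have "eventually (\<lambda>x. f x < d) (at_right 0)" using order_tendstoD(2)[OF assms] .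
 then obtain b where b: "0 < b" "\<And>x. 0 < x \<Longrightarrow> x < b \<Longrightarrow> f x < d"
  unfolding eventually_at_right_field by auto
 show ?thesis by (rule exI[of _ "b/2"]) (use b in \<open>auto intro: less_imp_le\<close>)
qed

context storm begin

text \<open>The levels 1/4, 3/8 and 1/2 are used one after the other: each phase of a trial ends at
  one level, and the next one starts with the margin 1/8 that \<open>ff_start\<close> requires. As g
  is at least 1, level 1/2 still gives s > 1/2.\<close>

definition alive :: "real \<Rightarrow> 'x \<times> 'h \<Rightarrow> bool" where "alive k sg \<longleftrightarrow> - k < es sg"

text \<open>The correlation \<open>JJ\<close> decreases by a multiple of \<open>dx^2 / eta\<close> (assumption \<open>H3\<close>); adding it with a small weight
 absorbs the variance of order \<open>dx^2\<close> that one step adds to \<open>W\<close>, without giving up any of the contraction of \<open>W\<close>.\<close>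

definition uJ :: "real \<Rightarrow> 'x \<times> 'h \<Rightarrow> real" where "uJ g sg = W sg + 1 + g * JJ sg"

lemma dx_alive:
 assumes "sg \<in> S" "alive (1/2) sg"
 shows "dx t sg \<le> \<eta> t * C1 * (1 + sqrt (W sg))"
 using H1[of "fst sg" "snd sg" t] assms unfolding dx_def alive_def es_def norm_W[symmetric] by (auto simp: S_def)

lemma H3_alive:
 assumes "sg \<in> S" "alive (1/2) sg"
 shows "snd sg \<bullet> (lin (nxt t sg) - lin (fst sg)) \<le> - c3 * (dx t sg)\<^sup>2 / \<eta> t + \<eta> t * r (es sg)"
 using H3[of "fst sg" "snd sg" t] assms unfolding dx_def alive_def es_def by (auto simp: S_def)

lemma H2_alive:
 assumes "sg \<in> S" "alive (1/2) sg"
 shows "F (nxt t sg) \<le> F (fst sg) - 3/8 * (dx t sg)\<^sup>2 / \<eta> t + 4 * \<eta> t * W sg"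
 using H2[of "fst sg" "snd sg" t] assms unfolding dx_def alive_def es_def W_def by (auto simp: S_def)

lemma JJ_bd: "sg \<in> S \<Longrightarrow> \<bar>JJ sg\<bar> \<le> DJ * sqrt (W sg)"
 unfolding JJ_def norm_W[symmetric]
 using Cauchy_Schwarz_ineq2[of "snd sg" "lin (fst sg)"] mult_left_mono[OF lin_bd[OF fst_S], of sg "norm (snd sg)"]
 by (simp add: mult.commute)

lemma JJ_step:
 "JJ (step t sg i) - JJ sg = snd sg \<bullet> (lin (nxt t sg) - lin (fst sg)) - \<beta> t * (snd sg \<bullet> lin (nxt t sg)) + xis t sg i \<bullet> lin (nxt t sg)"
 unfolding JJ_def step_def xis_def by (simp add: inner_add_left inner_diff_right algebra_simps)

lemma lin_nxt: "sg \<in> S \<Longrightarrow> \<bar>v \<bullet> lin (nxt t sg)\<bar> \<le> DJ * norm v"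
 using Cauchy_Schwarz_ineq2[of v "lin (nxt t sg)"] mult_left_mono[OF lin_bd[OF nxt_X], of sg "norm v" t]
 by (simp add: mult.commute)

lemma JJ_step_abs:
 assumes "sg \<in> S"
 shows "\<bar>JJ (step t sg i) - JJ sg\<bar> \<le> DJ * (sqrt (W sg) * dx t sg + \<beta> t * sqrt (W sg) + norm (xis t sg i))"
proof -
 have "\<bar>snd sg \<bullet> (lin (nxt t sg) - lin (fst sg))\<bar> \<le> norm (snd sg) * (DJ * dx t sg)"
  using Cauchy_Schwarz_ineq2 mult_left_mono[OF lin_lip[OF nxt_X[OF assms] fst_S[OF assms]], of "norm (snd sg)"]
  unfolding dx_def by (meson norm_ge_zero order_trans)
 moreover have "\<bar>\<beta> t * (snd sg \<bullet> lin (nxt t sg))\<bar> \<le> \<beta> t * (DJ * norm (snd sg))"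
  unfolding abs_mult using lin_nxt[OF assms, of "snd sg" t] beta_pos[of t] by (auto intro!: mult_left_mono)
 moreover have "\<bar>xis t sg i \<bullet> lin (nxt t sg)\<bar> \<le> DJ * norm (xis t sg i)" by (rule lin_nxt[OF assms])
 ultimately show ?thesis unfolding JJ_step norm_W[symmetric] by (simp add: algebra_simps)
qed

lemma avg_JJ_step:
 "avg n (\<lambda>i. JJ (step t sg i) - JJ sg) = snd sg \<bullet> (lin (nxt t sg) - lin (fst sg)) - \<beta> t * (snd sg \<bullet> lin (nxt t sg))"
 unfolding JJ_step using n_pos by (simp only: avg_add avg_xis avg_const)

lemma xis_alive:
 assumes "sg \<in> S" "alive (1/2) sg" "i < n"
 shows "norm (xis t sg i) \<le> (2 * N * C1 * \<eta> t + 2 * B * \<beta> t) * (1 + sqrt (W sg))"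
proof -
 have "2 * N * dx t sg \<le> 2 * N * (\<eta> t * C1 * (1 + sqrt (W sg)))"
  using dx_alive[OF assms(1,2)] N_ge by (intro mult_left_mono) auto
 moreover have "2 * B * \<beta> t * 1 \<le> 2 * B * \<beta> t * (1 + sqrt (W sg))"
  using B_nn beta_pos[of t] by (intro mult_left_mono) auto
 ultimately show ?thesis using xis_norm[OF assms(1,3), of t] by (simp add: algebra_simps)
qed

lemma one_sqrt_sq: "0 \<le> w \<Longrightarrow> (1 + sqrt w)\<^sup>2 \<le> 2 * (w + 1)"
 using zero_le_power2[of "1 - sqrt w"] by (simp add: power2_eq_square algebra_simps)

lemma uJ_bounds:
 assumes "sg \<in> S" "0 \<le> g" "g * DJ \<le> a" "0 \<le> a"
 shows "\<bar>uJ g sg - (W sg + 1)\<bar> \<le> a * (W sg + 1)"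
proof -
 have "\<bar>g * JJ sg\<bar> \<le> g * (DJ * sqrt (W sg))"
  using JJ_bd[OF assms(1)] assms(2) unfolding abs_mult by (auto intro: mult_left_mono)
 also have "\<dots> \<le> a * sqrt (W sg)" using assms(3) mult_right_mono[of "g * DJ" a "sqrt (W sg)"] by (simp add: mult.assoc)
 also have "\<dots> \<le> a * (W sg + 1)"
  using zero_le_power2[of "sqrt (W sg) - 1/2"] assms(4) W_nn[of sg] by (intro mult_left_mono) (auto simp: power2_eq_square algebra_simps)
 finally show ?thesis unfolding uJ_def by simp
qed

text \<open>The rate is nearly optimal: |e|^2 contracts at rate 2 beta and only an arbitrarily small
  share s is lost. \<open>phase_b\<close> depends on this, because there W has to fall by almost
  T^(2/3) in tau-time (ln T)/3. The weight g0 is frozen (later \<open>eta T\<close>), so that one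
  function serves on a whole window where eta varies by at most a factor 2.\<close>

lemma uJ_drift:
 assumes m: "0 < m" and s: "0 < s" "s < 1"
 shows "\<exists>\<kappa>>0. \<exists>K\<ge>0. \<exists>e0>0. \<forall>t g0 sg. 0 < g0 \<and> g0 \<le> \<eta> t \<and> \<eta> t \<le> 2 * g0 \<and> \<eta> t \<le> e0 \<and> sg \<in> S \<and> alive (1/2) sg \<longrightarrow>
   \<kappa> * g0 * DJ \<le> 1/16 \<and>
   A t (\<lambda>sg. uJ (\<kappa> * g0) sg ^ m) sg \<le> (1 - 2 * real m * (1 - s) * \<beta> t) * uJ (\<kappa> * g0) sg ^ m + K * \<beta> t"
proof -
 define K1 where "K1 = 6 * ((5 + B2\<^sup>2) * (5/4 * N\<^sup>2) + 1)"
 define K2 where "K2 = 6 * ((5 + B2\<^sup>2) * (20 * B\<^sup>2) + 1)"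
 \<comment> \<open>Chosen so that half of the gain from \<open>H3\<close> equals the
   \<open>dx^2\<close> part of the variance, \<open>5/4 * N^2\<close>, plus that of the second-order
   term, \<open>2 * m * K1\<close>.\<close>
 define \<kappa> where "\<kappa> = (2 / c3) * (5/4 * N\<^sup>2 + 2 * real m * K1)"
 have N2: "1 \<le> N\<^sup>2" using N_ge by (simp add: one_le_power)
 have K1: "0 < K1" unfolding K1_def using N2 by (auto intro!: add_nonneg_pos mult_nonneg_nonneg)
 have K2: "0 < K2" unfolding K2_def by (auto intro!: add_nonneg_pos mult_nonneg_nonneg)
 have kap: "0 < \<kappa>"
 proof -
  have "0 < 5/4 * N\<^sup>2 + 2 * real m * K1" using N2 K1 by (intro add_pos_nonneg) auto
  thus ?thesis unfolding \<kappa>_def using c3_pos by (intro mult_pos_pos divide_pos_pos) auto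
 qed
 have kapc3: "\<kappa> * c3 / 2 = 5/4 * N\<^sup>2 + 2 * real m * K1" unfolding \<kappa>_def using c3_pos by (simp add: field_simps)
 \<comment> \<open>With this dl the quadratic part of r costs the fraction s/4 of beta times
   W.\<close>
 define dl where "dl = s * c / (4 * \<kappa> * ((norm dir)\<^sup>2 + 1))"
 have dl: "0 < dl" unfolding dl_def using s c_pos kap by (auto intro!: divide_pos_pos mult_pos_pos add_nonneg_pos)
 obtain Cr0 where Cr0: "\<And>y. -1/2 \<le> y \<Longrightarrow> r y \<le> dl * y\<^sup>2 + Cr0" using r_bd[OF dl] by auto
 define Cr where "Cr = max Cr0 0"
 have Cr: "\<And>y. -1/2 \<le> y \<Longrightarrow> r y \<le> dl * y\<^sup>2 + Cr" "0 \<le> Cr" using Cr0 unfolding Cr_def by (force+)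
 define C4 where "C4 = 20 * B\<^sup>2 + 2 * real m * K2 + \<kappa> * Cr / c + 1"
 have C4: "1 \<le> C4" unfolding C4_def using K2 kap Cr c_pos by simp
 \<comment> \<open>Size of the residual at the level \<open>u = (C4 + 2) / s\<close>, above which
   the share s of the contraction absorbs it.\<close>
 define C5 where "C5 = real m * (C4 + 2) * ((C4 + 2) / s) ^ (m - 1)"
 have C5: "0 \<le> C5" unfolding C5_def using C4 s by simp
 \<comment> \<open>Three thresholds for eta: e1 makes the terms in beta^2 a small share of the
   contraction, e2 bounds increments by u/m as \<open>avg_power_le\<close> asks, and e3 keeps uJ
   comparable to \<open>W + 1\<close>.\<close>
 have "\<exists>e1>0. \<forall>x. 0 < x \<and> x \<le> e1 \<longrightarrow> c * x\<^sup>2 * (1 + 48 * real m) \<le> s / 8"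
  by (rule small_at_zero) (use s in \<open>auto intro!: tendsto_eq_intros\<close>)
 then obtain e1 where e1: "0 < e1" "\<And>x. 0 < x \<Longrightarrow> x \<le> e1 \<Longrightarrow> c * x\<^sup>2 * (1 + 48 * real m) \<le> s / 8" by auto
 have "\<exists>e2>0. \<forall>x. 0 < x \<and> x \<le> e2 \<longrightarrow> real m * 4 * (3 * (c * x\<^sup>2) + 3 * (2 * N * C1 * x + 2 * B * (c * x\<^sup>2)) + (2 * N * C1 * x + 2 * B * (c * x\<^sup>2))\<^sup>2 + x * C1) \<le> 1"
  by (rule small_at_zero) (auto intro!: tendsto_eq_intros)
 then obtain e2 where e2: "0 < e2" "\<And>x. 0 < x \<Longrightarrow> x \<le> e2 \<Longrightarrow> real m * 4 * (3 * (c * x\<^sup>2) + 3 * (2 * N * C1 * x + 2 * B * (c * x\<^sup>2)) + (2 * N * C1 * x + 2 * B * (c * x\<^sup>2))\<^sup>2 + x * C1) \<le> 1" by auto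
 have "\<exists>e3>0. \<forall>x. 0 < x \<and> x \<le> e3 \<longrightarrow> \<kappa> * x * DJ \<le> s / 16"
  by (rule small_at_zero) (use s in \<open>auto intro!: tendsto_eq_intros\<close>)
 then obtain e3 where e3: "0 < e3" "\<And>x. 0 < x \<Longrightarrow> x \<le> e3 \<Longrightarrow> \<kappa> * x * DJ \<le> s / 16" by auto
 define e0 where "e0 = min e1 (min e2 e3)"
 have main: "\<kappa> * g0 * DJ \<le> 1/16 \<and> A t (\<lambda>sg. uJ (\<kappa> * g0) sg ^ m) sg \<le> (1 - 2 * real m * (1 - s) * \<beta> t) * uJ (\<kappa> * g0) sg ^ m + C5 * \<beta> t"
  if g0: "0 < g0" "g0 \<le> \<eta> t" "\<eta> t \<le> 2 * g0" and et: "\<eta> t \<le> e0" and sg: "sg \<in> S" and al: "alive (1/2) sg" for t g0 sg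
 proof -
  define b w d e g u where "b = \<beta> t" and "w = W sg" and "d = dx t sg" and "e = \<eta> t" and "g = \<kappa> * g0" and "u = uJ g sg"
  define u' where "u' i = uJ g (step t sg i)" for i
  define a where "a = sqrt w"
  have b: "0 < b" "b \<le> 1" using beta_pos[of t] beta_le1[of t] unfolding b_def by auto
  have w: "0 \<le> w" unfolding w_def by simp
  have a: "0 \<le> a" "a\<^sup>2 = w" unfolding a_def using w by auto
  have d: "0 \<le> d" unfolding d_def by simp
  have e: "0 < e" unfolding e_def by (rule eta_pos)
  have be: "b = c * e\<^sup>2" unfolding b_def e_def beta_def ..
  have m1: "1 \<le> real m" using m by simp
  have g: "0 < g" unfolding g_def using kap g0 by simp
  have gDJ: "g * DJ \<le> s / 16"
  proof -
   have "\<kappa> * g0 * DJ \<le> \<kappa> * e * DJ" using g0 kap DJ_nn unfolding e_def by (intro mult_right_mono mult_left_mono) auto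
   also have "\<dots> \<le> s / 16" using e3(2)[of e] e et unfolding e0_def e_def by auto
   finally show ?thesis unfolding g_def .
  qed
  have gDJ': "g * DJ \<le> 1 / 16" using gDJ s by linarith
  have ub: "\<bar>u - (w + 1)\<bar> \<le> (s/16) * (w + 1)" unfolding u_def w_def by (rule uJ_bounds[OF sg]) (use g gDJ s in auto)
  have "s/16 * (w+1) \<le> 1/2 * (w+1)" using s w by (intro mult_right_mono) auto
  hence ub2: "(w + 1) / 2 \<le> u" using abs_le_D2[OF ub] by (simp add: field_simps)
  have upos: "0 < u" using ub2 w by argo
  define x where "x i = norm (xis t sg i)" for i
  have x: "0 \<le> x i" for i unfolding x_def by simp
  define q where "q = 2 * N * C1 * e + 2 * B * b"
  have q: "0 \<le> q" unfolding q_def using N_ge C1_nn B_nn e b by simp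
  have xq: "x i \<le> q * (1 + a)" if "i < n" for i
   using xis_alive[OF sg al that, of t] unfolding x_def q_def e_def b_def a_def w_def .
  have xB: "x i \<le> B2" if "i < n" for i unfolding x_def by (rule xis_B2[OF sg that])
  have dq: "d \<le> e * C1 * (1 + a)" using dx_alive[OF sg al, of t] unfolding d_def e_def a_def w_def .
  have du: "u' i - u = (W (step t sg i) - W sg) + g * (JJ (step t sg i) - JJ sg)" for i
   unfolding u'_def u_def uJ_def by (simp add: algebra_simps)
  have dabs: "\<bar>u' i - u\<bar> \<le> 2 * b * w + 2 * a * x i + (x i)\<^sup>2 + a * d + b * a + x i" if i: "i < n" for i
  proof -
   have "\<bar>g * (JJ (step t sg i) - JJ sg)\<bar> \<le> g * (DJ * (a * d + b * a + x i))"
    unfolding abs_mult using JJ_step_abs[OF sg, of t i] g unfolding a_def w_def d_def b_def x_def by (auto intro!: mult_left_mono)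
   also have "\<dots> = (g * DJ) * (a * d + b * a + x i)" by simp
   also have "\<dots> \<le> 1 * (a * d + b * a + x i)" using gDJ' a d b x[of i] by (intro mult_right_mono) auto
   finally show ?thesis unfolding du using abs_add_le[OF W_step_abs[OF sg i, of t]] unfolding b_def w_def a_def x_def by fastforce
  qed
  have small: "real m * \<bar>u' i - u\<bar> \<le> u" if i: "i < n" for i
  proof -
   define p where "p = (1 + a)\<^sup>2"
   have pa: "1 + a \<le> p" "a * (1 + a) \<le> p" "a \<le> p" "w \<le> p" unfolding p_def using a by (auto simp: power2_eq_square algebra_simps)
   have p0: "0 \<le> p" unfolding p_def by simp
   have "2 * b * w \<le> 2 * b * p" using pa b by (intro mult_left_mono) auto
   moreover have "2 * a * x i \<le> 2 * q * p"
   proof -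
    have "a * x i \<le> a * (q * (1 + a))" using xq[OF i] a by (intro mult_left_mono) auto
    also have "\<dots> = q * (a * (1 + a))" by simp
    also have "\<dots> \<le> q * p" using pa q by (intro mult_left_mono) auto
    finally show ?thesis by simp
   qed
   moreover have "(x i)\<^sup>2 \<le> q\<^sup>2 * p" unfolding p_def power_mult_distrib[symmetric] using xq[OF i] x by (intro power_mono) auto
   moreover have "a * d \<le> e * C1 * p"
   proof -
    have "a * d \<le> a * (e * C1 * (1 + a))" using dq a by (intro mult_left_mono) auto
    also have "\<dots> = e * C1 * (a * (1 + a))" by simp
    also have "\<dots> \<le> e * C1 * p" using pa e C1_nn by (intro mult_left_mono) auto
    finally show ?thesis .
   qed
   moreover have "b * a \<le> b * p" using pa b by (intro mult_left_mono) auto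
   moreover have "x i \<le> q * p" using xq[OF i] mult_left_mono[OF pa(1) q] by linarith
   ultimately have "\<bar>u' i - u\<bar> \<le> (3 * b + 3 * q + q\<^sup>2 + e * C1) * p" using dabs[OF i] by (simp add: algebra_simps)
   hence "real m * \<bar>u' i - u\<bar> \<le> real m * ((3 * b + 3 * q + q\<^sup>2 + e * C1) * p)" by (intro mult_left_mono) auto
   also have "\<dots> \<le> real m * ((3 * b + 3 * q + q\<^sup>2 + e * C1) * (4 * u))"
    using one_sqrt_sq[OF w] ub2 q b e C1_nn unfolding p_def a_def by (intro mult_left_mono) auto
   also have "\<dots> = (real m * 4 * (3 * b + 3 * q + q\<^sup>2 + e * C1)) * u" by simp
   also have "\<dots> \<le> 1 * u" using e2(2)[of e] e et upos unfolding e0_def e_def[symmetric] be[symmetric] q_def by (intro mult_right_mono) auto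
   finally show ?thesis by simp
  qed
  define V where "V = avg n (\<lambda>i. (x i)\<^sup>2)"
  have V: "V \<le> 5/4 * N\<^sup>2 * d\<^sup>2 + 20 * B\<^sup>2 * b\<^sup>2" unfolding V_def x_def d_def b_def by (rule xis_sq[OF sg])
  have V0: "0 \<le> V" unfolding V_def by (intro avg_nonneg) auto
  have E1: "avg n (\<lambda>i. u' i - u) \<le> - (2 * b - b\<^sup>2) * w + V + (- (\<kappa> * c3 / 2) * d\<^sup>2) + b * (s/4 * w + \<kappa> * Cr / c) + b * (s/16) * (w + 1)"
  proof -
   have "avg n (\<lambda>i. u' i - u) = - (2 * b - b\<^sup>2) * w + V + g * (snd sg \<bullet> (lin (nxt t sg) - lin (fst sg)) - b * (snd sg \<bullet> lin (nxt t sg)))"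
    unfolding du avg_add avg_cmult avg_W_step avg_JJ_step V_def x_def b_def w_def ..
   also have "\<dots> \<le> - (2 * b - b\<^sup>2) * w + V + (- (\<kappa> * c3 / 2) * d\<^sup>2 + b * (s/4 * w + \<kappa> * Cr / c) + b * (s/16) * (w + 1))"
   proof (rule add_left_mono)
    have f1: "g * (snd sg \<bullet> (lin (nxt t sg) - lin (fst sg))) \<le> g * (- c3 * d\<^sup>2 / e + e * r (es sg))"
     using H3_alive[OF sg al, of t] g unfolding d_def e_def by (intro mult_left_mono) auto
    have f2: "\<kappa> * c3 / 2 * d\<^sup>2 \<le> g * (c3 * d\<^sup>2 / e)"
    proof -
     have "e \<le> 2 * g0" using g0 unfolding e_def by simp
     hence "1/2 \<le> g0 / e" using e by (simp add: field_simps)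
     hence "(\<kappa> * c3 * d\<^sup>2) * (1/2) \<le> (\<kappa> * c3 * d\<^sup>2) * (g0 / e)" using kap c3_pos by (intro mult_left_mono) auto
     thus ?thesis unfolding g_def by (simp add: mult_ac)
    qed
    have f3: "g * (e * r (es sg)) \<le> b * (s/4 * w + \<kappa> * Cr / c)"
    proof -
     have "r (es sg) \<le> dl * (es sg)\<^sup>2 + Cr" using Cr(1)[of "es sg"] al unfolding alive_def by simp
     also have "(es sg)\<^sup>2 \<le> w * ((norm dir)\<^sup>2 + 1)"
     proof -
      have "\<bar>es sg\<bar> \<le> norm (snd sg) * norm dir" unfolding es_def by (rule Cauchy_Schwarz_ineq2)
      hence "(es sg)\<^sup>2 \<le> (norm (snd sg) * norm dir)\<^sup>2" by (metis abs_ge_zero power2_abs power_mono)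
      also have "\<dots> = w * (norm dir)\<^sup>2" unfolding w_def W_def by (simp add: power_mult_distrib)
      finally show ?thesis using w by (simp add: algebra_simps)
     qed
     hence "dl * (es sg)\<^sup>2 \<le> dl * (w * ((norm dir)\<^sup>2 + 1))" using dl by (intro mult_left_mono) auto
     also have "\<dots> = s * c / (4 * \<kappa>) * w"
     proof -
      have "(norm dir)\<^sup>2 + 1 \<noteq> 0" by (smt (verit) zero_le_power2)
      thus ?thesis unfolding dl_def by simp
     qed
     finally have rr: "r (es sg) \<le> s * c / (4 * \<kappa>) * w + Cr" by simp
     have "g * (e * r (es sg)) \<le> g * (e * (s * c / (4 * \<kappa>) * w + Cr))" using rr g e by (intro mult_left_mono) auto
     also have "\<dots> \<le> (\<kappa> * e) * (e * (s * c / (4 * \<kappa>) * w + Cr))"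
      using g0 kap e s c_pos w Cr(2) unfolding g_def e_def by (intro mult_right_mono mult_left_mono mult_nonneg_nonneg add_nonneg_nonneg) auto
     also have "\<dots> = b * (s/4 * w + \<kappa> * Cr / c)" unfolding be using kap c_pos by (simp add: power2_eq_square field_simps)
     finally show ?thesis .
    qed
    have f4: "- (g * (b * (snd sg \<bullet> lin (nxt t sg)))) \<le> b * (s/16) * (w + 1)"
    proof -
     have "\<bar>snd sg \<bullet> lin (nxt t sg)\<bar> \<le> DJ * a" using lin_nxt[OF sg, of "snd sg" t] unfolding a_def w_def norm_W[symmetric] .
     hence "g * (b * (- (snd sg \<bullet> lin (nxt t sg)))) \<le> g * (b * (DJ * a))" using g b by (intro mult_left_mono) auto
     also have "\<dots> = b * ((g * DJ) * a)" by simp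
     also have "\<dots> \<le> b * ((s/16) * (w + 1))"
     proof -
      have "a \<le> w + 1" using a zero_le_power2[of "a - 1/2"] by (simp add: power2_eq_square algebra_simps)
      thus ?thesis using gDJ a b s by (intro mult_left_mono mult_mono) auto
     qed
     finally show ?thesis by simp
    qed
    show "g * (snd sg \<bullet> (lin (nxt t sg) - lin (fst sg)) - b * (snd sg \<bullet> lin (nxt t sg))) \<le> - (\<kappa> * c3 / 2) * d\<^sup>2 + b * (s/4 * w + \<kappa> * Cr / c) + b * (s/16) * (w + 1)"
    proof -
     have "g * (snd sg \<bullet> (lin (nxt t sg) - lin (fst sg)) - b * (snd sg \<bullet> lin (nxt t sg))) = g * (snd sg \<bullet> (lin (nxt t sg) - lin (fst sg))) - g * (b * (snd sg \<bullet> lin (nxt t sg)))"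
      by (simp only: right_diff_distrib)
     moreover have "g * (- c3 * d\<^sup>2 / e + e * r (es sg)) = - (g * (c3 * d\<^sup>2 / e)) + g * (e * r (es sg))" by (simp add: algebra_simps)
     moreover have "- (\<kappa> * c3 / 2) * d\<^sup>2 = - (\<kappa> * c3 / 2 * d\<^sup>2)" by simp
     ultimately show ?thesis using f1 f2 f3 f4 by linarith
    qed
   qed
   finally show ?thesis by simp
  qed
  \<comment> \<open>A factor u is split off through \<open>w + 1 \<le> 2 * u\<close>; after division
    by u^2 the second moment then has the same form as the first.\<close>
  have E2: "avg n (\<lambda>i. (u' i - u)\<^sup>2) \<le> 2 * u * (24 * b\<^sup>2 * w + K1 * d\<^sup>2 + K2 * b\<^sup>2)"
  proof -
   have pt: "(u' i - u)\<^sup>2 \<le> (24 * b\<^sup>2 * w\<^sup>2 + 6 * (w * d\<^sup>2 + w * b\<^sup>2)) + (24 * w + 6 * B2\<^sup>2 + 6) * (x i)\<^sup>2" if i: "i < n" for i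
   proof -
    have "(x i)\<^sup>2 \<le> B2\<^sup>2" using xB[OF i] x by (intro power_mono) auto
    hence "(x i)\<^sup>2 * (x i)\<^sup>2 \<le> B2\<^sup>2 * (x i)\<^sup>2" by (intro mult_right_mono) auto
    moreover have "(u' i - u)\<^sup>2 \<le> 6 * ((2*b*w)\<^sup>2 + (2*a*x i)\<^sup>2 + ((x i)\<^sup>2)\<^sup>2 + (a*d)\<^sup>2 + (b*a)\<^sup>2 + (x i)\<^sup>2)"
     by (rule sum_sq6[OF dabs[OF i]])
    ultimately show ?thesis using a(2)
     by (simp add: power_mult_distrib algebra_simps)
   qed
   have "avg n (\<lambda>i. (u' i - u)\<^sup>2) \<le> (24 * b\<^sup>2 * w\<^sup>2 + 6 * (w * d\<^sup>2 + w * b\<^sup>2)) + (24 * w + 6 * B2\<^sup>2 + 6) * V"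
    using avg_mono[OF pt, of n] unfolding V_def by (simp only: avg_add avg_cmult avg_const[OF n_pos])
   also have "\<dots> \<le> 24 * b\<^sup>2 * (w * (w + 1)) + 6 * ((w + 1) * d\<^sup>2 + (w + 1) * b\<^sup>2) + (6 * (5 + B2\<^sup>2) * (w + 1)) * (5/4 * N\<^sup>2 * d\<^sup>2 + 20 * B\<^sup>2 * b\<^sup>2)"
   proof (intro add_mono)
    show "(24 * w + 6 * B2\<^sup>2 + 6) * V \<le> (6 * (5 + B2\<^sup>2) * (w + 1)) * (5/4 * N\<^sup>2 * d\<^sup>2 + 20 * B\<^sup>2 * b\<^sup>2)"
    proof (rule mult_mono[OF _ V])
     have "0 \<le> B2\<^sup>2 * w" using w by simp
     thus "24 * w + 6 * B2\<^sup>2 + 6 \<le> 6 * (5 + B2\<^sup>2) * (w + 1)" using w by (simp add: algebra_simps)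
    qed (use w V0 in auto)
    show "24 * b\<^sup>2 * w\<^sup>2 \<le> 24 * b\<^sup>2 * (w * (w + 1))" using w by (intro mult_left_mono) (auto simp: power2_eq_square algebra_simps)
    show "6 * (w * d\<^sup>2 + w * b\<^sup>2) \<le> 6 * ((w + 1) * d\<^sup>2 + (w + 1) * b\<^sup>2)" by (simp add: algebra_simps)
   qed
   also have "\<dots> = (w + 1) * (24 * b\<^sup>2 * w + K1 * d\<^sup>2 + K2 * b\<^sup>2)" unfolding K1_def K2_def by (simp add: algebra_simps)
   also have "\<dots> \<le> (2 * u) * (24 * b\<^sup>2 * w + K1 * d\<^sup>2 + K2 * b\<^sup>2)"
    using ub2 w K1 K2 by (intro mult_right_mono) auto
   finally show ?thesis .
  qed
  define E where "E = - b * (2 - s / 2) * w + b * C4"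
  have tot: "real m * (avg n (\<lambda>i. u' i - u) / u) + (real m)\<^sup>2 * (avg n (\<lambda>i. (u' i - u)\<^sup>2) / u\<^sup>2) \<le> real m * (E / u)"
  proof -
   have "(real m)\<^sup>2 * (avg n (\<lambda>i. (u' i - u)\<^sup>2) / u\<^sup>2) \<le> (real m)\<^sup>2 * ((2 * u * (24 * b\<^sup>2 * w + K1 * d\<^sup>2 + K2 * b\<^sup>2)) / u\<^sup>2)"
    using E2 by (intro mult_left_mono divide_right_mono) auto
   also have "\<dots> = real m * ((2 * real m * (24 * b\<^sup>2 * w + K1 * d\<^sup>2 + K2 * b\<^sup>2)) / u)"
    using upos by (simp add: power2_eq_square field_simps)
   finally have p1: "(real m)\<^sup>2 * (avg n (\<lambda>i. (u' i - u)\<^sup>2) / u\<^sup>2) \<le> real m * ((2 * real m * (24 * b\<^sup>2 * w + K1 * d\<^sup>2 + K2 * b\<^sup>2)) / u)" .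
   have p2: "avg n (\<lambda>i. u' i - u) + 2 * real m * (24 * b\<^sup>2 * w + K1 * d\<^sup>2 + K2 * b\<^sup>2) \<le> E"
   proof -
    have bsq: "b\<^sup>2 \<le> b" using b by (simp add: power2_eq_square mult_left_le)
    have "b * (b * (1 + 48 * real m)) * w \<le> b * (s/8) * w"
     using e1(2)[of e] e et b w unfolding e0_def e_def[symmetric] be[symmetric] by (intro mult_right_mono mult_left_mono) auto
    hence q1: "b\<^sup>2 * w + 48 * real m * (b\<^sup>2 * w) \<le> b * (s/8) * w" by (simp add: power2_eq_square algebra_simps)
    have q2: "(20 * B\<^sup>2 + 2 * real m * K2) * b\<^sup>2 \<le> (20 * B\<^sup>2 + 2 * real m * K2) * b"
     using bsq K2 by (intro mult_left_mono) auto
    have q3: "b * (s/16) * (w + 1) \<le> b * (s/16) * w + b" using b s by (simp add: algebra_simps mult_le_cancel_left1)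
    have "avg n (\<lambda>i. u' i - u) + 2 * real m * (24 * b\<^sup>2 * w + K1 * d\<^sup>2 + K2 * b\<^sup>2)
     \<le> (- (2 * b - b\<^sup>2) * w + (5/4 * N\<^sup>2 * d\<^sup>2 + 20 * B\<^sup>2 * b\<^sup>2) + (- (5/4 * N\<^sup>2 + 2 * real m * K1) * d\<^sup>2) + b * (s/4 * w + \<kappa> * Cr / c) + b * (s/16) * (w + 1)) + 2 * real m * (24 * b\<^sup>2 * w + K1 * d\<^sup>2 + K2 * b\<^sup>2)"
     using E1 V unfolding kapc3 by linarith
    also have "\<dots> = - 2 * b * w + (b\<^sup>2 * w + 48 * real m * (b\<^sup>2 * w)) + (20 * B\<^sup>2 + 2 * real m * K2) * b\<^sup>2 + b * (s/4 * w + \<kappa> * Cr / c) + b * (s/16) * (w + 1)"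
     by (simp add: algebra_simps)
    also have "\<dots> \<le> - 2 * b * w + b * (s/8) * w + (20 * B\<^sup>2 + 2 * real m * K2) * b + b * (s/4 * w + \<kappa> * Cr / c) + (b * (s/16) * w + b)"
     using q1 q2 q3 by linarith
    also have "\<dots> \<le> E"
    proof -
     have "0 \<le> b * s * w" using b s w by simp
     thus ?thesis unfolding E_def C4_def by (simp add: algebra_simps)
    qed
    finally show ?thesis .
   qed
   have "real m * (avg n (\<lambda>i. u' i - u) / u) + real m * ((2 * real m * (24 * b\<^sup>2 * w + K1 * d\<^sup>2 + K2 * b\<^sup>2)) / u) = real m * ((avg n (\<lambda>i. u' i - u) + 2 * real m * (24 * b\<^sup>2 * w + K1 * d\<^sup>2 + K2 * b\<^sup>2)) / u)"
    by (simp add: add_divide_distrib algebra_simps)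
   also have "\<dots> \<le> real m * (E / u)" using p2 upos by (intro mult_left_mono divide_right_mono) auto
   finally show ?thesis using p1 by linarith
  qed
  have EW: "E \<le> - b * (2 - 2 * s / 2) * u + b * (C4 + 2)"
  proof -
   have "u \<le> (1 + s/16) * (w + 1)" using abs_le_D1[OF ub] by argo
   hence "(2 - s) * u \<le> (2 - s) * ((1 + s/16) * (w + 1))" using s by (intro mult_left_mono) auto
   also have "\<dots> \<le> (2 - s/2) * (w + 1)"
   proof -
    have "(2 - s) * (1 + s/16) \<le> 2 - s/2" using s zero_le_power2[of s] by (simp add: power2_eq_square algebra_simps)
    thus ?thesis using w mult_right_mono[of "(2 - s) * (1 + s/16)" "2 - s/2" "w+1"] by simp
   qed
   finally have "(2 - s) * u \<le> (2 - s/2) * w + 2" using s by (simp add: algebra_simps add_divide_distrib)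
   hence "b * ((2 - s) * u) \<le> b * ((2 - s/2) * w + 2)" using b by (intro mult_left_mono) auto
   thus ?thesis unfolding E_def by (simp add: algebra_simps)
  qed
  define v where "v = u ^ (m - 1)"
  have v0: "0 \<le> v" unfolding v_def using upos by simp
  have um: "u ^ m = u * v" unfolding v_def using m by (metis power_minus_mult mult.commute)
  have "A t (\<lambda>sg. uJ g sg ^ m) sg = avg n (\<lambda>i. u' i ^ m)" unfolding A_def u'_def by simp
  also have "\<dots> \<le> u ^ m * (1 + real m * (avg n (\<lambda>i. u' i - u) / u) + (real m)\<^sup>2 * (avg n (\<lambda>i. (u' i - u)\<^sup>2) / u\<^sup>2))"
   by (rule avg_power_le[OF n_pos m upos small])
  also have "\<dots> \<le> u ^ m * (1 + real m * (E / u))" using tot upos by (intro mult_left_mono) auto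
  also have "\<dots> = u ^ m + real m * E * v" unfolding um using upos by (simp add: field_simps)
  also have "\<dots> \<le> u ^ m + real m * (- b * (2 - s) * u + b * (C4 + 2)) * v"
   using EW v0 by (intro add_left_mono mult_right_mono mult_left_mono) auto
  also have "\<dots> = (1 - real m * (2 - s) * b) * u ^ m + b * (real m * (C4 + 2) * v)"
   unfolding um by (simp add: algebra_simps)
  also have "\<dots> \<le> (1 - real m * (2 - s) * b) * u ^ m + b * (real m * s * u ^ m + C5)"
  proof -
   \<comment> \<open>Either u is large and the residual is a share s of u^m, or u is bounded and the
     residual is a constant.\<close>
   have "real m * (C4 + 2) * v \<le> real m * s * u ^ m + C5"
   proof (cases "(C4 + 2) / s \<le> u")
    case True
    hence "C4 + 2 \<le> s * u" using s by (simp add: field_simps)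
    hence "real m * ((C4 + 2) * v) \<le> real m * ((s * u) * v)" using v0 by (intro mult_left_mono mult_right_mono) auto
    thus ?thesis using C5 unfolding um by (simp add: mult_ac)
   next
    case False
    hence "v \<le> ((C4 + 2) / s) ^ (m - 1)" unfolding v_def using upos by (intro power_mono) auto
    hence "real m * (C4 + 2) * v \<le> C5" unfolding C5_def using C4 by (intro mult_left_mono) auto
    moreover have "0 \<le> real m * s * u ^ m" using upos s by simp
    ultimately show ?thesis by linarith
   qed
   thus ?thesis using b by (intro add_left_mono mult_left_mono) auto
  qed
  also have "\<dots> = (1 - 2 * real m * (1 - s) * b) * u ^ m + C5 * b" by (simp add: algebra_simps)
  finally show ?thesis using gDJ' unfolding u_def g_def b_def by simp
 qed
 have "0 < e0" unfolding e0_def using e1 e2 e3 by simp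
 thus ?thesis using kap C5 main by blast
qed

section \<open>The Lyapunov function U and its first and fifth moments\<close>

definition kU :: real where "kU = 40 * N\<^sup>2"
text \<open>The factor \<open>40 * N^2\<close> turns the descent \<open>3/8 * dx^2 / eta\<close>
  into \<open>15 * N^2 * dx^2\<close>, which outweighs the variance \<open>5/4 * N^2 * dx^2\<close>.
  The descent error \<open>4 * eta * |e|^2\<close> becomes \<open>160 * N^2 * eta^2 * |e|^2\<close>;
  since c is at least \<open>130 * N^2\<close> this is at most 16/13 of beta |e|^2, below the
  contraction 2 beta |e|^2.\<close>

definition U :: "nat \<Rightarrow> 'x \<times> 'h \<Rightarrow> real" where "U t sg = W sg + kU * \<eta> t * F (fst sg)"

lemma N2_ge: "1 \<le> N\<^sup>2" using N_ge by (simp add: one_le_power)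
lemma kU_pos: "0 < kU" unfolding kU_def using N2_ge by linarith

lemma N2_eta: "N\<^sup>2 * (\<eta> t)\<^sup>2 \<le> \<beta> t / 130"
 unfolding beta_def using mult_right_mono[OF c_ge, of "(\<eta> t)\<^sup>2"] by (simp add: mult_ac)

lemma fst_step: "fst (step t sg i) = nxt t sg" unfolding step_def by simp

lemma F_nn: "x \<in> X \<Longrightarrow> 0 \<le> F x" using F_bd[of x] Flo_pos by linarith

lemma Fhi_pos: "sg \<in> S \<Longrightarrow> 0 < Fhi" using F_bd[OF fst_S, of sg] Flo_pos by auto

lemma U_diff: "U (Suc t) (step t sg i) - U t sg = (W (step t sg i) - W sg) + kU * (\<eta> (Suc t) * F (nxt t sg) - \<eta> t * F (fst sg))"
 unfolding U_def fst_step by (simp add: algebra_simps)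

lemma etaF_alive:
 assumes sg: "sg \<in> S" and al: "alive (1/2) sg"
 shows "kU * (\<eta> (Suc t) * F (nxt t sg) - \<eta> t * F (fst sg)) \<le> - 15 * N\<^sup>2 * (dx t sg)\<^sup>2 + 16/13 * \<beta> t * W sg"
proof -
 have e: "0 < \<eta> t" by (rule eta_pos)
 have "\<eta> (Suc t) * F (nxt t sg) \<le> \<eta> t * F (nxt t sg)"
  using eta_dec[of t] F_nn[OF nxt_X[OF sg]] by (intro mult_right_mono) auto
 hence "\<eta> (Suc t) * F (nxt t sg) - \<eta> t * F (fst sg) \<le> \<eta> t * (F (nxt t sg) - F (fst sg))" by (simp add: algebra_simps)
 also have "\<dots> \<le> \<eta> t * (- 3/8 * (dx t sg)\<^sup>2 / \<eta> t + 4 * \<eta> t * W sg)"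
  using H2_alive[OF sg al, of t] e by (intro mult_left_mono) auto
 also have "\<dots> = - 3/8 * (dx t sg)\<^sup>2 + 4 * (\<eta> t)\<^sup>2 * W sg" using e by (simp add: field_simps power2_eq_square)
 finally have "kU * (\<eta> (Suc t) * F (nxt t sg) - \<eta> t * F (fst sg)) \<le> kU * (- 3/8 * (dx t sg)\<^sup>2 + 4 * (\<eta> t)\<^sup>2 * W sg)"
  using kU_pos by (intro mult_left_mono) auto
 also have "\<dots> = - 15 * N\<^sup>2 * (dx t sg)\<^sup>2 + 160 * (N\<^sup>2 * (\<eta> t)\<^sup>2) * W sg" unfolding kU_def by (simp add: algebra_simps)
 also have "\<dots> \<le> - 15 * N\<^sup>2 * (dx t sg)\<^sup>2 + 160 * (\<beta> t / 130) * W sg"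
  using N2_eta[of t] by (intro add_left_mono mult_right_mono) auto
 finally show ?thesis by simp
qed

lemma U_drift1:
 assumes sg: "sg \<in> S" and al: "alive (1/2) sg" and b: "\<beta> t \<le> 1/20"
 shows "A t (U (Suc t)) sg \<le> U t sg - 7/10 * \<beta> t * W sg - N\<^sup>2 * (dx t sg)\<^sup>2 + 20 * B\<^sup>2 * (\<beta> t)\<^sup>2"
proof -
 have "A t (U (Suc t)) sg - U t sg = avg n (\<lambda>i. U (Suc t) (step t sg i) - U t sg)"
  unfolding A_def using n_pos by (simp add: avg_diff)
 also have "\<dots> = avg n (\<lambda>i. W (step t sg i) - W sg) + kU * (\<eta> (Suc t) * F (nxt t sg) - \<eta> t * F (fst sg))"
  unfolding U_diff using n_pos by (simp only: avg_add avg_const)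
 also have "\<dots> \<le> (- (2 * \<beta> t - (\<beta> t)\<^sup>2) * W sg + (5/4 * N\<^sup>2 * (dx t sg)\<^sup>2 + 20 * B\<^sup>2 * (\<beta> t)\<^sup>2)) + (- 15 * N\<^sup>2 * (dx t sg)\<^sup>2 + 16/13 * \<beta> t * W sg)"
  unfolding avg_W_step by (intro add_mono xis_sq[OF sg] etaF_alive[OF sg al] order_refl)
 \<comment> \<open>2 - 16/13 - 1/20 exceeds 7/10, and 15 - 5/4 exceeds 1.\<close>
 also have "\<dots> \<le> - 7/10 * \<beta> t * W sg - N\<^sup>2 * (dx t sg)\<^sup>2 + 20 * B\<^sup>2 * (\<beta> t)\<^sup>2"
 proof -
  have "\<beta> t * \<beta> t * W sg \<le> 1/20 * \<beta> t * W sg" using b beta_pos[of t] by (intro mult_right_mono) auto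
  moreover have "0 \<le> \<beta> t * W sg" "0 \<le> N\<^sup>2 * (dx t sg)\<^sup>2" using beta_pos[of t] by auto
  ultimately show ?thesis by (simp add: power2_eq_square algebra_simps)
 qed
 finally show ?thesis by simp
qed

text \<open>Without a usable direction F may change arbitrarily within its range, while the noise is
  bounded by B2. A dead step thus costs a constant, to be weighed by the probability of being
  dead.\<close>

lemma U_drift_dead:
 assumes sg: "sg \<in> S"
 shows "A t (U (Suc t)) sg \<le> U t sg - \<beta> t * W sg + (B2\<^sup>2 + kU * \<eta> 0 * Fhi)"
proof -
 have "A t (U (Suc t)) sg - U t sg = avg n (\<lambda>i. U (Suc t) (step t sg i) - U t sg)"
  unfolding A_def using n_pos by (simp add: avg_diff)
 also have "\<dots> = avg n (\<lambda>i. W (step t sg i) - W sg) + kU * (\<eta> (Suc t) * F (nxt t sg) - \<eta> t * F (fst sg))"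
  unfolding U_diff using n_pos by (simp only: avg_add avg_const)
 also have "\<dots> \<le> (- (2 * \<beta> t - (\<beta> t)\<^sup>2) * W sg + B2\<^sup>2) + kU * (\<eta> 0 * Fhi - 0)"
  unfolding avg_W_step
 proof (intro add_mono order_refl avg_le[OF n_pos] mult_left_mono diff_mono mult_mono)
  show "(norm (xis t sg i))\<^sup>2 \<le> B2\<^sup>2" if "i < n" for i using xis_B2[OF sg that] by (intro power_mono) auto
  show "\<eta> (Suc t) \<le> \<eta> 0" by (rule eta_antimono) simp
  show "F (nxt t sg) \<le> Fhi" using F_bd[OF nxt_X[OF sg]] by simp
  show "0 \<le> F (nxt t sg)" by (rule F_nn[OF nxt_X[OF sg]])
  show "0 \<le> \<eta> t * F (fst sg)" using F_nn[OF fst_S[OF sg]] eta_pos[of t] by simp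
 qed (use kU_pos eta_pos[of 0] in auto)
 also have "\<dots> \<le> - \<beta> t * W sg + (B2\<^sup>2 + kU * \<eta> 0 * Fhi)"
  using mult_right_mono[of "(\<beta> t)\<^sup>2" "\<beta> t" "W sg"] beta_pos[of t] beta_le1[of t] W_nn[of sg]
  by (simp add: power2_eq_square algebra_simps mult_left_le)
 finally show ?thesis by simp
qed

lemma U_lower: "sg \<in> S \<Longrightarrow> W sg \<le> U t sg" "sg \<in> S \<Longrightarrow> kU * \<eta> t * Flo \<le> U t sg"
 "sg \<in> S \<Longrightarrow> 0 < U t sg"  "sg \<in> S \<Longrightarrow> U t sg \<le> W sg + kU * \<eta> t * Fhi" "sg \<in> S \<Longrightarrow> W sg + kU * \<eta> t * Flo \<le> U t sg"
proof -
 assume sg: "sg \<in> S"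
 have p: "0 < kU * \<eta> t" using kU_pos eta_pos[of t] by simp
 have "kU * \<eta> t * Flo \<le> kU * \<eta> t * F (fst sg)" "kU * \<eta> t * F (fst sg) \<le> kU * \<eta> t * Fhi"
  using F_bd[OF fst_S[OF sg]] p by (auto intro: mult_left_mono)
 moreover have "0 < kU * \<eta> t * Flo" using p Flo_pos by simp
 ultimately show "W sg \<le> U t sg" "kU * \<eta> t * Flo \<le> U t sg" "0 < U t sg" "U t sg \<le> W sg + kU * \<eta> t * Fhi" "W sg + kU * \<eta> t * Flo \<le> U t sg"
  unfolding U_def using W_nn[of sg] by linarith+
qed

text \<open>The noise floor of U is of order eta, and the residual is beta times its fifth power.
  The positive lower bound of F enters here: it keeps U above a multiple of eta, so that noise of
  size eta * (1 + |e|) changes U only by a small fraction.\<close>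

lemma U_drift5:
 "\<exists>K\<ge>0. \<exists>e0>0. \<forall>t sg. \<eta> t \<le> e0 \<and> sg \<in> S \<and> alive (1/2) sg \<longrightarrow>
   A t (\<lambda>sg. U (Suc t) sg ^ 5) sg \<le> (1 - 3 * \<beta> t) * U t sg ^ 5 + K * \<beta> t * \<eta> t ^ 5"
proof -
 \<comment> \<open>U is at least \<open>fl * eta\<close>, hence \<open>1 / U\<close> is at most
   \<open>1 / (fl * eta)\<close>; most of the smallness conditions are stated through this
   quotient.\<close>
 define fl where "fl = kU * Flo"
 have fl: "0 < fl" unfolding fl_def using kU_pos Flo_pos by simp
 define Fh where "Fh = max Fhi 0"
 have Fh: "0 \<le> Fh" unfolding Fh_def by simp
 define Q :: "real \<Rightarrow> real" where "Q x = 2 * N * C1 * x + 2 * B * (c * x\<^sup>2)" for x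
 have "\<exists>e1>0. \<forall>x. 0 < x \<and> x \<le> e1 \<longrightarrow> c * x\<^sup>2 * (1 + 291) \<le> 1/20"
  by (rule small_at_zero) (auto intro!: tendsto_eq_intros)
 then obtain e1 where e1: "0 < e1" "\<And>x. 0 < x \<Longrightarrow> x \<le> e1 \<Longrightarrow> c * x\<^sup>2 * (1 + 291) \<le> 1/20" by auto
 \<comment> \<open>With \<open>Q' = Q / x\<close> the products of Q with
   \<open>1 / sqrt (fl * x)\<close> and of Q^2 with \<open>1 / (fl * x)\<close> visibly tend to
   0.\<close>
 define Q' :: "real \<Rightarrow> real" where "Q' x = 2 * N * C1 + 2 * B * c * x" for x
 have QQ: "Q x = x * Q' x" for x unfolding Q_def Q'_def by (simp add: power2_eq_square algebra_simps)
 have Qlim: "(Q' \<longlongrightarrow> 2 * N * C1) (at_right 0)" unfolding Q'_def by (auto intro!: tendsto_eq_intros)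
 have sq1: "x * (1 / sqrt (fl * x)) = sqrt x / sqrt fl" if "0 < x" for x
 proof -
  have "x = sqrt x * sqrt x" using that by simp
  thus ?thesis using that fl by (simp add: real_sqrt_mult field_simps)
 qed
 have "\<exists>e2>0. \<forall>x. 0 < x \<and> x \<le> e2 \<longrightarrow> 66 * (Q' x)\<^sup>2 * (x\<^sup>2 + x / fl) \<le> 1/5"
 proof (rule small_at_zero)
  show "((\<lambda>x. 66 * (Q' x)\<^sup>2 * (x\<^sup>2 + x / fl)) \<longlongrightarrow> 0) (at_right 0)"
   using fl by (auto intro!: tendsto_eq_intros Qlim)
 qed simp
 moreover have "66 * (Q' x)\<^sup>2 * (x\<^sup>2 + x / fl) = 66 * (Q x)\<^sup>2 * (1 + 1 / (fl * x))" if "0 < x" for x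
  unfolding QQ using that fl by (simp add: power2_eq_square field_simps)
 ultimately obtain e2 where e2: "0 < e2" "\<And>x. 0 < x \<Longrightarrow> x \<le> e2 \<Longrightarrow> 66 * (Q x)\<^sup>2 * (1 + 1 / (fl * x)) \<le> 1/5" by auto
 have "\<exists>e3>0. \<forall>x. 0 < x \<and> x \<le> e3 \<longrightarrow> 66 * kU\<^sup>2 * x * L1\<^sup>2 / fl \<le> 1/5"
  by (rule small_at_zero) (use fl in \<open>auto intro!: tendsto_eq_intros\<close>)
 then obtain e3 where e3: "0 < e3" "\<And>x. 0 < x \<Longrightarrow> x \<le> e3 \<Longrightarrow> 66 * kU\<^sup>2 * x * L1\<^sup>2 / fl \<le> 1/5" by auto
 have ex4: "\<exists>e4>0. \<forall>x. 0 < x \<and> x \<le> e4 \<longrightarrow> 20 * (2 * (c * x\<^sup>2) + 2 * Q' x * (x + sqrt x / sqrt fl) + 2 * (Q' x)\<^sup>2 * (x\<^sup>2 + x / fl) + kU * L1 * C1 * (x / fl + x * (sqrt x / sqrt fl)) + kU * h3 * x * Fh / fl) \<le> 1"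
 proof (rule small_at_zero)
  show "((\<lambda>x. 20 * (2 * (c * x\<^sup>2) + 2 * Q' x * (x + sqrt x / sqrt fl) + 2 * (Q' x)\<^sup>2 * (x\<^sup>2 + x / fl) + kU * L1 * C1 * (x / fl + x * (sqrt x / sqrt fl)) + kU * h3 * x * Fh / fl)) \<longlongrightarrow> 0) (at_right 0)"
   using fl by (auto intro!: tendsto_eq_intros Qlim)
 qed simp
 have eq4: "20 * (2 * (c * x\<^sup>2) + 2 * Q' x * (x + sqrt x / sqrt fl) + 2 * (Q' x)\<^sup>2 * (x\<^sup>2 + x / fl) + kU * L1 * C1 * (x / fl + x * (sqrt x / sqrt fl)) + kU * h3 * x * Fh / fl)
   = 20 * (2 * (c * x\<^sup>2) + 2 * Q x * (1 + 1 / sqrt (fl * x)) + 2 * (Q x)\<^sup>2 * (1 + 1 / (fl * x)) + kU * x\<^sup>2 * L1 * C1 * (1 / (fl * x) + 1 / sqrt (fl * x)) + kU * h3 * x * Fh / fl)" if "0 < x" for x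
 proof -
  have "2 * Q x * (1 + 1 / sqrt (fl * x)) = 2 * Q' x * (x + x * (1 / sqrt (fl * x)))" unfolding QQ by (simp add: algebra_simps)
  moreover have "2 * (Q x)\<^sup>2 * (1 + 1 / (fl * x)) = 2 * (Q' x)\<^sup>2 * (x\<^sup>2 + x / fl)" unfolding QQ using that fl by (simp add: power2_eq_square field_simps)
  moreover have "kU * x\<^sup>2 * L1 * C1 * (1 / (fl * x) + 1 / sqrt (fl * x)) = kU * L1 * C1 * (x * (x * (1 / (fl * x))) + x * (x * (1 / sqrt (fl * x))))"
   by (simp add: power2_eq_square algebra_simps)
  moreover have "x * (x * (1 / (fl * x))) = x / fl" using that by simp
  ultimately show ?thesis by (simp only: sq1[OF that])
 qed
 from ex4 obtain e4 where e4': "0 < e4" "\<And>x. 0 < x \<Longrightarrow> x \<le> e4 \<Longrightarrow> 20 * (2 * (c * x\<^sup>2) + 2 * Q' x * (x + sqrt x / sqrt fl) + 2 * (Q' x)\<^sup>2 * (x\<^sup>2 + x / fl) + kU * L1 * C1 * (x / fl + x * (sqrt x / sqrt fl)) + kU * h3 * x * Fh / fl) \<le> 1"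
  by blast
 have e4: "0 < e4" "\<And>x. 0 < x \<Longrightarrow> x \<le> e4 \<Longrightarrow> 20 * (2 * (c * x\<^sup>2) + 2 * Q x * (1 + 1 / sqrt (fl * x)) + 2 * (Q x)\<^sup>2 * (1 + 1 / (fl * x)) + kU * x\<^sup>2 * L1 * C1 * (1 / (fl * x) + 1 / sqrt (fl * x)) + kU * h3 * x * Fh / fl) \<le> 1"
 proof -
  show "0 < e4" by (rule e4'(1))
  fix x :: real assume x: "0 < x" "x \<le> e4"
  show "20 * (2 * (c * x\<^sup>2) + 2 * Q x * (1 + 1 / sqrt (fl * x)) + 2 * (Q x)\<^sup>2 * (1 + 1 / (fl * x)) + kU * x\<^sup>2 * L1 * C1 * (1 / (fl * x) + 1 / sqrt (fl * x)) + kU * h3 * x * Fh / fl) \<le> 1"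
   using e4'(2)[OF x] unfolding eq4[OF x(1)] .
 qed
 define K1 where "K1 = 66 * kU\<^sup>2 * h3\<^sup>2 * Fh\<^sup>2 / fl"
 have K1: "0 \<le> K1" unfolding K1_def using fl by simp
 define K2 where "K2 = 240 * B\<^sup>2 * c * \<eta> 0 + 3 * K1 / c + 7/10 * kU * Fh + 1"
 have K2: "1 \<le> K2" unfolding K2_def using K1 c_pos eta_pos[of 0] kU_pos Fh by simp
 define K3 where "K3 = 5 * K2 * (10 * K2) ^ 4"
 have K3: "0 \<le> K3" unfolding K3_def using K2 by simp
 define e0 where "e0 = min (min e1 e2) (min e3 e4)"
 have main: "A t (\<lambda>sg. U (Suc t) sg ^ 5) sg \<le> (1 - 3 * \<beta> t) * U t sg ^ 5 + K3 * \<beta> t * \<eta> t ^ 5"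
  if et: "\<eta> t \<le> e0" and sg: "sg \<in> S" and al: "alive (1/2) sg" for t sg
 proof -
  define b w d e u q where "b = \<beta> t" and "w = W sg" and "d = dx t sg" and "e = \<eta> t" and "u = U t sg" and "q = Q (\<eta> t)"
  define u' where "u' i = U (Suc t) (step t sg i)" for i
  define a where "a = sqrt w"
  have FhF: "Fhi = Fh" unfolding Fh_def using Fhi_pos[OF sg] by simp
  have b: "0 < b" "b \<le> 1" using beta_pos[of t] beta_le1[of t] unfolding b_def by auto
  have w: "0 \<le> w" unfolding w_def by simp
  have a: "0 \<le> a" "a\<^sup>2 = w" unfolding a_def using w by auto
  have d: "0 \<le> d" unfolding d_def by simp
  have e: "0 < e" unfolding e_def by (rule eta_pos)
  have be: "b = c * e\<^sup>2" unfolding b_def e_def beta_def ..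
  have qe: "q = 2 * N * C1 * e + 2 * B * b" unfolding q_def Q_def e_def[symmetric] be ..
  have q: "0 \<le> q" unfolding qe using N_ge C1_nn B_nn e b by simp
  have ul: "w \<le> u" "fl * e \<le> u" "0 < u" "u \<le> w + kU * e * Fh"
   using U_lower[OF sg, of t] unfolding w_def u_def fl_def e_def FhF by (auto simp: mult_ac)
  have fle: "0 < fl * e" using fl e by simp
  have one_u: "1 \<le> u * (1 / (fl * e))" using ul fle by (simp add: field_simps)
  have wu: "w + 1 \<le> u * (1 + 1 / (fl * e))" using ul(1) one_u by (simp add: algebra_simps)
  have su: "sqrt u \<le> u * (1 / sqrt (fl * e))"
  proof -
   have "sqrt (fl * e) * sqrt u \<le> sqrt u * sqrt u" using ul by (intro mult_right_mono) auto
   hence "sqrt (fl * e) * sqrt u \<le> u" using ul by simp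
   thus ?thesis using fle by (simp add: field_simps)
  qed
  have au: "a \<le> u * (1 / sqrt (fl * e))" using su ul(1) unfolding a_def by (meson order_trans real_sqrt_le_mono)
  define x where "x i = norm (xis t sg i)" for i
  have x: "0 \<le> x i" for i unfolding x_def by simp
  have xq: "x i \<le> q * (1 + a)" if "i < n" for i
   using xis_alive[OF sg al that, of t] unfolding x_def qe e_def b_def a_def w_def .
  have xq2: "(x i)\<^sup>2 \<le> 2 * q\<^sup>2 * (w + 1)" if "i < n" for i
  proof -
   have "(x i)\<^sup>2 \<le> (q * (1 + a))\<^sup>2" using xq[OF that] x by (intro power_mono) auto
   also have "\<dots> \<le> q\<^sup>2 * (2 * (w + 1))" unfolding power_mult_distrib a_def using one_sqrt_sq[OF w] by (intro mult_left_mono) auto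
   finally show ?thesis by (simp add: algebra_simps)
  qed
  have dq: "d \<le> e * C1 * (1 + a)" using dx_alive[OF sg al, of t] unfolding d_def e_def a_def w_def .
  define z where "z = kU * (e * (L1 * d) + h3 * e\<^sup>2 * Fh)"
  have z0: "0 \<le> z" unfolding z_def using kU_pos e L1_nn d h3_nn Fh by simp
  have zb: "\<bar>kU * (\<eta> (Suc t) * F (nxt t sg) - \<eta> t * F (fst sg))\<bar> \<le> z"
  proof -
   have F': "0 \<le> F (nxt t sg)" "F (nxt t sg) \<le> Fh" using F_nn[OF nxt_X[OF sg]] F_bd[OF nxt_X[OF sg]] FhF by auto
   have "\<bar>\<eta> t * (F (nxt t sg) - F (fst sg))\<bar> \<le> e * (L1 * d)"
    unfolding abs_mult e_def d_def dx_def using F_lip[OF nxt_X[OF sg] fst_S[OF sg]] eta_pos[of t] by (auto intro!: mult_mono)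
   moreover have "\<bar>(\<eta> t - \<eta> (Suc t)) * F (nxt t sg)\<bar> \<le> (h3 * e\<^sup>2) * Fh"
    unfolding abs_mult e_def using F' eta_dec[of t] eta_diff[of t] h3_nn by (intro mult_mono) auto
   moreover have "\<eta> (Suc t) * F (nxt t sg) - \<eta> t * F (fst sg) = \<eta> t * (F (nxt t sg) - F (fst sg)) - (\<eta> t - \<eta> (Suc t)) * F (nxt t sg)"
    by (simp add: algebra_simps)
   ultimately have "\<bar>\<eta> (Suc t) * F (nxt t sg) - \<eta> t * F (fst sg)\<bar> \<le> e * (L1 * d) + h3 * e\<^sup>2 * Fh" by linarith
   thus ?thesis unfolding z_def abs_mult using kU_pos by (auto intro: mult_left_mono)
  qed
  have dabs: "\<bar>u' i - u\<bar> \<le> 2 * b * w + 2 * a * x i + (x i)\<^sup>2 + z" if i: "i < n" for i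
   using abs_add_le[OF W_step_abs[OF sg i, of t] zb] unfolding U_diff u'_def u_def b_def w_def a_def x_def by simp
  have small: "20 * \<bar>u' i - u\<bar> \<le> u" if i: "i < n" for i
  proof -
   have f1: "2 * b * w \<le> u * (2 * b)" using ul b by (simp add: mult.commute mult_left_mono)
   have f2: "2 * a * x i \<le> u * (2 * q * (1 + 1 / sqrt (fl * e)))"
   proof -
    have "a * x i \<le> a * (q * (1 + a))" using xq[OF i] a by (intro mult_left_mono) auto
    also have "\<dots> = q * (a + w)" using a by (simp add: power2_eq_square algebra_simps)
    also have "\<dots> \<le> q * (u * (1 / sqrt (fl * e)) + u)" using au ul q by (intro mult_left_mono add_mono) auto
    finally have "2 * (a * x i) \<le> 2 * (q * (u * (1 / sqrt (fl * e)) + u))" by simp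
    thus ?thesis by (simp add: algebra_simps)
   qed
   have f3: "(x i)\<^sup>2 \<le> u * (2 * q\<^sup>2 * (1 + 1 / (fl * e)))"
    using xq2[OF i] mult_left_mono[OF wu, of "2 * q\<^sup>2"] by (simp add: algebra_simps)
   have f4: "z \<le> u * (kU * e\<^sup>2 * L1 * C1 * (1 / (fl * e) + 1 / sqrt (fl * e)) + kU * h3 * e * Fh / fl)"
   proof -
    have "kU * (e * (L1 * d)) \<le> kU * (e * (L1 * (e * C1 * (1 + a))))" using dq kU_pos e L1_nn by (intro mult_left_mono) auto
    also have "\<dots> = kU * e\<^sup>2 * L1 * C1 * (1 + a)" by (simp add: power2_eq_square)
    also have "\<dots> \<le> kU * e\<^sup>2 * L1 * C1 * (u * (1 / (fl * e)) + u * (1 / sqrt (fl * e)))"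
     using one_u au kU_pos L1_nn C1_nn by (intro mult_left_mono add_mono) auto
    finally have 1: "kU * (e * (L1 * d)) \<le> u * (kU * e\<^sup>2 * L1 * C1 * (1 / (fl * e) + 1 / sqrt (fl * e)))" by (simp add: algebra_simps)
    have "kU * h3 * e\<^sup>2 * Fh * 1 \<le> kU * h3 * e\<^sup>2 * Fh * (u * (1 / (fl * e)))" using one_u kU_pos h3_nn Fh by (intro mult_left_mono) auto
    also have "\<dots> = u * (kU * h3 * e * Fh / fl)" using e fl by (simp add: power2_eq_square)
    finally show ?thesis using 1 unfolding z_def by (simp add: algebra_simps)
   qed
   have "20 * \<bar>u' i - u\<bar> \<le> 20 * (u * (2 * b) + u * (2 * q * (1 + 1 / sqrt (fl * e))) + u * (2 * q\<^sup>2 * (1 + 1 / (fl * e))) + u * (kU * e\<^sup>2 * L1 * C1 * (1 / (fl * e) + 1 / sqrt (fl * e)) + kU * h3 * e * Fh / fl))"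
    by (intro mult_left_mono order_trans[OF dabs[OF i]] add_mono f1 f2 f3 f4) auto
   also have "\<dots> = u * (20 * (2 * b + 2 * q * (1 + 1 / sqrt (fl * e)) + 2 * q\<^sup>2 * (1 + 1 / (fl * e)) + kU * e\<^sup>2 * L1 * C1 * (1 / (fl * e) + 1 / sqrt (fl * e)) + kU * h3 * e * Fh / fl))"
    by (simp add: algebra_simps)
   also have "\<dots> \<le> u * 1" using e4(2)[of e] e et ul(3) unfolding e0_def e_def[symmetric] be[symmetric] q_def[symmetric, folded e_def] by (intro mult_left_mono) auto
   finally show ?thesis by simp
  qed
  define V where "V = avg n (\<lambda>i. (x i)\<^sup>2)"
  have V: "V \<le> 5/4 * N\<^sup>2 * d\<^sup>2 + 20 * B\<^sup>2 * b\<^sup>2" unfolding V_def x_def d_def b_def by (rule xis_sq[OF sg])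
  have V0: "0 \<le> V" unfolding V_def by (intro avg_nonneg) auto
  have E1: "avg n (\<lambda>i. u' i - u) \<le> - (2 * b - b\<^sup>2) * w + V - 15 * N\<^sup>2 * d\<^sup>2 + 16/13 * b * w"
  proof -
   have "avg n (\<lambda>i. u' i - u) = (- (2 * b - b\<^sup>2) * w + V) + kU * (\<eta> (Suc t) * F (nxt t sg) - \<eta> t * F (fst sg))"
    unfolding u'_def u_def U_diff V_def x_def b_def w_def using n_pos by (simp only: avg_add avg_const avg_W_step)
   also have "\<dots> \<le> (- (2 * b - b\<^sup>2) * w + V) + (- 15 * N\<^sup>2 * d\<^sup>2 + 16/13 * b * w)"
    unfolding d_def b_def w_def by (intro add_left_mono etaF_alive[OF sg al])
   finally show ?thesis by simp
  qed
  have E2: "avg n (\<lambda>i. (u' i - u)\<^sup>2) \<le> u * ((22/5 + 1/5) * V + 132 * b\<^sup>2 * w + 1/5 * d\<^sup>2 + K1 * e ^ 3)"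
  proof -
   have pt: "(u' i - u)\<^sup>2 \<le> (132 * b\<^sup>2 * w\<^sup>2 + 33 * z\<^sup>2) + (22/5 * w + 66 * q\<^sup>2 * (w + 1)) * (x i)\<^sup>2" if i: "i < n" for i
   proof -
    define rest where "rest = 2 * b * w + (x i)\<^sup>2 + z"
    have "\<bar>u' i - u\<bar> \<le> 2 * a * x i + rest" using dabs[OF i] unfolding rest_def by simp
    hence "\<bar>u' i - u\<bar>\<^sup>2 \<le> (2 * a * x i + rest)\<^sup>2" by (intro power_mono) auto
    hence "(u' i - u)\<^sup>2 \<le> (2 * a * x i + rest)\<^sup>2" by simp
    \<comment> \<open>Unequal Young weights, because the main part \<open>4 * w * |xi|^2\<close> may
      only grow to 22/5.\<close>
    also have "\<dots> \<le> 11/10 * (2 * a * x i)\<^sup>2 + 11 * rest\<^sup>2"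
     using zero_le_power2[of "2 * a * x i - 10 * rest"] by (simp add: power2_eq_square algebra_simps)
    also have "rest\<^sup>2 \<le> 3 * ((2*b*w)\<^sup>2 + ((x i)\<^sup>2)\<^sup>2 + z\<^sup>2)"
     by (rule sum_sq3) (use b w z0 in \<open>simp add: rest_def\<close>)
    also have "((x i)\<^sup>2)\<^sup>2 \<le> (2 * q\<^sup>2 * (w + 1)) * (x i)\<^sup>2"
     unfolding power2_eq_square[of "(x i)\<^sup>2"] using xq2[OF i] by (intro mult_right_mono) auto
    finally show ?thesis using a(2) by (simp add: power_mult_distrib algebra_simps)
   qed
   have "avg n (\<lambda>i. (u' i - u)\<^sup>2) \<le> (132 * b\<^sup>2 * w\<^sup>2 + 33 * z\<^sup>2) + (22/5 * w + 66 * q\<^sup>2 * (w + 1)) * V"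
    using avg_mono[OF pt, of n] unfolding V_def by (simp only: avg_add avg_cmult avg_const[OF n_pos])
   also have "\<dots> \<le> (132 * b\<^sup>2 * (w * u) + u * (1/5 * d\<^sup>2 + K1 * e ^ 3)) + (22/5 * u + u * (1/5)) * V"
   proof (intro add_mono mult_right_mono V0)
    show "132 * b\<^sup>2 * w\<^sup>2 \<le> 132 * b\<^sup>2 * (w * u)" unfolding power2_eq_square[of w] using ul w by (intro mult_left_mono) auto
    show "22/5 * w \<le> 22/5 * u" using ul by simp
    have "66 * q\<^sup>2 * (w + 1) \<le> 66 * q\<^sup>2 * (u * (1 + 1 / (fl * e)))" using wu by (intro mult_left_mono) auto
    also have "\<dots> = u * (66 * q\<^sup>2 * (1 + 1 / (fl * e)))" by simp
    also have "\<dots> \<le> u * (1/5)" using e2(2)[of e] e et ul(3) unfolding e0_def q_def e_def[symmetric] by (intro mult_left_mono) auto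
    finally show "66 * q\<^sup>2 * (w + 1) \<le> u * (1/5)" .
    have "z\<^sup>2 \<le> 2 * ((kU * (e * (L1 * d)))\<^sup>2 + (kU * (h3 * e\<^sup>2 * Fh))\<^sup>2)"
     unfolding z_def distrib_left using zero_le_power2[of "kU * (e * (L1 * d)) - kU * (h3 * e\<^sup>2 * Fh)"] by (simp add: power2_eq_square algebra_simps)
    hence "33 * z\<^sup>2 \<le> 66 * kU\<^sup>2 * e\<^sup>2 * (L1\<^sup>2 * d\<^sup>2) * 1 + 66 * kU\<^sup>2 * (h3\<^sup>2 * e ^ 4 * Fh\<^sup>2) * 1"
     by (simp add: power_mult_distrib algebra_simps)
    also have "\<dots> \<le> 66 * kU\<^sup>2 * e\<^sup>2 * (L1\<^sup>2 * d\<^sup>2) * (u * (1 / (fl * e))) + 66 * kU\<^sup>2 * (h3\<^sup>2 * e ^ 4 * Fh\<^sup>2) * (u * (1 / (fl * e)))"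
     using one_u e by (intro add_mono mult_left_mono) auto
    also have "\<dots> = u * ((66 * kU\<^sup>2 * e * L1\<^sup>2 / fl) * d\<^sup>2 + K1 * e ^ 3)"
     unfolding K1_def using e fl by (simp add: field_simps power2_eq_square power3_eq_cube power4_eq_xxxx)
    also have "\<dots> \<le> u * (1/5 * d\<^sup>2 + K1 * e ^ 3)"
     using e3(2)[of e] e et ul(3) unfolding e0_def e_def[symmetric] by (intro mult_left_mono add_right_mono mult_right_mono) auto
    finally show "33 * z\<^sup>2 \<le> u * (1/5 * d\<^sup>2 + K1 * e ^ 3)" .
   qed
   also have "\<dots> = u * ((22/5 + 1/5) * V + 132 * b\<^sup>2 * w + 1/5 * d\<^sup>2 + K1 * e ^ 3)" by (simp add: algebra_simps)
   finally show ?thesis .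
  qed
  define E where "E = - 7/10 * b * u + K2 * b * e"
  have tot: "5 * (avg n (\<lambda>i. u' i - u) / u) + 11 * (avg n (\<lambda>i. (u' i - u)\<^sup>2) / u\<^sup>2) \<le> 5 * (E / u)"
  proof -
   define R where "R = (22/5 + 1/5) * V + 132 * b\<^sup>2 * w + 1/5 * d\<^sup>2 + K1 * e ^ 3"
   have "11 * (avg n (\<lambda>i. (u' i - u)\<^sup>2) / u\<^sup>2) \<le> 11 * ((u * R) / u\<^sup>2)"
    using E2 unfolding R_def by (intro mult_left_mono divide_right_mono) auto
   also have "\<dots> = 11 * (R / u)" using ul(3) by (simp add: power2_eq_square)
   finally have p1: "11 * (avg n (\<lambda>i. (u' i - u)\<^sup>2) / u\<^sup>2) \<le> 11 * (R / u)" .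
   have p2: "5 * avg n (\<lambda>i. u' i - u) + 11 * R \<le> 5 * E"
   proof -
    have "b * (b * (1 + 291)) * w \<le> b * (1/20) * w"
     using e1(2)[of e] e et b w unfolding e0_def e_def[symmetric] be[symmetric] by (intro mult_right_mono mult_left_mono) auto
    hence q1: "b\<^sup>2 * w + 291 * (b\<^sup>2 * w) \<le> b * w / 20" by (simp add: power2_eq_square algebra_simps)
    have e3b: "K1 * e ^ 3 = K1 / c * b * e" unfolding be using c_pos by (simp add: power2_eq_square power3_eq_cube)
    have bb: "B\<^sup>2 * b\<^sup>2 \<le> B\<^sup>2 * (b * (c * \<eta> 0 * e))"
    proof -
     have "b = c * e * e" unfolding be by (simp add: power2_eq_square)
     also have "\<dots> \<le> c * \<eta> 0 * e" using eta_antimono[of 0 t] e c_pos unfolding e_def by (intro mult_right_mono mult_left_mono) auto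
     finally show ?thesis unfolding power2_eq_square[of b] using b by (intro mult_left_mono) auto
    qed
    have N2d: "d\<^sup>2 \<le> N\<^sup>2 * d\<^sup>2" using N2_ge mult_right_mono[of 1 "N\<^sup>2" "d\<^sup>2"] by simp
    have wu': "b * u \<le> b * w + b * (kU * e * Fh)" using ul(4) b by (simp add: flip: distrib_left)
    have VV: "0 \<le> N\<^sup>2 * d\<^sup>2" "0 \<le> B\<^sup>2 * b\<^sup>2" "0 \<le> b * w" "0 \<le> B\<^sup>2 * (b * (c * \<eta> 0 * e))" "0 \<le> b * e" "0 \<le> K1 / c * b * e"
     using b w e c_pos eta_pos[of 0] K1 by auto
    have "5 * avg n (\<lambda>i. u' i - u) + 11 * R \<le> - 10 * (b * w) + 5 * (b\<^sup>2 * w) + 5 * V - 75 * (N\<^sup>2 * d\<^sup>2) + 80/13 * (b * w) + 11 * R"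
     using E1 by (simp add: algebra_simps)
    also have "\<dots> = - 50/13 * (b * w) + (5 * (b\<^sup>2 * w) + 1452 * (b\<^sup>2 * w)) + 278/5 * V - 75 * (N\<^sup>2 * d\<^sup>2) + 11/5 * d\<^sup>2 + 11 * (K1 * e ^ 3)"
     unfolding R_def by (simp add: algebra_simps)
    \<comment> \<open>Here the constants meet: 278/5 times 5/4 plus 11/5 is 71.7, below the 75 = 5 *
      15 earned by the descent of F.\<close>
    also have "\<dots> \<le> - 7/2 * (b * w) + 1120 * (B\<^sup>2 * b\<^sup>2) + 11 * (K1 / c * b * e)"
     using q1 V N2d VV unfolding e3b by linarith
    also have "\<dots> \<le> - 7/2 * (b * u) + 7/2 * (b * (kU * e * Fh)) + 1120 * (B\<^sup>2 * (b * (c * \<eta> 0 * e))) + 15 * (K1 / c * b * e)"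
     using wu' bb VV by linarith
    also have "\<dots> \<le> 5 * E" unfolding E_def K2_def using VV by (simp add: algebra_simps)
    finally show ?thesis .
   qed
   have "5 * (avg n (\<lambda>i. u' i - u) / u) + 11 * (R / u) = (5 * avg n (\<lambda>i. u' i - u) + 11 * R) / u"
    by (simp add: add_divide_distrib)
   also have "\<dots> \<le> 5 * E / u" using p2 ul(3) by (intro divide_right_mono) auto
   finally show ?thesis using p1 by simp
  qed
  have u5: "u ^ 5 = u * u ^ 4" by (simp add: numeral_eq_Suc)
  have "A t (\<lambda>sg. U (Suc t) sg ^ 5) sg = avg n (\<lambda>i. u' i ^ 5)" unfolding A_def u'_def by simp
  also have "\<dots> \<le> u ^ 5 * (1 + 5 * (avg n (\<lambda>i. u' i - u) / u) + 11 * (avg n (\<lambda>i. (u' i - u)\<^sup>2) / u\<^sup>2))"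
   by (rule avg_power5_le[OF n_pos ul(3) small])
  also have "\<dots> \<le> u ^ 5 * (1 + 5 * (E / u))" using tot ul(3) by (intro mult_left_mono) auto
  also have "\<dots> = u ^ 5 + 5 * E * u ^ 4" unfolding u5 using ul(3) by (simp add: field_simps)
  also have "\<dots> = (1 - 7/2 * b) * u ^ 5 + b * (5 * K2 * e * u ^ 4)"
   unfolding E_def u5 by (simp add: algebra_simps)
  also have "\<dots> \<le> (1 - 7/2 * b) * u ^ 5 + b * (1/2 * u ^ 5 + K3 * e ^ 5)"
  proof -
   \<comment> \<open>Above \<open>10 * K2 * e\<close> the term costs 1/2 of the rate 7/2; below, it
     is of the order of the noise floor.\<close>
   have "5 * K2 * e * u ^ 4 \<le> 1/2 * u ^ 5 + K3 * e ^ 5"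
   proof (cases "10 * K2 * e \<le> u")
    case True
    hence "(10 * K2 * e) * u ^ 4 \<le> u * u ^ 4" using ul(3) by (intro mult_right_mono) auto
    moreover have "u * u ^ 4 = u ^ 5" using u5 by simp
    moreover have "0 \<le> K3 * e ^ 5" using K3 e by simp
    ultimately show ?thesis by linarith
   next
    case False
    hence "u ^ 4 \<le> (10 * K2 * e) ^ 4" using ul(3) by (intro power_mono) auto
    hence "5 * K2 * e * u ^ 4 \<le> 5 * K2 * e * (10 * K2 * e) ^ 4" using K2 e by (intro mult_left_mono) auto
    also have "\<dots> = K3 * e ^ 5" unfolding K3_def by (simp add: power_mult_distrib numeral_eq_Suc)
    moreover have "0 \<le> 1/2 * u ^ 5" using ul(3) by simp
    ultimately show ?thesis by linarith
   qed
   thus ?thesis using b by (intro add_left_mono mult_left_mono) auto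
  qed
  also have "\<dots> = (1 - 3 * b) * u ^ 5 + K3 * b * e ^ 5" by (simp add: algebra_simps)
  finally show ?thesis unfolding u_def b_def e_def .
 qed
 have "0 < e0" unfolding e0_def using e1 e2 e3 e4 by simp
 thus ?thesis using K3 main by blast
qed

end

section \<open>Survival of the alive states\<close>

lemma exp_le_quadratic:
 fixes y :: real
 assumes "y \<le> 1"
 shows "exp y \<le> 1 + y + y\<^sup>2"
proof (cases "0 \<le> y")
 case True thus ?thesis using assms exp_bound by force
next
 case False
 define x where "x = - y"
 have x: "0 < x" using False unfolding x_def by simp
 have "exp (-x) = 1 / exp x" by (simp add: exp_minus field_simps)
 also have "\<dots> \<le> 1 / (1 + x)" using x exp_ge_add_one_self[of x] by (intro divide_left_mono) auto
 also have "\<dots> \<le> 1 - x + x\<^sup>2" using x by (simp add: field_simps power2_eq_square)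
 finally show ?thesis unfolding x_def by simp
qed

text \<open>With Y = mu * (es + k) this is the scalar inequality behind \<open>f_drift\<close>.
  Multiplied by exp Y it compares \<open>j * (l + Z)\<close> with \<open>l * exp Y\<close>; the
  quadratic Taylor bound of exp leaves Y^2/4 to spare, and mu * k is gained because k is at least
  1/4.\<close>

lemma survival_poly:
 fixes s \<mu> k C Y j E :: real
 assumes s: "0 < s" "s \<le> 1" and mu: "\<mu> = s\<^sup>2" and k: "1/4 \<le> k" and C: "0 \<le> C" "\<mu> * C \<le> 1/20"
  and Y: "0 \<le> Y" and j: "1 \<le> j" "j \<le> 1 + \<mu> / 32" and E: "E = exp (- Y)"
 shows "E * j * (1 - s / 8 + (Y - \<mu> * k + \<mu> / 64 + (Y\<^sup>2 / 4 + \<mu>\<^sup>2 * C))) \<le> 1 - s / 8"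
proof -
 define Z where "Z = Y - \<mu> * k + \<mu> / 64 + (Y\<^sup>2 / 4 + \<mu>\<^sup>2 * C)"
 define l where "l = 1 - s / 8"
 have mu0: "0 < \<mu>" "\<mu> \<le> 1" using s mu by (auto simp: power_le_one)
 have l: "0 \<le> l" unfolding l_def using s by simp
 have mC: "\<mu>\<^sup>2 * C \<le> \<mu> / 20" unfolding power2_eq_square using mult_left_mono[OF C(2), of \<mu>] mu0 by (simp add: mult.assoc)
 have mk: "\<mu> / 4 \<le> \<mu> * k" using mult_left_mono[OF k, of \<mu>] mu0 by simp
 have lZ: "l + Z \<le> 1 + Y + Y\<^sup>2 / 4" unfolding l_def Z_def using mC mk mu0 s by linarith
 have "(j - 1) * (l + Z) \<le> (j - 1) * (1 + Y + Y\<^sup>2 / 4)" using lZ j by (intro mult_left_mono) auto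
 also have "\<dots> \<le> (\<mu> / 32) * (1 + Y + Y\<^sup>2 / 4)" using j Y by (intro mult_right_mono) auto
 finally have 1: "j * (l + Z) \<le> (l + Z) + (\<mu> / 32) * (1 + Y + Y\<^sup>2 / 4)" by (simp add: algebra_simps)
 have "(l + Z) + (\<mu> / 32) * (1 + Y + Y\<^sup>2 / 4) \<le> l * (1 + Y + Y\<^sup>2 / 2)"
 proof -
  have a: "\<mu> * Y \<le> s * Y" unfolding mu power2_eq_square using s Y by (intro mult_right_mono) (auto simp: mult_left_le)
  have b: "\<mu> * Y\<^sup>2 \<le> Y\<^sup>2" using mu0 by (simp add: mult_left_le_one_le)
  have b': "s * Y\<^sup>2 \<le> Y\<^sup>2" using s by (simp add: mult_left_le_one_le)
  \<comment> \<open>AM-GM with s^2 = mu: the cross term s * Y is paid by Y^2 and mu. This is why the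
    rate improves by order sqrt mu and not only by order mu.\<close>
  have d: "(5/32) * (s * Y) \<le> 17/100 * Y\<^sup>2 + 15/100 * \<mu>"
  proof -
   have "s * Y \<le> Y\<^sup>2 + s\<^sup>2 / 4" using zero_le_power2[of "Y - (1/2) * s"] by (simp add: power2_eq_square algebra_simps)
   thus ?thesis unfolding mu using zero_le_power2[of Y] zero_le_power2[of s] by linarith
  qed
  have "l * (1 + Y + Y\<^sup>2 / 2) - ((l + Z) + (\<mu> / 32) * (1 + Y + Y\<^sup>2 / 4))
    = Y\<^sup>2 / 4 - (s * Y) / 8 - (s * Y\<^sup>2) / 16 + \<mu> * k - \<mu> / 64 - \<mu>\<^sup>2 * C - \<mu> / 32 - (\<mu> * Y) / 32 - (\<mu> * Y\<^sup>2) / 128"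
   unfolding Z_def l_def by (simp add: field_simps)
  also have "\<dots> \<ge> 0" using a b b' d mC mk mu0 zero_le_power2[of Y] by linarith
  finally show ?thesis by simp
 qed
 also have "\<dots> \<le> l * exp Y" using exp_lower_Taylor_quadratic[OF Y] l by (intro mult_left_mono) (auto simp: power2_eq_square)
 finally have "E * (j * (l + Z)) \<le> E * (l * exp Y)" using 1 unfolding E by (intro mult_left_mono) auto
 also have "\<dots> = l" unfolding E by (simp add: exp_minus)
 finally show ?thesis unfolding l_def Z_def by (simp add: mult.assoc)
qed

context storm begin

text \<open>A lower bound for the survival probability: nonpositive on dead states (lemma \<open>ff_dead\<close>), at most \<open>1\<close>,
 and shrinking in mean by a factor \<open>1 - (1 - sqrt mu / 8) * beta\<close> only. The gain \<open>sqrt mu\<close> is what makes the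
 number of attempts in \<open>{T/2..T}\<close> exceed the inverse of their success probability.\<close>

definition ff :: "real \<Rightarrow> real \<Rightarrow> real \<Rightarrow> real \<Rightarrow> 'x \<times> 'h \<Rightarrow> real" where
 "ff \<mu> k g H sg = 1 - exp (- \<mu> * (es sg + k)) * max 0 (1 + g * (JJ sg + H))"

lemma ff_le1: "ff \<mu> k g H sg \<le> 1" unfolding ff_def by simp

text \<open>The shift H = DJ * Am makes the correction factor at least 1 wherever |e| is at most Am.
  The truncation at 0 acts only elsewhere and keeps ff at most 1 there.\<close>

lemma ff_dead:
 assumes "sg \<in> S" "sqrt (W sg) \<le> Am" "0 \<le> g" "0 \<le> \<mu>" "\<not> alive k sg"
 shows "ff \<mu> k g (DJ * Am) sg \<le> 0"
proof -
 have "\<bar>JJ sg\<bar> \<le> DJ * Am" using JJ_bd[OF assms(1)] mult_left_mono[OF assms(2) DJ_nn] by linarith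
 hence "1 \<le> max 0 (1 + g * (JJ sg + DJ * Am))" using assms(3) by (auto simp: le_max_iff_disj)
 moreover have "0 \<le> - \<mu> * (es sg + k)" using assms(4,5) unfolding alive_def by (simp add: mult_nonneg_nonpos)
 hence "1 \<le> exp (- \<mu> * (es sg + k))" by simp
 ultimately have "1 * 1 \<le> exp (- \<mu> * (es sg + k)) * max 0 (1 + g * (JJ sg + DJ * Am))" by (intro mult_mono) auto
 thus ?thesis unfolding ff_def by simp
qed

lemma es_sq: "(es sg)\<^sup>2 \<le> (norm dir)\<^sup>2 * W sg"
proof -
 have "\<bar>es sg\<bar> \<le> norm (snd sg) * norm dir" unfolding es_def by (rule Cauchy_Schwarz_ineq2)
 hence "\<bar>es sg\<bar>\<^sup>2 \<le> (norm (snd sg) * norm dir)\<^sup>2" by (intro power_mono) auto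
 thus ?thesis unfolding W_def by (simp add: power_mult_distrib mult.commute)
qed

text \<open>The exponential of - mu * es has a second-order term mu^2 |xi|^2, whose mean of order
  mu^2 dx^2 is not controlled by beta. The factor \<open>1 + g * (JJ + H)\<close> with g of order
  mu^2 * eta removes it through \<open>H3\<close>. The hypotheses with Am say that mu is small
  enough for the expansion as long as |e| is at most Am.\<close>

lemma f_drift:
 "\<exists>\<kappa>>0. \<exists>\<mu>0>0. \<mu>0 \<le> 1 \<and> (\<forall>t g0 \<mu> k Am sg. 0 < \<mu> \<and> \<mu> \<le> \<mu>0 \<and> 1/4 \<le> k \<and> k \<le> 1/2 \<and> 0 < g0 \<and> g0 \<le> \<eta> t \<and> \<eta> t \<le> 2 * g0
   \<and> \<beta> t \<le> 1/100 \<and> \<beta> t * \<mu>\<^sup>2 * (norm dir)\<^sup>2 * Am\<^sup>2 \<le> 1/100 \<and> B2 \<le> Am \<and> 1 \<le> Am \<and> \<kappa> * \<mu> * g0 * DJ * Am \<le> 1/64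
   \<and> sg \<in> S \<and> alive k sg \<and> sqrt (W sg) \<le> Am \<longrightarrow>
   (1 - (1 - sqrt \<mu> / 8) * \<beta> t) * ff \<mu> k (\<kappa> * \<mu>\<^sup>2 * g0) (DJ * Am) sg \<le> A t (ff \<mu> k (\<kappa> * \<mu>\<^sup>2 * g0) (DJ * Am)) sg)"
proof -
 define nd where "nd = norm dir"
 have nd: "0 \<le> nd" unfolding nd_def by simp
 \<comment> \<open>Collects the coefficients of |xi|^2: \<open>2 * nd^2\<close> from the squared
   exponent with \<open>jb \<le> 2\<close>, nd from the product of the two noises, the rest from the
   cubic term.\<close>
 define C' where "C' = 2 * nd\<^sup>2 + nd + nd\<^sup>2 * B2 + 1"
 have C': "1 \<le> C'" unfolding C'_def using nd by simp
 \<comment> \<open>Balances the gain from \<open>H3\<close> against the variance part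
   \<open>5/4 * C' * N^2 * dx^2\<close>.\<close>
 define \<kappa> where "\<kappa> = 5/2 * C' * N\<^sup>2 / c3"
 have kap: "0 < \<kappa>" unfolding \<kappa>_def using C' N2_ge c3_pos by (intro divide_pos_pos mult_pos_pos) auto
 have kapc3: "\<kappa> * c3 / 2 = 5/4 * C' * N\<^sup>2" unfolding \<kappa>_def using c3_pos by simp
 define dl where "dl = c / (16 * \<kappa>)"
 have dl: "0 < dl" unfolding dl_def using c_pos kap by simp
 obtain Cr0 where Cr0: "\<And>y. -1/2 \<le> y \<Longrightarrow> r y \<le> dl * y\<^sup>2 + Cr0" using r_bd[OF dl] by auto
 define Cr where "Cr = max Cr0 0"
 have Cr: "\<And>y. -1/2 \<le> y \<Longrightarrow> r y \<le> dl * y\<^sup>2 + Cr" "0 \<le> Cr" using Cr0 unfolding Cr_def by (force+)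
 define C6 where "C6 = 20 * C' * B\<^sup>2 + \<kappa> * Cr / c"
 have C6: "0 \<le> C6" unfolding C6_def using C' kap Cr(2) c_pos by simp
 define C8 where "C8 = C6 + 1 + 1/16"
 \<comment> \<open>The second bound keeps mu * |xs| at most 1 for the quadratic expansion of exp;
   the third gives \<open>mu * C8 \<le> 1/20\<close>, as \<open>survival_poly\<close>
   requires.\<close>
 define \<mu>0 where "\<mu>0 = min 1 (min (1 / (nd * B2 + 1)) (1 / (20 * C8)))"
 have C8: "0 < C8" unfolding C8_def using C6 by simp
 have mu0: "0 < \<mu>0" "\<mu>0 \<le> 1" unfolding \<mu>0_def using C8 nd by (auto intro!: divide_pos_pos add_nonneg_pos)
 have main: "(1 - (1 - sqrt \<mu> / 8) * \<beta> t) * ff \<mu> k (\<kappa> * \<mu>\<^sup>2 * g0) (DJ * Am) sg \<le> A t (ff \<mu> k (\<kappa> * \<mu>\<^sup>2 * g0) (DJ * Am)) sg"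
  if mu: "0 < \<mu>" "\<mu> \<le> \<mu>0" and k: "1/4 \<le> k" "k \<le> 1/2" and g0: "0 < g0" "g0 \<le> \<eta> t" "\<eta> t \<le> 2 * g0"
   and b100: "\<beta> t \<le> 1/100" and bA: "\<beta> t * \<mu>\<^sup>2 * (norm dir)\<^sup>2 * Am\<^sup>2 \<le> 1/100" and Am: "B2 \<le> Am" "1 \<le> Am"
   and kA: "\<kappa> * \<mu> * g0 * DJ * Am \<le> 1/64" and sg: "sg \<in> S" and alk: "alive k sg" and WA: "sqrt (W sg) \<le> Am" for t g0 \<mu> k Am sg
 proof -
  define b e d g s w where "b = \<beta> t" and "e = \<eta> t" and "d = dx t sg" and "g = \<kappa> * \<mu>\<^sup>2 * g0" and "s = es sg" and "w = W sg"
  have al: "alive (1/2) sg" using alk k unfolding alive_def by simp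
  have b: "0 < b" "b \<le> 1/100" using beta_pos[of t] b100 unfolding b_def by auto
  have e: "0 < e" unfolding e_def by (rule eta_pos)
  have be: "b = c * e\<^sup>2" unfolding b_def e_def beta_def ..
  have mu1: "\<mu> \<le> 1" using mu mu0 by simp
  have muB: "\<mu> * (nd * B2 + 1) \<le> 1"
  proof -
   have "0 < nd * B2 + 1" using nd by (intro add_nonneg_pos) auto
   moreover have "\<mu> \<le> 1 / (nd * B2 + 1)" using mu unfolding \<mu>0_def by simp
   ultimately show ?thesis by (simp add: field_simps)
  qed
  have muC8: "\<mu> * C8 \<le> 1/20"
  proof -
   have "\<mu> \<le> 1 / (20 * C8)" using mu unfolding \<mu>0_def by simp
   thus ?thesis using C8 by (simp add: field_simps)
  qed
  have muC6: "\<mu> * C6 \<le> 1"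
  proof -
   have "\<mu> * C6 \<le> \<mu> * C8" unfolding C8_def using mu by (intro mult_left_mono) auto
   thus ?thesis using muC8 by linarith
  qed
  have g: "0 < g" unfolding g_def using kap mu g0 by simp
  have gDA: "g * DJ * Am \<le> \<mu> / 64"
  proof -
   have "\<mu> * (\<kappa> * \<mu> * g0 * DJ * Am) \<le> \<mu> * (1/64)" using kA mu by (intro mult_left_mono) auto
   thus ?thesis unfolding g_def by (simp add: power2_eq_square mult_ac)
  qed
  have gD: "g * DJ \<le> \<mu> / 64"
  proof -
   have "g * DJ * 1 \<le> g * DJ * Am" using Am g DJ_nn by (intro mult_left_mono) auto
   thus ?thesis using gDA by linarith
  qed
  have gDB: "g * DJ * B2 \<le> \<mu> / 64"
  proof -
   have "g * DJ * B2 \<le> g * DJ * Am" using Am g DJ_nn by (intro mult_left_mono) auto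
   thus ?thesis using gDA by linarith
  qed
  define x where "x i = norm (xis t sg i)" for i
  have x: "0 \<le> x i" for i unfolding x_def by simp
  have xB: "x i \<le> B2" if "i < n" for i unfolding x_def by (rule xis_B2[OF sg that])
  define xs where "xs i = xis t sg i \<bullet> dir" for i
  define ze where "ze i = xis t sg i \<bullet> lin (nxt t sg)" for i
  have xs: "\<bar>xs i\<bar> \<le> nd * x i" for i
   unfolding xs_def nd_def x_def using Cauchy_Schwarz_ineq2[of "xis t sg i" dir] by (simp add: mult.commute)
  have ze: "\<bar>ze i\<bar> \<le> DJ * x i" for i unfolding ze_def x_def by (rule lin_nxt[OF sg])
  define LX where "LX = snd sg \<bullet> lin (nxt t sg)"
  have LX: "\<bar>LX\<bar> \<le> DJ * Am"
  proof -
   have "\<bar>LX\<bar> \<le> DJ * norm (snd sg)" unfolding LX_def by (rule lin_nxt[OF sg])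
   also have "\<dots> \<le> DJ * Am" using WA DJ_nn unfolding norm_W by (intro mult_left_mono) auto
   finally show ?thesis .
  qed
  define jb where "jb = 1 + g * ((1 - b) * LX + DJ * Am)"
  define j where "j = 1 + g * (JJ sg + DJ * Am)"
  define E0 where "E0 = exp (- \<mu> * ((1 - b) * s + k))"
  have JJst: "JJ (step t sg i) = (1 - b) * LX + ze i" for i
   unfolding JJ_def step_def xis_def[symmetric] LX_def ze_def b_def by (simp add: inner_add_left)
  have jbLX: "\<bar>(1 - b) * LX\<bar> \<le> DJ * Am"
  proof -
   have "\<bar>(1 - b) * LX\<bar> \<le> 1 * (DJ * Am)" unfolding abs_mult using b LX by (intro mult_mono) auto
   thus ?thesis by simp
  qed
  have jb: "1 \<le> jb" "jb \<le> 2"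
  proof -
   have "0 \<le> g * ((1 - b) * LX + DJ * Am)" using jbLX g by (intro mult_nonneg_nonneg) auto
   thus "1 \<le> jb" unfolding jb_def by simp
   have "g * ((1 - b) * LX + DJ * Am) \<le> g * (2 * (DJ * Am))" by (intro mult_left_mono) (use abs_le_D1[OF jbLX] g in linarith)+
   also have "\<dots> = 2 * (g * DJ * Am)" by simp
   finally show "jb \<le> 2" unfolding jb_def using gDA mu1 by linarith
  qed
  have JJb: "\<bar>JJ sg\<bar> \<le> DJ * Am" using JJ_bd[OF sg] mult_left_mono[OF WA DJ_nn] by linarith
  have j: "1 \<le> j" "j \<le> 1 + \<mu> / 32"
  proof -
   have "0 \<le> g * (JJ sg + DJ * Am)" using JJb g by (intro mult_nonneg_nonneg) auto
   thus "1 \<le> j" unfolding j_def by simp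
   have "g * (JJ sg + DJ * Am) \<le> g * (2 * (DJ * Am))" by (intro mult_left_mono) (use abs_le_D1[OF JJb] g in linarith)+
   also have "\<dots> = 2 * (g * DJ * Am)" by simp
   finally show "j \<le> 1 + \<mu> / 32" unfolding j_def using gDA by linarith
  qed
  \<comment> \<open>The noises xs of es and ze of JJ enter linearly with mean zero, so only the
    coefficient of |xi|^2 survives the average.\<close>
  have pt: "exp (- \<mu> * (es (step t sg i) + k)) * max 0 (1 + g * (JJ (step t sg i) + DJ * Am))
    \<le> E0 * (jb + (g * ze i - \<mu> * jb * xs i) + \<mu>\<^sup>2 * C' * (x i)\<^sup>2)" if i: "i < n" for i
  proof -
   have gz: "\<bar>g * ze i\<bar> \<le> \<mu> / 64"
   proof -
    have "\<bar>g * ze i\<bar> \<le> g * (DJ * B2)" unfolding abs_mult using ze[of i] xB[OF i] g DJ_nn mult_left_mono[OF xB[OF i] DJ_nn] by (intro mult_mono) auto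
    thus ?thesis using gDB by (simp add: mult.assoc)
   qed
   have ji: "0 \<le> jb + g * ze i" using jb gz mu1 by linarith
   have e1: "1 + g * (JJ (step t sg i) + DJ * Am) = jb + g * ze i" unfolding JJst jb_def by (simp add: algebra_simps)
   have e2: "exp (- \<mu> * (es (step t sg i) + k)) = E0 * exp (- \<mu> * xs i)"
    unfolding es_step E0_def xs_def b_def s_def exp_add[symmetric] by (simp add: algebra_simps)
   have mx: "\<bar>\<mu> * xs i\<bar> \<le> 1"
   proof -
    have "\<bar>\<mu> * xs i\<bar> \<le> \<mu> * (nd * B2)" unfolding abs_mult using xs[of i] mult_left_mono[OF xB[OF i] nd] mu by (intro mult_mono) auto
    thus ?thesis using muB mu by (simp add: algebra_simps)
   qed
   have "exp (- \<mu> * xs i) \<le> 1 + (- \<mu> * xs i) + (- \<mu> * xs i)\<^sup>2" by (rule exp_le_quadratic) (use mx in auto)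
   hence "exp (- \<mu> * xs i) * (jb + g * ze i) \<le> (1 + (- \<mu> * xs i) + (- \<mu> * xs i)\<^sup>2) * (jb + g * ze i)" using ji by (intro mult_right_mono) auto
   also have "\<dots> = jb + (g * ze i - \<mu> * jb * xs i) + (\<mu>\<^sup>2 * jb * (xs i)\<^sup>2 - \<mu> * g * (xs i * ze i) + \<mu>\<^sup>2 * (xs i)\<^sup>2 * (g * ze i))"
    by (simp add: power2_eq_square algebra_simps)
   also have "\<dots> \<le> jb + (g * ze i - \<mu> * jb * xs i) + \<mu>\<^sup>2 * C' * (x i)\<^sup>2"
   proof (rule add_left_mono)
    have xs2: "(xs i)\<^sup>2 \<le> nd\<^sup>2 * (x i)\<^sup>2"
    proof -
     have "\<bar>xs i\<bar>\<^sup>2 \<le> (nd * x i)\<^sup>2" using xs[of i] by (intro power_mono) auto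
     thus ?thesis by (simp add: power_mult_distrib)
    qed
    have t1: "\<mu>\<^sup>2 * jb * (xs i)\<^sup>2 \<le> \<mu>\<^sup>2 * 2 * (nd\<^sup>2 * (x i)\<^sup>2)" using jb xs2 by (intro mult_mono) auto
    have t2: "- (\<mu> * g * (xs i * ze i)) \<le> \<mu>\<^sup>2 * nd * (x i)\<^sup>2"
    proof -
     have "\<bar>xs i * ze i\<bar> \<le> (nd * x i) * (DJ * x i)" unfolding abs_mult using xs ze nd x by (intro mult_mono) auto
     hence "\<bar>\<mu> * g * (xs i * ze i)\<bar> \<le> \<mu> * g * ((nd * x i) * (DJ * x i))" unfolding abs_mult[of "\<mu> * g"] using mu g by (auto intro: mult_left_mono)
     also have "\<dots> = \<mu> * nd * (x i)\<^sup>2 * (g * DJ)" by (simp add: power2_eq_square)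
     also have "\<dots> \<le> \<mu> * nd * (x i)\<^sup>2 * \<mu>" using gD mu nd by (intro mult_left_mono) auto
     finally show ?thesis by (simp add: power2_eq_square mult_ac)
    qed
    have t3: "\<mu>\<^sup>2 * (xs i)\<^sup>2 * (g * ze i) \<le> \<mu>\<^sup>2 * (nd\<^sup>2 * (x i)\<^sup>2) * 1"
     using gz mu1 xs2 by (intro mult_mono order_trans[OF mult_left_mono[of "g * ze i" 1]]) (auto intro: mult_mono)
    have t3': "\<mu>\<^sup>2 * (xs i)\<^sup>2 * (g * ze i) \<le> \<mu>\<^sup>2 * (1 + nd\<^sup>2 * B2) * (x i)\<^sup>2"
    proof -
     have "\<mu>\<^sup>2 * (xs i)\<^sup>2 * (g * ze i) \<le> \<mu>\<^sup>2 * (xs i)\<^sup>2 * (g * DJ * x i)" using ze[of i] g by (intro mult_left_mono) (auto simp: mult.assoc)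
     also have "\<dots> \<le> \<mu>\<^sup>2 * (nd\<^sup>2 * (x i)\<^sup>2) * (1 * B2)"
      using xs2 gD mu1 xB[OF i] x[of i] g DJ_nn by (intro mult_mono) auto
     also have "\<dots> \<le> \<mu>\<^sup>2 * (1 + nd\<^sup>2 * B2) * (x i)\<^sup>2" by (simp add: algebra_simps)
     finally show ?thesis .
    qed
    show "\<mu>\<^sup>2 * jb * (xs i)\<^sup>2 - \<mu> * g * (xs i * ze i) + \<mu>\<^sup>2 * (xs i)\<^sup>2 * (g * ze i) \<le> \<mu>\<^sup>2 * C' * (x i)\<^sup>2"
     using t1 t2 t3' unfolding C'_def by (simp add: algebra_simps)
   qed
   finally have "E0 * (exp (- \<mu> * xs i) * (jb + g * ze i)) \<le> E0 * (jb + (g * ze i - \<mu> * jb * xs i) + \<mu>\<^sup>2 * C' * (x i)\<^sup>2)"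
    unfolding E0_def by (intro mult_left_mono) auto
   thus ?thesis unfolding e1 e2 using ji by (simp add: max_def mult.assoc)
  qed
  define V where "V = avg n (\<lambda>i. (x i)\<^sup>2)"
  have V: "V \<le> 5/4 * N\<^sup>2 * d\<^sup>2 + 20 * B\<^sup>2 * b\<^sup>2" unfolding V_def x_def d_def b_def by (rule xis_sq[OF sg])
  define Phi where "Phi = avg n (\<lambda>i. exp (- \<mu> * (es (step t sg i) + k)) * max 0 (1 + g * (JJ (step t sg i) + DJ * Am)))"
  have Aff: "A t (ff \<mu> k g (DJ * Am)) sg = 1 - Phi"
   unfolding A_def ff_def Phi_def using n_pos by (simp only: avg_diff avg_const)
  have "Phi \<le> avg n (\<lambda>i. E0 * (jb + (g * ze i - \<mu> * jb * xs i) + \<mu>\<^sup>2 * C' * (x i)\<^sup>2))"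
   unfolding Phi_def by (intro avg_mono pt)
  also have "\<dots> = E0 * (jb + \<mu>\<^sup>2 * C' * V)"
   unfolding V_def ze_def xs_def by (simp only: avg_cmult avg_add avg_diff avg_const[OF n_pos] avg_xis) simp
  also have "\<dots> \<le> E0 * (j + b * (\<mu> / 64 + \<mu>\<^sup>2 * (s\<^sup>2 / 16 + C6)))"
  proof (rule mult_left_mono)
   define LD where "LD = snd sg \<bullet> (lin (nxt t sg) - lin (fst sg))"
   have LD: "LX = JJ sg + LD" unfolding LD_def LX_def JJ_def by (simp add: inner_diff_right)
   have jeq: "jb = j + g * LD - b * (g * LX)" unfolding jb_def j_def using LD by (simp add: algebra_simps)
   have p1: "g * LD \<le> - (g * (c3 * d\<^sup>2 / e)) + g * (e * r s)"
   proof -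
    have "g * LD \<le> g * (- c3 * d\<^sup>2 / e + e * r s)" unfolding LD_def s_def d_def e_def using H3_alive[OF sg al, of t] g by (intro mult_left_mono) auto
    thus ?thesis by (simp add: algebra_simps)
   qed
   have p2: "\<mu>\<^sup>2 * (\<kappa> * c3 / 2) * d\<^sup>2 \<le> g * (c3 * d\<^sup>2 / e)"
   proof -
    have "e \<le> 2 * g0" using g0 unfolding e_def by simp
    hence "1/2 \<le> g0 / e" using e by (simp add: field_simps)
    hence "(\<mu>\<^sup>2 * \<kappa> * c3 * d\<^sup>2) * (1/2) \<le> (\<mu>\<^sup>2 * \<kappa> * c3 * d\<^sup>2) * (g0 / e)" using kap c3_pos by (intro mult_left_mono) auto
    thus ?thesis unfolding g_def by (simp add: mult_ac)
   qed
   have p3: "g * (e * r s) \<le> b * (\<mu>\<^sup>2 * (s\<^sup>2 / 16 + \<kappa> * Cr / c))"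
   proof -
    have "r s \<le> dl * s\<^sup>2 + Cr" using Cr(1)[of s] al unfolding alive_def s_def by simp
    hence "g * (e * r s) \<le> g * (e * (dl * s\<^sup>2 + Cr))" using g e by (intro mult_left_mono) auto
    also have "\<dots> \<le> (\<kappa> * \<mu>\<^sup>2 * e) * (e * (dl * s\<^sup>2 + Cr))"
     unfolding g_def using g0 kap e dl Cr(2) unfolding e_def by (intro mult_right_mono mult_left_mono mult_nonneg_nonneg add_nonneg_nonneg) auto
    also have "\<dots> = b * (\<mu>\<^sup>2 * (s\<^sup>2 / 16 + \<kappa> * Cr / c))" unfolding be dl_def using kap c_pos by (simp add: power2_eq_square field_simps)
    finally show ?thesis .
   qed
   have p4: "- (b * (g * LX)) \<le> b * (\<mu> / 64)"
   proof -
    have "g * (- LX) \<le> g * (DJ * Am)" using LX g by (intro mult_left_mono) auto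
    hence "g * (- LX) \<le> \<mu> / 64" using gDA by (simp add: mult.assoc)
    hence "b * (g * (- LX)) \<le> b * (\<mu> / 64)" using b by (intro mult_left_mono) auto
    thus ?thesis by simp
   qed
   \<comment> \<open>By the choice of kappa the \<open>dx^2\<close> part here is exactly the one
     gained in p2.\<close>
   have p5: "\<mu>\<^sup>2 * C' * V \<le> \<mu>\<^sup>2 * (\<kappa> * c3 / 2) * d\<^sup>2 + b * (\<mu>\<^sup>2 * (20 * C' * B\<^sup>2))"
   proof -
    have "\<mu>\<^sup>2 * C' * V \<le> \<mu>\<^sup>2 * C' * (5/4 * N\<^sup>2 * d\<^sup>2 + 20 * B\<^sup>2 * b\<^sup>2)" using V C' by (intro mult_left_mono) auto
    also have "\<dots> = \<mu>\<^sup>2 * (\<kappa> * c3 / 2) * d\<^sup>2 + \<mu>\<^sup>2 * (20 * C' * B\<^sup>2) * b\<^sup>2" unfolding kapc3 by (simp add: algebra_simps)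
    also have "\<dots> \<le> \<mu>\<^sup>2 * (\<kappa> * c3 / 2) * d\<^sup>2 + \<mu>\<^sup>2 * (20 * C' * B\<^sup>2) * b"
     using b C' by (intro add_left_mono mult_left_mono) (auto simp: power2_eq_square mult_left_le)
    finally show ?thesis by (simp add: mult_ac)
   qed
   show "jb + \<mu>\<^sup>2 * C' * V \<le> j + b * (\<mu> / 64 + \<mu>\<^sup>2 * (s\<^sup>2 / 16 + C6))"
    using p1 p2 p3 p4 p5 unfolding jeq C6_def by (simp add: distrib_left)
  qed (simp add: E0_def)
  finally have Phi1: "Phi \<le> E0 * (j + b * (\<mu> / 64 + \<mu>\<^sup>2 * (s\<^sup>2 / 16 + C6)))" .
  define P where "P = \<mu> / 64 + \<mu>\<^sup>2 * (s\<^sup>2 / 16 + C6)"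
  have P0: "0 \<le> P" unfolding P_def using mu C6 by simp
  define Z where "Z = \<mu> * s + P"
  define ph where "ph = exp (- \<mu> * (s + k)) * j"
  have ph0: "0 \<le> ph" unfolding ph_def using j by simp
  have ss: "b * (\<mu>\<^sup>2 * s\<^sup>2) \<le> 1/100"
  proof -
   have "s\<^sup>2 \<le> nd\<^sup>2 * W sg" unfolding s_def nd_def by (rule es_sq)
   also have "W sg \<le> Am\<^sup>2" using WA Am by (metis W_nn real_sqrt_ge_zero real_sqrt_pow2 power_mono)
   hence "nd\<^sup>2 * W sg \<le> nd\<^sup>2 * Am\<^sup>2" by (intro mult_left_mono) auto
   finally have "b * (\<mu>\<^sup>2 * s\<^sup>2) \<le> b * (\<mu>\<^sup>2 * (nd\<^sup>2 * Am\<^sup>2))" using b by (intro mult_left_mono) auto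
   thus ?thesis using bA unfolding b_def nd_def by (simp add: mult.assoc)
  qed
  have m2C6: "\<mu>\<^sup>2 * C6 \<le> \<mu>" unfolding power2_eq_square using mult_left_mono[OF muC6, of \<mu>] mu by (simp add: mult.assoc)
  have bZ1: "b * Z \<le> 1"
  proof -
   have "(b * (\<mu> * s))\<^sup>2 = b * (b * (\<mu>\<^sup>2 * s\<^sup>2))" by (simp add: power2_eq_square)
   also have "\<dots> \<le> 1/100 * (1/100)" using b ss by (intro mult_mono) auto
   finally have "(b * (\<mu> * s))\<^sup>2 \<le> (1/100)\<^sup>2" by (simp add: power2_eq_square)
   hence a1: "b * (\<mu> * s) \<le> 1/100" by (rule power2_le_imp_le) simp
   have "b * (\<mu> / 64 + \<mu>\<^sup>2 * C6) \<le> (1/100) * (1/64 + 1)" using b m2C6 mu1 mu C6 by (intro mult_mono) auto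
   thus ?thesis using a1 ss unfolding Z_def P_def by (simp add: algebra_simps)
  qed
  \<comment> \<open>\<open>b * mu^2 * s^2 \<le> 1/100\<close> (fact ss) turns b * Z^2 into a small
    multiple of \<open>mu^2 * (s^2 + 1)\<close>, so squaring the drift does no harm even for large
    es.\<close>
  have bZ2: "Z + b * Z\<^sup>2 \<le> \<mu> * s + \<mu> / 64 + \<mu>\<^sup>2 * (s\<^sup>2 / 8 + C6 + 1)"
  proof -
   have "\<bar>Z\<bar> \<le> \<bar>\<mu> * s\<bar> + \<mu> * (65/64) + \<mu>\<^sup>2 * s\<^sup>2 / 16"
   proof -
    have "P \<le> \<mu> * (65/64) + \<mu>\<^sup>2 * s\<^sup>2 / 16" unfolding P_def using m2C6 by (simp add: algebra_simps)
    thus ?thesis unfolding Z_def using abs_triangle_ineq[of "\<mu> * s" P] P0 by linarith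
   qed
   hence "Z\<^sup>2 \<le> 3 * (\<bar>\<mu> * s\<bar>\<^sup>2 + (\<mu> * (65/64))\<^sup>2 + (\<mu>\<^sup>2 * s\<^sup>2 / 16)\<^sup>2)" by (rule sum_sq3)
   also have "\<dots> = 3 * (\<mu>\<^sup>2 * s\<^sup>2) + 3 * (65/64)\<^sup>2 * \<mu>\<^sup>2 + 3/256 * ((\<mu>\<^sup>2 * s\<^sup>2) * (\<mu>\<^sup>2 * s\<^sup>2))"
    by (simp add: power2_eq_square algebra_simps)
   finally have "b * Z\<^sup>2 \<le> b * (3 * (\<mu>\<^sup>2 * s\<^sup>2) + 3 * (65/64)\<^sup>2 * \<mu>\<^sup>2 + 3/256 * ((\<mu>\<^sup>2 * s\<^sup>2) * (\<mu>\<^sup>2 * s\<^sup>2)))"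
    using b by (intro mult_left_mono) auto
   also have "\<dots> = b * (3 * (\<mu>\<^sup>2 * s\<^sup>2)) + b * (3 * (65/64)\<^sup>2 * \<mu>\<^sup>2) + 3/256 * ((b * (\<mu>\<^sup>2 * s\<^sup>2)) * (\<mu>\<^sup>2 * s\<^sup>2))"
    by (simp add: algebra_simps)
   also have "\<dots> \<le> (1/100) * (3 * (\<mu>\<^sup>2 * s\<^sup>2)) + (1/100) * (3 * (65/64)\<^sup>2 * \<mu>\<^sup>2) + 3/256 * ((1/100) * (\<mu>\<^sup>2 * s\<^sup>2))"
    using b ss by (intro add_mono mult_right_mono mult_left_mono) auto
   also have "\<dots> \<le> \<mu>\<^sup>2 * (s\<^sup>2 / 16) + \<mu>\<^sup>2"
   proof -
    have nn: "0 \<le> \<mu>\<^sup>2 * s\<^sup>2" "0 \<le> \<mu>\<^sup>2" by auto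
    have "(1/100) * (3 * (65/64)\<^sup>2 * \<mu>\<^sup>2) = (12675/409600) * \<mu>\<^sup>2" by (simp add: power_divide)
    thus ?thesis using nn by linarith
   qed
   finally show ?thesis unfolding Z_def P_def by (simp add: algebra_simps)
  qed
  define y where "y = s + k"
  have y: "0 \<le> y" unfolding y_def s_def using alk unfolding alive_def by simp
  define Z' where "Z' = \<mu> * y - \<mu> * k + \<mu> / 64 + ((\<mu> * y)\<^sup>2 / 4 + \<mu>\<^sup>2 * C8)"
  have ZZ: "Z + b * Z\<^sup>2 \<le> Z'"
  proof -
   have "s\<^sup>2 \<le> 2 * y\<^sup>2 + 2 * k\<^sup>2" unfolding y_def using zero_le_power2[of "s + 2 * k"] by (simp add: power2_eq_square algebra_simps)
   moreover have "k\<^sup>2 \<le> (1/2)\<^sup>2" using k by (intro power_mono) auto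
   ultimately have "s\<^sup>2 / 8 \<le> y\<^sup>2 / 4 + 1/16" by (simp add: power2_eq_square)
   hence "\<mu>\<^sup>2 * (s\<^sup>2 / 8 + C6 + 1) \<le> \<mu>\<^sup>2 * (y\<^sup>2 / 4 + C8)" unfolding C8_def by (intro mult_left_mono) auto
   moreover have "\<mu> * s = \<mu> * y - \<mu> * k" unfolding y_def by (simp add: algebra_simps)
   moreover have "(\<mu> * y)\<^sup>2 / 4 + \<mu>\<^sup>2 * C8 = \<mu>\<^sup>2 * (y\<^sup>2 / 4 + C8)" by (simp add: power_mult_distrib algebra_simps)
   ultimately show ?thesis using bZ2 unfolding Z'_def by linarith
  qed
  \<comment> \<open>Passing to an exponential keeps the product form, so the relative drift of the
    penalty ph is read off from Z alone.\<close>
  have "Phi \<le> ph * exp (b * Z)"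
  proof -
   have "j + b * P \<le> j * (1 + b * P)" using j b P0 mult_right_mono[OF j(1), of "b * P"] by (simp add: algebra_simps)
   also have "\<dots> \<le> j * exp (b * P)" using j by (intro mult_left_mono exp_ge_add_one_self) auto
   finally have "E0 * (j + b * P) \<le> E0 * (j * exp (b * P))" unfolding E0_def by (intro mult_left_mono) auto
   also have "\<dots> = ph * exp (b * Z)"
   proof -
    have "E0 = exp (- \<mu> * (s + k)) * exp (b * (\<mu> * s))" unfolding E0_def exp_add[symmetric] by (simp add: algebra_simps)
    thus ?thesis unfolding ph_def Z_def by (simp add: distrib_left exp_add)
   qed
   finally show ?thesis using Phi1 unfolding P_def by linarith
  qed
  also have "\<dots> \<le> ph * (1 + b * Z')"
  proof (rule mult_left_mono[OF _ ph0])
   have "exp (b * Z) \<le> 1 + b * Z + (b * Z)\<^sup>2" by (rule exp_le_quadratic[OF bZ1])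
   also have "\<dots> = 1 + b * (Z + b * Z\<^sup>2)" by (simp add: power2_eq_square algebra_simps)
   also have "\<dots> \<le> 1 + b * Z'" using ZZ b by (intro add_left_mono mult_left_mono) auto
   finally show "exp (b * Z) \<le> 1 + b * Z'" .
  qed
  also have "\<dots> = ph + b * (ph * Z')" by (simp add: algebra_simps)
  \<comment> \<open>\<open>survival_poly\<close> with Y = mu * (es + k), nonnegative because the
    state is alive at level k.\<close>
  also have "ph * Z' \<le> (1 - sqrt \<mu> / 8) - ph * (1 - sqrt \<mu> / 8)"
  proof -
   have "exp (- (\<mu> * y)) * j * (1 - sqrt \<mu> / 8 + (\<mu> * y - \<mu> * k + \<mu> / 64 + ((\<mu> * y)\<^sup>2 / 4 + \<mu>\<^sup>2 * C8))) \<le> 1 - sqrt \<mu> / 8"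
    by (rule survival_poly) (use mu mu1 k C8 muC8 y j in \<open>auto simp: real_sqrt_le_1_iff\<close>)
   moreover have "ph = exp (- (\<mu> * y)) * j" unfolding ph_def y_def by simp
   ultimately have "ph * (1 - sqrt \<mu> / 8 + Z') \<le> 1 - sqrt \<mu> / 8" unfolding Z'_def by simp
   thus ?thesis by (simp add: algebra_simps)
  qed
  hence "ph + b * (ph * Z') \<le> ph + b * ((1 - sqrt \<mu> / 8) - ph * (1 - sqrt \<mu> / 8))" using b by (intro add_left_mono mult_left_mono) auto
  finally have fin: "Phi \<le> ph + b * ((1 - sqrt \<mu> / 8) - ph * (1 - sqrt \<mu> / 8))" .
  have ffeq: "ff \<mu> k g (DJ * Am) sg = 1 - ph" unfolding ff_def ph_def j_def[symmetric] s_def using j by (simp add: max_def)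
  show ?thesis unfolding g_def[symmetric] Aff ffeq b_def[symmetric] using fin by (simp add: algebra_simps add_divide_distrib diff_divide_distrib)
 qed
 show ?thesis using kap mu0 main by blast
qed

section \<open>The clock tau, survival and exit from small values of U\<close>

definition tau :: "nat \<Rightarrow> real" where "tau t = (\<Sum>j<t. \<beta> j)"

lemma tau_Suc: "tau (Suc t) = tau t + \<beta> t" unfolding tau_def by simp

lemma tau_mono: "s \<le> t \<Longrightarrow> tau s \<le> tau t"
 by (rule lift_Suc_mono_le) (auto simp: tau_Suc beta_pos less_imp_le)

text \<open>The clock advances by at most 1 per step, so its first passage over L overshoots by at
  most 1.\<close>

lemma window_exists:
 assumes "0 \<le> L" "t \<le> t'" "L \<le> tau t' - tau t"
 shows "\<exists>k. t + k \<le> t' \<and> L \<le> tau (t + k) - tau t \<and> tau (t + k) - tau t \<le> L + 1"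
proof -
 define k where "k = (LEAST k. L \<le> tau (t + k) - tau t)"
 have ex: "L \<le> tau (t + (t' - t)) - tau t" using assms by simp
 have k1: "L \<le> tau (t + k) - tau t" unfolding k_def by (rule LeastI[of _ "t' - t"]) (rule ex)
 have k2: "k \<le> t' - t" unfolding k_def by (rule Least_le) (rule ex)
 have "tau (t + k) - tau t \<le> L + 1"
 proof (cases k)
  case 0 thus ?thesis using assms by simp
 next
  case (Suc j)
  have "\<not> L \<le> tau (t + j) - tau t" using not_less_Least[of j "\<lambda>k. L \<le> tau (t + k) - tau t"] Suc unfolding k_def by auto
  thus ?thesis using Suc tau_Suc[of "t + j"] beta_le1[of "t + j"] by simp
 qed
 thus ?thesis using k1 k2 assms(2) by (intro exI[of _ k]) auto
qed

lemma pr_ge: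
 assumes "\<And>j sg. j < k \<Longrightarrow> sg \<in> S \<Longrightarrow> \<psi> (t + j) sg \<le> A (t + j) (\<psi> (t + Suc j)) sg" and "sg \<in> S"
 shows "\<psi> t sg \<le> pr t k (\<psi> (t + k)) sg"
 using assms
proof (induction k arbitrary: t sg)
 case (Suc k)
 have "\<psi> t sg \<le> A t (\<psi> (Suc t)) sg" using Suc.prems(1)[of 0 sg] Suc.prems(2) by simp
 also have "\<dots> \<le> A t (pr (Suc t) k (\<psi> (Suc t + k))) sg"
 proof (rule A_mono[OF Suc.prems(2)])
  fix sg assume sg: "sg \<in> S"
  show "\<psi> (Suc t) sg \<le> pr (Suc t) k (\<psi> (Suc t + k)) sg"
  proof (rule Suc.IH[OF _ sg])
   fix j sg assume "j < k" "sg \<in> S"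
   thus "\<psi> (Suc t + j) sg \<le> A (Suc t + j) (\<psi> (Suc t + Suc j)) sg" using Suc.prems(1)[of "Suc j" sg] by simp
  qed
 qed
 finally show ?case by simp
qed simp

lemma A_uminus: "A t (\<lambda>sg. - \<phi> sg) sg = - A t \<phi> sg"
 using A_cmult[of t "-1" \<phi> sg] by simp
lemma pr_uminus: "pr t k (\<lambda>sg. - \<phi> sg) sg = - pr t k \<phi> sg"
 using pr_cmult[of t k "-1" \<phi> sg] by simp
lemma pr_diff: "pr t k (\<lambda>sg. \<phi> sg - \<psi> sg) sg = pr t k \<phi> sg - pr t k \<psi> sg"
 using pr_add[of t k \<phi> "\<lambda>sg. - \<psi> sg" sg] pr_uminus[of t k \<psi> sg] by simp

lemma pr_le:
 assumes "\<And>j sg. j < k \<Longrightarrow> sg \<in> S \<Longrightarrow> A (t + j) (\<psi> (t + Suc j)) sg \<le> \<psi> (t + j) sg" and "sg \<in> S"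
 shows "pr t k (\<psi> (t + k)) sg \<le> \<psi> t sg"
 using pr_ge[of k "\<lambda>t sg. - \<psi> t sg" t sg] assms by (simp add: A_uminus pr_uminus)

text \<open>Y combines the survival function f, inflated by exp (lam * tau) against its loss, with a
  moment Theta whose weight follows its decay. Where the drift estimates fail, either f is
  nonpositive or Theta is so large that Y vanishes, and truncation at 0 keeps Y a submartingale.
  Positivity of Y at the end certifies aliveness and a small Theta together, so one inequality
  bounds their joint probability from below.\<close>

lemma survive:
 fixes f \<Theta> :: "nat \<Rightarrow> 'x \<times> 'h \<Rightarrow> real" and al :: "'x \<times> 'h \<Rightarrow> bool"
 assumes \<rho>: "0 < \<rho>" and bE: "0 \<le> bE" and K: "0 \<le> K" and lam: "0 \<le> lam"
  and rb: "\<And>j. j < k \<Longrightarrow> \<rho> * \<beta> (t + j) \<le> 1"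
  and f1: "\<And>j sg. sg \<in> S \<Longrightarrow> f j sg \<le> 1" and th0: "\<And>j sg. sg \<in> S \<Longrightarrow> 0 \<le> \<Theta> j sg"
  and C1: "\<And>j sg. j < k \<Longrightarrow> sg \<in> S \<Longrightarrow> al sg \<Longrightarrow> 0 < f (t + j) sg \<Longrightarrow> exp (- lam * \<beta> (t + j)) * f (t + j) sg \<le> A (t + j) (f (t + Suc j)) sg"
  and C1': "\<And>j sg. j < k \<Longrightarrow> sg \<in> S \<Longrightarrow> al sg \<Longrightarrow> A (t + j) (\<Theta> (t + Suc j)) sg \<le> exp (- \<rho> * \<beta> (t + j)) * \<Theta> (t + j) sg + K * \<beta> (t + j)"
  and C2: "\<And>j sg. j \<le> k \<Longrightarrow> sg \<in> S \<Longrightarrow> \<not> al sg \<Longrightarrow> f (t + j) sg \<le> 0 \<or>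
        exp (lam * (tau (t + k) - tau t)) \<le> bE * exp (- \<rho> * (tau (t + k) - tau t)) * \<Theta> (t + j) sg"
  and sg: "sg \<in> S"
 shows "f t sg - bE * exp (- \<rho> * (tau (t + k) - tau t)) * \<Theta> t sg - bE * (2 * K / \<rho>)
   \<le> exp (lam * (tau (t + k) - tau t)) *
    pr t k (\<lambda>sg. of_bool (al sg \<and> bE * \<Theta> (t + k) sg < exp (lam * (tau (t + k) - tau t)))) sg"
proof -
 \<comment> \<open>Total of the discounted residuals K * beta; the factor 2 makes up for replacing
   \<open>rho * beta\<close> by \<open>1 - exp (- rho * beta)\<close> while
   \<open>rho * beta \<le> 1\<close>.\<close>
 define K' where "K' = 2 * K / \<rho>"
 have K': "0 \<le> K'" unfolding K'_def using K \<rho> by simp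
 define a where "a j = exp (lam * (tau j - tau t))" for j
 define b where "b j = bE * exp (- \<rho> * (tau (t + k) - tau j))" for j
 \<comment> \<open>\<open>(bE - b j) * K'\<close> is the reserve for the residuals still to come; it
   is used up at the final time, where b equals bE.\<close>
 define Y where "Y j sg = max 0 (a j * f j sg - b j * \<Theta> j sg - (bE - b j) * K')" for j sg
 have b0: "0 \<le> b j" for j unfolding b_def using bE by simp
 have bmono: "b t \<le> b (t + j)" for j unfolding b_def using bE \<rho> tau_mono[of t "t + j"] by (intro mult_left_mono) auto
 have bbE: "b (t + j) \<le> bE" if "j \<le> k" for j
  unfolding b_def using bE \<rho> tau_mono[of "t + j" "t + k"] that by (intro mult_left_le) auto
 have apos: "0 < a j" for j unfolding a_def by simp
 have amono: "a (t + j) \<le> a (t + k)" if "j \<le> k" for j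
  unfolding a_def using lam tau_mono[of "t + j" "t + k"] that by (auto intro!: mult_left_mono)
 \<comment> \<open>A positive Y places the state where C1 and C1' apply; elsewhere the submartingale
   property is trivial because Y is 0.\<close>
 have Ypos: "al sg \<and> 0 < f (t + j) sg" if "j \<le> k" "sg \<in> S" "0 < Y (t + j) sg" for j sg
 proof -
  have p: "0 < a (t + j) * f (t + j) sg - b (t + j) * \<Theta> (t + j) sg - (bE - b (t + j)) * K'"
   using that(3) unfolding Y_def by (auto simp: max_def split: if_splits)
  have q: "0 \<le> (bE - b (t + j)) * K'" using bbE[OF that(1)] K' by simp
  have q2: "0 \<le> b (t + j) * \<Theta> (t + j) sg" using b0 th0[OF that(2)] by simp
  have fp: "0 < f (t + j) sg" using p q q2 apos[of "t + j"] by (smt (verit) mult_nonneg_nonpos)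
  moreover have "al sg"
  proof (rule ccontr)
   assume "\<not> al sg"
   from C2[OF that(1,2) this] fp have c: "a (t + k) \<le> b t * \<Theta> (t + j) sg" unfolding a_def b_def by auto
   have "a (t + j) * f (t + j) sg \<le> a (t + j) * 1" using f1[OF that(2)] apos[of "t + j"] by (intro mult_left_mono) auto
   also have "\<dots> \<le> a (t + k)" using amono[OF that(1)] by simp
   also have "\<dots> \<le> b t * \<Theta> (t + j) sg" by (rule c)
   also have "\<dots> \<le> b (t + j) * \<Theta> (t + j) sg" using bmono th0[OF that(2)] by (intro mult_right_mono) auto
   finally show False using p q by linarith
  qed
  ultimately show ?thesis by simp
 qed
 have sub: "Y (t + j) sg \<le> A (t + j) (Y (t + Suc j)) sg" if j: "j < k" and sg: "sg \<in> S" for j sg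
 proof (cases "0 < Y (t + j) sg")
  case False
  hence "Y (t + j) sg = 0" unfolding Y_def by auto
  moreover have "0 \<le> A (t + j) (Y (t + Suc j)) sg" unfolding A_def Y_def by (intro avg_nonneg) auto
  ultimately show ?thesis by simp
 next
  case True
  have al: "al sg" and fp: "0 < f (t + j) sg" using Ypos[OF _ sg True] j by auto
  define be where "be = \<beta> (t + j)"
  have be: "0 < be" unfolding be_def by (rule beta_pos)
  have tS: "tau (t + Suc j) = tau (t + j) + be" unfolding be_def using tau_Suc[of "t + j"] by simp
  have aS: "a (t + Suc j) = a (t + j) * exp (lam * be)" unfolding a_def tS exp_add[symmetric] by (simp add: algebra_simps)
  have bS: "b (t + j) = b (t + Suc j) * exp (- \<rho> * be)" unfolding b_def tS mult.assoc exp_add[symmetric] by (simp add: algebra_simps)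
  have Yeq: "Y (t + j) sg = a (t + j) * f (t + j) sg - b (t + j) * \<Theta> (t + j) sg - (bE - b (t + j)) * K'"
   using True unfolding Y_def by (auto simp: max_def split: if_splits)
  have x2: "K * be \<le> (1 - exp (- \<rho> * be)) * K'"
  proof -
   have rb1: "\<rho> * be \<le> 1" unfolding be_def by (rule rb[OF j])
   have y: "0 \<le> \<rho> * be" using \<rho> be by simp
   have "exp (- \<rho> * be) = 1 / exp (\<rho> * be)" by (simp add: exp_minus field_simps)
   also have "\<dots> \<le> 1 / (1 + \<rho> * be)" using y exp_ge_add_one_self[of "\<rho> * be"] by (intro divide_left_mono) auto
   also have "\<dots> \<le> 1 - \<rho> * be / 2"
   proof -
    have "(\<rho> * be) * (\<rho> * be) \<le> (\<rho> * be) * 1" using y rb1 by (intro mult_left_mono) auto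
    hence "1 \<le> (1 - \<rho> * be / 2) * (1 + \<rho> * be)" by (simp add: algebra_simps)
    thus ?thesis using y by (simp add: pos_divide_le_eq)
   qed
   finally have "\<rho> * be / 2 \<le> 1 - exp (- \<rho> * be)" by simp
   hence "\<rho> * be / 2 * K' \<le> (1 - exp (- \<rho> * be)) * K'" using K' by (intro mult_right_mono) auto
   moreover have "\<rho> * be / 2 * K' = K * be" unfolding K'_def using \<rho> by simp
   ultimately show ?thesis by linarith
  qed
  have "a (t + j) * f (t + j) sg = a (t + Suc j) * (exp (- lam * be) * f (t + j) sg)"
   unfolding aS by (simp add: exp_minus field_simps)
  also have "\<dots> \<le> a (t + Suc j) * A (t + j) (f (t + Suc j)) sg"
   using C1[OF j sg al fp] apos[of "t + Suc j"] unfolding be_def by (intro mult_left_mono) auto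
  finally have p1: "a (t + j) * f (t + j) sg \<le> a (t + Suc j) * A (t + j) (f (t + Suc j)) sg" .
  have "b (t + Suc j) * A (t + j) (\<Theta> (t + Suc j)) sg \<le> b (t + Suc j) * (exp (- \<rho> * be) * \<Theta> (t + j) sg + K * be)"
   using C1'[OF j sg al] b0 unfolding be_def by (intro mult_left_mono) auto
  also have "\<dots> \<le> b (t + Suc j) * (exp (- \<rho> * be) * \<Theta> (t + j) sg + (1 - exp (- \<rho> * be)) * K')"
   using x2 b0 by (intro mult_left_mono add_left_mono) auto
  also have "\<dots> = b (t + j) * \<Theta> (t + j) sg + (b (t + Suc j) - b (t + j)) * K'" unfolding bS by (simp add: algebra_simps)
  finally have p2: "b (t + Suc j) * A (t + j) (\<Theta> (t + Suc j)) sg \<le> b (t + j) * \<Theta> (t + j) sg + (b (t + Suc j) - b (t + j)) * K'" .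
  have "Y (t + j) sg \<le> a (t + Suc j) * A (t + j) (f (t + Suc j)) sg - b (t + Suc j) * A (t + j) (\<Theta> (t + Suc j)) sg - (bE - b (t + Suc j)) * K'"
   unfolding Yeq using p1 p2 by (simp add: algebra_simps)
  also have "\<dots> = A (t + j) (\<lambda>sg. a (t + Suc j) * f (t + Suc j) sg - b (t + Suc j) * \<Theta> (t + Suc j) sg - (bE - b (t + Suc j)) * K') sg"
   by (simp only: A_diff A_cmult A_const)
  also have "\<dots> \<le> A (t + j) (Y (t + Suc j)) sg" by (rule A_mono[OF sg]) (simp add: Y_def)
  finally show ?thesis .
 qed
 have "f t sg - b t * \<Theta> t sg - bE * K' \<le> Y t sg"
 proof -
  have "0 \<le> b t * K'" using b0 K' by simp
  thus ?thesis unfolding Y_def a_def by (simp add: algebra_simps)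
 qed
 also have "Y t sg \<le> pr t k (Y (t + k)) sg" by (rule pr_ge[OF sub sg])
 also have "\<dots> \<le> pr t k (\<lambda>sg. a (t + k) * of_bool (al sg \<and> bE * \<Theta> (t + k) sg < a (t + k))) sg"
 proof (rule pr_mono[OF sg])
  fix sg assume sg: "sg \<in> S"
  show "Y (t + k) sg \<le> a (t + k) * of_bool (al sg \<and> bE * \<Theta> (t + k) sg < a (t + k))"
  proof (cases "0 < Y (t + k) sg")
   case True
   have al: "al sg" "0 < f (t + k) sg" using Ypos[OF _ sg True] by auto
   have beq: "b (t + k) = bE" unfolding b_def by simp
   have Yeq: "Y (t + k) sg = a (t + k) * f (t + k) sg - bE * \<Theta> (t + k) sg"
    using True unfolding Y_def beq by (auto simp: max_def split: if_splits)
   have "a (t + k) * f (t + k) sg \<le> a (t + k) * 1" using f1[OF sg] apos[of "t + k"] by (intro mult_left_mono) auto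
   moreover have "0 \<le> bE * \<Theta> (t + k) sg" using bE th0[OF sg] by simp
   ultimately show ?thesis using True al unfolding Yeq by simp
  next
   case False
   hence "Y (t + k) sg = 0" unfolding Y_def by auto
   thus ?thesis using apos[of "t + k"] by simp
  qed
 qed
 also have "\<dots> = a (t + k) * pr t k (\<lambda>sg. of_bool (al sg \<and> bE * \<Theta> (t + k) sg < a (t + k))) sg" by (rule pr_cmult)
 finally show ?thesis unfolding a_def b_def K'_def .
qed

text \<open>Small enough that |es| \<le> norm dir * |e| forces es > -1/2; the added 1 keeps the
  quotient defined when dir is 0.\<close>

definition w0 :: real where "w0 = 1 / (8 * ((norm dir)\<^sup>2 + 1))"

lemma w0_pos: "0 < w0" unfolding w0_def by (intro divide_pos_pos mult_pos_pos add_nonneg_pos) auto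

lemma alive_W:
 assumes "W sg \<le> w0" shows "alive (1/2) sg"
proof -
 have p: "0 < (norm dir)\<^sup>2 + 1" by (intro add_nonneg_pos) auto
 have "(es sg)\<^sup>2 \<le> (norm dir)\<^sup>2 * W sg" by (rule es_sq)
 also have "\<dots> \<le> (norm dir)\<^sup>2 * w0" using assms by (intro mult_left_mono) auto
 also have "\<dots> \<le> 1/8" unfolding w0_def using p by (simp add: field_simps)
 also have "\<dots> < (1/2)\<^sup>2" by (simp add: power2_eq_square)
 finally have "\<bar>es sg\<bar> < 1/2" by (metis abs_ge_zero power2_abs power2_less_imp_less zero_le_divide_1_iff zero_le_numeral)
 thus ?thesis unfolding alive_def by linarith
qed

text \<open>Markov's inequality with two weights on U^5. The constant weight
  \<open>1 / w0 ^ 5\<close> detects a passage above w0 at any time, and its residual accumulates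
  with tau. The weight that grows to \<open>1 / w ^ 5\<close> detects only the final level; since it
  is small at early times, its residual does not accumulate.\<close>

lemma exit_bound:
 "\<exists>K\<ge>0. \<exists>e0>0. \<forall>t k w sg. \<eta> t \<le> e0 \<and> sg \<in> S \<and> 0 < w \<and> w \<le> w0 \<longrightarrow>
   pr t k (\<lambda>sg. of_bool (w < U (t + k) sg)) sg
    \<le> (1 / w0 ^ 5 + exp (- 2 * (tau (t + k) - tau t)) / w ^ 5) * U t sg ^ 5
     + K * \<eta> t ^ 5 * ((tau (t + k) - tau t) / w0 ^ 5 + 1 / w ^ 5)"
proof -
 obtain K e1 where K: "0 \<le> K" and e1: "0 < e1"
  and dr: "\<And>t sg. \<eta> t \<le> e1 \<Longrightarrow> sg \<in> S \<Longrightarrow> alive (1/2) sg \<Longrightarrow>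
   A t (\<lambda>sg. U (Suc t) sg ^ 5) sg \<le> (1 - 3 * \<beta> t) * U t sg ^ 5 + K * \<beta> t * \<eta> t ^ 5"
  using U_drift5 by blast
 have "\<exists>e2>0. \<forall>x. 0 < x \<and> x \<le> e2 \<longrightarrow> 2 * (c * x\<^sup>2) \<le> 1"
  by (rule small_at_zero) (auto intro!: tendsto_eq_intros)
 then obtain e2 where e2: "0 < e2" "\<And>x. 0 < x \<Longrightarrow> x \<le> e2 \<Longrightarrow> 2 * (c * x\<^sup>2) \<le> 1" by auto
 have main: "pr t k (\<lambda>sg. of_bool (w < U (t + k) sg)) sg
    \<le> (1 / w0 ^ 5 + exp (- 2 * (tau (t + k) - tau t)) / w ^ 5) * U t sg ^ 5
     + K * \<eta> t ^ 5 * ((tau (t + k) - tau t) / w0 ^ 5 + 1 / w ^ 5)"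
  if et: "\<eta> t \<le> min e1 e2" and sg: "sg \<in> S" and w: "0 < w" "w \<le> w0" for t k w sg
 proof -
  define H where "H = K * \<eta> t ^ 5"
  have H: "0 \<le> H" unfolding H_def using K eta_pos[of t] by simp
  define v0 where "v0 = 1 / w0 ^ 5"
  have v0: "0 < v0" unfolding v0_def using w0_pos by simp
  define q where "q j = exp (- 2 * (tau (t + k) - tau j)) / w ^ 5" for j
  have q0: "0 < q j" for j unfolding q_def using w by simp
  define Z where "Z j sg = (v0 + q j) * U j sg ^ 5 + H * ((tau (t + k) - tau j) * v0 + (1 / w ^ 5 - q j))" for j sg
  have qle: "q (t + j) \<le> 1 / w ^ 5" if "j \<le> k" for j
   unfolding q_def using tau_mono[of "t + j" "t + k"] that w by (intro divide_right_mono) auto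
  have Hnn: "0 \<le> H * ((tau (t + k) - tau (t + j)) * v0 + (1 / w ^ 5 - q (t + j)))" if "j \<le> k" for j
   using H v0 qle[OF that] tau_mono[of "t + j" "t + k"] that by (intro mult_nonneg_nonneg add_nonneg_nonneg) auto
  have Zdead: "1 \<le> Z (t + j) sg" if "j \<le> k" "sg \<in> S" "w0 < U (t + j) sg" for j sg
  proof -
   have "w0 ^ 5 \<le> U (t + j) sg ^ 5" using that w0_pos by (intro power_mono) auto
   hence "1 \<le> v0 * U (t + j) sg ^ 5" unfolding v0_def using w0_pos by (simp add: field_simps)
   moreover have "0 \<le> q (t + j) * U (t + j) sg ^ 5" using q0[of "t + j"] U_lower(3)[OF that(2), of "t + j"] by simp
   ultimately show ?thesis unfolding Z_def using Hnn[OF that(1)] by (simp add: algebra_simps)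
  qed
  \<comment> \<open>Capping at 1 stops the process above w0, where no drift estimate is
    available.\<close>
  have sup: "A (t + j) (\<lambda>sg. min 1 (Z (t + Suc j) sg)) sg \<le> min 1 (Z (t + j) sg)" if j: "j < k" and sg: "sg \<in> S" for j sg
  proof (cases "w0 < U (t + j) sg")
   case True
   hence "min 1 (Z (t + j) sg) = 1" using Zdead[OF _ sg, of j] j by simp
   moreover have "A (t + j) (\<lambda>sg. min 1 (Z (t + Suc j) sg)) sg \<le> 1" unfolding A_def by (intro avg_le n_pos) auto
   ultimately show ?thesis by simp
  next
   case False
   define b where "b = \<beta> (t + j)"
   have b: "0 < b" unfolding b_def by (rule beta_pos)
   have ej: "\<eta> (t + j) \<le> \<eta> t" by (rule eta_antimono) simp
   have b2: "2 * b \<le> 1" unfolding b_def beta_def using e2(2)[of "\<eta> (t + j)"] ej et eta_pos[of "t + j"] by simp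
   have "alive (1/2) sg" using False U_lower(1)[OF sg, of "t + j"] by (intro alive_W) linarith
   hence "A (t + j) (\<lambda>sg. U (Suc (t + j)) sg ^ 5) sg \<le> (1 - 3 * b) * U (t + j) sg ^ 5 + K * b * \<eta> (t + j) ^ 5"
    unfolding b_def using ej et by (intro dr sg) auto
   also have "\<dots> \<le> (1 - 3 * b) * U (t + j) sg ^ 5 + b * H"
    unfolding H_def using K b ej eta_pos[of "t + j"] by (auto intro!: mult_left_mono power_mono simp: mult_ac)
   finally have d: "A (t + j) (\<lambda>sg. U (t + Suc j) sg ^ 5) sg \<le> (1 - 3 * b) * U (t + j) sg ^ 5 + b * H" by simp
   have tS: "tau (t + Suc j) = tau (t + j) + b" unfolding b_def using tau_Suc[of "t + j"] by simp
   have qS: "q (t + j) = q (t + Suc j) * exp (- 2 * b)" unfolding q_def tS by (simp add: exp_add[symmetric] algebra_simps)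
   have u0: "0 \<le> U (t + j) sg ^ 5" using U_lower(3)[OF sg, of "t + j"] by simp
   have ex1: "1 - 3 * b \<le> exp (- 2 * b)" using exp_ge_add_one_self[of "- 2 * b"] b by linarith
   \<comment> \<open>Over one step q grows by at least the fraction b of its new value, and this
     pays for the residual \<open>b * H\<close>.\<close>
   have ex2: "exp (- 2 * b) \<le> 1 - b"
   proof -
    have "exp (- 2 * b) = 1 / exp (2 * b)" by (simp add: exp_minus field_simps)
    also have "\<dots> \<le> 1 / (1 + 2 * b)" using b exp_ge_add_one_self[of "2 * b"] by (intro divide_left_mono) auto
    also have "\<dots> \<le> 1 - b" using b b2 by (simp add: field_simps)
    finally show ?thesis .
   qed
   have "A (t + j) (Z (t + Suc j)) sg = (v0 + q (t + Suc j)) * A (t + j) (\<lambda>sg. U (t + Suc j) sg ^ 5) sg + H * ((tau (t + k) - tau (t + Suc j)) * v0 + (1 / w ^ 5 - q (t + Suc j)))"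
    unfolding Z_def by (simp only: A_add A_cmult A_const)
   also have "\<dots> \<le> (v0 + q (t + Suc j)) * ((1 - 3 * b) * U (t + j) sg ^ 5 + b * H) + H * ((tau (t + k) - tau (t + Suc j)) * v0 + (1 / w ^ 5 - q (t + Suc j)))"
    using d v0 q0[of "t + Suc j"] by (intro add_right_mono mult_left_mono) auto
   also have "\<dots> = v0 * ((1 - 3 * b) * U (t + j) sg ^ 5) + q (t + Suc j) * (1 - 3 * b) * U (t + j) sg ^ 5 + H * ((tau (t + k) - tau (t + j)) * v0 + (1 / w ^ 5 - q (t + Suc j) * (1 - b)))"
    unfolding tS by (simp add: algebra_simps)
   also have "\<dots> \<le> v0 * (1 * U (t + j) sg ^ 5) + q (t + Suc j) * exp (- 2 * b) * U (t + j) sg ^ 5 + H * ((tau (t + k) - tau (t + j)) * v0 + (1 / w ^ 5 - q (t + Suc j) * exp (- 2 * b)))"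
    using v0 b u0 q0[of "t + Suc j"] ex1 ex2 H by (intro add_mono mult_left_mono mult_right_mono diff_mono order_refl) auto
   also have "\<dots> = Z (t + j) sg" unfolding Z_def qS by (simp add: algebra_simps)
   finally have "A (t + j) (Z (t + Suc j)) sg \<le> Z (t + j) sg" .
   moreover have "A (t + j) (\<lambda>sg. min 1 (Z (t + Suc j) sg)) sg \<le> A (t + j) (Z (t + Suc j)) sg" by (rule A_mono[OF sg]) auto
   moreover have "A (t + j) (\<lambda>sg. min 1 (Z (t + Suc j) sg)) sg \<le> 1" unfolding A_def by (intro avg_le n_pos) auto
   ultimately show ?thesis by simp
  qed
  have "pr t k (\<lambda>sg. of_bool (w < U (t + k) sg)) sg \<le> pr t k (\<lambda>sg. min 1 (Z (t + k) sg)) sg"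
  proof (rule pr_mono[OF sg])
   fix sg assume sg: "sg \<in> S"
   have nn: "0 \<le> (v0 + q (t + k)) * U (t + k) sg ^ 5" using v0 q0[of "t + k"] U_lower(3)[OF sg, of "t + k"] by simp
   show "of_bool (w < U (t + k) sg) \<le> min 1 (Z (t + k) sg)"
   proof (cases "w < U (t + k) sg")
    case True
    hence "w ^ 5 \<le> U (t + k) sg ^ 5" using w by (intro power_mono) auto
    hence "1 \<le> q (t + k) * U (t + k) sg ^ 5" unfolding q_def using w by (simp add: field_simps)
    moreover have "0 \<le> v0 * U (t + k) sg ^ 5" using v0 U_lower(3)[OF sg, of "t + k"] by simp
    ultimately have "1 \<le> Z (t + k) sg" unfolding Z_def using Hnn[of k] by (simp add: algebra_simps)
    thus ?thesis by simp
   next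
    case False
    have "0 \<le> Z (t + k) sg" unfolding Z_def using nn Hnn[of k] by simp
    thus ?thesis using False by simp
   qed
  qed
  also have "\<dots> \<le> min 1 (Z t sg)" by (rule pr_le[of k t "\<lambda>j sg. min 1 (Z j sg)", OF sup sg])
  also have "\<dots> \<le> Z t sg" by simp
  also have "\<dots> \<le> (v0 + q t) * U t sg ^ 5 + H * ((tau (t + k) - tau t) * v0 + 1 / w ^ 5)"
   unfolding Z_def using H q0[of t] by (intro add_left_mono mult_left_mono) auto
  finally show ?thesis unfolding H_def v0_def q_def by simp
 qed
 show ?thesis
  by (rule exI[of _ K], rule conjI[OF K], rule exI[of _ "min e1 e2"]) (use e1 e2 main in auto)
qed

end

section \<open>Decay of the error in one block\<close>

text \<open>Every condition that T be large is brought into this form below and settled by comparing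
  two exponents.\<close>

lemma ev_powr:
 fixes K a b :: real
 assumes "a < b"
 shows "eventually (\<lambda>T::nat. K * real T powr a \<le> real T powr b) sequentially"
proof -
 have "((\<lambda>T::nat. K * real T powr (a - b)) \<longlongrightarrow> K * 0) sequentially"
  using assms by (intro tendsto_mult tendsto_const tendsto_neg_powr filterlim_real_sequentially) auto
 hence "eventually (\<lambda>T::nat. K * real T powr (a - b) < 1) sequentially"
  by (intro order_tendstoD) auto
 thus ?thesis
 proof (eventually_elim)
  case (elim T)
  show ?case
  proof (cases "T = 0")
   case False
   hence "K * real T powr a = (K * real T powr (a - b)) * real T powr b" by (simp add: powr_diff)
   also have "\<dots> \<le> 1 * real T powr b" using elim by (intro mult_right_mono) auto
   finally show ?thesis by simp
  qed simp
 qed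
qed

lemma exp_mult_ln: "0 < T \<Longrightarrow> exp (a * ln T) = (T::real) powr a"
 by (simp add: powr_def)

context storm begin

text \<open>The conclusion of \<open>f_drift\<close> with its witnesses as parameters, so that the
  same kappa and mu0 are shared by all phases and determine the final exponent.\<close>

definition fdr :: "real \<Rightarrow> real \<Rightarrow> bool" where
 "fdr \<kappa> \<mu>0 \<longleftrightarrow> (\<forall>t g0 \<mu> k Am sg. 0 < \<mu> \<and> \<mu> \<le> \<mu>0 \<and> 1/4 \<le> k \<and> k \<le> 1/2 \<and> 0 < g0 \<and> g0 \<le> \<eta> t \<and> \<eta> t \<le> 2 * g0
   \<and> \<beta> t \<le> 1/100 \<and> \<beta> t * \<mu>\<^sup>2 * (norm dir)\<^sup>2 * Am\<^sup>2 \<le> 1/100 \<and> B2 \<le> Am \<and> 1 \<le> Am \<and> \<kappa> * \<mu> * g0 * DJ * Am \<le> 1/64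
   \<and> sg \<in> S \<and> alive k sg \<and> sqrt (W sg) \<le> Am \<longrightarrow>
   (1 - (1 - sqrt \<mu> / 8) * \<beta> t) * ff \<mu> k (\<kappa> * \<mu>\<^sup>2 * g0) (DJ * Am) sg \<le> A t (ff \<mu> k (\<kappa> * \<mu>\<^sup>2 * g0) (DJ * Am)) sg)"

lemma ex_fdr: "\<exists>\<kappa>>0. \<exists>\<mu>0>0. \<mu>0 \<le> 1 \<and> fdr \<kappa> \<mu>0"
 using f_drift unfolding fdr_def .

definition ujr :: "nat \<Rightarrow> real \<Rightarrow> real \<Rightarrow> real \<Rightarrow> real \<Rightarrow> bool" where
 "ujr m s \<kappa> K e0 \<longleftrightarrow> (\<forall>t g0 sg. 0 < g0 \<and> g0 \<le> \<eta> t \<and> \<eta> t \<le> 2 * g0 \<and> \<eta> t \<le> e0 \<and> sg \<in> S \<and> alive (1/2) sg \<longrightarrow>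
   \<kappa> * g0 * DJ \<le> 1/16 \<and>
   A t (\<lambda>sg. uJ (\<kappa> * g0) sg ^ m) sg \<le> (1 - 2 * real m * (1 - s) * \<beta> t) * uJ (\<kappa> * g0) sg ^ m + K * \<beta> t)"

lemma ex_ujr: "0 < m \<Longrightarrow> 0 < s \<Longrightarrow> s < 1 \<Longrightarrow> \<exists>\<kappa>>0. \<exists>K\<ge>0. \<exists>e0>0. ujr m s \<kappa> K e0"
 unfolding ujr_def by (rule uJ_drift)

definition win :: "nat \<Rightarrow> nat \<Rightarrow> bool" where "win T t \<longleftrightarrow> T \<le> 2 * t + 1 \<and> t \<le> T"

lemma win_eta: "win T t \<Longrightarrow> \<eta> T \<le> \<eta> t \<and> \<eta> t \<le> 2 * \<eta> T"
 unfolding win_def using eta_antimono eta_half by auto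

lemma win_add: "win T t \<Longrightarrow> t + j \<le> T \<Longrightarrow> win T (t + j)" unfolding win_def by auto

text \<open>The margin 1/8 in es gains about mu/8 in the exponential, while the correction factor
  costs only mu/32.\<close>

lemma ff_start:
 assumes sg: "sg \<in> S" and es: "- k + 1/8 \<le> es sg" and WA: "sqrt (W sg) \<le> Am" and g: "0 \<le> g" "g * DJ * Am \<le> \<mu> / 64" and mu: "0 < \<mu>" "\<mu> \<le> 1"
 shows "\<mu> / 16 \<le> ff \<mu> k g (DJ * Am) sg"
proof -
 have JJb: "\<bar>JJ sg\<bar> \<le> DJ * Am" using JJ_bd[OF sg] mult_left_mono[OF WA DJ_nn] by linarith
 have "g * (JJ sg + DJ * Am) \<le> g * (2 * (DJ * Am))" by (intro mult_left_mono) (use abs_le_D1[OF JJb] g in linarith)+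
 hence j: "max 0 (1 + g * (JJ sg + DJ * Am)) \<le> 1 + \<mu> / 32" using g mu by auto
 have "exp (- \<mu> * (es sg + k)) \<le> exp (- \<mu> / 8)"
 proof -
  have "\<mu> * (1/8) \<le> \<mu> * (es sg + k)" using es mu by (intro mult_left_mono) auto
  thus ?thesis by simp
 qed
 also have "\<dots> \<le> 1 + (- \<mu> / 8) + (- \<mu> / 8)\<^sup>2" by (rule exp_le_quadratic) (use mu in auto)
 also have "\<dots> \<le> 1 - 7 * \<mu> / 64"
 proof -
  have "\<mu> * \<mu> \<le> \<mu>" using mu by (simp add: mult_left_le)
  thus ?thesis by (simp add: power2_eq_square)
 qed
 finally have e: "exp (- \<mu> * (es sg + k)) \<le> 1 - 7 * \<mu> / 64" .
 have "exp (- \<mu> * (es sg + k)) * max 0 (1 + g * (JJ sg + DJ * Am)) \<le> (1 - 7 * \<mu> / 64) * (1 + \<mu> / 32)"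
  using e j mu by (intro mult_mono) auto
 also have "\<dots> \<le> 1 - \<mu> / 16" using mu by (simp add: algebra_simps)
 finally show ?thesis unfolding ff_def by simp
qed

text \<open>\<open>survive\<close> for the region where the state is alive at level kk and |e| is at
  most Am, outside of which \<open>f_drift\<close> says nothing. Dead states are handled by
  \<open>ff_dead\<close>; leaving through large |e| is charged to the moment Theta by C2.\<close>

lemma survive_ff:
 fixes \<Theta> :: "nat \<Rightarrow> 'x \<times> 'h \<Rightarrow> real"
 assumes fd: "fdr \<kappa>f \<mu>0" "0 < \<kappa>f" and mu: "0 < \<mu>" "\<mu> \<le> \<mu>0" "\<mu>0 \<le> 1" and kk: "1/4 \<le> kk" "kk \<le> 1/2"
  and w: "win T t" "t + k \<le> T" and \<beta>1: "\<beta> t \<le> 1/100" and bA: "\<beta> t * \<mu>\<^sup>2 * (norm dir)\<^sup>2 * Am\<^sup>2 \<le> 1/100"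
  and Am: "B2 \<le> Am" "1 \<le> Am" and kA: "\<kappa>f * \<mu> * \<eta> T * DJ * Am \<le> 1/64"
  and lam: "1 - sqrt \<mu> / 16 \<le> lam" "lam \<le> 2" and b\<mu>: "16 * \<beta> t \<le> sqrt \<mu>"
  and \<rho>: "0 < \<rho>" "\<rho> * \<beta> t \<le> 1" and bE: "0 \<le> bE" and K: "0 \<le> K" and th0: "\<And>j sg. sg \<in> S \<Longrightarrow> 0 \<le> \<Theta> j sg"
  and C1': "\<And>j sg. j < k \<Longrightarrow> sg \<in> S \<Longrightarrow> alive kk sg \<Longrightarrow> A (t + j) (\<Theta> (t + Suc j)) sg \<le> (1 - \<rho> * \<beta> (t + j)) * \<Theta> (t + j) sg + K * \<beta> (t + j)"
  and C2: "\<And>j sg. j \<le> k \<Longrightarrow> sg \<in> S \<Longrightarrow> Am < sqrt (W sg) \<Longrightarrow>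
        exp (lam * (tau (t + k) - tau t)) \<le> bE * exp (- \<rho> * (tau (t + k) - tau t)) * \<Theta> (t + j) sg"
  and sg: "sg \<in> S" "- kk + 1/8 \<le> es sg" "sqrt (W sg) \<le> Am"
  and s1: "bE * exp (- \<rho> * (tau (t + k) - tau t)) * \<Theta> t sg \<le> \<mu> / 64" and s2: "bE * (2 * K / \<rho>) \<le> \<mu> / 64"
 shows "\<mu> / 32 \<le> exp (lam * (tau (t + k) - tau t)) *
    pr t k (\<lambda>sg. of_bool (alive kk sg \<and> bE * \<Theta> (t + k) sg < exp (lam * (tau (t + k) - tau t)))) sg"
proof -
 define g where "g = \<kappa>f * \<mu>\<^sup>2 * \<eta> T"
 have g: "0 \<le> g" unfolding g_def using fd(2) mu eta_pos[of T] by simp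
 have gDA: "g * DJ * Am \<le> \<mu> / 64"
 proof -
  have "\<mu> * (\<kappa>f * \<mu> * \<eta> T * DJ * Am) \<le> \<mu> * (1/64)" using kA mu by (intro mult_left_mono) auto
  thus ?thesis unfolding g_def by (simp add: power2_eq_square mult_ac)
 qed
 have sq1: "sqrt \<mu> \<le> 1" using mu by simp
 have lam0: "0 \<le> lam" using lam sq1 by linarith
 define al where "al sg \<longleftrightarrow> alive kk sg \<and> sqrt (W sg) \<le> Am" for sg
 have bj: "\<beta> (t + j) \<le> \<beta> t" for j by (rule beta_antimono) simp
 have "ff \<mu> kk g (DJ * Am) sg - bE * exp (- \<rho> * (tau (t + k) - tau t)) * \<Theta> t sg - bE * (2 * K / \<rho>)
   \<le> exp (lam * (tau (t + k) - tau t)) *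
    pr t k (\<lambda>sg. of_bool (al sg \<and> bE * \<Theta> (t + k) sg < exp (lam * (tau (t + k) - tau t)))) sg"
 proof (rule survive[where f = "\<lambda>_. ff \<mu> kk g (DJ * Am)"])
  fix j assume "j < k"
  show "\<rho> * \<beta> (t + j) \<le> 1" using \<rho> mult_left_mono[OF bj[of j], of \<rho>] by linarith
 next
  fix j sg assume j: "j < k" and sg: "sg \<in> S" "al sg" and fp: "0 < ff \<mu> kk g (DJ * Am) sg"
  define b where "b = \<beta> (t + j)"
  have b: "0 < b" "b \<le> 1/100" "16 * b \<le> sqrt \<mu>" unfolding b_def using beta_pos bj[of j] \<beta>1 b\<mu> by (auto intro: order_trans)
  have wj: "win T (t + j)" using win_add[OF w(1)] w(2) j by simp
  have bA': "b * \<mu>\<^sup>2 * (norm dir)\<^sup>2 * Am\<^sup>2 \<le> 1/100"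
   using mult_right_mono[OF bj[of j], of "\<mu>\<^sup>2 * (norm dir)\<^sup>2 * Am\<^sup>2"] bA unfolding b_def by (simp add: mult.assoc)
  have dr: "(1 - (1 - sqrt \<mu> / 8) * b) * ff \<mu> kk g (DJ * Am) sg \<le> A (t + j) (ff \<mu> kk g (DJ * Am)) sg"
   using fd(1)[unfolded fdr_def, rule_format, of \<mu> kk "\<eta> T" "t + j" Am sg] mu kk eta_pos[of T] win_eta[OF wj] b bA' Am kA sg
   unfolding g_def b_def al_def by auto
  \<comment> \<open>Half of the gain sqrt mu / 8 pays for replacing 1 - x by exp (- x); this turns
    the 8 into 16.\<close>
  have "exp (- lam * b) \<le> exp (- (1 - sqrt \<mu> / 16) * b)"
  proof -
   have "(1 - sqrt \<mu> / 16) * b \<le> lam * b" using lam b by (intro mult_right_mono) auto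
   hence "- lam * b \<le> - (1 - sqrt \<mu> / 16) * b" by linarith
   thus ?thesis by simp
  qed
  also have "\<dots> \<le> 1 + (- (1 - sqrt \<mu> / 16) * b) + (- (1 - sqrt \<mu> / 16) * b)\<^sup>2"
  proof (rule exp_le_quadratic)
   have "sqrt \<mu> \<le> 16" using sq1 by linarith
   hence "0 \<le> (1 - sqrt \<mu> / 16) * b" using b by (intro mult_nonneg_nonneg) auto
   thus "- (1 - sqrt \<mu> / 16) * b \<le> 1" by linarith
  qed
  also have "\<dots> \<le> 1 - (1 - sqrt \<mu> / 16) * b + b * (sqrt \<mu> / 16)"
  proof -
   have "0 \<le> sqrt \<mu>" using mu by simp
   hence s1b: "1 - sqrt \<mu> / 16 \<le> 1" by linarith
   have s1: "0 \<le> 1 - sqrt \<mu> / 16" using sq1 by linarith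
   have "((1 - sqrt \<mu> / 16) * b)\<^sup>2 \<le> (1 * b)\<^sup>2" using s1 s1b b by (intro power_mono mult_right_mono mult_nonneg_nonneg) auto
   also have "\<dots> \<le> b * (sqrt \<mu> / 16)" using b by (simp add: power2_eq_square)
   finally have "((1 - sqrt \<mu> / 16) * b)\<^sup>2 \<le> b * (sqrt \<mu> / 16)" .
   moreover have "(- (1 - sqrt \<mu> / 16) * b)\<^sup>2 = ((1 - sqrt \<mu> / 16) * b)\<^sup>2" by (simp only: mult_minus_left power2_minus)
   ultimately show ?thesis by linarith
  qed
  also have "\<dots> = 1 - (1 - sqrt \<mu> / 8) * b" by (simp add: algebra_simps)
  finally have "exp (- lam * b) * ff \<mu> kk g (DJ * Am) sg \<le> (1 - (1 - sqrt \<mu> / 8) * b) * ff \<mu> kk g (DJ * Am) sg" using fp by (intro mult_right_mono) auto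
  thus "exp (- lam * \<beta> (t + j)) * ff \<mu> kk g (DJ * Am) sg \<le> A (t + j) (ff \<mu> kk g (DJ * Am)) sg" using dr unfolding b_def by linarith
 next
  fix j sg assume j: "j < k" and sg: "sg \<in> S" "al sg"
  have "1 - \<rho> * \<beta> (t + j) \<le> exp (- \<rho> * \<beta> (t + j))" using exp_ge_add_one_self[of "- \<rho> * \<beta> (t + j)"] by simp
  hence "(1 - \<rho> * \<beta> (t + j)) * \<Theta> (t + j) sg \<le> exp (- \<rho> * \<beta> (t + j)) * \<Theta> (t + j) sg" using th0[OF sg(1)] by (intro mult_right_mono) auto
  thus "A (t + j) (\<Theta> (t + Suc j)) sg \<le> exp (- \<rho> * \<beta> (t + j)) * \<Theta> (t + j) sg + K * \<beta> (t + j)"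
   using C1'[OF j sg(1)] sg(2) unfolding al_def by fastforce
 next
  fix j sg assume j: "j \<le> k" and sg: "sg \<in> S" "\<not> al sg"
  show "ff \<mu> kk g (DJ * Am) sg \<le> 0 \<or> exp (lam * (tau (t + k) - tau t)) \<le> bE * exp (- \<rho> * (tau (t + k) - tau t)) * \<Theta> (t + j) sg"
  proof (cases "Am < sqrt (W sg)")
   case True thus ?thesis using C2[OF j sg(1)] by simp
  next
   case False
   hence "\<not> alive kk sg" "sqrt (W sg) \<le> Am" using sg(2) unfolding al_def by auto
   thus ?thesis using ff_dead[OF sg(1), of Am g \<mu> kk] g mu by simp
  qed
 qed (use \<rho> bE K lam0 th0 sg ff_le1 in auto)
 also have "\<dots> \<le> exp (lam * (tau (t + k) - tau t)) *
    pr t k (\<lambda>sg. of_bool (alive kk sg \<and> bE * \<Theta> (t + k) sg < exp (lam * (tau (t + k) - tau t)))) sg"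
  by (intro mult_left_mono pr_mono sg) (auto simp: al_def)
 finally show ?thesis using s1 s2 ff_start[OF sg g gDA mu(1)] mu by linarith
qed

section \<open>Powers of T and the four phases of one trial\<close>

definition scl :: "real \<Rightarrow> real \<Rightarrow> bool" where
 "scl a1 a2 \<longleftrightarrow> 0 < a1 \<and> 0 < a2 \<and> (\<forall>T t. 1 \<le> T \<and> t \<le> T \<longrightarrow> a1 * real T powr (-1/3) \<le> \<eta> t) \<and>
   (\<forall>T t. 1 \<le> T \<and> win T t \<longrightarrow> \<eta> t \<le> a2 * real T powr (-1/3))"

text \<open>The lower bound holds at all times up to T, the upper one only on the second half, since
  early step sizes are larger.\<close>

lemma ex_scl: "\<exists>a1 a2. scl a1 a2"
proof -
 have 1: "h1 * 2 powr (-1/3) * real T powr (-1/3) \<le> \<eta> t" if T: "1 \<le> T" "t \<le> T" for T t :: nat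
 proof -
  have "(2 * real T) powr (-1/3) \<le> (real t + 1) powr (-1/3)" using T by (intro powr_mono2') auto
  hence "h1 * (2 * real T) powr (-1/3) \<le> \<eta> t" using eta_lo[of t] h1_pos by (meson mult_left_mono less_imp_le order_trans)
  thus ?thesis by (simp add: powr_mult)
 qed
 have 2: "\<eta> t \<le> (\<bar>h2\<bar> + 1) * (1/2) powr (-1/3) * real T powr (-1/3)" if T: "1 \<le> T" "win T t" for T t :: nat
 proof -
  have "real T \<le> 2 * real t + 1" using T unfolding win_def by linarith
  hence "(real t + 1) powr (-1/3) \<le> (1/2 * real T) powr (-1/3)" using T by (intro powr_mono2') auto
  hence "h2 * (real t + 1) powr (-1/3) \<le> (\<bar>h2\<bar> + 1) * (1/2 * real T) powr (-1/3)" by (intro mult_mono) auto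
  hence "\<eta> t \<le> (\<bar>h2\<bar> + 1) * (1/2 * real T) powr (-1/3)" using eta_hi[of t] by linarith
  thus ?thesis by (simp only: powr_mult mult.assoc)
 qed
 have "scl (h1 * 2 powr (-1/3)) ((\<bar>h2\<bar> + 1) * (1/2) powr (-1/3))"
  unfolding scl_def using 1 2 h1_pos by auto
 thus ?thesis by blast
qed

lemma scl_hi: "scl a1 a2 \<Longrightarrow> 1 \<le> T \<Longrightarrow> win T t \<Longrightarrow> \<eta> t \<le> a2 * real T powr (-1/3)"
 and scl_lo: "scl a1 a2 \<Longrightarrow> 1 \<le> T \<Longrightarrow> t \<le> T \<Longrightarrow> a1 * real T powr (-1/3) \<le> \<eta> t"
 and scl_pos: "scl a1 a2 \<Longrightarrow> 0 < a1" "scl a1 a2 \<Longrightarrow> 0 < a2"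
 unfolding scl_def by auto

lemma uJ_W:
 assumes "sg \<in> S" "0 \<le> g" "g * DJ \<le> 1/16"
 shows "W sg / 2 \<le> uJ g sg" "uJ g sg \<le> 2 * (W sg + 1)" "0 \<le> uJ g sg"
proof -
 have b: "\<bar>uJ g sg - (W sg + 1)\<bar> \<le> 1/16 * (W sg + 1)" by (rule uJ_bounds[OF assms]) simp
 show "W sg / 2 \<le> uJ g sg" "uJ g sg \<le> 2 * (W sg + 1)" "0 \<le> uJ g sg"
  using abs_le_D1[OF b] abs_le_D2[OF b] W_nn[of sg] by (simp_all add: field_simps)
qed

text \<open>Here |e| may exceed T^(1/3), which forces mu down to T^(-4 eps) and leaves practically
  no gain in the survival exponent. The phase is therefore kept to tau-time 6 eps ln T, so that even
  the crude rate lam = 2 costs only T^(-17 eps). It ends with |e| below T^(1/3), where mu can be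
  fixed.\<close>

lemma phase_a:
 fixes m :: nat
 assumes fd: "fdr \<kappa>f \<mu>0" "0 < \<kappa>f" "0 < \<mu>0" "\<mu>0 \<le> 1" and eps: "0 < \<epsilon>" "\<epsilon> \<le> 1/100" and m: "20 \<le> m"
 shows "\<forall>\<^sub>F T in sequentially. \<forall>t t'. win T t \<and> t \<le> t' \<and> t' \<le> T \<and> 6 * \<epsilon> * ln (real T) + 1 \<le> tau t' - tau t \<longrightarrow>
  (\<exists>k. t + k \<le> t' \<and> tau (t + k) - tau t \<le> 6 * \<epsilon> * ln (real T) + 1 \<and>
   (\<forall>sg\<in>S. -1/8 \<le> es sg \<and> W sg \<le> real T powr (2/3 + 2 * \<epsilon>) \<longrightarrow>
     real T powr (- 17 * \<epsilon>) \<le> pr t k (\<lambda>sg. of_bool (alive (1/4) sg \<and> W sg \<le> real T powr (2/3 - 3 * \<epsilon>))) sg))"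
proof -
 have m0: "0 < m" using m by simp
 obtain \<kappa> C e0 where kap: "0 < \<kappa>" and C: "0 \<le> C" and e0: "0 < e0" and ujr: "ujr m (1/2) \<kappa> C e0"
  using ex_ujr[OF m0, of "1/2"] by auto
 have uj: "\<kappa> * g0 * DJ \<le> 1/16 \<and>
   A t (\<lambda>sg. uJ (\<kappa> * g0) sg ^ m) sg \<le> (1 - 2 * real m * (1 - 1/2) * \<beta> t) * uJ (\<kappa> * g0) sg ^ m + C * \<beta> t"
  if "0 < g0" "g0 \<le> \<eta> t" "\<eta> t \<le> 2 * g0" "\<eta> t \<le> e0" "sg \<in> S" "alive (1/2) sg" for t g0 sg
  using ujr[unfolded ujr_def] that by blast
 obtain a1 a2 where sc: "scl a1 a2" using ex_scl by auto
 note a = scl_pos[OF sc] and hi = scl_hi[OF sc]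
 define M where "M = real m"
 have M: "20 \<le> M" unfolding M_def using m by simp
 define nd where "nd = norm dir"
 have ev: "\<forall>\<^sub>F T in sequentially. (1::nat) \<le> T"
  "\<forall>\<^sub>F T in sequentially. (a2 / e0) * real T powr (-1/3) \<le> real T powr 0"
  "\<forall>\<^sub>F T in sequentially. (1 / \<mu>0) * real T powr (- 4 * \<epsilon>) \<le> real T powr 0"
  "\<forall>\<^sub>F T in sequentially. (100 * c * a2\<^sup>2) * real T powr (- 2/3) \<le> real T powr 0"
  "\<forall>\<^sub>F T in sequentially. (M * c * a2\<^sup>2) * real T powr (- 2/3) \<le> real T powr 0"
  "\<forall>\<^sub>F T in sequentially. (100 * c * a2\<^sup>2 * nd\<^sup>2) * real T powr (- 4 * \<epsilon>) \<le> real T powr 0"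
  "\<forall>\<^sub>F T in sequentially. B2 * real T powr 0 \<le> real T powr (1/3 + 2 * \<epsilon>)"
  "\<forall>\<^sub>F T in sequentially. 1 * real T powr 0 \<le> real T powr (1/3 + 2 * \<epsilon>)"
  "\<forall>\<^sub>F T in sequentially. (64 * \<kappa>f * a2 * DJ) * real T powr (- 2 * \<epsilon>) \<le> real T powr 0"
  "\<forall>\<^sub>F T in sequentially. (16 * c * a2\<^sup>2) * real T powr (- 2/3) \<le> real T powr (- 2 * \<epsilon>)"
  "\<forall>\<^sub>F T in sequentially. (exp 2 * 64 * (8 ^ m * exp M)) * real T powr (12 * \<epsilon>) \<le> real T powr (2 * \<epsilon> * M - 4 * \<epsilon>)"
  "\<forall>\<^sub>F T in sequentially. (2 * C / M / 4 ^ m) * real T powr (- 4 * \<epsilon> + 4 * \<epsilon> * M - 2/3 * M) \<le> real T powr (- 4 * \<epsilon>)"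
  "\<forall>\<^sub>F T in sequentially. (32 * exp 2) * real T powr (- 17 * \<epsilon>) \<le> real T powr (- 16 * \<epsilon>)"
  "\<forall>\<^sub>F T in sequentially. (exp 2 * 64 * 8 ^ m) * real T powr (16 * \<epsilon> - 4 * \<epsilon> * M + 2/3 * M) \<le> real T powr ((2/3 - 3 * \<epsilon>) * M)"
  "\<forall>\<^sub>F T in sequentially. 1 * real T powr 0 \<le> real T powr (2/3 + 2 * \<epsilon>)"
 proof -
  show "\<forall>\<^sub>F T in sequentially. (1::nat) \<le> T" by (rule eventually_ge_at_top)
  \<comment> \<open>The condition that reads off the final level of W needs M > 16, whence m at
    least 20.\<close>
  have "16 * \<epsilon> < \<epsilon> * M" using eps M by simp
  moreover have "\<epsilon> * M \<le> 1/100 * M" using eps M by (intro mult_right_mono) auto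
  ultimately have eM: "16 * \<epsilon> < \<epsilon> * M" "\<epsilon> * M \<le> 1/100 * M" by auto
  show "\<forall>\<^sub>F T in sequentially. (exp 2 * 64 * (8 ^ m * exp M)) * real T powr (12 * \<epsilon>) \<le> real T powr (2 * \<epsilon> * M - 4 * \<epsilon>)"
   "\<forall>\<^sub>F T in sequentially. (2 * C / M / 4 ^ m) * real T powr (- 4 * \<epsilon> + 4 * \<epsilon> * M - 2/3 * M) \<le> real T powr (- 4 * \<epsilon>)"
   "\<forall>\<^sub>F T in sequentially. (exp 2 * 64 * 8 ^ m) * real T powr (16 * \<epsilon> - 4 * \<epsilon> * M + 2/3 * M) \<le> real T powr ((2/3 - 3 * \<epsilon>) * M)"
   by (rule ev_powr, use eps M eM in \<open>simp add: algebra_simps\<close>)+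
 qed (rule ev_powr, use eps in simp)+
 show ?thesis using ev
 proof eventually_elim
  case (elim T)
  define P where "P x = real T powr x" for x
  have T: "1 \<le> real T" "0 < real T" using elim(1) by auto
  have P0: "0 < P x" for x unfolding P_def using T by simp
  have Pz: "P 0 = 1" unfolding P_def using T by simp
  have PP: "P x * P y = P (x + y)" for x y unfolding P_def by (simp add: powr_add)
  have Pm: "P x ^ m = P (x * M)" for x unfolding P_def M_def using T by (simp add: powr_power mult.commute)
  have Pe: "exp (x * ln (real T)) = P x" for x unfolding P_def by (rule exp_mult_ln[OF T(2)])
  note E = elim(2-)[folded P_def, unfolded Pz]
  show ?case
  proof (intro allI impI)
   fix t t' assume as: "win T t \<and> t \<le> t' \<and> t' \<le> T \<and> 6 * \<epsilon> * ln (real T) + 1 \<le> tau t' - tau t"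
   define L where "L = 6 * \<epsilon> * ln (real T)"
   have L: "0 \<le> L" unfolding L_def using eps T by simp
   obtain k where k: "t + k \<le> t'" "L \<le> tau (t + k) - tau t" "tau (t + k) - tau t \<le> L + 1"
    using window_exists[of L t t'] as L unfolding L_def by auto
   define \<Delta> where "\<Delta> = tau (t + k) - tau t"
   have D: "L \<le> \<Delta>" "\<Delta> \<le> L + 1" unfolding \<Delta>_def using k by auto
   have wt: "win T t" and tk: "t + k \<le> T" using as k by auto
   \<comment> \<open>Makes \<open>beta * mu^2 * Am^2\<close> of order T^(-4 eps): the exponents are
     -2/3, -8 eps and 2/3 + 4 eps.\<close>
   define \<mu> where "\<mu> = P (- 4 * \<epsilon>)"
   have mu: "0 < \<mu>" "\<mu> \<le> \<mu>0" unfolding \<mu>_def using P0 E(2) fd(3) by (auto simp: field_simps)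
   \<comment> \<open>Am^2 lies a factor T^(2 eps) above the initial bound for W, so that the m-th
     moment makes an excursion to Am expensive.\<close>
   define Am where "Am = P (1/3 + 2 * \<epsilon>)"
   have et: "\<eta> t \<le> a2 * P (-1/3)" unfolding P_def using hi[OF elim(1) wt] .
   have ete0: "\<eta> t \<le> e0" using et E(1) e0 by (simp add: field_simps)
   have bt: "\<beta> t \<le> c * a2\<^sup>2 * P (-2/3)"
   proof -
    have "(\<eta> t)\<^sup>2 \<le> (a2 * P (-1/3))\<^sup>2" using et eta_pos[of t] by (intro power_mono) auto
    also have "\<dots> = a2\<^sup>2 * P (-2/3)" by (simp add: power_mult_distrib power2_eq_square PP)
    finally show ?thesis unfolding beta_def using c_pos by (simp add: mult.assoc)
   qed
   have bt100: "\<beta> t \<le> 1/100" using bt E(3) by simp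
   have sq: "sqrt \<mu> = P (- 2 * \<epsilon>)"
   proof -
    have "\<mu> = P (- 2 * \<epsilon>) * P (- 2 * \<epsilon>)" unfolding \<mu>_def PP by simp
    thus ?thesis using P0[of "- 2 * \<epsilon>"] by (simp add: real_sqrt_mult)
   qed
   have gT: "0 < \<eta> T" "\<eta> T \<le> \<eta> t" "\<eta> t \<le> 2 * \<eta> T" using eta_pos win_eta[OF wt] by auto
   \<comment> \<open>Solves \<open>bE * exp (- M * Delta) * uJ ^ m = mu / 64\<close> for the largest
     initial value of uJ and Delta = L.\<close>
   define bE where "bE = P (- 4 * \<epsilon> + 4 * \<epsilon> * M - 2/3 * M) / (64 * 4 ^ m)"
   have bE: "0 < bE" unfolding bE_def using P0 by simp
   have kD: "\<kappa> * \<eta> T * DJ \<le> 1/16" if "sg \<in> S" "alive (1/2) sg" for sg using uj[OF gT ete0 that] by simp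
   have exL: "exp (2 * \<Delta>) \<le> exp 2 * P (12 * \<epsilon>)"
   proof -
    have "exp (2 * \<Delta>) \<le> exp (2 + (12 * \<epsilon>) * ln (real T))" using D unfolding L_def by simp
    thus ?thesis unfolding exp_add Pe .
   qed
   have exM: "exp (- M) * P (- 6 * \<epsilon> * M) \<le> exp (- M * \<Delta>)" "exp (- M * \<Delta>) \<le> P (- 6 * \<epsilon> * M)"
   proof -
    have "M * L \<le> M * \<Delta>" "M * \<Delta> \<le> M * (L + 1)" using D M by (auto intro: mult_left_mono)
    hence "exp (- M + (- 6 * \<epsilon> * M) * ln (real T)) \<le> exp (- M * \<Delta>)" "exp (- M * \<Delta>) \<le> exp ((- 6 * \<epsilon> * M) * ln (real T))"
     unfolding L_def by (auto simp: algebra_simps)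
    thus "exp (- M) * P (- 6 * \<epsilon> * M) \<le> exp (- M * \<Delta>)" "exp (- M * \<Delta>) \<le> P (- 6 * \<epsilon> * M)" unfolding exp_add Pe by auto
   qed
   show "\<exists>k. t + k \<le> t' \<and> tau (t + k) - tau t \<le> 6 * \<epsilon> * ln (real T) + 1 \<and>
    (\<forall>sg\<in>S. -1/8 \<le> es sg \<and> W sg \<le> real T powr (2/3 + 2 * \<epsilon>) \<longrightarrow>
     real T powr (- 17 * \<epsilon>) \<le> pr t k (\<lambda>sg. of_bool (alive (1/4) sg \<and> W sg \<le> real T powr (2/3 - 3 * \<epsilon>))) sg)"
   proof (intro exI[of _ k] conjI ballI impI)
    show "t + k \<le> t'" "tau (t + k) - tau t \<le> 6 * \<epsilon> * ln (real T) + 1" using k unfolding L_def by auto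
    fix sg assume sg: "sg \<in> S" and st: "-1/8 \<le> es sg \<and> W sg \<le> real T powr (2/3 + 2 * \<epsilon>)"
    have alsg: "alive (1/2) sg" using st unfolding alive_def by simp
    have kD': "\<kappa> * \<eta> T * DJ \<le> 1/16" by (rule kD[OF sg alsg])
    have kg: "0 \<le> \<kappa> * \<eta> T" using kap gT by simp
    note uW = uJ_W[OF _ kg kD']
    have WA: "sqrt (W sg) \<le> Am"
    proof -
     have "P (2/3 + 2 * \<epsilon>) \<le> P (2/3 + 4 * \<epsilon>)" unfolding P_def using T eps by (intro powr_mono) auto
     also have "\<dots> = Am\<^sup>2" unfolding Am_def power2_eq_square PP by (simp add: algebra_simps)
     finally have "W sg \<le> Am\<^sup>2" using st unfolding P_def by linarith
     thus ?thesis using P0[of "1/3 + 2 * \<epsilon>"] unfolding Am_def by (intro real_le_lsqrt) auto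
    qed
    have "\<mu> / 32 \<le> exp (2 * (tau (t + k) - tau t)) *
     pr t k (\<lambda>sg. of_bool (alive (1/4) sg \<and> bE * (\<lambda>_. \<lambda>sg. uJ (\<kappa> * \<eta> T) sg ^ m) (t + k) sg < exp (2 * (tau (t + k) - tau t)))) sg"
    proof (rule survive_ff[OF fd(1,2) mu fd(4) _ _ wt tk bt100, where Am = Am and \<rho> = M and K = C])
     have "\<beta> t * \<mu>\<^sup>2 * (norm dir)\<^sup>2 * Am\<^sup>2 = \<beta> t * (nd\<^sup>2 * P (2/3 - 4 * \<epsilon>))"
      unfolding \<mu>_def Am_def nd_def power2_eq_square by (simp add: PP mult_ac)
     also have "\<dots> \<le> (c * a2\<^sup>2 * P (-2/3)) * (nd\<^sup>2 * P (2/3 - 4 * \<epsilon>))" using bt P0[of "2/3 - 4 * \<epsilon>"] by (intro mult_right_mono) auto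
     also have "\<dots> = (c * a2\<^sup>2 * nd\<^sup>2) * P (- 4 * \<epsilon>)" using PP[of "-2/3" "2/3 - 4 * \<epsilon>"] by (simp add: mult_ac)
     finally show "\<beta> t * \<mu>\<^sup>2 * (norm dir)\<^sup>2 * Am\<^sup>2 \<le> 1/100" using E(5) by simp
     show "B2 \<le> Am" "1 \<le> Am" using E(6,7) unfolding Am_def by auto
     have "\<kappa>f * \<mu> * \<eta> T * DJ * Am = (\<kappa>f * DJ * P (1/3 - 2 * \<epsilon>)) * \<eta> T"
      unfolding \<mu>_def Am_def using PP[of "- 4 * \<epsilon>" "1/3 + 2 * \<epsilon>"] by (simp add: mult_ac)
     also have "\<dots> \<le> (\<kappa>f * DJ * P (1/3 - 2 * \<epsilon>)) * (a2 * P (-1/3))" using gT(2) et fd(2) DJ_nn P0[of "1/3 - 2 * \<epsilon>"] by (intro mult_left_mono) auto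
     also have "\<dots> = (\<kappa>f * a2 * DJ) * P (- 2 * \<epsilon>)" using PP[of "1/3 - 2 * \<epsilon>" "-1/3"] by (simp add: mult_ac)
     finally show "\<kappa>f * \<mu> * \<eta> T * DJ * Am \<le> 1/64" using E(8) by simp
     have "0 \<le> sqrt \<mu>" using mu by simp
     thus "1 - sqrt \<mu> / 16 \<le> 2" by linarith
     show "16 * \<beta> t \<le> sqrt \<mu>" unfolding sq using bt E(9) by simp
     show "0 < M" using M by simp
     have "M * \<beta> t \<le> M * (c * a2\<^sup>2 * P (-2/3))" using bt M by (intro mult_left_mono) auto
     thus "M * \<beta> t \<le> 1" using E(4) by (simp add: mult.assoc)
     show "A (t + j) (\<lambda>sg. uJ (\<kappa> * \<eta> T) sg ^ m) sg' \<le> (1 - M * \<beta> (t + j)) * uJ (\<kappa> * \<eta> T) sg' ^ m + C * \<beta> (t + j)"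
      if "j < k" "sg' \<in> S" "alive (1/4) sg'" for j sg'
     proof -
      have wj: "win T (t + j)" using win_add[OF wt] tk that by simp
      have "\<eta> (t + j) \<le> e0" using eta_antimono[of t "t + j"] ete0 by simp
      moreover have "alive (1/2) sg'" using that unfolding alive_def by simp
      ultimately show ?thesis using uj[OF gT(1) _ _ _ that(2)] win_eta[OF wj] unfolding M_def by fastforce
     qed
     show "exp (2 * (tau (t + k) - tau t)) \<le> bE * exp (- M * (tau (t + k) - tau t)) * uJ (\<kappa> * \<eta> T) sg' ^ m"
      if "j \<le> k" "sg' \<in> S" "Am < sqrt (W sg')" for j sg'
     proof -
      have Am0: "0 < Am" unfolding Am_def by (rule P0)
      have "Am\<^sup>2 \<le> (sqrt (W sg'))\<^sup>2" using that Am0 by (intro power_mono) auto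
      hence "P (2/3 + 4 * \<epsilon>) \<le> W sg'" unfolding Am_def power2_eq_square PP by (simp add: algebra_simps)
      hence "P (2/3 + 4 * \<epsilon>) / 2 \<le> uJ (\<kappa> * \<eta> T) sg'" using uW(1)[OF that(2)] by linarith
      hence "(P (2/3 + 4 * \<epsilon>) / 2) ^ m \<le> uJ (\<kappa> * \<eta> T) sg' ^ m" using P0[of "2/3 + 4 * \<epsilon>"] by (intro power_mono) auto
      hence ul: "P ((2/3 + 4 * \<epsilon>) * M) / 2 ^ m \<le> uJ (\<kappa> * \<eta> T) sg' ^ m" unfolding power_divide Pm .
      have "exp (2 * \<Delta>) \<le> exp 2 * P (12 * \<epsilon>)" by (rule exL)
      also have "\<dots> \<le> P (2 * \<epsilon> * M - 4 * \<epsilon>) / (64 * (8 ^ m * exp M))" using E(10) by (simp add: field_simps)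
      also have "\<dots> = bE * (exp (- M) * P (- 6 * \<epsilon> * M)) * (P ((2/3 + 4 * \<epsilon>) * M) / 2 ^ m)"
      proof -
       have "P (2 * \<epsilon> * M - 4 * \<epsilon>) = P (- 4 * \<epsilon> + 4 * \<epsilon> * M - 2/3 * M) * (P (- 6 * \<epsilon> * M) * P ((2/3 + 4 * \<epsilon>) * M))"
        unfolding PP by (simp add: algebra_simps)
       moreover have "(8::real) ^ m = 4 ^ m * 2 ^ m" by (simp flip: power_mult_distrib)
       ultimately show ?thesis unfolding bE_def by (simp add: exp_minus field_simps)
      qed
      also have "\<dots> \<le> bE * exp (- M * \<Delta>) * uJ (\<kappa> * \<eta> T) sg' ^ m"
       using exM(1) ul bE by (intro mult_mono mult_left_mono) (auto intro!: mult_nonneg_nonneg divide_nonneg_nonneg less_imp_le[OF P0])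
      finally show ?thesis unfolding \<Delta>_def .
     qed
     show "bE * exp (- M * (tau (t + k) - tau t)) * uJ (\<kappa> * \<eta> T) sg ^ m \<le> \<mu> / 64"
     proof -
      have "W sg \<le> P (2/3 + 2 * \<epsilon>)" "1 \<le> P (2/3 + 2 * \<epsilon>)" using conjunct2[OF st] E(14) unfolding P_def by auto
      hence "2 * (W sg + 1) \<le> 2 * (P (2/3 + 2 * \<epsilon>) + P (2/3 + 2 * \<epsilon>))" by (intro mult_left_mono add_mono) auto
      hence "uJ (\<kappa> * \<eta> T) sg \<le> 4 * P (2/3 + 2 * \<epsilon>)" using uW(2)[OF sg] by simp
      hence "uJ (\<kappa> * \<eta> T) sg ^ m \<le> (4 * P (2/3 + 2 * \<epsilon>)) ^ m" using uW(3)[OF sg] by (intro power_mono) auto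
      hence "bE * exp (- M * \<Delta>) * uJ (\<kappa> * \<eta> T) sg ^ m \<le> bE * P (- 6 * \<epsilon> * M) * (4 * P (2/3 + 2 * \<epsilon>)) ^ m"
       using exM(2) bE uW(3)[OF sg] P0[of "- 6 * \<epsilon> * M"] by (intro mult_mono) auto
      also have "\<dots> = (P (- 4 * \<epsilon> + 4 * \<epsilon> * M - 2/3 * M) * P (- 6 * \<epsilon> * M) * P ((2/3 + 2 * \<epsilon>) * M)) / 64"
       unfolding bE_def power_mult_distrib Pm by simp
      also have "\<dots> = \<mu> / 64" unfolding PP \<mu>_def by (simp add: algebra_simps)
      finally show ?thesis unfolding \<Delta>_def .
     qed
     show "bE * (2 * C / M) \<le> \<mu> / 64" using E(11) unfolding bE_def \<mu>_def by (simp add: field_simps)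
    qed (use bE C sg st WA uW in auto)
    also have "\<dots> \<le> exp (2 * \<Delta>) * pr t k (\<lambda>sg. of_bool (alive (1/4) sg \<and> W sg \<le> P (2/3 - 3 * \<epsilon>))) sg"
     unfolding \<Delta>_def
    proof (intro mult_left_mono pr_mono sg)
     fix sg' assume sg': "sg' \<in> S"
     have "W sg' \<le> P (2/3 - 3 * \<epsilon>)" if lt: "bE * uJ (\<kappa> * \<eta> T) sg' ^ m < exp (2 * (tau (t + k) - tau t))"
     proof (rule ccontr)
      assume "\<not> ?thesis"
      hence "P (2/3 - 3 * \<epsilon>) / 2 \<le> uJ (\<kappa> * \<eta> T) sg'" using uW(1)[OF sg'] by linarith
      hence "(P (2/3 - 3 * \<epsilon>) / 2) ^ m \<le> uJ (\<kappa> * \<eta> T) sg' ^ m" using P0[of "2/3 - 3 * \<epsilon>"] by (intro power_mono) auto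
      hence "bE * (P ((2/3 - 3 * \<epsilon>) * M) / 2 ^ m) \<le> bE * uJ (\<kappa> * \<eta> T) sg' ^ m" unfolding power_divide Pm using bE by (intro mult_left_mono) auto
      also have "\<dots> < exp 2 * P (12 * \<epsilon>)" using lt exL unfolding \<Delta>_def by linarith
      finally have "P (- 4 * \<epsilon> + 4 * \<epsilon> * M - 2/3 * M) * P ((2/3 - 3 * \<epsilon>) * M) < exp 2 * P (12 * \<epsilon>) * (64 * 4 ^ m * 2 ^ m)"
       unfolding bE_def by (simp add: field_simps)
      also have "\<dots> = (exp 2 * 64 * 8 ^ m) * P (12 * \<epsilon>)" by (simp add: power_mult_distrib[symmetric])
      finally have "P (16 * \<epsilon> - 4 * \<epsilon> * M + 2/3 * M - 12 * \<epsilon>) * (P (- 4 * \<epsilon> + 4 * \<epsilon> * M - 2/3 * M) * P ((2/3 - 3 * \<epsilon>) * M)) < P (16 * \<epsilon> - 4 * \<epsilon> * M + 2/3 * M - 12 * \<epsilon>) * ((exp 2 * 64 * 8 ^ m) * P (12 * \<epsilon>))"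
       using P0 by (intro mult_strict_left_mono) auto
      also have "\<dots> = (exp 2 * 64 * 8 ^ m) * (P (16 * \<epsilon> - 4 * \<epsilon> * M + 2/3 * M - 12 * \<epsilon>) * P (12 * \<epsilon>))" by simp
      finally have "P ((2/3 - 3 * \<epsilon>) * M) < (exp 2 * 64 * 8 ^ m) * P (16 * \<epsilon> - 4 * \<epsilon> * M + 2/3 * M)"
       unfolding PP by (simp add: algebra_simps)
      thus False using E(13) by linarith
     qed
     thus "of_bool (alive (1/4) sg' \<and> bE * uJ (\<kappa> * \<eta> T) sg' ^ m < exp (2 * (tau (t + k) - tau t))) \<le> (of_bool (alive (1/4) sg' \<and> W sg' \<le> P (2/3 - 3 * \<epsilon>)) :: real)"
      by auto
    qed auto
    also have "\<dots> \<le> (exp 2 * P (12 * \<epsilon>)) * pr t k (\<lambda>sg. of_bool (alive (1/4) sg \<and> W sg \<le> P (2/3 - 3 * \<epsilon>))) sg"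
    proof (rule mult_right_mono[OF exL])
     show "0 \<le> pr t k (\<lambda>sg. of_bool (alive (1/4) sg \<and> W sg \<le> P (2/3 - 3 * \<epsilon>))) sg"
      using pr_mono[OF sg, of "\<lambda>_. 0" "\<lambda>sg. of_bool (alive (1/4) sg \<and> W sg \<le> P (2/3 - 3 * \<epsilon>))" t k] by simp
    qed
    finally have fin: "\<mu> / 32 \<le> (exp 2 * P (12 * \<epsilon>)) * pr t k (\<lambda>sg. of_bool (alive (1/4) sg \<and> W sg \<le> P (2/3 - 3 * \<epsilon>))) sg" .
    \<comment> \<open>The gain mu/32 against exp (2 * Delta) is of order T^(-16 eps); one more eps
      swallows the constants.\<close>
    have "(exp 2 * P (12 * \<epsilon>)) * P (- 17 * \<epsilon>) \<le> \<mu> / 32"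
    proof -
     have "P (12 * \<epsilon>) * ((32 * exp 2) * P (- 17 * \<epsilon>)) \<le> P (12 * \<epsilon>) * P (- 16 * \<epsilon>)" using E(12) P0[of "12 * \<epsilon>"] by (intro mult_left_mono) auto
     also have "\<dots> = \<mu>" unfolding PP \<mu>_def by simp
     finally show ?thesis by (simp add: mult_ac)
    qed
    hence "(exp 2 * P (12 * \<epsilon>)) * P (- 17 * \<epsilon>) \<le> (exp 2 * P (12 * \<epsilon>)) * pr t k (\<lambda>sg. of_bool (alive (1/4) sg \<and> W sg \<le> P (2/3 - 3 * \<epsilon>))) sg"
     using fin by linarith
    hence "P (- 17 * \<epsilon>) \<le> pr t k (\<lambda>sg. of_bool (alive (1/4) sg \<and> W sg \<le> P (2/3 - 3 * \<epsilon>))) sg"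
     using mult_le_cancel_left_pos[of "exp 2 * P (12 * \<epsilon>)"] P0[of "12 * \<epsilon>"] by auto
    thus "real T powr (- 17 * \<epsilon>) \<le> pr t k (\<lambda>sg. of_bool (alive (1/4) sg \<and> W sg \<le> real T powr (2/3 - 3 * \<epsilon>))) sg" unfolding P_def .
   qed
  qed
 qed
qed

lemma pr_nonneg: "sg \<in> S \<Longrightarrow> (\<And>sg. sg \<in> S \<Longrightarrow> 0 \<le> \<phi> sg) \<Longrightarrow> 0 \<le> pr t k \<phi> sg"
 using pr_mono[of sg "\<lambda>_. 0" \<phi> t k] by simp

lemma beta_le_scale:
 assumes "\<eta> t \<le> a2 * real T powr (-1/3)"
 shows "\<beta> t \<le> c * a2\<^sup>2 * real T powr (-2/3)"
proof -
 have "(\<eta> t)\<^sup>2 \<le> (a2 * real T powr (-1/3))\<^sup>2" using assms eta_pos[of t] by (intro power_mono) auto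
 also have "\<dots> = a2\<^sup>2 * real T powr (-2/3)" by (simp add: power_mult_distrib power2_eq_square powr_add[symmetric])
 finally show ?thesis unfolding beta_def using c_pos by (simp add: mult.assoc)
qed

text \<open>The decisive phase. With mu0 fixed, W falls at nearly rate 2 over tau-time (ln T)/3,
  which matches the starting power 2/3. Survival costs exp (lam * tau) with lam = 1 - sqrt mu0 / 16,
  hence an exponent strictly below 1/3 up to eps.\<close>

lemma phase_b:
 fixes m :: nat
 assumes fd: "fdr \<kappa>f \<mu>0" "0 < \<kappa>f" "0 < \<mu>0" "\<mu>0 \<le> 1" and eps: "0 < \<epsilon>" "\<epsilon> \<le> 1/100" and m: "1 \<le> \<epsilon> * real m"
 shows "\<forall>\<^sub>F T in sequentially. \<forall>t t'. win T t \<and> t \<le> t' \<and> t' \<le> T \<and> 1/3 * ln (real T) + 1 \<le> tau t' - tau t \<longrightarrow>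
  (\<exists>k. t + k \<le> t' \<and> tau (t + k) - tau t \<le> 1/3 * ln (real T) + 1 \<and>
   (\<forall>sg\<in>S. alive (1/4) sg \<and> W sg \<le> real T powr (2/3 - 3 * \<epsilon>) \<longrightarrow>
     real T powr (- (1 - sqrt \<mu>0 / 16) / 3 - \<epsilon>) \<le> pr t k (\<lambda>sg. of_bool (alive (3/8) sg \<and> W sg \<le> real T powr (1 / real m))) sg))"
proof -
 define M where "M = real m"
 have M0: "0 < M" unfolding M_def using m eps by (cases m) auto
 have eM: "1 \<le> \<epsilon> * M" unfolding M_def using m .
 have m0: "0 < m" using M0 unfolding M_def by simp
 obtain \<kappa> C e0 where kap: "0 < \<kappa>" and C: "0 \<le> C" and e0: "0 < e0" and ujr: "ujr m (4 * \<epsilon>) \<kappa> C e0"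
  using ex_ujr[OF m0, of "4 * \<epsilon>"] eps by auto
 \<comment> \<open>Decay rate of the m-th moment. R/3 falls short of 2/3 * M by 8/3 * eps * M; as
   8/3 lies between the 2 in Am^2 and the 3 in the starting bound, both exponents below get the
   right sign.\<close>
 define R where "R = 2 * M * (1 - 4 * \<epsilon>)"
 have R: "0 < R" unfolding R_def using M0 eps by simp
 have uj: "\<kappa> * g0 * DJ \<le> 1/16 \<and>
   A t (\<lambda>sg. uJ (\<kappa> * g0) sg ^ m) sg \<le> (1 - R * \<beta> t) * uJ (\<kappa> * g0) sg ^ m + C * \<beta> t"
  if "0 < g0" "g0 \<le> \<eta> t" "\<eta> t \<le> 2 * g0" "\<eta> t \<le> e0" "sg \<in> S" "alive (1/2) sg" for t g0 sg
  using ujr[unfolded ujr_def] that unfolding R_def M_def by blast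
 obtain a1 a2 where sc: "scl a1 a2" using ex_scl by auto
 note a = scl_pos[OF sc] and hi = scl_hi[OF sc]
 define nd where "nd = norm dir"
 define sm where "sm = sqrt \<mu>0"
 have sm: "0 < sm" "sm \<le> 1" unfolding sm_def using fd by auto
 define lam where "lam = 1 - sm / 16"
 have lam: "0 < lam" "lam \<le> 1" unfolding lam_def using sm by auto
 \<comment> \<open>Independent of T, because the residual of the moment is of constant
   order.\<close>
 define bE where "bE = \<mu>0 / (64 * (2 * C / R + 1))"
 have CR: "0 \<le> 2 * C / R" using C R by simp
 have bE: "0 < bE" unfolding bE_def using fd CR by (intro divide_pos_pos mult_pos_pos) auto
 have ev: "\<forall>\<^sub>F T in sequentially. (1::nat) \<le> T"
  "\<forall>\<^sub>F T in sequentially. (a2 / e0) * real T powr (-1/3) \<le> real T powr 0"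
  "\<forall>\<^sub>F T in sequentially. (100 * c * a2\<^sup>2) * real T powr (- 2/3) \<le> real T powr 0"
  "\<forall>\<^sub>F T in sequentially. (R * (c * a2\<^sup>2)) * real T powr (- 2/3) \<le> real T powr 0"
  "\<forall>\<^sub>F T in sequentially. (100 * c * a2\<^sup>2 * nd\<^sup>2) * real T powr (- 2 * \<epsilon>) \<le> real T powr 0"
  "\<forall>\<^sub>F T in sequentially. B2 * real T powr 0 \<le> real T powr (1/3 - \<epsilon>)"
  "\<forall>\<^sub>F T in sequentially. 1 * real T powr 0 \<le> real T powr (1/3 - \<epsilon>)"
  "\<forall>\<^sub>F T in sequentially. (64 * \<kappa>f * a2 * DJ) * real T powr (- \<epsilon>) \<le> real T powr 0"
  "\<forall>\<^sub>F T in sequentially. (16 * c * a2\<^sup>2 / sm) * real T powr (- 2/3) \<le> real T powr 0"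
  "\<forall>\<^sub>F T in sequentially. (exp lam * 2 ^ m * exp R / bE) * real T powr (1/3) \<le> real T powr ((2/3 - 2 * \<epsilon>) * M - R / 3)"
  "\<forall>\<^sub>F T in sequentially. (64 * bE * 4 ^ m / \<mu>0) * real T powr (- R / 3 + (2/3 - 3 * \<epsilon>) * M) \<le> real T powr 0"
  "\<forall>\<^sub>F T in sequentially. (32 * exp lam / \<mu>0) * real T powr (- lam / 3 - \<epsilon>) \<le> real T powr (- lam / 3)"
  "\<forall>\<^sub>F T in sequentially. (exp lam * 2 ^ m / bE) * real T powr (1/3) \<le> real T powr 1"
  "\<forall>\<^sub>F T in sequentially. 1 * real T powr 0 \<le> real T powr (2/3 - 3 * \<epsilon>)"
 proof -
  show "\<forall>\<^sub>F T in sequentially. (1::nat) \<le> T" by (rule eventually_ge_at_top)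
  have R1: "(2/3 - 2 * \<epsilon>) * M - R / 3 = 2/3 * (\<epsilon> * M)" "- R / 3 + (2/3 - 3 * \<epsilon>) * M = - (\<epsilon> * M) / 3"
   unfolding R_def by (simp_all add: field_simps)
  show "\<forall>\<^sub>F T in sequentially. (exp lam * 2 ^ m * exp R / bE) * real T powr (1/3) \<le> real T powr ((2/3 - 2 * \<epsilon>) * M - R / 3)"
   unfolding R1 by (rule ev_powr) (use eM in linarith)
  show "\<forall>\<^sub>F T in sequentially. (64 * bE * 4 ^ m / \<mu>0) * real T powr (- R / 3 + (2/3 - 3 * \<epsilon>) * M) \<le> real T powr 0"
   unfolding R1 by (rule ev_powr) (use eM in linarith)
 qed (rule ev_powr, use eps in simp)+
 show ?thesis using ev
 proof eventually_elim
  case (elim T)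
  define P where "P x = real T powr x" for x
  have T: "1 \<le> real T" "0 < real T" using elim(1) by auto
  have P0: "0 < P x" for x unfolding P_def using T by simp
  have Pz: "P 0 = 1" unfolding P_def using T by simp
  have PP: "P x * P y = P (x + y)" for x y unfolding P_def by (simp add: powr_add)
  have Pm: "P x ^ m = P (x * M)" for x unfolding P_def M_def using T by (simp add: powr_power mult.commute)
  have Pe: "exp (x * ln (real T)) = P x" for x unfolding P_def by (rule exp_mult_ln[OF T(2)])
  note E = elim(2-)[folded P_def, unfolded Pz]
  show ?case
  proof (intro allI impI)
   fix t t' assume as: "win T t \<and> t \<le> t' \<and> t' \<le> T \<and> 1/3 * ln (real T) + 1 \<le> tau t' - tau t"
   define L where "L = 1/3 * ln (real T)"
   have L: "0 \<le> L" unfolding L_def using T by simp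
   obtain k where k: "t + k \<le> t'" "L \<le> tau (t + k) - tau t" "tau (t + k) - tau t \<le> L + 1"
    using window_exists[of L t t'] as L unfolding L_def by auto
   define \<Delta> where "\<Delta> = tau (t + k) - tau t"
   have D: "L \<le> \<Delta>" "\<Delta> \<le> L + 1" unfolding \<Delta>_def using k by auto
   have wt: "win T t" and tk: "t + k \<le> T" using as k by auto
   \<comment> \<open>A power below T^(1/3), so that for large T the conditions of
     \<open>f_drift\<close> hold with mu0 independent of T.\<close>
   define Am where "Am = P (1/3 - \<epsilon>)"
   have et: "\<eta> t \<le> a2 * P (-1/3)" unfolding P_def using hi[OF elim(1) wt] .
   have ete0: "\<eta> t \<le> e0" using et E(1) e0 by (simp add: field_simps)
   have bt: "\<beta> t \<le> c * a2\<^sup>2 * P (-2/3)" unfolding P_def by (rule beta_le_scale[OF et[unfolded P_def]])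
   have bt100: "\<beta> t \<le> 1/100" using bt E(2) by simp
   have gT: "0 < \<eta> T" "\<eta> T \<le> \<eta> t" "\<eta> t \<le> 2 * \<eta> T" using eta_pos win_eta[OF wt] by auto
   have kD: "\<kappa> * \<eta> T * DJ \<le> 1/16" if "sg \<in> S" "alive (1/2) sg" for sg using uj[OF gT ete0 that] by simp
   have exL: "exp (lam * \<Delta>) \<le> exp lam * P (lam / 3)"
   proof -
    have "lam * \<Delta> \<le> lam * (L + 1)" using D lam by (intro mult_left_mono) auto
    hence "exp (lam * \<Delta>) \<le> exp (lam + (lam / 3) * ln (real T))" unfolding L_def by (simp add: algebra_simps)
    thus ?thesis unfolding exp_add Pe .
   qed
   have exL': "exp (lam * \<Delta>) \<le> exp lam * P (1/3)"
   proof -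
    have "P (lam / 3) \<le> P (1/3)" unfolding P_def using T lam by (intro powr_mono) auto
    hence "exp lam * P (lam / 3) \<le> exp lam * P (1/3)" by (intro mult_left_mono) auto
    thus ?thesis using exL by linarith
   qed
   have exM: "exp (- R) * P (- R / 3) \<le> exp (- R * \<Delta>)" "exp (- R * \<Delta>) \<le> P (- R / 3)"
   proof -
    have "R * L \<le> R * \<Delta>" "R * \<Delta> \<le> R * (L + 1)" using D R by (auto intro: mult_left_mono)
    hence "exp (- R + (- R / 3) * ln (real T)) \<le> exp (- R * \<Delta>)" "exp (- R * \<Delta>) \<le> exp ((- R / 3) * ln (real T))"
     unfolding L_def by (auto simp: algebra_simps)
    thus "exp (- R) * P (- R / 3) \<le> exp (- R * \<Delta>)" "exp (- R * \<Delta>) \<le> P (- R / 3)" unfolding exp_add Pe by auto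
   qed
   show "\<exists>k. t + k \<le> t' \<and> tau (t + k) - tau t \<le> 1/3 * ln (real T) + 1 \<and>
    (\<forall>sg\<in>S. alive (1/4) sg \<and> W sg \<le> real T powr (2/3 - 3 * \<epsilon>) \<longrightarrow>
     real T powr (- (1 - sqrt \<mu>0 / 16) / 3 - \<epsilon>) \<le> pr t k (\<lambda>sg. of_bool (alive (3/8) sg \<and> W sg \<le> real T powr (1 / real m))) sg)"
   proof (intro exI[of _ k] conjI ballI impI)
    show "t + k \<le> t'" "tau (t + k) - tau t \<le> 1/3 * ln (real T) + 1" using k unfolding L_def by auto
    fix sg assume sg: "sg \<in> S" and st: "alive (1/4) sg \<and> W sg \<le> real T powr (2/3 - 3 * \<epsilon>)"
    have Wst: "W sg \<le> P (2/3 - 3 * \<epsilon>)" using st unfolding P_def by simp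
    have alsg: "alive (1/2) sg" using st unfolding alive_def by simp
    have kD': "\<kappa> * \<eta> T * DJ \<le> 1/16" by (rule kD[OF sg alsg])
    have kg: "0 \<le> \<kappa> * \<eta> T" using kap gT by simp
    note uW = uJ_W[OF _ kg kD']
    have WA: "sqrt (W sg) \<le> Am"
    proof -
     have "P (2/3 - 3 * \<epsilon>) \<le> P (2/3 - 2 * \<epsilon>)" unfolding P_def using T eps by (intro powr_mono) auto
     also have "\<dots> = Am\<^sup>2" unfolding Am_def power2_eq_square PP by (simp add: algebra_simps)
     finally have "W sg \<le> Am\<^sup>2" using Wst by linarith
     thus ?thesis using P0[of "1/3 - \<epsilon>"] unfolding Am_def by (intro real_le_lsqrt) auto
    qed
    have "\<mu>0 / 32 \<le> exp (lam * (tau (t + k) - tau t)) *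
     pr t k (\<lambda>sg. of_bool (alive (3/8) sg \<and> bE * (\<lambda>_. \<lambda>sg. uJ (\<kappa> * \<eta> T) sg ^ m) (t + k) sg < exp (lam * (tau (t + k) - tau t)))) sg"
    proof (rule survive_ff[OF fd(1,2) fd(3) order_refl fd(4) _ _ wt tk bt100, where Am = Am and \<rho> = R and K = C])
     have mu2: "\<mu>0\<^sup>2 \<le> 1" using fd by (simp add: power_le_one)
     have "\<beta> t * \<mu>0\<^sup>2 * (norm dir)\<^sup>2 * Am\<^sup>2 = \<mu>0\<^sup>2 * (\<beta> t * (nd\<^sup>2 * P (2/3 - 2 * \<epsilon>)))"
      unfolding Am_def nd_def power2_eq_square by (simp add: PP mult_ac)
     also have "\<dots> \<le> 1 * ((c * a2\<^sup>2 * P (-2/3)) * (nd\<^sup>2 * P (2/3 - 2 * \<epsilon>)))"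
      using bt mu2 P0[of "2/3 - 2 * \<epsilon>"] beta_pos[of t] by (intro mult_mono mult_right_mono) auto
     also have "\<dots> = (c * a2\<^sup>2 * nd\<^sup>2) * P (- 2 * \<epsilon>)" using PP[of "-2/3" "2/3 - 2 * \<epsilon>"] by (simp add: mult_ac)
     finally show "\<beta> t * \<mu>0\<^sup>2 * (norm dir)\<^sup>2 * Am\<^sup>2 \<le> 1/100" using E(4) by simp
     show "B2 \<le> Am" "1 \<le> Am" using E(5,6) unfolding Am_def by auto
     have "\<kappa>f * \<mu>0 * \<eta> T * DJ * Am = \<mu>0 * ((\<kappa>f * DJ * P (1/3 - \<epsilon>)) * \<eta> T)"
      unfolding Am_def by (simp add: mult_ac)
     also have "\<dots> \<le> 1 * ((\<kappa>f * DJ * P (1/3 - \<epsilon>)) * (a2 * P (-1/3)))"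
      using gT et fd DJ_nn P0[of "1/3 - \<epsilon>"] by (intro mult_mono mult_left_mono) auto
     also have "\<dots> = (\<kappa>f * a2 * DJ) * P (- \<epsilon>)" using PP[of "1/3 - \<epsilon>" "-1/3"] by (simp add: mult_ac)
     finally show "\<kappa>f * \<mu>0 * \<eta> T * DJ * Am \<le> 1/64" using E(7) by simp
     show "1 - sqrt \<mu>0 / 16 \<le> lam" unfolding lam_def sm_def by simp
     show "lam \<le> 2" using lam by simp
     have "16 * \<beta> t \<le> 16 * (c * a2\<^sup>2 * P (-2/3))" using bt by simp
     also have "\<dots> \<le> sm" using E(8) sm by (simp add: field_simps)
     finally show "16 * \<beta> t \<le> sqrt \<mu>0" unfolding sm_def .
     show "0 < R" by (rule R)
     have "R * \<beta> t \<le> R * (c * a2\<^sup>2 * P (-2/3))" using bt R by (intro mult_left_mono) auto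
     thus "R * \<beta> t \<le> 1" using E(3) by (simp add: mult.assoc)
     show "A (t + j) (\<lambda>sg. uJ (\<kappa> * \<eta> T) sg ^ m) sg' \<le> (1 - R * \<beta> (t + j)) * uJ (\<kappa> * \<eta> T) sg' ^ m + C * \<beta> (t + j)"
      if "j < k" "sg' \<in> S" "alive (3/8) sg'" for j sg'
     proof -
      have wj: "win T (t + j)" using win_add[OF wt] tk that by simp
      have "\<eta> (t + j) \<le> e0" using eta_antimono[of t "t + j"] ete0 by simp
      moreover have "alive (1/2) sg'" using that unfolding alive_def by simp
      ultimately show ?thesis using uj[OF gT(1) _ _ _ that(2)] win_eta[OF wj] by fastforce
     qed
     show "exp (lam * (tau (t + k) - tau t)) \<le> bE * exp (- R * (tau (t + k) - tau t)) * uJ (\<kappa> * \<eta> T) sg' ^ m"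
      if "j \<le> k" "sg' \<in> S" "Am < sqrt (W sg')" for j sg'
     proof -
      have Am0: "0 < Am" unfolding Am_def by (rule P0)
      have "Am\<^sup>2 \<le> (sqrt (W sg'))\<^sup>2" using that Am0 by (intro power_mono) auto
      hence "P (2/3 - 2 * \<epsilon>) \<le> W sg'" unfolding Am_def power2_eq_square PP by (simp add: algebra_simps)
      hence "P (2/3 - 2 * \<epsilon>) / 2 \<le> uJ (\<kappa> * \<eta> T) sg'" using uW(1)[OF that(2)] by linarith
      hence "(P (2/3 - 2 * \<epsilon>) / 2) ^ m \<le> uJ (\<kappa> * \<eta> T) sg' ^ m" using P0[of "2/3 - 2 * \<epsilon>"] by (intro power_mono) auto
      hence ul: "P ((2/3 - 2 * \<epsilon>) * M) / 2 ^ m \<le> uJ (\<kappa> * \<eta> T) sg' ^ m" unfolding power_divide Pm .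
      have "exp (lam * \<Delta>) \<le> exp lam * P (1/3)" by (rule exL')
      also have "\<dots> \<le> bE * P ((2/3 - 2 * \<epsilon>) * M - R / 3) / (2 ^ m * exp R)" using E(9) bE by (simp add: field_simps)
      also have "\<dots> = bE * (exp (- R) * P (- R / 3)) * (P ((2/3 - 2 * \<epsilon>) * M) / 2 ^ m)"
      proof -
       have "P ((2/3 - 2 * \<epsilon>) * M - R / 3) = P (- R / 3) * P ((2/3 - 2 * \<epsilon>) * M)" unfolding PP by simp
       thus ?thesis by (simp add: exp_minus field_simps)
      qed
      also have "\<dots> \<le> bE * exp (- R * \<Delta>) * uJ (\<kappa> * \<eta> T) sg' ^ m"
       using exM(1) ul bE by (intro mult_mono mult_left_mono) (auto intro!: mult_nonneg_nonneg divide_nonneg_nonneg less_imp_le[OF P0])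
      finally show ?thesis unfolding \<Delta>_def .
     qed
     show "bE * exp (- R * (tau (t + k) - tau t)) * uJ (\<kappa> * \<eta> T) sg ^ m \<le> \<mu>0 / 64"
     proof -
      have "1 \<le> P (2/3 - 3 * \<epsilon>)" using E(13) by auto
      hence "2 * (W sg + 1) \<le> 2 * (P (2/3 - 3 * \<epsilon>) + P (2/3 - 3 * \<epsilon>))" using Wst by (intro mult_left_mono add_mono) auto
      hence "uJ (\<kappa> * \<eta> T) sg \<le> 4 * P (2/3 - 3 * \<epsilon>)" using uW(2)[OF sg] by simp
      hence "uJ (\<kappa> * \<eta> T) sg ^ m \<le> (4 * P (2/3 - 3 * \<epsilon>)) ^ m" using uW(3)[OF sg] by (intro power_mono) auto
      hence "bE * exp (- R * \<Delta>) * uJ (\<kappa> * \<eta> T) sg ^ m \<le> bE * P (- R / 3) * (4 * P (2/3 - 3 * \<epsilon>)) ^ m"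
       using exM(2) bE uW(3)[OF sg] P0[of "- R / 3"] by (intro mult_mono) auto
      also have "\<dots> = bE * 4 ^ m * (P (- R / 3) * P ((2/3 - 3 * \<epsilon>) * M))"
       unfolding power_mult_distrib Pm by simp
      also have "\<dots> \<le> \<mu>0 / 64" unfolding PP using E(10) fd(3) by (simp add: field_simps)
      finally show ?thesis unfolding \<Delta>_def .
     qed
     show "bE * (2 * C / R) \<le> \<mu>0 / 64"
     proof -
      have "bE * (2 * C / R) \<le> bE * (2 * C / R + 1)" using bE by (intro mult_left_mono) auto
      also have "\<dots> = \<mu>0 / 64"
      proof -
       have "\<mu>0 / (64 * z) * z = \<mu>0 / 64" if "0 < z" for z :: real using that by simp
       thus ?thesis unfolding bE_def using CR by (metis add_nonneg_pos zero_less_one)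
      qed
      finally show ?thesis .
     qed
    qed (use bE C sg st WA uW in \<open>auto simp: alive_def\<close>)
    also have "\<dots> \<le> exp (lam * \<Delta>) * pr t k (\<lambda>sg. of_bool (alive (3/8) sg \<and> W sg \<le> P (1 / M))) sg"
     unfolding \<Delta>_def
    proof (intro mult_left_mono pr_mono sg)
     fix sg' assume sg': "sg' \<in> S"
     \<comment> \<open>The final bound on the m-th moment is of order T^(1/3); the larger power T is
       used, whose m-th root gives T^(1/m).\<close>
     have "W sg' \<le> P (1 / M)" if lt: "bE * uJ (\<kappa> * \<eta> T) sg' ^ m < exp (lam * (tau (t + k) - tau t))"
     proof (rule ccontr)
      assume "\<not> ?thesis"
      hence "P (1 / M) / 2 \<le> uJ (\<kappa> * \<eta> T) sg'" using uW(1)[OF sg'] by linarith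
      hence "(P (1 / M) / 2) ^ m \<le> uJ (\<kappa> * \<eta> T) sg' ^ m" using P0[of "1 / M"] by (intro power_mono) auto
      hence "bE * (P 1 / 2 ^ m) \<le> bE * uJ (\<kappa> * \<eta> T) sg' ^ m" unfolding power_divide Pm using bE M0 by (intro mult_left_mono) auto
      also have "\<dots> < exp lam * P (1/3)" using lt exL' unfolding \<Delta>_def by linarith
      finally have "P 1 < (exp lam * 2 ^ m / bE) * P (1/3)" using bE by (simp add: field_simps)
      thus False using E(12) by linarith
     qed
     thus "of_bool (alive (3/8) sg' \<and> bE * uJ (\<kappa> * \<eta> T) sg' ^ m < exp (lam * (tau (t + k) - tau t))) \<le> (of_bool (alive (3/8) sg' \<and> W sg' \<le> P (1 / M)) :: real)"
      by auto
    qed auto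
    also have "\<dots> \<le> (exp lam * P (lam / 3)) * pr t k (\<lambda>sg. of_bool (alive (3/8) sg \<and> W sg \<le> P (1 / M))) sg"
     by (rule mult_right_mono[OF exL]) (auto intro: pr_nonneg[OF sg])
    finally have fin: "\<mu>0 / 32 \<le> (exp lam * P (lam / 3)) * pr t k (\<lambda>sg. of_bool (alive (3/8) sg \<and> W sg \<le> P (1 / M))) sg" .
    have "(exp lam * P (lam / 3)) * P (- lam / 3 - \<epsilon>) \<le> \<mu>0 / 32"
    proof -
     have "P (lam / 3) * ((32 * exp lam / \<mu>0) * P (- lam / 3 - \<epsilon>)) \<le> P (lam / 3) * P (- lam / 3)" using E(11) P0[of "lam / 3"] by (intro mult_left_mono) auto
     also have "\<dots> = 1" unfolding PP using Pz by simp
     finally show ?thesis using fd(3) by (simp add: field_simps)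
    qed
    hence "(exp lam * P (lam / 3)) * P (- lam / 3 - \<epsilon>) \<le> (exp lam * P (lam / 3)) * pr t k (\<lambda>sg. of_bool (alive (3/8) sg \<and> W sg \<le> P (1 / M))) sg"
     using fin by linarith
    hence "P (- lam / 3 - \<epsilon>) \<le> pr t k (\<lambda>sg. of_bool (alive (3/8) sg \<and> W sg \<le> P (1 / M))) sg"
     using mult_le_cancel_left_pos[of "exp lam * P (lam / 3)"] P0[of "lam / 3"] by auto
    thus "real T powr (- (1 - sqrt \<mu>0 / 16) / 3 - \<epsilon>) \<le> pr t k (\<lambda>sg. of_bool (alive (3/8) sg \<and> W sg \<le> real T powr (1 / real m))) sg"
     unfolding P_def lam_def sm_def M_def .
   qed
  qed
 qed
qed

definition u5r :: "real \<Rightarrow> real \<Rightarrow> bool" where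
 "u5r K e0 \<longleftrightarrow> (\<forall>t sg. \<eta> t \<le> e0 \<and> sg \<in> S \<and> alive (1/2) sg \<longrightarrow>
   A t (\<lambda>sg. U (Suc t) sg ^ 5) sg \<le> (1 - 3 * \<beta> t) * U t sg ^ 5 + K * \<beta> t * \<eta> t ^ 5)"

lemma ex_u5r: "\<exists>K\<ge>0. \<exists>e0>0. u5r K e0"
 unfolding u5r_def by (rule U_drift5)

text \<open>uJ contains the summand 1 and its drift a constant residual, so it cannot certify
  arbitrarily small values; the remaining power T^(1/m) is removed with U^5, whose residual is of
  order eta^5. The tau-time is a small multiple of ln T, and the loss T^(-16/m) is negligible for
  large m.\<close>

lemma phase_c:
 fixes m :: nat
 assumes fd: "fdr \<kappa>f \<mu>0" "0 < \<kappa>f" "0 < \<mu>0" "\<mu>0 \<le> 1" and w1: "0 < w1" and m: "20 \<le> m"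
 shows "\<forall>\<^sub>F T in sequentially. \<forall>t t'. win T t \<and> t \<le> t' \<and> t' \<le> T \<and> 10 / real m * ln (real T) + 1 \<le> tau t' - tau t \<longrightarrow>
  (\<exists>k. t + k \<le> t' \<and> tau (t + k) - tau t \<le> 10 / real m * ln (real T) + 1 \<and>
   (\<forall>sg\<in>S. alive (3/8) sg \<and> W sg \<le> real T powr (1 / real m) \<longrightarrow>
     real T powr (- 16 / real m) \<le> pr t k (\<lambda>sg. of_bool (U (t + k) sg \<le> w1)) sg))"
proof -
 define q where "q = 1 / real m"
 have q: "0 < q" "q \<le> 1/20" unfolding q_def using m by (auto simp: field_simps)
 have q10: "10 / real m = 10 * q" "- 16 / real m = - 16 * q" unfolding q_def by auto
 obtain K e0 where K: "0 \<le> K" and e0: "0 < e0" and u5: "u5r K e0" using ex_u5r by auto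
 obtain a1 a2 where sc: "scl a1 a2" using ex_scl by auto
 note a = scl_pos[OF sc] and hi = scl_hi[OF sc]
 define nd where "nd = norm dir"
 define sm where "sm = sqrt \<mu>0"
 have sm: "0 < sm" "sm \<le> 1" unfolding sm_def using fd by auto
 have ev: "\<forall>\<^sub>F T in sequentially. (1::nat) \<le> T"
  "\<forall>\<^sub>F T in sequentially. (a2 / e0) * real T powr (-1/3) \<le> real T powr 0"
  "\<forall>\<^sub>F T in sequentially. (100 * c * a2\<^sup>2) * real T powr (- 2/3) \<le> real T powr 0"
  "\<forall>\<^sub>F T in sequentially. (100 * c * a2\<^sup>2 * nd\<^sup>2) * real T powr (8 * q - 2/3) \<le> real T powr 0"
  "\<forall>\<^sub>F T in sequentially. B2 * real T powr 0 \<le> real T powr (4 * q)"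
  "\<forall>\<^sub>F T in sequentially. 1 * real T powr 0 \<le> real T powr (4 * q)"
  "\<forall>\<^sub>F T in sequentially. (64 * \<kappa>f * a2 * DJ) * real T powr (4 * q - 1/3) \<le> real T powr 0"
  "\<forall>\<^sub>F T in sequentially. (16 * c * a2\<^sup>2 / sm) * real T powr (- 2/3) \<le> real T powr 0"
  "\<forall>\<^sub>F T in sequentially. (exp 3 * w1 ^ 5) * real T powr (15 * q) \<le> real T powr (25 * q)"
  "\<forall>\<^sub>F T in sequentially. (kU * a2 * \<bar>Fhi\<bar>) * real T powr (-1/3) \<le> real T powr q"
  "\<forall>\<^sub>F T in sequentially. (64 * 32 * exp (3/2) / (w1 ^ 5 * \<mu>0)) * real T powr (- 10 * q) \<le> real T powr 0"
  "\<forall>\<^sub>F T in sequentially. (64 * exp (3/2) * K * a2 ^ 5 / (w1 ^ 5 * \<mu>0)) * real T powr (15 * q - 5/3) \<le> real T powr 0"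
  "\<forall>\<^sub>F T in sequentially. (32 * exp (3/2) / \<mu>0) * real T powr (- 16 * q) \<le> real T powr (- 15 * q)"
 proof -
  show "\<forall>\<^sub>F T in sequentially. (1::nat) \<le> T" by (rule eventually_ge_at_top)
 qed (rule ev_powr, use q in simp)+
 show ?thesis using ev
 proof eventually_elim
  case (elim T)
  define P where "P x = real T powr x" for x
  have T: "1 \<le> real T" "0 < real T" using elim(1) by auto
  have P0: "0 < P x" for x unfolding P_def using T by simp
  have Pz: "P 0 = 1" unfolding P_def using T by simp
  have PP: "P x * P y = P (x + y)" for x y unfolding P_def by (simp add: powr_add)
  have P5: "P x ^ 5 = P (5 * x)" for x unfolding P_def using T by (simp add: powr_power mult.commute)
  have Pe: "exp (x * ln (real T)) = P x" for x unfolding P_def by (rule exp_mult_ln[OF T(2)])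
  note E = elim(2-)[folded P_def, unfolded Pz]
  show ?case unfolding q10 q_def[symmetric]
  proof (intro allI impI)
   fix t t' assume as: "win T t \<and> t \<le> t' \<and> t' \<le> T \<and> 10 * q * ln (real T) + 1 \<le> tau t' - tau t"
   define L where "L = 10 * q * ln (real T)"
   have L: "0 \<le> L" unfolding L_def using T q by simp
   obtain k where k: "t + k \<le> t'" "L \<le> tau (t + k) - tau t" "tau (t + k) - tau t \<le> L + 1"
    using window_exists[of L t t'] as L unfolding L_def by auto
   define \<Delta> where "\<Delta> = tau (t + k) - tau t"
   have D: "L \<le> \<Delta>" "\<Delta> \<le> L + 1" unfolding \<Delta>_def using k by auto
   have wt: "win T t" and tk: "t + k \<le> T" using as k by auto
   define Am where "Am = P (4 * q)"
   have et: "\<eta> t \<le> a2 * P (-1/3)" unfolding P_def using hi[OF elim(1) wt] .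
   have ete0: "\<eta> t \<le> e0" using et E(1) e0 by (simp add: field_simps)
   have bt: "\<beta> t \<le> c * a2\<^sup>2 * P (-2/3)" unfolding P_def by (rule beta_le_scale[OF et[unfolded P_def]])
   have bt100: "\<beta> t \<le> 1/100" using bt E(2) by simp
   have gT: "0 < \<eta> T" "\<eta> T \<le> \<eta> t" "\<eta> t \<le> 2 * \<eta> T" using eta_pos win_eta[OF wt] by auto
   \<comment> \<open>Chosen so that \<open>bE * w1 ^ 5\<close> equals the upper bound for
     \<open>exp (3/2 * Delta)\<close>; a final U above w1 then contradicts the certified
     inequality.\<close>
   define bE where "bE = exp (3/2) * P (15 * q) / w1 ^ 5"
   have bE: "0 < bE" unfolding bE_def using P0 w1 by simp
   define K' where "K' = K * \<eta> t ^ 5"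
   have K': "0 \<le> K'" unfolding K'_def using K eta_pos[of t] by simp
   have exL: "exp (3/2 * \<Delta>) \<le> exp (3/2) * P (15 * q)"
   proof -
    have "exp (3/2 * \<Delta>) \<le> exp (3/2 + (15 * q) * ln (real T))" using D unfolding L_def by simp
    thus ?thesis unfolding exp_add Pe .
   qed
   have exM: "exp (- 3) * P (- 30 * q) \<le> exp (- 3 * \<Delta>)" "exp (- 3 * \<Delta>) \<le> P (- 30 * q)"
   proof -
    have "exp (- 3 + (- 30 * q) * ln (real T)) \<le> exp (- 3 * \<Delta>)" "exp (- 3 * \<Delta>) \<le> exp ((- 30 * q) * ln (real T))"
     using D unfolding L_def by auto
    thus "exp (- 3) * P (- 30 * q) \<le> exp (- 3 * \<Delta>)" "exp (- 3 * \<Delta>) \<le> P (- 30 * q)" unfolding exp_add Pe by auto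
   qed
   show "\<exists>k. t + k \<le> t' \<and> tau (t + k) - tau t \<le> 10 * q * ln (real T) + 1 \<and>
    (\<forall>sg\<in>S. alive (3/8) sg \<and> W sg \<le> real T powr q \<longrightarrow>
     real T powr (- 16 * q) \<le> pr t k (\<lambda>sg. of_bool (U (t + k) sg \<le> w1)) sg)"
   proof (intro exI[of _ k] conjI ballI impI)
    show "t + k \<le> t'" "tau (t + k) - tau t \<le> 10 * q * ln (real T) + 1" using k unfolding L_def by auto
    fix sg assume sg: "sg \<in> S" and st: "alive (3/8) sg \<and> W sg \<le> real T powr q"
    have Wst: "W sg \<le> P q" using st unfolding P_def by simp
    have WA: "sqrt (W sg) \<le> Am"
    proof -
     have "P q \<le> P (8 * q)" unfolding P_def using T q by (intro powr_mono) auto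
     also have "\<dots> = Am\<^sup>2" unfolding Am_def power2_eq_square PP by (simp add: algebra_simps)
     finally have "W sg \<le> Am\<^sup>2" using Wst by linarith
     thus ?thesis using P0[of "4 * q"] unfolding Am_def by (intro real_le_lsqrt) auto
    qed
    have "\<mu>0 / 32 \<le> exp (3/2 * (tau (t + k) - tau t)) *
     pr t k (\<lambda>sg. of_bool (alive (1/2) sg \<and> bE * (\<lambda>j sg. U j sg ^ 5) (t + k) sg < exp (3/2 * (tau (t + k) - tau t)))) sg"
    proof (rule survive_ff[OF fd(1,2) fd(3) order_refl fd(4) _ _ wt tk bt100, where Am = Am and \<rho> = 3 and K = K'])
     have mu2: "\<mu>0\<^sup>2 \<le> 1" using fd by (simp add: power_le_one)
     have "\<beta> t * \<mu>0\<^sup>2 * (norm dir)\<^sup>2 * Am\<^sup>2 = \<mu>0\<^sup>2 * (\<beta> t * (nd\<^sup>2 * P (8 * q)))"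
      unfolding Am_def nd_def power2_eq_square by (simp add: PP mult_ac)
     also have "\<dots> \<le> 1 * ((c * a2\<^sup>2 * P (-2/3)) * (nd\<^sup>2 * P (8 * q)))"
      using bt mu2 P0[of "8 * q"] beta_pos[of t] by (intro mult_mono mult_right_mono) auto
     also have "\<dots> = (c * a2\<^sup>2 * nd\<^sup>2) * P (8 * q - 2/3)" using PP[of "-2/3" "8 * q"] by (simp add: mult_ac)
     finally show "\<beta> t * \<mu>0\<^sup>2 * (norm dir)\<^sup>2 * Am\<^sup>2 \<le> 1/100" using E(3) by simp
     show "B2 \<le> Am" "1 \<le> Am" using E(4,5) unfolding Am_def by auto
     have "\<kappa>f * \<mu>0 * \<eta> T * DJ * Am = \<mu>0 * ((\<kappa>f * DJ * P (4 * q)) * \<eta> T)"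
      unfolding Am_def by (simp add: mult_ac)
     also have "\<dots> \<le> 1 * ((\<kappa>f * DJ * P (4 * q)) * (a2 * P (-1/3)))"
      using gT et fd DJ_nn P0[of "4 * q"] by (intro mult_mono mult_left_mono) auto
     also have "\<dots> = (\<kappa>f * a2 * DJ) * P (4 * q - 1/3)" using PP[of "4 * q" "-1/3"] by (simp add: mult_ac)
     finally show "\<kappa>f * \<mu>0 * \<eta> T * DJ * Am \<le> 1/64" using E(6) by simp
     show "1 - sqrt \<mu>0 / 16 \<le> 3/2" using sm unfolding sm_def by linarith
     have "16 * \<beta> t \<le> 16 * (c * a2\<^sup>2 * P (-2/3))" using bt by simp
     also have "\<dots> \<le> sm" using E(7) sm by (simp add: field_simps)
     finally show "16 * \<beta> t \<le> sqrt \<mu>0" unfolding sm_def .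
     show "3 * \<beta> t \<le> 1" using bt100 by simp
     show "0 \<le> U j sg' ^ 5" if "sg' \<in> S" for j sg' using U_lower(3)[OF that, of j] by simp
     show "A (t + j) (\<lambda>sg. U (t + Suc j) sg ^ 5) sg' \<le> (1 - 3 * \<beta> (t + j)) * U (t + j) sg' ^ 5 + K' * \<beta> (t + j)"
      if "j < k" "sg' \<in> S" "alive (1/2) sg'" for j sg'
     proof -
      have ej: "\<eta> (t + j) \<le> \<eta> t" by (rule eta_antimono) simp
      have "A (t + j) (\<lambda>sg. U (Suc (t + j)) sg ^ 5) sg' \<le> (1 - 3 * \<beta> (t + j)) * U (t + j) sg' ^ 5 + K * \<beta> (t + j) * \<eta> (t + j) ^ 5"
       using u5[unfolded u5r_def, rule_format, of "t + j" sg'] ej ete0 that by auto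
      moreover have "K * \<beta> (t + j) * \<eta> (t + j) ^ 5 \<le> K' * \<beta> (t + j)"
      proof -
       have "\<eta> (t + j) ^ 5 \<le> \<eta> t ^ 5" using ej eta_pos[of "t + j"] by (intro power_mono) auto
       hence "K * \<beta> (t + j) * \<eta> (t + j) ^ 5 \<le> K * \<beta> (t + j) * \<eta> t ^ 5" using K beta_pos[of "t + j"] by (intro mult_left_mono) auto
       thus ?thesis unfolding K'_def by (simp add: mult_ac)
      qed
      ultimately show ?thesis by simp
     qed
     show "exp (3/2 * (tau (t + k) - tau t)) \<le> bE * exp (- 3 * (tau (t + k) - tau t)) * U (t + j) sg' ^ 5"
      if "j \<le> k" "sg' \<in> S" "Am < sqrt (W sg')" for j sg'
     proof -
      have Am0: "0 < Am" unfolding Am_def by (rule P0)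
      have "Am\<^sup>2 \<le> (sqrt (W sg'))\<^sup>2" using that Am0 by (intro power_mono) auto
      hence "P (8 * q) \<le> W sg'" unfolding Am_def power2_eq_square PP by (simp add: algebra_simps)
      hence "P (8 * q) \<le> U (t + j) sg'" using U_lower(1)[OF that(2), of "t + j"] by linarith
      hence "P (8 * q) ^ 5 \<le> U (t + j) sg' ^ 5" using P0[of "8 * q"] by (intro power_mono) auto
      hence ul: "P (40 * q) \<le> U (t + j) sg' ^ 5" unfolding P5 by simp
      have "exp (3/2 * \<Delta>) \<le> exp (3/2) * P (15 * q)" by (rule exL)
      also have "\<dots> \<le> exp (3/2) * (P (25 * q) / (exp 3 * w1 ^ 5))" using E(8) w1 by (intro mult_left_mono) (auto simp: field_simps)
      also have "\<dots> = bE * (exp (- 3) * P (- 30 * q)) * P (40 * q)"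
      proof -
       have "P (25 * q) = P (15 * q) * (P (- 30 * q) * P (40 * q))" unfolding PP by simp
       thus ?thesis unfolding bE_def by (simp add: exp_minus field_simps)
      qed
      also have "\<dots> \<le> bE * exp (- 3 * \<Delta>) * U (t + j) sg' ^ 5"
       using exM(1) ul bE by (intro mult_mono mult_left_mono) (auto intro!: mult_nonneg_nonneg less_imp_le[OF P0])
      finally show ?thesis unfolding \<Delta>_def .
     qed
     show "bE * exp (- 3 * (tau (t + k) - tau t)) * U t sg ^ 5 \<le> \<mu>0 / 64"
     proof -
      have "kU * \<eta> t * Fhi \<le> kU * (a2 * P (-1/3)) * \<bar>Fhi\<bar>" using et kU_pos eta_pos[of t] Fhi_pos[OF sg] by (intro mult_mono mult_left_mono) auto
      hence "kU * \<eta> t * Fhi \<le> P q" using E(9) by (simp add: mult_ac)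
      hence "U t sg \<le> 2 * P q" using U_lower(4)[OF sg, of t] Wst by linarith
      hence "U t sg ^ 5 \<le> (2 * P q) ^ 5" using U_lower(3)[OF sg, of t] by (intro power_mono) auto
      hence "bE * exp (- 3 * \<Delta>) * U t sg ^ 5 \<le> bE * P (- 30 * q) * (2 * P q) ^ 5"
       using exM(2) bE U_lower(3)[OF sg, of t] P0[of "- 30 * q"] by (intro mult_mono) auto
      also have "\<dots> = 32 * exp (3/2) / w1 ^ 5 * (P (15 * q) * (P (- 30 * q) * P (5 * q)))"
       unfolding bE_def power_mult_distrib P5 by simp
      also have "\<dots> = 32 * exp (3/2) / w1 ^ 5 * P (- 10 * q)" unfolding PP by simp
      also have "\<dots> \<le> \<mu>0 / 64" using E(10) fd(3) w1 by (simp add: field_simps)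
      finally show ?thesis unfolding \<Delta>_def .
     qed
     show "bE * (2 * K' / 3) \<le> \<mu>0 / 64"
     proof -
      have "\<eta> t ^ 5 \<le> (a2 * P (-1/3)) ^ 5" using et eta_pos[of t] by (intro power_mono) auto
      also have "\<dots> = a2 ^ 5 * P (- 5/3)" unfolding power_mult_distrib P5 by simp
      finally have "K' \<le> K * (a2 ^ 5 * P (- 5/3))" unfolding K'_def using K by (intro mult_left_mono) auto
      hence "bE * (2 * K' / 3) \<le> bE * (K * (a2 ^ 5 * P (- 5/3)))" using bE K' by (intro mult_left_mono) auto
      also have "\<dots> = exp (3/2) * K * a2 ^ 5 / w1 ^ 5 * (P (15 * q) * P (- 5/3))" unfolding bE_def by simp
      also have "\<dots> = exp (3/2) * K * a2 ^ 5 / w1 ^ 5 * P (15 * q - 5/3)" unfolding PP by simp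
      also have "\<dots> \<le> \<mu>0 / 64" using E(11) fd(3) w1 by (simp add: field_simps)
      finally show ?thesis .
     qed
    qed (use bE K' sg st WA in \<open>auto simp: alive_def\<close>)
    also have "\<dots> \<le> exp (3/2 * \<Delta>) * pr t k (\<lambda>sg. of_bool (U (t + k) sg \<le> w1)) sg"
     unfolding \<Delta>_def
    proof (intro mult_left_mono pr_mono sg)
     fix sg' assume sg': "sg' \<in> S"
     have "U (t + k) sg' \<le> w1" if lt: "bE * U (t + k) sg' ^ 5 < exp (3/2 * (tau (t + k) - tau t))"
     proof (rule ccontr)
      assume "\<not> ?thesis"
      hence "w1 ^ 5 \<le> U (t + k) sg' ^ 5" using w1 by (intro power_mono) auto
      hence "bE * w1 ^ 5 \<le> bE * U (t + k) sg' ^ 5" using bE by (intro mult_left_mono) auto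
      also have "\<dots> < exp (3/2) * P (15 * q)" using lt exL unfolding \<Delta>_def by linarith
      finally show False unfolding bE_def using w1 by simp
     qed
     thus "of_bool (alive (1/2) sg' \<and> bE * U (t + k) sg' ^ 5 < exp (3/2 * (tau (t + k) - tau t))) \<le> (of_bool (U (t + k) sg' \<le> w1) :: real)"
      by auto
    qed auto
    also have "\<dots> \<le> (exp (3/2) * P (15 * q)) * pr t k (\<lambda>sg. of_bool (U (t + k) sg \<le> w1)) sg"
     by (rule mult_right_mono[OF exL]) (auto intro: pr_nonneg[OF sg])
    finally have fin: "\<mu>0 / 32 \<le> (exp (3/2) * P (15 * q)) * pr t k (\<lambda>sg. of_bool (U (t + k) sg \<le> w1)) sg" .
    have "(exp (3/2) * P (15 * q)) * P (- 16 * q) \<le> \<mu>0 / 32"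
    proof -
     have "P (15 * q) * ((32 * exp (3/2) / \<mu>0) * P (- 16 * q)) \<le> P (15 * q) * P (- 15 * q)" using E(12) P0[of "15 * q"] by (intro mult_left_mono) auto
     also have "\<dots> = 1" unfolding PP using Pz by simp
     finally show ?thesis using fd(3) by (simp add: field_simps)
    qed
    hence "(exp (3/2) * P (15 * q)) * P (- 16 * q) \<le> (exp (3/2) * P (15 * q)) * pr t k (\<lambda>sg. of_bool (U (t + k) sg \<le> w1)) sg"
     using fin by linarith
    hence "P (- 16 * q) \<le> pr t k (\<lambda>sg. of_bool (U (t + k) sg \<le> w1)) sg"
     using mult_le_cancel_left_pos[of "exp (3/2) * P (15 * q)"] P0[of "15 * q"] by auto
    thus "real T powr (- 16 * q) \<le> pr t k (\<lambda>sg. of_bool (U (t + k) sg \<le> w1)) sg" unfolding P_def .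
   qed
  qed
 qed
qed

lemma tau_diff_le:
 assumes sc: "scl a1 a2" and T: "1 \<le> T" and w: "win T t" "t + k \<le> T"
 shows "tau (t + k) - tau t \<le> c * a2\<^sup>2 * real T powr (1/3)"
proof -
 have bt: "\<beta> t \<le> c * a2\<^sup>2 * real T powr (-2/3)" by (rule beta_le_scale[OF scl_hi[OF sc T w(1)]])
 have "tau (t + j) - tau t \<le> real j * \<beta> t" for j
 proof (induction j)
  case (Suc j)
  have "\<beta> (t + j) \<le> \<beta> t" by (rule beta_antimono) simp
  thus ?case using Suc tau_Suc[of "t + j"] by (simp add: algebra_simps)
 qed simp
 hence "tau (t + k) - tau t \<le> real k * \<beta> t" .
 also have "\<dots> \<le> real T * (c * a2\<^sup>2 * real T powr (-2/3))"
  using bt w beta_pos[of t] by (intro mult_mono) auto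
 also have "\<dots> = c * a2\<^sup>2 * (real T powr 1 * real T powr (-2/3))" using T by simp
 also have "\<dots> = c * a2\<^sup>2 * real T powr (1/3)" unfolding powr_add[symmetric] by simp
 finally show ?thesis .
qed

lemma beta_ge_scale:
 assumes sc: "scl a1 a2" and T: "1 \<le> T" "t \<le> T"
 shows "c * a1\<^sup>2 * real T powr (-2/3) \<le> \<beta> t"
proof -
 have "(a1 * real T powr (-1/3))\<^sup>2 \<le> (\<eta> t)\<^sup>2" using scl_lo[OF sc T] scl_pos[OF sc] by (intro power_mono) auto
 moreover have "(a1 * real T powr (-1/3))\<^sup>2 = a1\<^sup>2 * real T powr (-2/3)" by (simp add: power_mult_distrib power2_eq_square powr_add[symmetric])
 ultimately show ?thesis unfolding beta_def using c_pos by (simp add: mult.assoc)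
qed

lemma tau_diff_ge:
 assumes sc: "scl a1 a2" and T: "1 \<le> T" and w: "t + k \<le> T"
 shows "real k * (c * a1\<^sup>2 * real T powr (-2/3)) \<le> tau (t + k) - tau t"
 using w
proof (induction k)
 case (Suc k)
 have "c * a1\<^sup>2 * real T powr (-2/3) \<le> \<beta> (t + k)" by (rule beta_ge_scale[OF sc T]) (use Suc in simp)
 thus ?case using Suc tau_Suc[of "t + k"] by (simp add: algebra_simps)
qed simp

definition exr :: "real \<Rightarrow> real \<Rightarrow> bool" where
 "exr K e0 \<longleftrightarrow> (\<forall>t k w sg. \<eta> t \<le> e0 \<and> sg \<in> S \<and> 0 < w \<and> w \<le> w0 \<longrightarrow>
   pr t k (\<lambda>sg. of_bool (w < U (t + k) sg)) sg
    \<le> (1 / w0 ^ 5 + exp (- 2 * (tau (t + k) - tau t)) / w ^ 5) * U t sg ^ 5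
     + K * \<eta> t ^ 5 * ((tau (t + k) - tau t) / w0 ^ 5 + 1 / w ^ 5))"

lemma ex_exr: "\<exists>K\<ge>0. \<exists>e0>0. exr K e0"
 unfolding exr_def by (rule exit_bound)

lemma eta5_le:
 assumes "\<eta> t \<le> a2 * real T powr (-1/3)" "1 \<le> T"
 shows "\<eta> t ^ 5 \<le> a2 ^ 5 * real T powr (-5/3)"
proof -
 have "\<eta> t ^ 5 \<le> (a2 * real T powr (-1/3)) ^ 5" using assms eta_pos[of t] by (intro power_mono) auto
 also have "\<dots> = a2 ^ 5 * real T powr (-5/3)" using assms by (simp add: power_mult_distrib powr_power)
 finally show ?thesis .
qed

lemma pr_compl:
 assumes "sg \<in> S"
 shows "pr t k (\<lambda>sg. of_bool (Q sg)) sg = 1 - pr t k (\<lambda>sg. of_bool (\<not> Q sg)) sg"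
proof -
 have "pr t k (\<lambda>sg. of_bool (Q sg)) sg = pr t k (\<lambda>sg. 1 - of_bool (\<not> Q sg)) sg"
  by (rule arg_cong[where f="\<lambda>\<phi>. pr t k \<phi> sg"]) auto
 thus ?thesis by (simp add: pr_diff)
qed

text \<open>The exponent -3/10 lies above the noise floor -1/3, so the residual eta^5, of order
  T^(-5/3), is small even after division by T^(-3/2). On the other hand five times 3/10 exceeds 4/3,
  which \<open>stay\<close> uses.\<close>

lemma phase_d:
 "\<forall>\<^sub>F T in sequentially. \<forall>t k. win T t \<and> t + k \<le> T \<and> ln (real T) \<le> tau (t + k) - tau t \<longrightarrow>
   (\<forall>sg\<in>S. U t sg \<le> w0 / 2 \<longrightarrow> 1/2 \<le> pr t k (\<lambda>sg. of_bool (U (t + k) sg \<le> real T powr (-3/10))) sg)"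
proof -
 obtain K e0 where K: "0 \<le> K" and e0: "0 < e0" and ex: "exr K e0" using ex_exr by auto
 obtain a1 a2 where sc: "scl a1 a2" using ex_scl by auto
 note a = scl_pos[OF sc]
 have ev: "\<forall>\<^sub>F T in sequentially. (1::nat) \<le> T"
  "\<forall>\<^sub>F T in sequentially. (a2 / e0) * real T powr (-1/3) \<le> real T powr 0"
  "\<forall>\<^sub>F T in sequentially. (1 / w0) * real T powr (-3/10) \<le> real T powr 0"
  "\<forall>\<^sub>F T in sequentially. w0 ^ 5 * real T powr (-1/2) \<le> real T powr 0"
  "\<forall>\<^sub>F T in sequentially. (8 * K * a2 ^ 5 * (c * a2\<^sup>2) / w0 ^ 5) * real T powr (-4/3) \<le> real T powr 0"
  "\<forall>\<^sub>F T in sequentially. (8 * K * a2 ^ 5) * real T powr (-1/6) \<le> real T powr 0"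
 proof -
  show "\<forall>\<^sub>F T in sequentially. (1::nat) \<le> T" by (rule eventually_ge_at_top)
 qed (rule ev_powr, simp)+
 show ?thesis using ev
 proof eventually_elim
  case (elim T)
  define P where "P x = real T powr x" for x
  have T: "1 \<le> real T" "0 < real T" using elim(1) by auto
  have P0: "0 < P x" for x unfolding P_def using T by simp
  have Pz: "P 0 = 1" unfolding P_def using T by simp
  have PP: "P x * P y = P (x + y)" for x y unfolding P_def by (simp add: powr_add)
  have P5: "P x ^ 5 = P (5 * x)" for x unfolding P_def using T by (simp add: powr_power mult.commute)
  have Pe: "exp (x * ln (real T)) = P x" for x unfolding P_def by (rule exp_mult_ln[OF T(2)])
  note E = elim(2-)[folded P_def, unfolded Pz]
  show ?case
  proof (intro allI impI ballI)
   fix t k sg assume as: "win T t \<and> t + k \<le> T \<and> ln (real T) \<le> tau (t + k) - tau t" and sg: "sg \<in> S" and u: "U t sg \<le> w0 / 2"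
   have et: "\<eta> t \<le> a2 * P (-1/3)" unfolding P_def using scl_hi[OF sc elim(1)] as by simp
   have ete0: "\<eta> t \<le> e0" using et E(1) e0 by (simp add: field_simps)
   define w where "w = P (-3/10)"
   have w: "0 < w" "w \<le> w0" unfolding w_def using P0 E(2) w0_pos by (auto simp: field_simps)
   have w5: "1 / w ^ 5 = P (3/2)"
   proof -
    have "w ^ 5 * P (3/2) = 1" unfolding w_def P5 PP using Pz by simp
    thus ?thesis using w by (simp add: field_simps)
   qed
   have w0p: "0 < w0 ^ 5" using w0_pos by simp
   have D: "tau (t + k) - tau t \<le> c * a2\<^sup>2 * P (1/3)" unfolding P_def by (rule tau_diff_le[OF sc elim(1)]) (use as in auto)
   have ex2: "exp (- 2 * (tau (t + k) - tau t)) \<le> P (-2)"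
   proof -
    have "exp (- 2 * (tau (t + k) - tau t)) \<le> exp ((-2) * ln (real T))" using as by simp
    thus ?thesis unfolding Pe .
   qed
   have bad: "pr t k (\<lambda>sg. of_bool (w < U (t + k) sg)) sg
     \<le> (1 / w0 ^ 5 + exp (- 2 * (tau (t + k) - tau t)) / w ^ 5) * U t sg ^ 5
     + K * \<eta> t ^ 5 * ((tau (t + k) - tau t) / w0 ^ 5 + 1 / w ^ 5)"
    using ex[unfolded exr_def] ete0 sg w by blast
   \<comment> \<open>Starting at half of w0, the initial term is at most 2 * 2^(-5); the two
     residuals tend to 0.\<close>
   also have "\<dots> \<le> 1/16 + (1/8 + 1/8)"
   proof (rule add_mono)
    have u5: "U t sg ^ 5 \<le> (w0 / 2) ^ 5" using u U_lower(3)[OF sg, of t] by (intro power_mono) auto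
    have "exp (- 2 * (tau (t + k) - tau t)) / w ^ 5 = exp (- 2 * (tau (t + k) - tau t)) * P (3/2)" unfolding w5[symmetric] by simp
    also have "\<dots> \<le> P (-2) * P (3/2)" using ex2 P0[of "3/2"] by (intro mult_right_mono) auto
    also have "\<dots> = P (-1/2)" unfolding PP by simp
    also have "\<dots> \<le> 1 / w0 ^ 5" using E(3) w0p by (simp add: pos_le_divide_eq mult.commute)
    finally have q: "exp (- 2 * (tau (t + k) - tau t)) / w ^ 5 \<le> 1 / w0 ^ 5" .
    have "(1 / w0 ^ 5 + exp (- 2 * (tau (t + k) - tau t)) / w ^ 5) * U t sg ^ 5 \<le> (1 / w0 ^ 5 + 1 / w0 ^ 5) * (w0 / 2) ^ 5"
     using q u5 w0p U_lower(3)[OF sg, of t] by (intro mult_mono add_left_mono) auto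
    also have "\<dots> = 1/16" using w0_pos by (simp add: power_divide)
    finally show "(1 / w0 ^ 5 + exp (- 2 * (tau (t + k) - tau t)) / w ^ 5) * U t sg ^ 5 \<le> 1/16" .
    have e5: "\<eta> t ^ 5 \<le> a2 ^ 5 * P (-5/3)" unfolding P_def by (rule eta5_le[OF et[unfolded P_def] elim(1)])
    have "K * \<eta> t ^ 5 * ((tau (t + k) - tau t) / w0 ^ 5 + 1 / w ^ 5) \<le> K * (a2 ^ 5 * P (-5/3)) * (c * a2\<^sup>2 * P (1/3) / w0 ^ 5 + P (3/2))"
     unfolding w5 using K e5 D w0p eta_pos[of t] tau_mono[of t "t + k"] P0[of "3/2"] P0[of "-5/3"] a
     by (intro mult_mono add_mono divide_right_mono) auto
    also have "\<dots> = K * a2 ^ 5 * (c * a2\<^sup>2) / w0 ^ 5 * (P (-5/3) * P (1/3)) + K * a2 ^ 5 * (P (-5/3) * P (3/2))"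
     by (simp add: algebra_simps)
    also have "\<dots> = K * a2 ^ 5 * (c * a2\<^sup>2) / w0 ^ 5 * P (-4/3) + K * a2 ^ 5 * P (-1/6)" unfolding PP by simp
    also have "\<dots> \<le> 1/8 + 1/8" using E(4,5) by (intro add_mono) (simp_all add: mult_ac)
    finally show "K * \<eta> t ^ 5 * ((tau (t + k) - tau t) / w0 ^ 5 + 1 / w ^ 5) \<le> 1/8 + 1/8" .
   qed
   finally have "pr t k (\<lambda>sg. of_bool (\<not> U (t + k) sg \<le> w)) sg \<le> 1/2" by (simp add: not_le)
   thus "1/2 \<le> pr t k (\<lambda>sg. of_bool (U (t + k) sg \<le> real T powr (-3/10))) sg"
    unfolding pr_compl[OF sg, of t k "\<lambda>sg. U (t + k) sg \<le> real T powr (-3/10)"] w_def P_def by simp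
  qed
 qed
qed

text \<open>The Markov property, in the form that links two successive phases.\<close>

lemma pr_chain:
 assumes sg: "sg \<in> S" and c1: "c1 \<le> pr t k1 (\<lambda>sg. of_bool (Q sg)) sg" and c2: "0 \<le> c2" "\<And>sg. sg \<in> S \<Longrightarrow> Q sg \<Longrightarrow> c2 \<le> pr (t + k1) k2 \<phi> sg"
  and nn: "\<And>sg. sg \<in> S \<Longrightarrow> 0 \<le> \<phi> sg"
 shows "c1 * c2 \<le> pr t (k1 + k2) \<phi> sg"
proof -
 have "c1 * c2 \<le> c2 * pr t k1 (\<lambda>sg. of_bool (Q sg)) sg" using mult_left_mono[OF c1 c2(1)] by (simp only: mult.commute)
 also have "\<dots> = pr t k1 (\<lambda>sg. c2 * of_bool (Q sg)) sg" by (simp add: pr_cmult)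
 also have "\<dots> \<le> pr t k1 (pr (t + k1) k2 \<phi>) sg"
 proof (rule pr_mono[OF sg])
  fix sg assume s: "sg \<in> S"
  show "c2 * of_bool (Q sg) \<le> pr (t + k1) k2 \<phi> sg"
   using c2(2)[OF s] pr_nonneg[where t="t + k1" and k=k2, OF s nn] by (cases "Q sg") auto
 qed
 also have "\<dots> = pr t (k1 + k2) \<phi> sg" by (simp add: pr_plus)
 finally show ?thesis .
qed

text \<open>The tau-times of the phases add up to less than 3 ln T. The exponents add up to 18 eps,
  a third of 1 - sqrt mu0 / 16, and 16 / m; the factor 1/2 stems from the last phase.\<close>

lemma succ:
 fixes m :: nat
 assumes fd: "fdr \<kappa>f \<mu>0" "0 < \<kappa>f" "0 < \<mu>0" "\<mu>0 \<le> 1" and eps: "0 < \<epsilon>" "\<epsilon> \<le> 1/100" and m: "20 \<le> m" "1 \<le> \<epsilon> * real m"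
 shows "\<forall>\<^sub>F T in sequentially. \<forall>t ts. win T t \<and> t \<le> ts \<and> ts \<le> T \<and> 3 * ln (real T) \<le> tau ts - tau t \<longrightarrow>
  (\<forall>sg\<in>S. -1/8 \<le> es sg \<and> W sg \<le> real T powr (2/3 + 2 * \<epsilon>) \<longrightarrow>
   1/2 * real T powr (- 18 * \<epsilon> - (1 - sqrt \<mu>0 / 16) / 3 - 16 / real m) \<le> pr t (ts - t) (\<lambda>sg. of_bool (U ts sg \<le> real T powr (-3/10))) sg)"
proof -
 have "0 < w0 / 2" using w0_pos by simp
 show ?thesis
 using phase_a[OF fd eps m(1)] phase_b[OF fd eps m(2)] phase_c[OF fd \<open>0 < w0 / 2\<close> m(1)] phase_d eventually_ge_at_top[of "nat \<lceil>exp (3::real)\<rceil>"]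
proof eventually_elim
 case (elim T)
 have lnT: "3 \<le> ln (real T)"
 proof -
  have "exp 3 \<le> real T" using elim(5) by linarith
  thus ?thesis by (metis exp_gt_zero ln_exp ln_le_cancel_iff order_less_le_trans)
 qed
 show ?case
 proof (intro allI impI ballI)
  fix t ts sg assume as: "win T t \<and> t \<le> ts \<and> ts \<le> T \<and> 3 * ln (real T) \<le> tau ts - tau t"
   and sg: "sg \<in> S" and st: "-1/8 \<le> es sg \<and> W sg \<le> real T powr (2/3 + 2 * \<epsilon>)"
  define x where "x = ln (real T)"
  have x: "3 \<le> x" unfolding x_def by (rule lnT)
  have ex: "6 * \<epsilon> * x \<le> 6/100 * x" using eps x by (intro mult_right_mono) auto
  have mx: "10 / real m * x \<le> 1/2 * x" using m x by (intro mult_right_mono) (auto simp: field_simps)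
  have asx: "3 * x \<le> tau ts - tau t" using as unfolding x_def by simp
  obtain k1 where k1: "t + k1 \<le> ts" "tau (t + k1) - tau t \<le> 6 * \<epsilon> * x + 1"
   and p1: "\<And>sg. sg \<in> S \<Longrightarrow> -1/8 \<le> es sg \<and> W sg \<le> real T powr (2/3 + 2 * \<epsilon>) \<Longrightarrow>
     real T powr (- 17 * \<epsilon>) \<le> pr t k1 (\<lambda>sg. of_bool (alive (1/4) sg \<and> W sg \<le> real T powr (2/3 - 3 * \<epsilon>))) sg"
   using elim(1)[rule_format, of t ts] as asx ex x unfolding x_def[symmetric] by auto
  define t1 where "t1 = t + k1"
  have w1: "win T t1" unfolding t1_def using win_add as k1 by auto
  obtain k2 where k2: "t1 + k2 \<le> ts" "tau (t1 + k2) - tau t1 \<le> 1/3 * x + 1"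
   and p2: "\<And>sg. sg \<in> S \<Longrightarrow> alive (1/4) sg \<and> W sg \<le> real T powr (2/3 - 3 * \<epsilon>) \<Longrightarrow>
     real T powr (- (1 - sqrt \<mu>0 / 16) / 3 - \<epsilon>) \<le> pr t1 k2 (\<lambda>sg. of_bool (alive (3/8) sg \<and> W sg \<le> real T powr (1 / real m))) sg"
   using elim(2)[rule_format, of t1 ts] as asx ex x k1 w1 unfolding x_def[symmetric] t1_def by auto
  define t2 where "t2 = t1 + k2"
  have w2: "win T t2" unfolding t2_def using win_add[OF w1] as k2 by auto
  have h3: "win T t2 \<and> t2 \<le> ts \<and> ts \<le> T \<and> 10 / real m * ln (real T) + 1 \<le> tau ts - tau t2"
  proof -
   have "10 / real m * x + 1 \<le> tau ts - tau t2"
    using asx ex mx x k1(2) k2(2) unfolding t1_def[symmetric] t2_def[symmetric] by linarith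
   thus ?thesis using as w2 k2(1) unfolding x_def t2_def by simp
  qed
  obtain k3 where k3: "t2 + k3 \<le> ts" "tau (t2 + k3) - tau t2 \<le> 10 / real m * x + 1"
   and p3: "\<And>sg. sg \<in> S \<Longrightarrow> alive (3/8) sg \<and> W sg \<le> real T powr (1 / real m) \<Longrightarrow>
     real T powr (- 16 / real m) \<le> pr t2 k3 (\<lambda>sg. of_bool (U (t2 + k3) sg \<le> w0 / 2)) sg"
   using elim(3)[rule_format, OF h3] unfolding x_def by blast
  define t3 where "t3 = t2 + k3"
  have w3: "win T t3" unfolding t3_def using win_add[OF w2] as k3 by auto
  define k4 where "k4 = ts - t3"
  have t3k: "t3 + k4 = ts" unfolding k4_def t3_def using k3 by simp
  have "x \<le> tau (t3 + k4) - tau t3"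
   using asx ex mx x k1 k2 k3 unfolding t3k t1_def[symmetric] t2_def[symmetric] t3_def[symmetric] by linarith
  hence p4: "1/2 \<le> pr t3 k4 (\<lambda>sg. of_bool (U ts sg \<le> real T powr (-3/10))) sg" if "sg \<in> S" "U t3 sg \<le> w0 / 2" for sg
   using elim(4)[rule_format, of t3 k4 sg] w3 as that unfolding x_def t3k by auto
  have c3: "real T powr (- 16 / real m) * (1/2) \<le> pr t2 (k3 + k4) (\<lambda>sg. of_bool (U ts sg \<le> real T powr (-3/10))) sg"
   if "sg \<in> S" "alive (3/8) sg \<and> W sg \<le> real T powr (1 / real m)" for sg
   by (rule pr_chain[OF that(1) p3[OF that]]) (use p4 in \<open>auto simp: t3_def\<close>)
  have c2: "real T powr (- (1 - sqrt \<mu>0 / 16) / 3 - \<epsilon>) * (real T powr (- 16 / real m) * (1/2)) \<le> pr t1 (k2 + (k3 + k4)) (\<lambda>sg. of_bool (U ts sg \<le> real T powr (-3/10))) sg"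
   if "sg \<in> S" "alive (1/4) sg \<and> W sg \<le> real T powr (2/3 - 3 * \<epsilon>)" for sg
   by (rule pr_chain[OF that(1) p2[OF that]]) (use c3 in \<open>auto simp: t2_def\<close>)
  have c1: "real T powr (- 17 * \<epsilon>) * (real T powr (- (1 - sqrt \<mu>0 / 16) / 3 - \<epsilon>) * (real T powr (- 16 / real m) * (1/2))) \<le> pr t (k1 + (k2 + (k3 + k4))) (\<lambda>sg. of_bool (U ts sg \<le> real T powr (-3/10))) sg"
   by (rule pr_chain[OF sg p1[OF sg st]]) (use c2 in \<open>auto simp: t1_def\<close>)
  have kk: "k1 + (k2 + (k3 + k4)) = ts - t" unfolding k4_def t3_def t2_def t1_def using k1 k2 k3 unfolding t1_def t2_def by simp
  have "real T powr (- 17 * \<epsilon>) * (real T powr (- (1 - sqrt \<mu>0 / 16) / 3 - \<epsilon>) * (real T powr (- 16 / real m) * (1/2)))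
    = 1/2 * real T powr (- 17 * \<epsilon> + (- (1 - sqrt \<mu>0 / 16) / 3 - \<epsilon>) + (- 16 / real m))" by (simp only: powr_add mult_ac)
  also have "- 17 * \<epsilon> + (- (1 - sqrt \<mu>0 / 16) / 3 - \<epsilon>) + (- 16 / real m) = - 18 * \<epsilon> - (1 - sqrt \<mu>0 / 16) / 3 - 16 / real m" by (simp add: field_simps)
  finally show "1/2 * real T powr (- 18 * \<epsilon> - (1 - sqrt \<mu>0 / 16) / 3 - 16 / real m) \<le> pr t (ts - t) (\<lambda>sg. of_bool (U ts sg \<le> real T powr (-3/10))) sg"
   using c1 unfolding kk by simp
 qed
qed
qed

section \<open>Repeated attempts\<close>

definition zr :: "nat \<Rightarrow> real \<Rightarrow> nat \<Rightarrow> bool" where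
 "zr m K T \<longleftrightarrow> (\<forall>t sg. 24 * real m * \<beta> t \<le> 1 \<and> t < T \<and> sg \<in> S \<longrightarrow>
   A t (\<lambda>sg. (W sg + real T powr (2/3)) ^ m) sg \<le> (W sg + real T powr (2/3)) ^ m + K * (real T powr (2/3)) ^ (m - 1))"

text \<open>Before time T, beta is at least a multiple of T^(-2/3), so the level
  \<open>26 * m * B2^2 / beta\<close> of \<open>u0_drift\<close> is at most a multiple of q =
  T^(2/3).\<close>

lemma ex_zr:
 assumes m: "0 < m"
 shows "\<exists>K\<ge>0. \<forall>\<^sub>F T in sequentially. zr m K T"
proof -
 obtain a1 a2 where sc: "scl a1 a2" using ex_scl by blast
 define G where "G = 26 * real m * B2\<^sup>2 / (c * a1\<^sup>2) + 1"
 have a: "0 < a1" by (rule scl_pos[OF sc])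
 have G: "0 \<le> G" unfolding G_def using a c_pos by (intro add_nonneg_nonneg divide_nonneg_pos) auto
 have ev: "\<forall>\<^sub>F T in sequentially. (5 * (real m)\<^sup>2 * (B2\<^sup>2 + 1)) * real T powr 0 \<le> real T powr (2/3)"
  by (rule ev_powr) simp
 show ?thesis
 proof (intro exI[of _ "13 * (real m)\<^sup>2 * B2\<^sup>2 * G ^ (m - 1)"] conjI)
  show "0 \<le> 13 * (real m)\<^sup>2 * B2\<^sup>2 * G ^ (m - 1)" using G by simp
  show "\<forall>\<^sub>F T in sequentially. zr m (13 * (real m)\<^sup>2 * B2\<^sup>2 * G ^ (m - 1)) T"
   using ev eventually_ge_at_top[of 1]
  proof eventually_elim
   case (elim T)
   define q where "q = real T powr (2/3)"
   have q: "5 * (real m)\<^sup>2 * (B2\<^sup>2 + 1) \<le> q" "0 < q" unfolding q_def using elim by auto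
   show ?case unfolding zr_def q_def[symmetric]
   proof (intro allI impI)
    fix t sg assume as: "24 * real m * \<beta> t \<le> 1 \<and> t < T \<and> sg \<in> S"
    have "c * a1\<^sup>2 * real T powr (-2/3) \<le> \<beta> t" by (rule beta_ge_scale[OF sc elim(2)]) (use as in simp)
    moreover have "real T powr (-2/3) = 1 / q" unfolding q_def using powr_minus_divide[of "real T" "2/3"] by simp
    ultimately have b: "c * a1\<^sup>2 / q \<le> \<beta> t" by simp
    have "26 * real m * B2\<^sup>2 / \<beta> t \<le> 26 * real m * B2\<^sup>2 / (c * a1\<^sup>2 / q)"
     by (rule divide_left_mono) (use b q a c_pos beta_pos[of t] in auto)
    also have "\<dots> = 26 * real m * B2\<^sup>2 / (c * a1\<^sup>2) * q" by simp
    finally have "26 * real m * B2\<^sup>2 / \<beta> t + q \<le> G * q" unfolding G_def by (simp add: algebra_simps)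
    moreover have "0 \<le> 26 * real m * B2\<^sup>2 / \<beta> t + q" using q beta_pos[of t] by (intro add_nonneg_nonneg divide_nonneg_pos) auto
    ultimately have "(26 * real m * B2\<^sup>2 / \<beta> t + q) ^ (m - 1) \<le> G ^ (m - 1) * q ^ (m - 1)"
     by (metis power_mono power_mult_distrib)
    hence "13 * (real m)\<^sup>2 * B2\<^sup>2 * (26 * real m * B2\<^sup>2 / \<beta> t + q) ^ (m - 1) \<le> 13 * (real m)\<^sup>2 * B2\<^sup>2 * (G ^ (m - 1) * q ^ (m - 1))"
     by (intro mult_left_mono) auto
    thus "A t (\<lambda>sg. (W sg + q) ^ m) sg \<le> (W sg + q) ^ m + 13 * (real m)\<^sup>2 * B2\<^sup>2 * G ^ (m - 1) * q ^ (m - 1)"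
     using u0_drift[of sg m t q] as m q unfolding mult.assoc[of _ "G ^ (m - 1)" "q ^ (m - 1)"] by linarith
   qed
  qed
 qed
qed

text \<open>A supermartingale in every state, alive or not, that is at least \<open>1\<close> once \<open>W > T powr a\<close>.\<close>

definition zz :: "nat \<Rightarrow> real \<Rightarrow> real \<Rightarrow> nat \<Rightarrow> nat \<Rightarrow> 'x \<times> 'h \<Rightarrow> real" where
 "zz m K a T t sg = ((W sg + real T powr (2/3)) ^ m + (real T - real t) * (K * (real T powr (2/3)) ^ (m - 1))) / (real T powr a) ^ m"

lemma zz_drift:
 assumes "zr m K T" "t < T" "24 * real m * \<beta> t \<le> 1" "sg \<in> S"
 shows "A t (zz m K a T (Suc t)) sg \<le> zz m K a T t sg"
proof -
 define V where "V = K * (real T powr (2/3)) ^ (m - 1)"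
 define R where "R = (real T powr a) ^ m"
 have R: "0 < R" unfolding R_def using assms by simp
 have "A t (zz m K a T (Suc t)) sg = A t (\<lambda>sg. (1 / R) * ((W sg + real T powr (2/3)) ^ m + (real T - real (Suc t)) * V)) sg"
  unfolding zz_def V_def[symmetric] R_def[symmetric] by simp
 also have "\<dots> = (1 / R) * (A t (\<lambda>sg. (W sg + real T powr (2/3)) ^ m) sg + (real T - real (Suc t)) * V)"
  unfolding A_cmult A_add A_const ..
 also have "\<dots> \<le> (1 / R) * ((W sg + real T powr (2/3)) ^ m + V + (real T - real (Suc t)) * V)"
  using assms(1)[unfolded zr_def, rule_format, of t sg] assms(2-) R unfolding V_def by (intro mult_left_mono add_right_mono) auto
 also have "\<dots> = zz m K a T t sg" unfolding zz_def V_def[symmetric] R_def[symmetric] by (simp add: algebra_simps add_divide_distrib diff_divide_distrib)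
 finally show ?thesis .
qed

lemma zz_nonneg: "0 \<le> K \<Longrightarrow> t \<le> T \<Longrightarrow> 0 \<le> zz m K a T t sg"
 unfolding zz_def by (intro divide_nonneg_nonneg add_nonneg_nonneg zero_le_power mult_nonneg_nonneg) auto

lemma zz_big:
 assumes "0 \<le> K" "t \<le> T" "1 \<le> T" "real T powr a < W sg"
 shows "1 \<le> zz m K a T t sg"
proof -
 have R: "0 < (real T powr a) ^ m" using assms by simp
 have "(real T powr a) ^ m \<le> (W sg + real T powr (2/3)) ^ m" using assms by (intro power_mono add_increasing2) auto
 moreover have "0 \<le> (real T - real t) * (K * (real T powr (2/3)) ^ (m - 1))" using assms by simp
 ultimately show ?thesis unfolding zz_def using R by (simp add: pos_le_divide_eq)
qed

lemma zz_pr: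
 assumes z: "zr m K T" and T: "t + k \<le> T" and b: "24 * real m * \<beta> t \<le> 1" and sg: "sg \<in> S"
 shows "pr t k (zz m K a T (t + k)) sg \<le> zz m K a T t sg"
proof (rule pr_le[OF _ sg])
 fix j sg assume j: "j < k" "sg \<in> S"
 have "24 * real m * \<beta> (t + j) \<le> 24 * real m * \<beta> t" using beta_antimono[of t "t + j"] by (intro mult_left_mono) auto
 thus "A (t + j) (zz m K a T (t + Suc j)) sg \<le> zz m K a T (t + j) sg"
  using zz_drift[OF z, of "t + j" sg a] j T b by simp
qed

text \<open>T steps add T * T^(2/3 * (m - 1)) in total, to be compared with T^(a * m): any a above
  2/3 wins once m is large.\<close>

lemma zz_small:
 assumes m: "0 < m" and K: "0 \<le> K" and b: "0 \<le> b" and p: "(2/3 + b - a) * real m < - p" "1/3 + (2/3 - a) * real m < - p"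
 shows "\<forall>\<^sub>F T in sequentially. \<forall>t sg. t \<le> T \<and> W sg \<le> real T powr (2/3 + b) \<longrightarrow> zz m K a T t sg \<le> real T powr (- p)"
proof -
 have e1: "\<forall>\<^sub>F T in sequentially. (2 * 2 ^ m) * real T powr ((2/3 + b - a) * real m) \<le> real T powr (- p)" by (rule ev_powr[OF p(1)])
 have e2: "\<forall>\<^sub>F T in sequentially. (2 * K) * real T powr (1/3 + (2/3 - a) * real m) \<le> real T powr (- p)" by (rule ev_powr[OF p(2)])
 show ?thesis using e1 e2 eventually_ge_at_top[of 1]
 proof eventually_elim
  case (elim T)
  define P where "P x = real T powr x" for x
  define M where "M = real m"
  have T: "1 \<le> real T" "0 < real T" using elim(3) by auto
  have P0: "0 < P x" for x unfolding P_def using T by simp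
  have PP: "P x * P y = P (x + y)" for x y unfolding P_def by (simp add: powr_add)
  have Pd: "P x / P y = P (x - y)" for x y unfolding P_def by (simp add: powr_diff)
  have Pm: "P x ^ m = P (x * M)" for x unfolding P_def M_def using T by (simp add: powr_power mult.commute)
  have Pm1: "P x ^ (m - 1) = P (x * (M - 1))" for x unfolding P_def M_def using T m by (simp add: powr_power mult.commute of_nat_diff)
  have P1: "P 1 = real T" unfolding P_def using T by simp
  note E = elim(1,2)[folded P_def M_def]
  show ?case
  proof (intro allI impI)
   fix t sg assume as: "t \<le> T \<and> W sg \<le> real T powr (2/3 + b)"
   have "P (2/3) \<le> P (2/3 + b)" unfolding P_def using T b by (intro powr_mono) auto
   hence "W sg + P (2/3) \<le> 2 * P (2/3 + b)" using as unfolding P_def by linarith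
   hence "(W sg + P (2/3)) ^ m \<le> (2 * P (2/3 + b)) ^ m" using P0[of "2/3"] by (intro power_mono) auto
   also have "\<dots> = 2 ^ m * P ((2/3 + b) * M)" by (simp add: power_mult_distrib Pm)
   finally have t1: "(W sg + P (2/3)) ^ m \<le> 2 ^ m * P ((2/3 + b) * M)" .
   have "(real T - real t) * (K * P (2/3) ^ (m - 1)) \<le> real T * (K * P (2/3) ^ (m - 1))"
    using K P0[of "2/3"] by (intro mult_right_mono) auto
   also have "\<dots> = K * (P 1 * P (2/3 * (M - 1)))" unfolding Pm1 P1 by simp
   also have "\<dots> = K * P (1/3 + 2/3 * M)" unfolding PP by (simp add: right_diff_distrib diff_divide_distrib)
   finally have t2: "(real T - real t) * (K * P (2/3) ^ (m - 1)) \<le> K * P (1/3 + 2/3 * M)" .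
   have "zz m K a T t sg = ((W sg + P (2/3)) ^ m + (real T - real t) * (K * P (2/3) ^ (m - 1))) / P (a * M)"
    unfolding zz_def P_def[symmetric] Pm[of a] ..
   also have "\<dots> \<le> (2 ^ m * P ((2/3 + b) * M) + K * P (1/3 + 2/3 * M)) / P (a * M)"
    using t1 t2 P0[of "a * M"] by (intro divide_right_mono add_mono) auto
   also have "\<dots> = 2 ^ m * (P ((2/3 + b) * M) / P (a * M)) + K * (P (1/3 + 2/3 * M) / P (a * M))"
    by (simp add: add_divide_distrib)
   also have "\<dots> = 2 ^ m * P ((2/3 + b - a) * M) + K * P (1/3 + (2/3 - a) * M)" unfolding Pd by (simp add: algebra_simps)
   also have "\<dots> \<le> P (- p) / 2 + P (- p) / 2" using E by (intro add_mono) auto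
   finally show "zz m K a T t sg \<le> real T powr (- p)" unfolding P_def by simp
  qed
 qed
qed

section \<open>Return from dead states and the success probability of one block\<close>

definition B1 :: real where "B1 = norm dir * B2"

lemma B1_nn: "0 \<le> B1" unfolding B1_def by simp

text \<open>The mean of \<open>es\<close> contracts to \<open>0\<close> whatever the state, so that \<open>1 + 8 * es\<close> cannot stay negative;
 this gives a constant probability of coming back to \<open>es \<ge> -1/8\<close>.\<close>

lemma recover:
 fixes \<alpha> \<gamma> Z :: "nat \<Rightarrow> 'x \<times> 'h \<Rightarrow> real" and g :: "nat \<Rightarrow> real"
 assumes a: "0 < p1" "p1 \<le> 1" and nn: "\<And>sg. sg \<in> S \<Longrightarrow> 0 \<le> \<phi> sg"
  and g: "\<And>j. t \<le> j \<Longrightarrow> j < T1 \<Longrightarrow> g j = (1 - \<beta> j) * g (Suc j)" "\<And>j. 0 \<le> g j" "\<And>j. g j \<le> 1" "g T1 = 1" and T1: "T1 \<le> ts"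
  and Z0: "\<And>j sg. j \<le> T1 \<Longrightarrow> 0 \<le> Z j sg" and Zd: "\<And>j sg. t \<le> j \<Longrightarrow> j < T1 \<Longrightarrow> sg \<in> S \<Longrightarrow> A j (Z (Suc j)) sg \<le> Z j sg"
  and ZQ: "\<And>j sg. j \<le> T1 \<Longrightarrow> \<not> Q sg \<Longrightarrow> 1 \<le> Z j sg"
  and good: "\<And>j sg. t \<le> j \<Longrightarrow> j \<le> T1 \<Longrightarrow> sg \<in> S \<Longrightarrow> Q sg \<Longrightarrow> -1/8 \<le> es sg \<Longrightarrow> p1 \<le> pr j (ts - j) \<phi> sg"
 shows "t \<le> j \<Longrightarrow> j + k = T1 \<Longrightarrow> sg \<in> S \<Longrightarrow> es sg \<le> B1 \<Longrightarrow> p1 * ((1 + 8 * g j * es sg) / (1 + 8 * B1)) - Z j sg \<le> pr j (ts - j) \<phi> sg"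
proof (induction k arbitrary: j sg)
 \<comment> \<open>Where es is at least -1/8 the success bound p1 applies, and the linear fraction
   is at most 1 because es does not exceed B1.\<close>
 have easy: "p1 * ((1 + 8 * g j * es sg) / (1 + 8 * B1)) - Z j sg \<le> pr j (ts - j) \<phi> sg"
  if "t \<le> j" "j \<le> T1" "sg \<in> S" "es sg \<le> B1" "-1/8 \<le> es sg" for j sg
 proof -
  have "g j * es sg \<le> 1 * B1" using g(2)[of j] g(3)[of j] that(4) B1_nn
  proof (cases "0 \<le> es sg")
   case False
   thus ?thesis using g(2)[of j] B1_nn mult_nonneg_nonpos[of "g j" "es sg"] by linarith
  qed (intro mult_mono, auto)
  hence "(1 + 8 * g j * es sg) / (1 + 8 * B1) \<le> 1" using B1_nn by simp
  hence le: "p1 * ((1 + 8 * g j * es sg) / (1 + 8 * B1)) \<le> p1" using mult_left_mono[of _ 1 p1] a by (simp only: mult_1_right less_imp_le)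
  show ?thesis
  proof (cases "Q sg")
   case True thus ?thesis using le good[OF that(1,2,3) True that(5)] Z0[OF that(2), of sg] by linarith
  next
   case False thus ?thesis using le a ZQ[OF that(2) False] pr_nonneg[where \<phi>=\<phi> and t=j and k="ts - j", OF that(3) nn] by linarith
  qed
 qed
 {
  case 0
  show ?case
  proof (cases "-1/8 \<le> es sg")
   case True thus ?thesis using easy 0 by auto
  next
   case False
   have "j = T1" using 0 by simp
   have "(1 + 8 * g j * es sg) / (1 + 8 * B1) \<le> 0" using False B1_nn g(4) \<open>j = T1\<close> by (intro divide_nonpos_pos) auto
   hence "p1 * ((1 + 8 * g j * es sg) / (1 + 8 * B1)) \<le> 0" using mult_nonneg_nonpos[of p1] a by (simp only: less_imp_le)
   thus ?thesis using Z0[of j sg] pr_nonneg[where \<phi>=\<phi> and t=j and k="ts - j", OF 0(3) nn] \<open>j = T1\<close> by linarith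
  qed
 next
  case (Suc k)
  show ?case
  proof (cases "-1/8 \<le> es sg")
   case True thus ?thesis using easy Suc by auto
  next
   case False
   have jT: "j < T1" "Suc j + k = T1" using Suc.prems by auto
   obtain d where d: "ts - j = Suc d" "ts - Suc j = d" using jT T1 by (metis Suc_diff_Suc less_le_trans)
   \<comment> \<open>From below -1/8 one step cannot carry es above B1, so the induction hypothesis
     applies to the successor.\<close>
   have st: "es (step j sg i) \<le> B1" if "i < n" for i
   proof -
    have "xis j sg i \<bullet> dir \<le> norm (xis j sg i) * norm dir" by (rule norm_cauchy_schwarz)
    also have "\<dots> \<le> B2 * norm dir" by (intro mult_right_mono xis_B2 Suc.prems that) auto
    finally have "xis j sg i \<bullet> dir \<le> B1" unfolding B1_def by (simp add: mult.commute)
    moreover have "(1 - \<beta> j) * es sg \<le> 0" using False beta_le1[of j] by (intro mult_nonneg_nonpos) auto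
    ultimately show ?thesis unfolding es_step by linarith
   qed
   define w where "w = p1 / (1 + 8 * B1)"
   have wf: "p1 * ((1 + 8 * x * y) / (1 + 8 * B1)) = w + 8 * w * x * y" for x y unfolding w_def by (simp add: algebra_simps add_divide_distrib)
   \<comment> \<open>The recursion of g cancels the factor 1 - beta of \<open>A_es\<close>: the
     linear part is an exact martingale, and Z a supermartingale.\<close>
   have "w + 8 * w * g j * es sg - Z j sg \<le> w + 8 * w * g (Suc j) * A j es sg - A j (Z (Suc j)) sg"
    unfolding A_es g(1)[OF Suc.prems(1) jT(1)] using Zd[OF Suc.prems(1) jT(1) Suc.prems(3)] by (simp add: algebra_simps)
   also have "\<dots> = A j (\<lambda>sg. w + 8 * w * g (Suc j) * es sg - Z (Suc j) sg) sg"
    unfolding A_add A_diff A_const A_cmult by simp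
   also have "\<dots> \<le> A j (pr (Suc j) d \<phi>) sg"
    unfolding A_def
   proof (rule avg_mono)
    fix i assume "i < n"
    show "w + 8 * w * g (Suc j) * es (step j sg i) - Z (Suc j) (step j sg i) \<le> pr (Suc j) d \<phi> (step j sg i)"
     using Suc.IH[of "Suc j" "step j sg i"] Suc.prems jT st[OF \<open>i < n\<close>] step_S unfolding wf d(2) by auto
   qed
   also have "\<dots> = pr j (ts - j) \<phi> sg" unfolding d(1) by simp
   finally show ?thesis unfolding wf .
  qed
 }
qed

lemma decay_prod:
 assumes "t + k = T1"
 shows "(\<Prod>i\<in>{t..<T1}. 1 - \<beta> i) \<le> exp (- (tau T1 - tau t))"
 using assms
proof (induction k arbitrary: T1)
 case 0 thus ?case by simp
next
 case (Suc k)
 have T: "T1 = Suc (t + k)" using Suc.prems by simp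
 have "(\<Prod>i\<in>{t..<T1}. 1 - \<beta> i) = (\<Prod>i\<in>{t..<t + k}. 1 - \<beta> i) * (1 - \<beta> (t + k))" unfolding T by simp
 also have "\<dots> \<le> exp (- (tau (t + k) - tau t)) * exp (- \<beta> (t + k))"
 proof (rule mult_mono)
  show "1 - \<beta> (t + k) \<le> exp (- \<beta> (t + k))" using exp_ge_add_one_self[of "- \<beta> (t + k)"] by simp
 qed (use Suc.IH[of "t + k"] beta_le1 in auto)
 also have "\<dots> = exp (- (tau T1 - tau t))" unfolding T tau_Suc by (simp add: exp_add[symmetric])
 finally show ?case .
qed

lemma ev_beta:
 assumes "0 \<le> M"
 shows "\<forall>\<^sub>F T in sequentially. \<forall>t. win T t \<longrightarrow> M * \<beta> t \<le> 1"
proof -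
 obtain a1 a2 where sc: "scl a1 a2" using ex_scl by blast
 have ev: "\<forall>\<^sub>F T in sequentially. (M * (c * a2\<^sup>2)) * real T powr (-2/3) \<le> real T powr 0" by (rule ev_powr) simp
 show ?thesis using ev eventually_ge_at_top[of 1]
 proof eventually_elim
  case (elim T)
  show ?case
  proof (intro allI impI)
   fix t assume "win T t"
   have "M * \<beta> t \<le> M * (c * a2\<^sup>2 * real T powr (-2/3))"
    by (intro mult_left_mono beta_le_scale scl_hi[OF sc elim(2)] \<open>win T t\<close> assms)
   thus "M * \<beta> t \<le> 1" using elim by (simp add: mult.assoc)
  qed
 qed
qed

text \<open>Waiting for tau-time 2 ln T contracts es by T^(-2), so \<open>1 + 8 * g * es\<close> is
  at least 1/2 however negative es was at the start. The error from W leaving its bound is at most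
  T^(-1/2), negligible against T^(-gam) with gam < 1/3. The remaining tau-time suffices for
  \<open>succ\<close>.\<close>

lemma block:
 fixes m :: nat
 assumes fd: "fdr \<kappa>f \<mu>0" "0 < \<kappa>f" "0 < \<mu>0" "\<mu>0 \<le> 1" and eps: "0 < \<epsilon>" "\<epsilon> \<le> 1/100" and m: "20 \<le> m" "2 \<le> \<epsilon> * real m"
  and gam: "gam = 18 * \<epsilon> + (1 - sqrt \<mu>0 / 16) / 3 + 16 / real m" "gam < 1/3"
 shows "\<forall>\<^sub>F T in sequentially. \<forall>t ts. win T t \<and> t \<le> ts \<and> ts \<le> T \<and> 6 * ln (real T) \<le> tau ts - tau t \<longrightarrow>
  (\<forall>sg\<in>S. W sg \<le> real T powr (2/3 + \<epsilon>) \<longrightarrow>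
   1 / (8 * (1 + 8 * B1)) * real T powr (- gam) \<le> pr t (ts - t) (\<lambda>sg. of_bool (U ts sg \<le> real T powr (-3/10))) sg)"
proof -
 have m0: "0 < m" using m by simp
 obtain K where K: "0 \<le> K" and z: "\<forall>\<^sub>F T in sequentially. zr m K T" using ex_zr[OF m0] by blast
 define a where "a = 2/3 + 2 * \<epsilon>"
 define nd where "nd = norm dir"
 have b1: "0 < 1 + 8 * B1" using B1_nn by linarith
 have sm: "\<forall>\<^sub>F T in sequentially. \<forall>t sg. t \<le> T \<and> W sg \<le> real T powr (2/3 + \<epsilon>) \<longrightarrow> zz m K a T t sg \<le> real T powr (- 1/2)"
  using zz_small[OF m0 K, of \<epsilon> a "1/2"] m eps unfolding a_def by (simp add: algebra_simps)
 have s1: "\<forall>\<^sub>F T in sequentially. (8 * (1 + 8 * B1)) * real T powr (-1/2) \<le> real T powr (- gam)" by (rule ev_powr) (use gam(2) in linarith)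
 have s2: "\<forall>\<^sub>F T in sequentially. (16 * nd) * real T powr (-2 + (1/3 + \<epsilon> / 2)) \<le> real T powr 0" by (rule ev_powr) (use eps in simp)
 have s3: "\<forall>\<^sub>F T in sequentially. 1 * real T powr 0 \<le> real T powr 1" by (rule ev_powr) simp
 have bt: "\<forall>\<^sub>F T in sequentially. \<forall>t. win T t \<longrightarrow> (24 * real m) * \<beta> t \<le> 1" by (rule ev_beta) simp
 have l3: "\<forall>\<^sub>F T in sequentially. 1 \<le> ln (real T)"
  using filterlim_compose[OF ln_at_top filterlim_real_sequentially] by (simp add: filterlim_at_top)
 have sc: "\<forall>\<^sub>F T in sequentially. \<forall>t ts. win T t \<and> t \<le> ts \<and> ts \<le> T \<and> 3 * ln (real T) \<le> tau ts - tau t \<longrightarrow>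
  (\<forall>sg\<in>S. -1/8 \<le> es sg \<and> W sg \<le> real T powr (2/3 + 2 * \<epsilon>) \<longrightarrow>
   1/2 * real T powr (- 18 * \<epsilon> - (1 - sqrt \<mu>0 / 16) / 3 - 16 / real m) \<le> pr t (ts - t) (\<lambda>sg. of_bool (U ts sg \<le> real T powr (-3/10))) sg)"
  by (rule succ[OF fd eps m(1)]) (use m in simp)
 show ?thesis using sc z sm s1 s2 s3 bt l3 eventually_ge_at_top[of 1]
 proof (eventually_elim)
  case (elim T)
  have T: "1 \<le> real T" "0 < real T" using elim(9) by auto
  define p1 where "p1 = 1/2 * real T powr (- gam)"
  have gg: "- 18 * \<epsilon> - (1 - sqrt \<mu>0 / 16) / 3 - 16 / real m = - gam" unfolding gam(1) by simp
  have gpos: "0 \<le> gam" unfolding gam(1) using eps fd by (intro add_nonneg_nonneg divide_nonneg_nonneg) (auto simp: real_sqrt_le_1_iff intro: order_trans[of _ 1])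
  have p1: "0 < p1" "p1 \<le> 1"
  proof -
   show "0 < p1" unfolding p1_def using T by simp
   have "real T powr (- gam) \<le> real T powr 0" using T gpos by (intro powr_mono) auto
   thus "p1 \<le> 1" unfolding p1_def using T by simp
  qed
  note E1 = elim(1)[unfolded gg, folded p1_def]
  show ?case
  proof (intro allI impI ballI)
   fix t ts sg assume as: "win T t \<and> t \<le> ts \<and> ts \<le> T \<and> 6 * ln (real T) \<le> tau ts - tau t" and sg: "sg \<in> S"
    and Wb: "W sg \<le> real T powr (2/3 + \<epsilon>)"
   define \<phi> where "\<phi> = (\<lambda>sg. of_bool (U ts sg \<le> real T powr (-3/10)) :: real)"
   have "W sg \<le> real T powr (2/3 + 2 * \<epsilon>)" using Wb T eps powr_mono[of "2/3 + \<epsilon>" "2/3 + 2 * \<epsilon>" "real T"] by linarith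
   have fin: "1 / (8 * (1 + 8 * B1)) * real T powr (- gam) = p1 / (4 * (1 + 8 * B1))" unfolding p1_def by simp
   show "1 / (8 * (1 + 8 * B1)) * real T powr (- gam) \<le> pr t (ts - t) (\<lambda>sg. of_bool (U ts sg \<le> real T powr (-3/10))) sg"
   proof (cases "-1/8 \<le> es sg")
    case True
    have "p1 \<le> pr t (ts - t) \<phi> sg" unfolding \<phi>_def using E1[rule_format, of t ts sg] as sg True \<open>W sg \<le> real T powr (2/3 + 2 * \<epsilon>)\<close> elim(8) by auto
    moreover have "p1 / (4 * (1 + 8 * B1)) \<le> p1" using p1 B1_nn by (simp add: divide_le_eq)
    ultimately show ?thesis unfolding fin \<phi>_def by linarith
   next
    case False
    obtain k where k: "t + k \<le> ts" "2 * ln (real T) \<le> tau (t + k) - tau t" "tau (t + k) - tau t \<le> 2 * ln (real T) + 1"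
     using window_exists[of "2 * ln (real T)" t ts] as elim(8) by auto
    define T1 where "T1 = t + k"
    define g where "g = (\<lambda>j. \<Prod>i\<in>{j..<T1}. 1 - \<beta> i)"
    have t3: "3 * ln (real T) \<le> tau ts - tau j" if "j \<le> T1" for j
     using tau_mono[OF that] k as elim(8) unfolding T1_def by linarith
    have tT1: "t \<le> T1" "T1 \<le> ts" "T1 \<le> T" unfolding T1_def using k as by auto
    have main: "p1 * ((1 + 8 * g t * es sg) / (1 + 8 * B1)) - zz m K a T t sg \<le> pr t (ts - t) \<phi> sg"
    proof (rule recover[where Q = "\<lambda>sg. W sg \<le> real T powr a" and Z = "zz m K a T", OF p1])
     show "0 \<le> \<phi> sg" for sg unfolding \<phi>_def by simp
     show "g j = (1 - \<beta> j) * g (Suc j)" if "t \<le> j" "j < T1" for j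
      unfolding g_def using that by (simp add: prod.atLeast_Suc_lessThan)
     show "0 \<le> g j" for j unfolding g_def using beta_le1 by (intro prod_nonneg) auto
     show "g j \<le> 1" for j unfolding g_def using beta_le1 beta_pos by (intro prod_le_1) (auto simp: less_imp_le)
     show "g T1 = 1" unfolding g_def by simp
     show "T1 \<le> ts" by (rule tT1)
     show "0 \<le> zz m K a T j sg" if "j \<le> T1" for j sg using zz_nonneg[OF K] that tT1 by simp
     show "A j (zz m K a T (Suc j)) sg \<le> zz m K a T j sg" if j: "t \<le> j" "j < T1" "sg \<in> S" for j sg
     proof (rule zz_drift[OF elim(2)])
      have "win T j" using as j tT1 unfolding win_def by auto
      thus "24 * real m * \<beta> j \<le> 1" using elim(7) by simp
     qed (use j tT1 in auto)
     show "1 \<le> zz m K a T j sg" if "j \<le> T1" "\<not> W sg \<le> real T powr a" for j sg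
      by (rule zz_big[OF K _ elim(9)]) (use that tT1 in auto)
     show "p1 \<le> pr j (ts - j) \<phi> sg" if j: "t \<le> j" "j \<le> T1" "sg \<in> S" "W sg \<le> real T powr a" "-1/8 \<le> es sg" for j sg
     proof -
      have "win T j" using as j tT1 unfolding win_def by auto
      thus ?thesis unfolding \<phi>_def using E1[rule_format, of j ts sg] as j tT1 t3[OF j(2)] unfolding a_def by auto
     qed
     show "t \<le> t" "t + k = T1" "sg \<in> S" unfolding T1_def using sg by auto
     show "es sg \<le> B1" using False B1_nn by linarith
    qed
    have "zz m K a T t sg \<le> real T powr (-1/2)" using elim(3) Wb as unfolding win_def by blast
    also have "\<dots> \<le> p1 / (4 * (1 + 8 * B1))" using elim(4) b1 unfolding p1_def by (simp add: field_simps)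
    finally have z: "zz m K a T t sg \<le> p1 / (4 * (1 + 8 * B1))" .
    have ge: "- 1/2 \<le> 8 * g t * es sg"
    proof -
     have "g t \<le> exp (- (tau T1 - tau t))" unfolding g_def by (rule decay_prod[of t k]) (simp add: T1_def)
     also have "\<dots> \<le> exp ((-2) * ln (real T))" using k unfolding T1_def by simp
     also have "\<dots> = real T powr (-2)" by (rule exp_mult_ln[OF T(2)])
     finally have g: "g t \<le> real T powr (-2)" .
     have "\<bar>es sg\<bar> \<le> norm (snd sg) * nd" unfolding es_def nd_def by (rule Cauchy_Schwarz_ineq2)
     also have "\<dots> \<le> real T powr (1/3 + \<epsilon>/2) * nd"
     proof (rule mult_right_mono)
      have "sqrt (W sg) \<le> sqrt (real T powr (2/3 + \<epsilon>))" using Wb by simp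
      also have "\<dots> = real T powr (1/3 + \<epsilon>/2)" using T by (simp add: powr_half_sqrt[symmetric] powr_powr field_simps)
      finally show "norm (snd sg) \<le> real T powr (1/3 + \<epsilon>/2)" unfolding norm_W .
     qed (simp add: nd_def)
     finally have e: "\<bar>es sg\<bar> \<le> real T powr (1/3 + \<epsilon>/2) * nd" .
     have g0: "0 \<le> g t" unfolding g_def using beta_le1 by (intro prod_nonneg) auto
     have "g t * \<bar>es sg\<bar> \<le> real T powr (-2) * (real T powr (1/3 + \<epsilon>/2) * nd)"
      using g e g0 by (intro mult_mono) auto
     also have "\<dots> = nd * real T powr (-2 + (1/3 + \<epsilon>/2))" by (simp only: powr_add mult_ac)
     also have "\<dots> \<le> 1/16" using elim(5) T by simp
     finally have "g t * \<bar>es sg\<bar> \<le> 1/16" .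
     moreover have "g t * (- \<bar>es sg\<bar>) \<le> g t * es sg" using g0 by (intro mult_left_mono) auto
     ultimately show ?thesis by simp
    qed
    have "p1 / (2 * (1 + 8 * B1)) \<le> p1 * ((1 + 8 * g t * es sg) / (1 + 8 * B1))"
    proof -
     have "p1 / (2 * (1 + 8 * B1)) = p1 * ((1/2) / (1 + 8 * B1))" by simp
     also have "\<dots> \<le> p1 * ((1 + 8 * g t * es sg) / (1 + 8 * B1))" using ge b1 p1 by (intro mult_left_mono divide_right_mono) auto
     finally show ?thesis .
    qed
    moreover have "p1 / (2 * y) = 2 * (p1 / (4 * y))" for y :: real by simp
    moreover have "x \<le> w" if "2 * x \<le> y" "y - v \<le> w" "v \<le> x" for x y v w :: real using that by linarith
    ultimately have "p1 / (4 * (1 + 8 * B1)) \<le> pr t (ts - t) \<phi> sg" using main z by metis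
    thus ?thesis unfolding fin \<phi>_def .
   qed
  qed
 qed
qed

section \<open>The probability of a dead state\<close>

definition dd :: "'x \<times> 'h \<Rightarrow> real" where "dd sg = of_bool (\<not> alive (1/2) sg)"

lemma dd_bd: "0 \<le> dd sg" "dd sg \<le> 1" unfolding dd_def by auto

lemma pr_le_const: "sg \<in> S \<Longrightarrow> (\<And>sg. sg \<in> S \<Longrightarrow> \<phi> sg \<le> a) \<Longrightarrow> pr t k \<phi> sg \<le> a"
 using pr_mono[of sg \<phi> "\<lambda>_. a" t k] by simp

text \<open>Both terms of the exit bound meet the target: the fifth power of T^(-3/10) is T^(-3/2),
  and eta^5 over tau-time T^(1/3) gives T^(-5/3 + 1/3) = T^(-4/3).\<close>

lemma stay:
 "\<exists>E\<ge>0. \<forall>\<^sub>F T in sequentially. \<forall>t. \<forall>sg\<in>S. win T t \<and> U t sg \<le> real T powr (-3/10) \<longrightarrow>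
   pr t (T - t) dd sg \<le> E * real T powr (-4/3)"
proof -
 obtain K e0 where K: "0 \<le> K" and e0: "0 < e0" and ex: "exr K e0" using ex_exr by auto
 obtain a1 a2 where sc: "scl a1 a2" using ex_scl by auto
 note a = scl_pos[OF sc]
 have w0p: "0 < w0 ^ 5" using w0_pos by simp
 define E where "E = 2 / w0 ^ 5 + K * a2 ^ 5 * (c * a2\<^sup>2 + 1) / w0 ^ 5"
 have E: "0 \<le> E" unfolding E_def using w0p K a c_pos by (intro add_nonneg_nonneg divide_nonneg_pos mult_nonneg_nonneg) auto
 have x: "0 \<le> K * a2 ^ 5 * (c * a2\<^sup>2 + 1) / w0 ^ 5" using w0p K a c_pos by (intro divide_nonneg_pos mult_nonneg_nonneg) auto
 have e1: "\<forall>\<^sub>F T in sequentially. (a2 / e0) * real T powr (-1/3) \<le> real T powr 0" by (rule ev_powr) simp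
 have "\<forall>\<^sub>F T in sequentially. \<forall>t. \<forall>sg\<in>S. win T t \<and> U t sg \<le> real T powr (-3/10) \<longrightarrow>
   pr t (T - t) dd sg \<le> E * real T powr (-4/3)"
  using e1 eventually_ge_at_top[of 1]
 proof eventually_elim
  case (elim T)
  define P where "P x = real T powr x" for x
  have T: "1 \<le> real T" "0 < real T" using elim(2) by auto
  have P0: "0 < P x" for x unfolding P_def using T by simp
  have Pz: "P 0 = 1" unfolding P_def using T by simp
  have PP: "P x * P y = P (x + y)" for x y unfolding P_def by (simp add: powr_add)
  have P5: "P x ^ 5 = P (5 * x)" for x unfolding P_def using T by (simp add: powr_power mult.commute)
  have Pm: "x \<le> y \<Longrightarrow> P x \<le> P y" for x y unfolding P_def using T by (intro powr_mono) auto
  show ?case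
  proof (intro allI ballI impI)
   fix t sg assume sg: "sg \<in> S" and as: "win T t \<and> U t sg \<le> real T powr (-3/10)"
   define k where "k = T - t"
   have tk: "t + k = T" unfolding k_def using as unfolding win_def by auto
   have et: "\<eta> t \<le> a2 * P (-1/3)" unfolding P_def using scl_hi[OF sc elim(2)] as by simp
   have "a2 / e0 * P (-1/3) \<le> 1" using elim(1) T unfolding P_def by simp
   hence "a2 * P (-1/3) \<le> e0" using e0 by (simp add: pos_divide_le_eq)
   hence ete0: "\<eta> t \<le> e0" using et by linarith
   have e5: "\<eta> t ^ 5 \<le> a2 ^ 5 * P (-5/3)" unfolding P_def by (rule eta5_le[OF et[unfolded P_def] elim(2)])
   define \<Delta> where "\<Delta> = tau (t + k) - tau t"
   have D: "0 \<le> \<Delta>" "\<Delta> \<le> c * a2\<^sup>2 * P (1/3)"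
    unfolding P_def \<Delta>_def using tau_diff_le[OF sc elim(2)] as tau_mono[of t "t + k"] tk by auto
   have u5: "U t sg ^ 5 \<le> P (-3/2)"
   proof -
    have "U t sg ^ 5 \<le> P (-3/10) ^ 5" using as U_lower(3)[OF sg, of t] unfolding P_def by (intro power_mono) auto
    thus ?thesis unfolding P5 by simp
   qed
   have "pr t k dd sg \<le> pr t k (\<lambda>sg. of_bool (w0 < U (t + k) sg)) sg"
   proof (rule pr_mono[OF sg])
    fix sg assume s: "sg \<in> S"
    show "dd sg \<le> of_bool (w0 < U (t + k) sg)" using alive_W[of sg] U_lower(1)[OF s, of "t + k"] unfolding dd_def by fastforce
   qed
   also have "\<dots> \<le> (1 / w0 ^ 5 + exp (- 2 * \<Delta>) / w0 ^ 5) * U t sg ^ 5 + K * \<eta> t ^ 5 * (\<Delta> / w0 ^ 5 + 1 / w0 ^ 5)"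
    using ex[unfolded exr_def, rule_format, of t sg w0 k] ete0 sg w0_pos unfolding \<Delta>_def by simp
   also have "\<dots> \<le> (1 / w0 ^ 5 + 1 / w0 ^ 5) * P (-3/2) + K * (a2 ^ 5 * P (-5/3)) * (c * a2\<^sup>2 * P (1/3) / w0 ^ 5 + P (1/3) / w0 ^ 5)"
    using D w0p u5 e5 K P0[of "-5/3"] P0[of "1/3"] Pm[of 0 "1/3"] Pz a U_lower(3)[OF sg, of t] eta_pos[of t]
    by (intro add_mono mult_mono divide_right_mono add_left_mono) auto
   also have "\<dots> = 2 / w0 ^ 5 * P (-3/2) + K * a2 ^ 5 * (c * a2\<^sup>2 + 1) / w0 ^ 5 * (P (-5/3) * P (1/3))"
    by (simp add: algebra_simps add_divide_distrib)
   also have "P (-5/3) * P (1/3) = P (-4/3)" unfolding PP by simp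
   also have "2 / w0 ^ 5 * P (-3/2) + K * a2 ^ 5 * (c * a2\<^sup>2 + 1) / w0 ^ 5 * P (-4/3) \<le> E * P (-4/3)"
    unfolding E_def distrib_right using Pm[of "-3/2" "-4/3"] w0p x by (intro add_mono mult_left_mono) auto
   finally show "pr t (T - t) dd sg \<le> E * real T powr (-4/3)" unfolding k_def P_def .
  qed
 qed
 thus ?thesis using E by blast
qed

text \<open>In each block of tau-length at most 6 ln T + 1 a trial succeeds with probability at
  least p; afterwards E bounds the probability of being dead at T, and after a failure the other
  blocks remain. States with W above T^a are charged to zz; being a supermartingale, it is counted
  only once and not once per block.\<close>

lemma iterate:
 fixes m :: nat
 assumes p: "0 \<le> p" "p \<le> 1" and E: "0 \<le> E" and T: "1 \<le> T" and K: "0 \<le> K" and z: "zr m K T"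
  and bt: "\<And>t. win T t \<Longrightarrow> 24 * real m * \<beta> t \<le> 1"
  and st: "\<And>t sg. sg \<in> S \<Longrightarrow> win T t \<Longrightarrow> U t sg \<le> real T powr (-3/10) \<Longrightarrow> pr t (T - t) dd sg \<le> E"
  and bl: "\<And>t ts sg. win T t \<Longrightarrow> t \<le> ts \<Longrightarrow> ts \<le> T \<Longrightarrow> 6 * ln (real T) \<le> tau ts - tau t \<Longrightarrow> sg \<in> S \<Longrightarrow> W sg \<le> real T powr a \<Longrightarrow>
   p \<le> pr t (ts - t) (\<lambda>sg. of_bool (U ts sg \<le> real T powr (-3/10))) sg"
 shows "win T t \<Longrightarrow> sg \<in> S \<Longrightarrow> real j * (6 * ln (real T) + 1) \<le> tau T - tau t \<Longrightarrow>
  pr t (T - t) dd sg \<le> E + (1 - p) ^ j + zz m K a T t sg"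
proof (induction j arbitrary: t sg)
 case 0
 have "pr t (T - t) dd sg \<le> 1" by (rule pr_le_const[OF 0(2)]) (rule dd_bd)
 thus ?case using E zz_nonneg[OF K, of t T m a sg] 0(1) unfolding win_def by simp
next
 case (Suc j)
 have tT: "t \<le> T" using Suc.prems unfolding win_def by simp
 have l0: "0 \<le> ln (real T)" using T by simp
 have "0 \<le> real j * (6 * ln (real T) + 1)" using l0 by simp
 moreover have "real (Suc j) * (6 * ln (real T) + 1) = real j * (6 * ln (real T) + 1) + (6 * ln (real T) + 1)" by (simp add: algebra_simps)
 ultimately have cl: "6 * ln (real T) \<le> tau T - tau t" "real j * (6 * ln (real T) + 1) + (6 * ln (real T) + 1) \<le> tau T - tau t"
  using Suc.prems(3) by linarith+
 obtain k where k: "t + k \<le> T" "6 * ln (real T) \<le> tau (t + k) - tau t" "tau (t + k) - tau t \<le> 6 * ln (real T) + 1"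
  using window_exists[of "6 * ln (real T)" t T] l0 tT cl(1) by auto
 define ts where "ts = t + k"
 have ws: "win T ts" unfolding ts_def by (rule win_add[OF Suc.prems(1) k(1)])
 have rem: "real j * (6 * ln (real T) + 1) \<le> tau T - tau ts" using cl(2) k unfolding ts_def by linarith
 have q: "0 \<le> (1 - p) ^ j" using p by simp
 show ?case
 proof (cases "W sg \<le> real T powr a")
  case False
  have "pr t (T - t) dd sg \<le> 1" by (rule pr_le_const[OF Suc.prems(2)]) (rule dd_bd)
  moreover have "1 \<le> zz m K a T t sg" using zz_big[OF K tT T] False by simp
  moreover have "0 \<le> (1 - p) ^ Suc j" using p by simp
  ultimately show ?thesis using E by linarith
 next
  case True
  define G where "G = (\<lambda>sg. U ts sg \<le> real T powr (-3/10))"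
  have pk: "p \<le> pr t k (\<lambda>sg. of_bool (G sg)) sg"
   using bl[OF Suc.prems(1), of ts sg] k True Suc.prems(2) unfolding ts_def G_def by simp
  have Tk: "T - t = k + (T - ts)" unfolding ts_def using k by simp
  have "pr t (T - t) dd sg = pr t k (pr ts (T - ts) dd) sg" unfolding Tk pr_plus ts_def ..
  \<comment> \<open>The induction hypothesis is used in both cases except that success replaces
    \<open>(1 - p) ^ j\<close> by 0.\<close>
  also have "\<dots> \<le> pr t k (\<lambda>sg. (E + (1 - p) ^ j) - (1 - p) ^ j * of_bool (G sg) + zz m K a T ts sg) sg"
  proof (rule pr_mono[OF Suc.prems(2)])
   fix sg assume s: "sg \<in> S"
   show "pr ts (T - ts) dd sg \<le> (E + (1 - p) ^ j) - (1 - p) ^ j * of_bool (G sg) + zz m K a T ts sg"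
    using Suc.IH[OF ws s rem] st[OF s ws] zz_nonneg[OF K, of ts T m a sg] ws unfolding G_def win_def by (cases "G sg") (auto simp: G_def)
  qed
  also have "\<dots> = E + (1 - p) ^ j - (1 - p) ^ j * pr t k (\<lambda>sg. of_bool (G sg)) sg + pr t k (zz m K a T ts) sg"
   by (simp only: pr_add pr_diff pr_cmult pr_const)
  also have "\<dots> \<le> E + (1 - p) ^ j - (1 - p) ^ j * p + zz m K a T t sg"
   using zz_pr[OF z, of t k sg a] k bt[OF Suc.prems(1)] Suc.prems(2) mult_left_mono[OF pk q] unfolding ts_def by linarith
  also have "\<dots> = E + (1 - p) ^ Suc j + zz m K a T t sg" by (simp add: algebra_simps)
  finally show ?thesis .
 qed
qed

text \<open>|e| grows by at most B2 per step, deterministically. This bridges the fixed number of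
  early steps during which the asymptotic estimates are not yet valid.\<close>

lemma pr_growth:
 assumes "\<And>sg. sg \<in> S \<Longrightarrow> norm (snd sg) \<le> R + real k * B2 \<Longrightarrow> \<phi> sg \<le> a"
 shows "sg \<in> S \<Longrightarrow> norm (snd sg) \<le> R \<Longrightarrow> pr t k \<phi> sg \<le> a"
 using assms
proof (induction k arbitrary: t sg R)
 case (Suc k)
 show ?case unfolding pr.simps A_def
 proof (rule avg_le[OF n_pos])
  fix i assume i: "i < n"
  show "pr (Suc t) k \<phi> (step t sg i) \<le> a"
  proof (rule Suc.IH[of _ "R + B2"])
   have "norm (snd (step t sg i)) \<le> norm ((1 - \<beta> t) *\<^sub>R snd sg) + norm (xis t sg i)"
    unfolding step_def xis_def snd_conv by (rule norm_triangle_ineq)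
   also have "norm ((1 - \<beta> t) *\<^sub>R snd sg) \<le> 1 * norm (snd sg)"
    unfolding norm_scaleR using beta_le1[of t] beta_pos[of t] by (intro mult_right_mono) auto
   finally show "norm (snd (step t sg i)) \<le> R + B2" using xis_B2[OF Suc.prems(1) i, of t] Suc.prems(2) by simp
   show "\<phi> sg \<le> a" if "sg \<in> S" "norm (snd sg) \<le> R + B2 + real k * B2" for sg
    using Suc.prems(3)[OF that(1)] that(2) by (simp add: algebra_simps)
  qed (rule step_S[OF Suc.prems(1)])
 qed
qed simp

lemma ev_beta_from:
 assumes "0 \<le> M"
 shows "\<exists>t0. \<forall>t\<ge>t0. M * \<beta> t \<le> 1"
proof -
 have "\<forall>\<^sub>F T in sequentially. \<forall>t. win T t \<longrightarrow> M * \<beta> t \<le> 1" by (rule ev_beta[OF assms])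
 then obtain T where "\<forall>t. win T t \<longrightarrow> M * \<beta> t \<le> 1" unfolding eventually_sequentially by blast
 hence T: "M * \<beta> T \<le> 1" unfolding win_def by auto
 show ?thesis
 proof (intro exI[of _ T] allI impI)
  fix t assume "T \<le> t"
  thus "M * \<beta> t \<le> 1" using mult_left_mono[OF beta_antimono[of T t] assms] T by linarith
 qed
qed

text \<open>With gam < th < 1/3 there is room for T^th blocks in the second half of the run, and
  T^th failures in a row, each of probability at most 1 - b * T^(-gam), are less likely than any
  fixed power of T.\<close>

lemma dead_prob:
 "\<exists>K\<ge>0. \<forall>\<^sub>F T in sequentially. \<forall>sg\<in>S. norm (snd sg) \<le> R \<longrightarrow> pr 0 T dd sg \<le> K * real T powr (-4/3)"
proof -
 obtain \<kappa>f \<mu>0 where fd: "fdr \<kappa>f \<mu>0" "0 < \<kappa>f" "0 < \<mu>0" "\<mu>0 \<le> 1" using ex_fdr by blast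
 define s where "s = sqrt \<mu>0"
 have s: "0 < s" "s \<le> 1" unfolding s_def using fd by auto
 \<comment> \<open>With these values 18 eps + 16/m is at most 0.012 s, below the gain s/48 in the
   survival exponent; moreover eps * m is at least 3, as the moment bounds require.\<close>
 define \<epsilon> where "\<epsilon> = s / 2000"
 define m where "m = nat \<lceil>6000 / s\<rceil>"
 have mr: "6000 / s \<le> real m" unfolding m_def by linarith
 have em: "3 \<le> \<epsilon> * real m"
 proof -
  have "\<epsilon> * (6000 / s) \<le> \<epsilon> * real m" using mr s unfolding \<epsilon>_def by (intro mult_left_mono) auto
  moreover have "\<epsilon> * (6000 / s) = 3" unfolding \<epsilon>_def using s by simp
  ultimately show ?thesis by simp
 qed
 have m: "20 \<le> m" "0 < m"
 proof -
  have "6000 \<le> 6000 / s" using s by (simp add: pos_le_divide_eq)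
  hence "20 \<le> real m" using mr by linarith
  thus "20 \<le> m" "0 < m" by auto
 qed
 have eps: "0 < \<epsilon>" "\<epsilon> \<le> 1/100" unfolding \<epsilon>_def using s by auto
 define gam where "gam = 18 * \<epsilon> + (1 - sqrt \<mu>0 / 16) / 3 + 16 / real m"
 have g: "gam < 1/3"
 proof -
  have "16 / real m \<le> 16 / (6000 / s)" using mr s m(2) by (intro divide_left_mono mult_pos_pos) auto
  hence "16 / real m \<le> 16 / 6000 * s" by simp
  moreover have "(1 - s / 16) / 3 = 1/3 - s / 48" by (simp add: field_simps)
  ultimately show ?thesis unfolding gam_def s_def[symmetric] \<epsilon>_def using s by linarith
 qed
 define th where "th = (1/3 + gam) / 2"
 have th: "gam < th" "th < 1/3" unfolding th_def using g by auto
 define a where "a = 2/3 + \<epsilon>"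
 obtain K where K: "0 \<le> K" and z: "\<forall>\<^sub>F T in sequentially. zr m K T" using ex_zr[OF m(2)] by blast
 obtain E where E: "0 \<le> E" and st: "\<forall>\<^sub>F T in sequentially. \<forall>t. \<forall>sg\<in>S. win T t \<and> U t sg \<le> real T powr (-3/10) \<longrightarrow>
   pr t (T - t) dd sg \<le> E * real T powr (-4/3)" using stay by blast
 obtain t0 where t0: "\<And>t. t0 \<le> t \<Longrightarrow> (24 * real m) * \<beta> t \<le> 1" using ev_beta_from[of "24 * real m"] by auto
 obtain a1 a2 where sc: "scl a1 a2" using ex_scl by auto
 note ap = scl_pos[OF sc]
 define d where "d = c * a1\<^sup>2 / 2"
 have d: "0 < d" unfolding d_def using c_pos ap by simp
 define b where "b = 1 / (8 * (1 + 8 * B1))"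
 have b: "0 < b" unfolding b_def using B1_nn by (intro divide_pos_pos) auto
 have b1: "b \<le> 1" unfolding b_def using B1_nn by simp
 have gp: "0 \<le> gam" unfolding gam_def s_def[symmetric] using eps s by (intro add_nonneg_nonneg) auto
 have bl: "\<forall>\<^sub>F T in sequentially. \<forall>t ts. win T t \<and> t \<le> ts \<and> ts \<le> T \<and> 6 * ln (real T) \<le> tau ts - tau t \<longrightarrow>
  (\<forall>sg\<in>S. W sg \<le> real T powr a \<longrightarrow> b * real T powr (- gam) \<le> pr t (ts - t) (\<lambda>sg. of_bool (U ts sg \<le> real T powr (-3/10))) sg)"
  unfolding a_def b_def by (rule block[OF fd eps m(1) _ gam_def g]) (use em in simp)
 have bt: "\<forall>\<^sub>F T in sequentially. \<forall>t. win T t \<longrightarrow> (24 * real m) * \<beta> t \<le> 1" by (rule ev_beta) simp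
 have sm: "\<forall>\<^sub>F T in sequentially. \<forall>t sg. t \<le> T \<and> W sg \<le> real T powr (2/3 + 0) \<longrightarrow> zz m K a T t sg \<le> real T powr (- (4/3))"
  by (rule zz_small[OF m(2) K]) (use em in \<open>simp_all add: a_def\<close>)
 define M where "M = (R + real t0 * B2)\<^sup>2"
 \<comment> \<open>Half of each gap between exponents is kept to swallow logarithms through
   \<open>ln x \<le> x powr e / e\<close>.\<close>
 define e where "e = (1/3 - th) / 2"
 define e' where "e' = (th - gam) / 2"
 have ee: "0 < e" "0 < e'" "th + e < 1/3" "th - gam = e' + e'" unfolding e_def e'_def using th by (auto simp: field_simps)
 have v1: "\<forall>\<^sub>F T in sequentially. M * real T powr 0 \<le> real T powr (2/3)" by (rule ev_powr) simp
 have v2: "\<forall>\<^sub>F T in sequentially. (14 / e / d) * real T powr (th + e) \<le> real T powr (1/3)" by (rule ev_powr[OF ee(3)])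
 have v3: "\<forall>\<^sub>F T in sequentially. (4/3 / e' / b) * real T powr e' \<le> real T powr (e' + e')" by (rule ev_powr) (use ee in simp)
 have v4: "\<forall>\<^sub>F T in sequentially. 1 \<le> ln (real T)"
  using filterlim_compose[OF ln_at_top filterlim_real_sequentially] by (simp add: filterlim_at_top)
 have "\<forall>\<^sub>F T in sequentially. \<forall>sg\<in>S. norm (snd sg) \<le> R \<longrightarrow> pr 0 T dd sg \<le> (E + 2) * real T powr (-4/3)"
  using z st bl bt sm v1 v2 v3 v4 eventually_ge_at_top[of "2 * t0 + 2"]
 proof eventually_elim
  case (elim T)
  have T: "1 \<le> real T" "0 < real T" "1 \<le> T" using elim(10) by auto
  define t1 where "t1 = T div 2"
  have t1: "win T t1" "t0 \<le> t1" "t1 \<le> T" unfolding t1_def win_def using elim(10) by auto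
  define p where "p = b * real T powr (- gam)"
  have p: "0 \<le> p" "p \<le> 1"
  proof -
   show "0 \<le> p" unfolding p_def using b by simp
   have "real T powr (- gam) \<le> real T powr 0" using T gp by (intro powr_mono) auto
   hence "b * real T powr (- gam) \<le> 1 * 1" using b b1 T by (intro mult_mono) auto
   thus "p \<le> 1" unfolding p_def by simp
  qed
  define J where "J = nat \<lceil>real T powr th\<rceil>"
  have th0: "0 \<le> th" using th gp by simp
  have Tth: "1 \<le> real T powr th" using ge_one_powr_ge_zero[OF T(1) th0] .
  have J: "real T powr th \<le> real J" "real J \<le> 2 * real T powr th" unfolding J_def using Tth by linarith+
  have clock: "real J * (6 * ln (real T) + 1) \<le> tau T - tau t1"
  proof -
   have "ln (real T) \<le> real T powr e / e" by (rule ln_powr_bound) (use T ee in auto)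
   hence "6 * ln (real T) + 1 \<le> 7 * (real T powr e / e)" using elim(9) by linarith
   hence "real J * (6 * ln (real T) + 1) \<le> (2 * real T powr th) * (7 * (real T powr e / e))"
    using J elim(9) by (intro mult_mono) auto
   also have "\<dots> = 14 / e * real T powr (th + e)" by (simp add: powr_add)
   also have "\<dots> \<le> d * real T powr (1/3)" using mult_left_mono[OF elim(7), of d] d by simp
   also have "\<dots> = real T / 2 * (c * a1\<^sup>2 * real T powr (-2/3))"
   proof -
    have "real T powr (1/3) = real T powr 1 * real T powr (-2/3)" unfolding powr_add[symmetric] by simp
    thus ?thesis unfolding d_def using T by simp
   qed
   also have "\<dots> \<le> real (T - t1) * (c * a1\<^sup>2 * real T powr (-2/3))"
    unfolding t1_def using c_pos by (intro mult_right_mono) (auto simp: of_nat_diff)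
   also have "\<dots> \<le> tau (t1 + (T - t1)) - tau t1" by (rule tau_diff_ge[OF sc T(3)]) (use t1 in simp)
   finally show ?thesis using t1 by simp
  qed
  have pJ: "(1 - p) ^ J \<le> real T powr (-4/3)"
  proof -
   have "4/3 * ln (real T) \<le> 4/3 * (real T powr e' / e')" by (intro mult_left_mono ln_powr_bound) (use T ee in auto)
   also have "\<dots> \<le> b * real T powr (e' + e')" using elim(8) b ee by (simp add: field_simps)
   also have "\<dots> = p * real T powr th" unfolding p_def ee(4)[symmetric] by (simp add: powr_diff powr_minus field_simps)
   also have "\<dots> \<le> p * real J" using J p by (intro mult_left_mono) auto
   finally have q: "4/3 * ln (real T) \<le> p * real J" .
   have "(1 - p) ^ J \<le> exp (- p) ^ J" using exp_ge_add_one_self[of "- p"] p by (intro power_mono) auto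
   also have "\<dots> = exp (- (p * real J))" by (simp add: exp_of_nat_mult[symmetric] mult.commute)
   also have "\<dots> \<le> exp ((-4/3) * ln (real T))" using q by simp
   also have "\<dots> = real T powr (-4/3)" by (rule exp_mult_ln[OF T(2)])
   finally show ?thesis .
  qed
  have it: "pr t1 (T - t1) dd sg \<le> E * real T powr (-4/3) + (1 - p) ^ J + zz m K a T t1 sg" if "sg \<in> S" for sg
  proof (rule iterate[OF p _ T(3) K elim(1)])
   show "0 \<le> E * real T powr (-4/3)" using E by simp
   show "24 * real m * \<beta> t \<le> 1" if "win T t" for t using elim(4) that by simp
   show "pr t (T - t) dd sg \<le> E * real T powr (-4/3)" if "sg \<in> S" "win T t" "U t sg \<le> real T powr (-3/10)" for t sg
    using elim(2) that by blast
   show "p \<le> pr t (ts - t) (\<lambda>sg. of_bool (U ts sg \<le> real T powr (-3/10))) sg"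
    if "win T t" "t \<le> ts" "ts \<le> T" "6 * ln (real T) \<le> tau ts - tau t" "sg \<in> S" "W sg \<le> real T powr a" for t ts sg
    unfolding p_def using elim(3)[rule_format, of t ts sg] that by blast
  qed (use t1 that clock in auto)
  show ?case
  proof (intro ballI impI)
   fix sg assume sg: "sg \<in> S" and R: "norm (snd sg) \<le> R"
   \<comment> \<open>Up to t0 only deterministic growth is used, which leaves W below a constant and
     hence below T^(2/3); from t0 on zz is a supermartingale.\<close>
   have "pr 0 t1 (zz m K a T t1) sg = pr 0 t0 (pr t0 (t1 - t0) (zz m K a T t1)) sg"
    using pr_plus[of 0 t0 "t1 - t0" "zz m K a T t1" sg] t1 by simp
   also have "\<dots> \<le> real T powr (- (4/3))"
   proof (rule pr_growth[OF _ sg R])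
    fix sg assume s: "sg \<in> S" and n: "norm (snd sg) \<le> R + real t0 * B2"
    have "W sg \<le> M" unfolding W_def M_def using n by (intro power_mono) auto
    hence "W sg \<le> real T powr (2/3 + 0)" using elim(6) T by simp
    moreover have "pr t0 (t1 - t0) (zz m K a T (t0 + (t1 - t0))) sg \<le> zz m K a T t0 sg"
     by (rule zz_pr[OF elim(1)]) (use t1 t0[of t0] s in auto)
    ultimately show "pr t0 (t1 - t0) (zz m K a T t1) sg \<le> real T powr (- (4/3))"
     using elim(5)[rule_format, of t0 sg] t1 by simp
   qed
   finally have zb: "pr 0 t1 (zz m K a T t1) sg \<le> real T powr (-4/3)" by simp
   have "pr 0 T dd sg = pr 0 t1 (pr t1 (T - t1) dd) sg" using pr_plus[of 0 t1 "T - t1" dd sg] t1 by simp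
   also have "\<dots> \<le> pr 0 t1 (\<lambda>sg. (E * real T powr (-4/3) + (1 - p) ^ J) + zz m K a T t1 sg) sg"
    by (rule pr_mono[OF sg]) (use it in simp)
   also have "\<dots> = E * real T powr (-4/3) + (1 - p) ^ J + pr 0 t1 (zz m K a T t1) sg"
    by (simp only: pr_add pr_const)
   also have "\<dots> \<le> (E + 2) * real T powr (-4/3)" using zb pJ by (simp add: algebra_simps)
   finally show "pr 0 T dd sg \<le> (E + 2) * real T powr (-4/3)" .
  qed
 qed
 thus ?thesis using E by (intro exI[of _ "E + 2"] conjI) auto
qed

end

section \<open>Summation by parts\<close>

text \<open>For consecutive cube roots x and y, x^3 - y^3 = 1 gives
  \<open>1 / x^2 \<le> 3 * (x - y)\<close>, and the sum telescopes.\<close>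

lemma sum_powr_le: "(\<Sum>k<T. (real k + 1) powr (-2/3)) \<le> 3 * real T powr (1/3)"
proof (induction T)
 case (Suc T)
 define x where "x = (real T + 1) powr (1/3)"
 define y where "y = real T powr (1/3)"
 have c: "x ^ 3 = real T + 1" "y ^ 3 = real T" unfolding x_def y_def by (cases "T = 0"; simp add: powr_power)+
 have y: "0 \<le> y" "y \<le> x" "0 < x" unfolding x_def y_def by (auto intro: powr_mono2)
 have i: "(real T + 1) powr (-2/3) = 1 / x\<^sup>2"
 proof -
  have "(real T + 1) powr (-2/3) = 1 / (real T + 1) powr (2/3)" using powr_minus_divide[of "real T + 1" "2/3"] by simp
  also have "(real T + 1) powr (2/3) = x\<^sup>2" unfolding x_def by (simp add: powr_power)
  finally show ?thesis .
 qed
 have "(x - y) * (x\<^sup>2 + x * y + y\<^sup>2) = x ^ 3 - y ^ 3" by (simp add: algebra_simps power2_eq_square power3_eq_cube)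
 hence "1 = (x - y) * (x\<^sup>2 + x * y + y\<^sup>2)" using c by simp
 also have "\<dots> \<le> (x - y) * (3 * x\<^sup>2)"
 proof (rule mult_left_mono)
  have "x * y \<le> x * x" "y * y \<le> x * x" using y by (auto intro: mult_mono)
  thus "x\<^sup>2 + x * y + y\<^sup>2 \<le> 3 * x\<^sup>2" by (simp add: power2_eq_square)
 qed (use y in simp)
 finally have "1 \<le> (3 * (x - y)) * x\<^sup>2" by (simp only: mult_ac)
 moreover have "0 < x\<^sup>2" using y by simp
 ultimately have "1 / x\<^sup>2 \<le> 3 * (x - y)" by (simp only: pos_divide_le_eq)
 thus ?case using Suc.IH i unfolding x_def y_def by (simp add: algebra_simps)
qed simp

context storm begin

text \<open>Up to a constant factor this bounds the squared distance at the next iterate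
  (\<open>stat_step\<close>): \<open>dx / eta\<close> is the size of the projected gradient step, W
  the error of the direction. In a dead state only a constant bound remains.\<close>

definition cost :: "nat \<Rightarrow> 'x \<times> 'h \<Rightarrow> real" where
 "cost k sg = (if alive (1/2) sg then (dx k sg)\<^sup>2 / (\<eta> k)\<^sup>2 + W sg else 1)"

text \<open>After weighting, beta * W becomes c * W and the residual beta^2 becomes a multiple of
  eta^2, whose sum is of order T^(1/3). The weight itself grows by at most h4 * eta per step, which
  costs a small multiple of W plus a multiple of eta^2; dead steps contribute k^(-4/3) *
  k^(2/3).\<close>

lemma main_sum:
 assumes ed: "\<And>t. 1 / (\<eta> (Suc t))\<^sup>2 - 1 / (\<eta> t)\<^sup>2 \<le> h4 * \<eta> (Suc t)" and h4: "0 \<le> h4" and R: "0 \<le> R"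
 shows "\<exists>K\<ge>0. \<forall>T\<ge>1. \<forall>sg\<in>S. norm (snd sg) \<le> R \<longrightarrow> (\<Sum>k<T. pr 0 k (cost k) sg) \<le> K * real T powr (1/3)"
proof (cases "S = {}")
 case True thus ?thesis by (intro exI[of _ 0]) auto
next
 case False
 then obtain sg' where "sg' \<in> S" by blast
 hence Fhi: "0 < Fhi" by (rule Fhi_pos)
 obtain Kd T0 where Kd: "0 \<le> Kd" and dp: "\<And>T sg. T0 \<le> T \<Longrightarrow> sg \<in> S \<Longrightarrow> norm (snd sg) \<le> R \<Longrightarrow> pr 0 T dd sg \<le> Kd * real T powr (-4/3)"
  using dead_prob[of R] unfolding eventually_sequentially by metis
 obtain k1 where k1: "\<And>t. k1 \<le> t \<Longrightarrow> 20 * \<beta> t \<le> 1" using ev_beta_from[of 20] by auto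
 \<comment> \<open>\<open>Mh * beta \<le> 1\<close> is the square of the condition
   \<open>5 * (h4 + 1) * eta \<le> c\<close>, which allows \<open>ev_beta_from\<close> to supply
   it.\<close>
 define Mh where "Mh = (5 * (h4 + 1) / c)\<^sup>2 / c"
 have "0 \<le> Mh" unfolding Mh_def using c_pos by simp
 then obtain k2 where k2: "\<And>t. k2 \<le> t \<Longrightarrow> Mh * \<beta> t \<le> 1" using ev_beta_from[of Mh] by auto
 define k0 where "k0 = max (max T0 k1) (max k2 1)"
 have k0: "T0 \<le> k" "k1 \<le> k" "k2 \<le> k" "1 \<le> k" if "k0 \<le> k" for k using that unfolding k0_def by auto
 have h4eta: "h4 * \<eta> k \<le> c / 5" if "k0 \<le> k" for k
 proof -
  have "(5 * (h4 + 1) / c * \<eta> k)\<^sup>2 = Mh * \<beta> k" unfolding Mh_def beta_def using c_pos by (simp add: power_mult_distrib power_divide)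
  also have "\<dots> \<le> 1\<^sup>2" using k2[OF k0(3)[OF that]] by simp
  finally have "5 * (h4 + 1) / c * \<eta> k \<le> 1" by (rule power2_le_imp_le) simp
  hence "5 * (h4 + 1) * \<eta> k \<le> c" using c_pos by (simp add: pos_divide_le_eq)
  moreover have "5 * h4 * \<eta> k \<le> 5 * (h4 + 1) * \<eta> k" using eta_pos[of k] by (intro mult_right_mono) auto
  ultimately show ?thesis by simp
 qed
 define M1 where "M1 = B2\<^sup>2 + kU * \<eta> 0 * Fhi"
 have M1: "0 \<le> M1" unfolding M1_def using kU_pos eta_pos[of 0] Fhi by (intro add_nonneg_nonneg mult_nonneg_nonneg) auto
 define \<iota> where "\<iota> k = 1 / (\<eta> k)\<^sup>2" for k
 have io: "0 < \<iota> k" "c \<le> \<iota> k" "\<iota> k * \<beta> k = c" "\<iota> k * (\<eta> k)\<^sup>2 = 1" for k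
 proof -
  have e: "0 < (\<eta> k)\<^sup>2" using eta_pos[of k] by simp
  show "0 < \<iota> k" unfolding \<iota>_def using e by simp
  show "c \<le> \<iota> k" unfolding \<iota>_def using e beta_le1[of k] unfolding beta_def by (simp add: pos_le_divide_eq)
  show "\<iota> k * \<beta> k = c" "\<iota> k * (\<eta> k)\<^sup>2 = 1" unfolding \<iota>_def beta_def using e by auto
 qed
 define z where "z k = (real k + 1) powr (-2/3)" for k
 have z0: "0 < z k" for k unfolding z_def by simp
 have zz: "z k \<le> 1" for k unfolding z_def using powr_mono[of "-2/3" 0 "real k + 1"] by simp
 have eta2: "(\<eta> k)\<^sup>2 \<le> h2\<^sup>2 * z k" for k
 proof -
  have "(\<eta> k)\<^sup>2 \<le> (h2 * (real k + 1) powr (-1/3))\<^sup>2" using eta_hi[of k] eta_pos[of k] by (intro power_mono) auto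
  also have "\<dots> = h2\<^sup>2 * z k" unfolding z_def by (simp add: power_mult_distrib powr_power)
  finally show ?thesis .
 qed
 \<comment> \<open>k^(-4/3) is at most 4 * z_k^2, and one factor z_k cancels against
   1/eta^2.\<close>
 have dk: "d \<le> 4 * Kd * z k" "d * \<iota> k \<le> 4 * Kd / h1\<^sup>2 * z k" if "k0 \<le> k" "0 \<le> d" "d \<le> Kd * real k powr (-4/3)" for k d
 proof -
  have k: "1 \<le> real k" using k0(4)[OF that(1)] by simp
  have "real k powr (-4/3) \<le> ((real k + 1) / 2) powr (-4/3)" using k by (intro powr_mono2') auto
  also have "\<dots> = (real k + 1) powr (-4/3) / 2 powr (-4/3)" by (rule powr_divide)
  also have "\<dots> = (real k + 1) powr (-4/3) * 2 powr (4/3)"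
   using powr_minus_divide[of 2 "4/3::real"] by simp
  also have "\<dots> \<le> (real k + 1) powr (-4/3) * 2 powr 2" by (intro mult_left_mono powr_mono) auto
  also have "\<dots> = 4 * (z k * z k)" unfolding z_def powr_add[symmetric] by simp
  finally have q: "real k powr (-4/3) \<le> 4 * (z k * z k)" .
  have d4: "d \<le> 4 * Kd * (z k * z k)" using that(3) mult_left_mono[OF q Kd] by simp
  have "z k * z k \<le> 1 * z k" using z0[of k] zz[of k] by (intro mult_right_mono) auto
  hence "4 * Kd * (z k * z k) \<le> 4 * Kd * z k" using Kd by (intro mult_left_mono) auto
  thus "d \<le> 4 * Kd * z k" using d4 by linarith
  have "h1\<^sup>2 * z k \<le> (\<eta> k)\<^sup>2"
  proof -
   have "(h1 * (real k + 1) powr (-1/3))\<^sup>2 \<le> (\<eta> k)\<^sup>2" using eta_lo[of k] h1_pos by (intro power_mono) auto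
   thus ?thesis unfolding z_def by (simp add: power_mult_distrib powr_power)
  qed
  hence i: "\<iota> k \<le> 1 / (h1\<^sup>2 * z k)" unfolding \<iota>_def using h1_pos z0[of k] eta_pos[of k] by (intro divide_left_mono) auto
  have "d * \<iota> k \<le> 4 * Kd * (z k * z k) * (1 / (h1\<^sup>2 * z k))" using d4 i that(2) io(1)[of k] Kd z0[of k] by (intro mult_mono) auto
  also have "\<dots> = 4 * Kd / h1\<^sup>2 * z k" using z0[of k] by simp
  finally show "d * \<iota> k \<le> 4 * Kd / h1\<^sup>2 * z k" .
 qed
 define C' where "C' = h4 * kU * Fhi * h2\<^sup>2 + 20 * B\<^sup>2 * c\<^sup>2 * h2\<^sup>2 + M1 * (4 * Kd / h1\<^sup>2)"
 have C': "0 \<le> C'" unfolding C'_def using h4 kU_pos Fhi M1 Kd by (intro add_nonneg_nonneg mult_nonneg_nonneg divide_nonneg_nonneg) auto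
 define Wm where "Wm = (R + real k0 * B2)\<^sup>2"
 have Wm: "0 \<le> Wm" unfolding Wm_def by simp
 define \<Psi>m where "\<Psi>m = \<iota> k0 * (Wm + kU * \<eta> k0 * Fhi)"
 have Pm: "0 \<le> \<Psi>m" unfolding \<Psi>m_def using io(1)[of k0] Wm kU_pos eta_pos[of k0] Fhi by (intro mult_nonneg_nonneg add_nonneg_nonneg) auto
 define Cs where "Cs = 1 + 2 / c"
 have Cs: "1 \<le> Cs" "2 / c \<le> Cs" unfolding Cs_def using c_pos by auto
 define C0 where "C0 = D\<^sup>2 * \<iota> k0 + Wm + 1"
 have C0: "0 \<le> C0" unfolding C0_def using io(1)[of k0] Wm by simp
 define K where "K = real k0 * C0 + Cs * \<Psi>m + (Cs * C' + 4 * Kd) * 3"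
 have K: "0 \<le> K" unfolding K_def using C0 Cs(1) Pm C' Kd by (intro add_nonneg_nonneg mult_nonneg_nonneg) auto
 have main: "(\<Sum>k<T. pr 0 k (cost k) sg) \<le> K * real T powr (1/3)" if T: "1 \<le> T" and sg: "sg \<in> S" and nsg: "norm (snd sg) \<le> R" for T sg
 proof -
  define e where "e k = pr 0 k (U k) sg" for k
  define w where "w k = pr 0 k W sg" for k
  define x where "x k = pr 0 k (\<lambda>sg. of_bool (alive (1/2) sg) * (dx k sg)\<^sup>2) sg" for k
  define d where "d k = pr 0 k dd sg" for k
  have nn: "0 \<le> w k" "0 \<le> x k" "0 \<le> d k" for k
   unfolding w_def x_def d_def using dd_bd by (auto intro!: pr_nonneg[OF sg])
  have we: "w k \<le> e k" "e k \<le> w k + kU * \<eta> k * Fhi" for k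
  proof -
   show "w k \<le> e k" unfolding w_def e_def by (rule pr_mono[OF sg]) (rule U_lower(1))
   have "e k \<le> pr 0 k (\<lambda>sg. W sg + kU * \<eta> k * Fhi) sg" unfolding e_def by (rule pr_mono[OF sg]) (rule U_lower(4))
   thus "e k \<le> w k + kU * \<eta> k * Fhi" unfolding w_def by (simp only: pr_add pr_const)
  qed
  have drift: "e (Suc k) \<le> e k - 7/10 * \<beta> k * w k - x k + 20 * B\<^sup>2 * (\<beta> k)\<^sup>2 + M1 * d k" if "k0 \<le> k" for k
  proof -
   have "e (Suc k) = pr 0 k (A k (U (Suc k))) sg" unfolding e_def using pr_plus[of 0 k 1 "U (Suc k)" sg] by simp
   also have "\<dots> \<le> pr 0 k (\<lambda>sg. U k sg - 7/10 * \<beta> k * W sg - of_bool (alive (1/2) sg) * (dx k sg)\<^sup>2 + 20 * B\<^sup>2 * (\<beta> k)\<^sup>2 + M1 * dd sg) sg"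
   proof (rule pr_mono[OF sg])
    fix sg assume s: "sg \<in> S"
    show "A k (U (Suc k)) sg \<le> U k sg - 7/10 * \<beta> k * W sg - of_bool (alive (1/2) sg) * (dx k sg)\<^sup>2 + 20 * B\<^sup>2 * (\<beta> k)\<^sup>2 + M1 * dd sg"
    proof (cases "alive (1/2) sg")
     case True
     have "(dx k sg)\<^sup>2 \<le> N\<^sup>2 * (dx k sg)\<^sup>2" using mult_right_mono[OF N2_ge, of "(dx k sg)\<^sup>2"] by simp
     thus ?thesis using U_drift1[OF s True, of k] k1[OF k0(2)[OF that]] True unfolding dd_def by simp
    next
     case False
     have "0 \<le> \<beta> k * W sg" using beta_pos[of k] by simp
     moreover have "of_bool (alive (1/2) sg) = (0::real)" "dd sg = 1" unfolding dd_def using False by auto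
     moreover have "0 \<le> 20 * B\<^sup>2 * (\<beta> k)\<^sup>2" by simp
     moreover have "7/10 * \<beta> k * W sg = 7/10 * (\<beta> k * W sg)" by (rule mult.assoc)
     ultimately have "A k (U (Suc k)) sg \<le> U k sg - 7/10 * \<beta> k * W sg - 0 + 20 * B\<^sup>2 * (\<beta> k)\<^sup>2 + M1"
      using U_drift_dead[OF s, of k, folded M1_def] by linarith
     thus ?thesis unfolding \<open>dd sg = 1\<close> using False by simp
    qed
   qed
   also have "\<dots> = e k - 7/10 * \<beta> k * w k - x k + 20 * B\<^sup>2 * (\<beta> k)\<^sup>2 + M1 * d k"
    unfolding e_def w_def x_def d_def by (simp only: pr_add pr_diff pr_const pr_cmult)
   finally show ?thesis .
  qed
  \<comment> \<open>Growth of the weight produces \<open>c / 5 * w (Suc k)\<close>, one index too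
    late. Subtracting \<open>c / 5 * w k\<close> moves it to index k, where 7/10 - 1/5 = 1/2 of the
    contraction is left.\<close>
  define \<Psi> where "\<Psi> k = \<iota> k * e k - c / 5 * w k" for k
  have \<Psi>0: "0 \<le> \<Psi> k" for k
  proof -
   have "c * w k \<le> \<iota> k * e k" using io(2)[of k] io(1)[of k] we(1)[of k] nn(1)[of k] by (intro mult_mono) auto
   moreover have "0 \<le> c * w k" using c_pos nn(1)[of k] by simp
   ultimately show ?thesis unfolding \<Psi>_def by simp
  qed
  have one: "c / 2 * w k + x k * \<iota> k \<le> \<Psi> k - \<Psi> (Suc k) + C' * z k" if "k0 \<le> k" for k
  proof -
   have "\<iota> k * e (Suc k) \<le> \<iota> k * (e k - 7/10 * \<beta> k * w k - x k + 20 * B\<^sup>2 * (\<beta> k)\<^sup>2 + M1 * d k)"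
    using drift[OF that] io(1)[of k] by (intro mult_left_mono) auto
   also have "\<dots> = \<iota> k * e k - 7/10 * (\<iota> k * \<beta> k) * w k - x k * \<iota> k + 20 * B\<^sup>2 * ((\<iota> k * \<beta> k) * \<beta> k) + M1 * (d k * \<iota> k)"
    by (simp add: algebra_simps power2_eq_square)
   also have "\<dots> = \<iota> k * e k - 7/10 * c * w k - x k * \<iota> k + 20 * B\<^sup>2 * c\<^sup>2 * (\<eta> k)\<^sup>2 + M1 * (d k * \<iota> k)"
    unfolding io(3) by (simp add: beta_def power2_eq_square)
   finally have a1: "\<iota> k * e (Suc k) \<le> \<iota> k * e k - 7/10 * c * w k - x k * \<iota> k + 20 * B\<^sup>2 * c\<^sup>2 * (\<eta> k)\<^sup>2 + M1 * (d k * \<iota> k)" .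
   have e0: "0 \<le> e (Suc k)" using we(1)[of "Suc k"] nn(1)[of "Suc k"] by linarith
   have "(\<iota> (Suc k) - \<iota> k) * e (Suc k) \<le> (h4 * \<eta> (Suc k)) * e (Suc k)" unfolding \<iota>_def using ed[of k] e0 by (intro mult_right_mono) auto
   also have "\<dots> \<le> (h4 * \<eta> (Suc k)) * (w (Suc k) + kU * \<eta> (Suc k) * Fhi)"
    using we(2)[of "Suc k"] h4 eta_pos[of "Suc k"] by (intro mult_left_mono) auto
   also have "\<dots> = (h4 * \<eta> (Suc k)) * w (Suc k) + h4 * kU * Fhi * (\<eta> (Suc k))\<^sup>2" by (simp add: algebra_simps power2_eq_square)
   also have "\<dots> \<le> c / 5 * w (Suc k) + h4 * kU * Fhi * (\<eta> k)\<^sup>2"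
    using h4eta[of "Suc k"] that nn(1)[of "Suc k"] eta_dec[of k] eta_pos[of "Suc k"] h4 kU_pos Fhi
    by (intro add_mono mult_right_mono mult_left_mono power_mono mult_nonneg_nonneg) auto
   finally have a2: "\<iota> (Suc k) * e (Suc k) - \<iota> k * e (Suc k) \<le> c / 5 * w (Suc k) + h4 * kU * Fhi * (\<eta> k)\<^sup>2" by (simp add: left_diff_distrib)
   have a3: "h4 * kU * Fhi * (\<eta> k)\<^sup>2 \<le> h4 * kU * Fhi * (h2\<^sup>2 * z k)" using eta2[of k] h4 kU_pos Fhi by (intro mult_left_mono) auto
   have a4: "20 * B\<^sup>2 * c\<^sup>2 * (\<eta> k)\<^sup>2 \<le> 20 * B\<^sup>2 * c\<^sup>2 * (h2\<^sup>2 * z k)" using eta2[of k] by (intro mult_left_mono) auto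
   have a5: "M1 * (d k * \<iota> k) \<le> M1 * (4 * Kd / h1\<^sup>2 * z k)"
    using dk(2)[OF that nn(3)[of k]] dp[OF k0(1)[OF that] sg nsg] M1 unfolding d_def by (intro mult_left_mono) auto
   have a6: "C' * z k = h4 * kU * Fhi * (h2\<^sup>2 * z k) + 20 * B\<^sup>2 * c\<^sup>2 * (h2\<^sup>2 * z k) + M1 * (4 * Kd / h1\<^sup>2 * z k)"
    unfolding C'_def by (simp add: algebra_simps)
   have a7: "7/10 * c * w k = c / 2 * w k + c / 5 * w k" by simp
   show ?thesis unfolding \<Psi>_def using a1 a2 a3 a4 a5 a6 a7 by linarith
  qed
  have tele: "(\<Sum>k\<in>{k0..<k0 + j}. c / 2 * w k + x k * \<iota> k) + \<Psi> (k0 + j) \<le> \<Psi> k0 + C' * (\<Sum>k\<in>{k0..<k0 + j}. z k)" for j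
  proof (induction j)
   case (Suc j) thus ?case using one[of "k0 + j"] by (simp add: algebra_simps)
  qed simp
  have pc: "pr 0 k (cost k) sg = x k * \<iota> k + pr 0 k (\<lambda>sg. of_bool (alive (1/2) sg) * W sg) sg + d k" for k
  proof -
   have "cost k = (\<lambda>sg. \<iota> k * (of_bool (alive (1/2) sg) * (dx k sg)\<^sup>2) + of_bool (alive (1/2) sg) * W sg + dd sg)"
    unfolding cost_def \<iota>_def dd_def by (rule ext) auto
   thus ?thesis unfolding x_def d_def by (simp only: pr_add pr_cmult mult.commute[of _ "\<iota> k"])
  qed
  have cw: "pr 0 k (\<lambda>sg. of_bool (alive (1/2) sg) * W sg) sg \<le> w k" for k unfolding w_def by (rule pr_mono[OF sg]) auto
  have late: "pr 0 k (cost k) sg \<le> Cs * (c / 2 * w k + x k * \<iota> k) + 4 * Kd * z k" if "k0 \<le> k" for k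
  proof -
   have "d k \<le> 4 * Kd * z k" using dk(1)[OF that nn(3)[of k]] dp[OF k0(1)[OF that] sg nsg] unfolding d_def by auto
   moreover have "x k * \<iota> k \<le> Cs * (x k * \<iota> k)" using mult_right_mono[OF Cs(1), of "x k * \<iota> k"] nn(2)[of k] io(1)[of k] by simp
   moreover have "w k \<le> Cs * (c / 2 * w k)"
   proof -
    have "2 / c * (c / 2 * w k) \<le> Cs * (c / 2 * w k)" using Cs(2) c_pos nn(1)[of k] by (intro mult_right_mono) auto
    thus ?thesis using c_pos by simp
   qed
   ultimately show ?thesis using pc[of k] cw[of k] by (simp add: distrib_left)
  qed
  \<comment> \<open>Before k0 the cost is bounded by a constant, using only the deterministic growth
    of |e| and the diameter of X.\<close>
  have early: "pr 0 k (cost k) sg \<le> C0" if "k \<le> k0" for k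
  proof (rule pr_growth[OF _ sg nsg])
   fix sg assume s: "sg \<in> S" and nr: "norm (snd sg) \<le> R + real k * B2"
   have "norm (snd sg) \<le> R + real k0 * B2" using nr that mult_right_mono[of "real k" "real k0" B2] by simp
   hence wle: "W sg \<le> Wm" unfolding W_def Wm_def by (intro power_mono) auto
   have "(dx k sg)\<^sup>2 / (\<eta> k)\<^sup>2 \<le> D\<^sup>2 / (\<eta> k0)\<^sup>2"
    using dx_D[OF s, of k] eta_antimono[OF that] eta_pos[of k0] eta_pos[of k] by (intro frac_le power_mono) auto
   thus "cost k sg \<le> C0" unfolding cost_def C0_def \<iota>_def using wle Wm by (simp add: add_increasing)
  qed
  have \<Psi>k: "\<Psi> k0 \<le> \<Psi>m"
  proof -
   have "e k0 \<le> Wm + kU * \<eta> k0 * Fhi" unfolding e_def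
   proof (rule pr_growth[OF _ sg nsg])
    fix sg assume s: "sg \<in> S" and nr: "norm (snd sg) \<le> R + real k0 * B2"
    have "W sg \<le> Wm" unfolding W_def Wm_def using nr by (intro power_mono) auto
    thus "U k0 sg \<le> Wm + kU * \<eta> k0 * Fhi" using U_lower(4)[OF s, of k0] by linarith
   qed
   hence "\<iota> k0 * e k0 \<le> \<Psi>m" unfolding \<Psi>m_def using io(1)[of k0] by (intro mult_left_mono) auto
   moreover have "0 \<le> c / 5 * w k0" using c_pos nn(1)[of k0] by simp
   ultimately show ?thesis unfolding \<Psi>_def by linarith
  qed
  have zs: "(\<Sum>k\<in>I. z k) \<le> 3 * real T powr (1/3)" if "I \<subseteq> {..<T}" for I
  proof -
   have "(\<Sum>k\<in>I. z k) \<le> (\<Sum>k<T. z k)" using that z0 by (intro sum_mono2) (auto simp: less_imp_le)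
   thus ?thesis unfolding z_def using sum_powr_le[of T] by linarith
  qed
  define I where "I = {k. k0 \<le> k \<and> k < T}"
  have I: "I \<subseteq> {..<T}" "finite I" unfolding I_def by auto
  have "(\<Sum>k\<in>I. c / 2 * w k + x k * \<iota> k) \<le> \<Psi>m + C' * (\<Sum>k\<in>I. z k)"
  proof (cases "k0 \<le> T")
   case True
   then obtain j where j: "T = k0 + j" using le_Suc_ex by blast
   have "I = {k0..<k0 + j}" unfolding I_def j by auto
   thus ?thesis using tele[of j] \<Psi>0[of "k0 + j"] \<Psi>k by simp
  next
   case False
   hence "I = {}" unfolding I_def by auto
   thus ?thesis using Pm by simp
  qed
  also have "\<dots> \<le> \<Psi>m + C' * (3 * real T powr (1/3))" using zs[OF I(1)] C' by (intro add_left_mono mult_left_mono) auto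
  finally have sI: "(\<Sum>k\<in>I. c / 2 * w k + x k * \<iota> k) \<le> \<Psi>m + C' * (3 * real T powr (1/3))" .
  have "(\<Sum>k\<in>I. pr 0 k (cost k) sg) \<le> (\<Sum>k\<in>I. Cs * (c / 2 * w k + x k * \<iota> k) + 4 * Kd * z k)"
   by (rule sum_mono) (use late in \<open>auto simp: I_def\<close>)
  also have "\<dots> = Cs * (\<Sum>k\<in>I. c / 2 * w k + x k * \<iota> k) + 4 * Kd * (\<Sum>k\<in>I. z k)"
   by (simp only: sum.distrib[of "\<lambda>k. Cs * (c / 2 * w k + x k * \<iota> k)"] sum_distrib_left)
  also have "\<dots> \<le> Cs * (\<Psi>m + C' * (3 * real T powr (1/3))) + 4 * Kd * (3 * real T powr (1/3))"
   using sI zs[OF I(1)] Cs(1) Kd by (intro add_mono mult_left_mono) auto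
  finally have lateS: "(\<Sum>k\<in>I. pr 0 k (cost k) sg) \<le> Cs * \<Psi>m + (Cs * C' + 4 * Kd) * 3 * real T powr (1/3)" by (simp add: algebra_simps)
  have T1: "1 \<le> real T powr (1/3)" using T by (intro ge_one_powr_ge_zero) auto
  have "(\<Sum>k<T. pr 0 k (cost k) sg) = (\<Sum>k\<in>{..<T} - I. pr 0 k (cost k) sg) + (\<Sum>k\<in>I. pr 0 k (cost k) sg)"
   by (rule sum.subset_diff[OF I(1)]) simp
  moreover have "(\<Sum>k\<in>{..<T} - I. pr 0 k (cost k) sg) \<le> real k0 * C0"
  proof -
   have "(\<Sum>k\<in>{..<T} - I. pr 0 k (cost k) sg) \<le> (\<Sum>k\<in>{..<T} - I. C0)" by (rule sum_mono) (use early in \<open>auto simp: I_def\<close>)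
   also have "\<dots> \<le> (\<Sum>k<k0. C0)" using C0 by (intro sum_mono2) (auto simp: I_def)
   finally show ?thesis by simp
  qed
  moreover have "s \<le> (u + v) * 1 + y" if "s = a + b" "a \<le> u" "b \<le> v + y" for s a b u v y :: real using that by simp
  ultimately have "(\<Sum>k<T. pr 0 k (cost k) sg) \<le> (real k0 * C0 + Cs * \<Psi>m) * 1 + (Cs * C' + 4 * Kd) * 3 * real T powr (1/3)" using lateS by blast
  also have "\<dots> \<le> (real k0 * C0 + Cs * \<Psi>m) * real T powr (1/3) + (Cs * C' + 4 * Kd) * 3 * real T powr (1/3)"
   using T1 C0 Cs(1) Pm by (intro add_right_mono mult_left_mono add_nonneg_nonneg mult_nonneg_nonneg) auto
  also have "\<dots> = K * real T powr (1/3)" unfolding K_def by (simp add: algebra_simps)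
  finally show ?thesis .
 qed
 show ?thesis using K main by blast
qed

end

section \<open>The objective\<close>

lemma grad_eqI:
 fixes f :: "'b::euclidean_space \<Rightarrow> real"
 assumes "(f has_derivative (\<lambda>h. v \<bullet> h)) (at x)"
 shows "grad f x = v"
 unfolding grad_def
proof (rule the_equality[where P = "\<lambda>v. (f has_derivative (\<lambda>h. v \<bullet> h)) (at x)", OF assms])
 fix w assume "(f has_derivative (\<lambda>h. w \<bullet> h)) (at x)"
 hence "(\<lambda>h. w \<bullet> h) = (\<lambda>h. v \<bullet> h)" using assms by (rule has_derivative_unique)
 thus "w = v" by (metis vector_eq_rdot)
qed

text \<open>Riesz representation: the representing vector is the adjoint of the derivative applied
  to 1.\<close>

lemma has_derivative_grad:
 fixes f :: "'b::euclidean_space \<Rightarrow> real"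
 assumes "f differentiable (at x)"
 shows "(f has_derivative (\<lambda>h. grad f x \<bullet> h)) (at x)"
proof -
 obtain f' where f': "(f has_derivative f') (at x)" using assms unfolding differentiable_def by blast
 have "linear f'" by (rule has_derivative_linear[OF f'])
 hence "f' h = adjoint f' 1 \<bullet> h" for h using adjoint_works[of f' h 1] by (simp add: inner_commute)
 hence "(f has_derivative (\<lambda>h. adjoint f' 1 \<bullet> h)) (at x)" using f' by (metis (no_types, lifting) ext)
 thus ?thesis using grad_eqI by metis
qed

lemma norm_comp_le: "norm (fst v) \<le> norm v" "norm (snd v) \<le> norm v"
 using norm_fst_le[of "fst v" "snd v"] norm_snd_le[of "snd v" "fst v"] by simp_all

lemma norm_prod_sq: "(norm v)\<^sup>2 = (norm (fst v))\<^sup>2 + (norm (snd v))\<^sup>2"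
 by (cases v) (simp add: norm_Pair)

lemma mean_norm_le:
 assumes "0 < (n::nat)" "\<And>i. i < n \<Longrightarrow> norm (f i) \<le> b"
 shows "norm ((1 / real n) *\<^sub>R (\<Sum>i<n. f i)) \<le> b"
proof -
 have "norm (\<Sum>i<n. f i) \<le> real (card {..<n}) * b" by (rule sum_norm_bound) (use assms in auto)
 thus ?thesis using assms(1) by (simp add: divide_le_eq mult.commute)
qed

text \<open>Mean value bounds in one variable at a time. The first two constants build
  \<open>L_g\<close>; the first together with the last three builds the four constants inside
  \<open>L_ng\<close>.\<close>

lemma exp_quot_lip:
 fixes a C :: real
 assumes a: "0 < a" and p: "0 \<le> p" "p \<le> C" and q: "0 \<le> q" "q \<le> C" and y: "a \<le> y" "a \<le> z"
 shows "\<bar>exp (p / y) - exp (q / y)\<bar> \<le> exp (C / a) / a * \<bar>p - q\<bar>"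
  and "\<bar>exp (p / y) - exp (p / z)\<bar> \<le> exp (C / a) * C / a\<^sup>2 * \<bar>y - z\<bar>"
  and "\<bar>exp (p / y) / y - exp (p / z) / z\<bar> \<le> exp (C / a) * (C / a ^ 3 + 1 / a\<^sup>2) * \<bar>y - z\<bar>"
  and "\<bar>p * exp (p / y) / y\<^sup>2 - q * exp (q / y) / y\<^sup>2\<bar> \<le> exp (C / a) * (C + a) / a ^ 3 * \<bar>p - q\<bar>"
  and "\<bar>p * exp (p / y) / y\<^sup>2 - p * exp (p / z) / z\<^sup>2\<bar> \<le> exp (C / a) * (C\<^sup>2 + 2 * a * C) / a ^ 4 * \<bar>y - z\<bar>"
proof -
 have ex: "exp (x / w) \<le> exp (C / a)" if "0 \<le> x" "x \<le> C" "a \<le> w" for x w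
  using frac_le[of C x a w] that a by simp
 have iv: "1 / w ^ k \<le> 1 / a ^ k" if "a \<le> w" for w k using that a by (intro divide_left_mono power_mono) auto
 have xk: "x / w ^ k \<le> C / a ^ k" if "0 \<le> x" "x \<le> C" "a \<le> w" for x w k using that a by (intro frac_le power_mono) auto
 show "\<bar>exp (p / y) - exp (q / y)\<bar> \<le> exp (C / a) / a * \<bar>p - q\<bar>"
 proof -
  have "norm (exp (p / y) - exp (q / y)) \<le> exp (C / a) / a * norm (p - q)"
  proof (rule field_differentiable_bound[where S = "{0..C}" and f' = "\<lambda>x. exp (x / y) * (1 / y)"])
   fix x assume x: "x \<in> {0..C}"
   show "((\<lambda>x. exp (x / y)) has_field_derivative exp (x / y) * (1 / y)) (at x within {0..C})"
    using y a by (auto intro!: derivative_eq_intros)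
   have "exp (x / y) * (1 / y) \<le> exp (C / a) * (1 / a)" using ex[of x y] iv[of y 1] x y a by (intro mult_mono) auto
   thus "norm (exp (x / y) * (1 / y)) \<le> exp (C / a) / a" using y a by simp
  qed (use p q in auto)
  thus ?thesis by simp
 qed
 show "\<bar>exp (p / y) - exp (p / z)\<bar> \<le> exp (C / a) * C / a\<^sup>2 * \<bar>y - z\<bar>"
 proof -
  have "norm (exp (p / y) - exp (p / z)) \<le> exp (C / a) * C / a\<^sup>2 * norm (y - z)"
  proof (rule field_differentiable_bound[where S = "{a..}" and f' = "\<lambda>x. - (exp (p / x) * (p / x\<^sup>2))"])
   fix x assume x: "x \<in> {a..}"
   show "((\<lambda>x. exp (p / x)) has_field_derivative - (exp (p / x) * (p / x\<^sup>2))) (at x within {a..})"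
    using x a by (auto intro!: derivative_eq_intros simp: power2_eq_square)
   have "exp (p / x) * (p / x\<^sup>2) \<le> exp (C / a) * (C / a\<^sup>2)" using ex[of p x] xk[of p x 2] x p a by (intro mult_mono) auto
   thus "norm (- (exp (p / x) * (p / x\<^sup>2))) \<le> exp (C / a) * C / a\<^sup>2" using p by simp
  qed (use y in auto)
  thus ?thesis by simp
 qed
 show "\<bar>exp (p / y) / y - exp (p / z) / z\<bar> \<le> exp (C / a) * (C / a ^ 3 + 1 / a\<^sup>2) * \<bar>y - z\<bar>"
 proof -
  have "norm (exp (p / y) / y - exp (p / z) / z) \<le> exp (C / a) * (C / a ^ 3 + 1 / a\<^sup>2) * norm (y - z)"
  proof (rule field_differentiable_bound[where S = "{a..}" and f' = "\<lambda>x. - (exp (p / x) * (p / x ^ 3 + 1 / x\<^sup>2))"])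
   fix x assume x: "x \<in> {a..}"
   have x0: "0 < x" using x a by auto
   show "((\<lambda>x. exp (p / x) / x) has_field_derivative - (exp (p / x) * (p / x ^ 3 + 1 / x\<^sup>2))) (at x within {a..})"
    using x0 by (auto intro!: derivative_eq_intros simp: power2_eq_square power3_eq_cube field_simps)
   have "exp (p / x) * (p / x ^ 3 + 1 / x\<^sup>2) \<le> exp (C / a) * (C / a ^ 3 + 1 / a\<^sup>2)"
    using ex[of p x] xk[of p x 3] iv[of x 2] x0 x p a by (intro mult_mono add_mono) auto
   moreover have "0 \<le> exp (p / x) * (p / x ^ 3 + 1 / x\<^sup>2)" using p x0 by (intro mult_nonneg_nonneg add_nonneg_nonneg) auto
   ultimately show "norm (- (exp (p / x) * (p / x ^ 3 + 1 / x\<^sup>2))) \<le> exp (C / a) * (C / a ^ 3 + 1 / a\<^sup>2)" by simp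
  qed (use y in auto)
  thus ?thesis by simp
 qed
 show "\<bar>p * exp (p / y) / y\<^sup>2 - q * exp (q / y) / y\<^sup>2\<bar> \<le> exp (C / a) * (C + a) / a ^ 3 * \<bar>p - q\<bar>"
 proof -
  have y0: "0 < y" using y a by auto
  have "norm (p * exp (p / y) / y\<^sup>2 - q * exp (q / y) / y\<^sup>2) \<le> exp (C / a) * (C + a) / a ^ 3 * norm (p - q)"
  proof (rule field_differentiable_bound[where S = "{0..C}" and f' = "\<lambda>x. exp (x / y) * (x / y ^ 3 + 1 / y\<^sup>2)"])
   fix x assume x: "x \<in> {0..C}"
   show "((\<lambda>x. x * exp (x / y) / y\<^sup>2) has_field_derivative exp (x / y) * (x / y ^ 3 + 1 / y\<^sup>2)) (at x within {0..C})"
    using y0 by (auto intro!: derivative_eq_intros simp: power2_eq_square power3_eq_cube field_simps)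
   have "exp (x / y) * (x / y ^ 3 + 1 / y\<^sup>2) \<le> exp (C / a) * (C / a ^ 3 + 1 / a\<^sup>2)"
    using ex[of x y] xk[of x y 3] iv[of y 2] x y0 y a by (intro mult_mono add_mono) auto
   moreover have "0 \<le> exp (x / y) * (x / y ^ 3 + 1 / y\<^sup>2)" using x y0 by (intro mult_nonneg_nonneg add_nonneg_nonneg) auto
   moreover have "exp (C / a) * (C / a ^ 3 + 1 / a\<^sup>2) = exp (C / a) * (C + a) / a ^ 3"
    using a by (simp add: power2_eq_square power3_eq_cube field_simps)
   ultimately show "norm (exp (x / y) * (x / y ^ 3 + 1 / y\<^sup>2)) \<le> exp (C / a) * (C + a) / a ^ 3" by simp
  qed (use p q in auto)
  thus ?thesis by simp
 qed
 show "\<bar>p * exp (p / y) / y\<^sup>2 - p * exp (p / z) / z\<^sup>2\<bar> \<le> exp (C / a) * (C\<^sup>2 + 2 * a * C) / a ^ 4 * \<bar>y - z\<bar>"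
 proof -
  have "norm (p * exp (p / y) / y\<^sup>2 - p * exp (p / z) / z\<^sup>2) \<le> exp (C / a) * (C\<^sup>2 + 2 * a * C) / a ^ 4 * norm (y - z)"
  proof (rule field_differentiable_bound[where S = "{a..}" and f' = "\<lambda>x. - (exp (p / x) * (p * (p / x ^ 4) + 2 * (p / x ^ 3)))"])
   fix x assume x: "x \<in> {a..}"
   have x0: "0 < x" using x a by auto
   show "((\<lambda>x. p * exp (p / x) / x\<^sup>2) has_field_derivative - (exp (p / x) * (p * (p / x ^ 4) + 2 * (p / x ^ 3)))) (at x within {a..})"
    using x0 by (auto intro!: derivative_eq_intros simp: power2_eq_square power3_eq_cube power4_eq_xxxx field_simps)
   have "exp (p / x) * (p * (p / x ^ 4) + 2 * (p / x ^ 3)) \<le> exp (C / a) * (C * (C / a ^ 4) + 2 * (C / a ^ 3))"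
    using ex[of p x] xk[of p x 3] xk[of p x 4] x0 x p a by (intro mult_mono add_mono) auto
   moreover have "0 \<le> exp (p / x) * (p * (p / x ^ 4) + 2 * (p / x ^ 3))" using p x0 by (intro mult_nonneg_nonneg add_nonneg_nonneg) auto
   moreover have "exp (C / a) * (C * (C / a ^ 4) + 2 * (C / a ^ 3)) = exp (C / a) * (C\<^sup>2 + 2 * a * C) / a ^ 4"
    using a by (simp add: power2_eq_square power3_eq_cube power4_eq_xxxx field_simps)
   ultimately show "norm (- (exp (p / x) * (p * (p / x ^ 4) + 2 * (p / x ^ 3)))) \<le> exp (C / a) * (C\<^sup>2 + 2 * a * C) / a ^ 4" by simp
  qed (use y in auto)
  thus ?thesis by simp
 qed
qed

section \<open>Regularity of the exponentiated losses and of F on X\<close>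

locale dro =
 fixes l :: "nat \<Rightarrow> 'a::euclidean_space \<Rightarrow> real" and W :: "'a set" and n :: nat
  and lam0 \<rho> R G C L :: real
 assumes n_pos: "1 \<le> n" and W_ne: "W \<noteq> {}" and W_closed: "closed W" and W_convex: "convex W"
  and l_diff: "\<And>i w. i < n \<Longrightarrow> l i differentiable (at w)"
  and l_nonneg: "\<And>i w. i < n \<Longrightarrow> w \<in> W \<Longrightarrow> l i w \<ge> 0"
  and lam0_pos: "lam0 > 0" and rho_pos: "\<rho> > 0"
  and A_a: "\<And>w. w \<in> W \<Longrightarrow> norm w \<le> R"
  and A_b1: "\<And>i w. i < n \<Longrightarrow> w \<in> W \<Longrightarrow> norm (grad (l i) w) \<le> G"
  and A_b2: "\<And>i w. i < n \<Longrightarrow> w \<in> W \<Longrightarrow> \<bar>l i w\<bar> \<le> C"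
  and A_c: "\<And>i w1 w2. i < n \<Longrightarrow> w1 \<in> W \<Longrightarrow> w2 \<in> W \<Longrightarrow>
        norm (grad (l i) w1 - grad (l i) w2) \<le> L * norm (w1 - w2)"
begin

definition lt :: real where "lt = lam_tilde lam0 C \<rho>"
definition X :: "('a \<times> real) set" where "X = Xset W lam0 lt"
definition Gm :: real where "Gm = exp (C / lam0)"
definition Lg :: real where "Lg = L_g lam0 C G"
definition Ln :: real where "Ln = L_ng lam0 C G L"
definition LF :: real where "LF = L_F lam0 C G L \<rho>"
definition gr :: "nat \<Rightarrow> 'a \<times> real \<Rightarrow> 'a \<times> real" where
 "gr i x = ((exp (l i (fst x) / snd x) / snd x) *\<^sub>R grad (l i) (fst x), - (l i (fst x) * exp (l i (fst x) / snd x) / (snd x)\<^sup>2))"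
definition gb :: "'a \<times> real \<Rightarrow> real" where "gb = gbar n l"
definition qb :: "'a \<times> real \<Rightarrow> 'a \<times> real" where "qb x = (1 / real n) *\<^sub>R (\<Sum>i<n. gr i x)"
definition Fo :: "'a \<times> real \<Rightarrow> real" where "Fo = Fobj n l \<rho>"
definition gF :: "'a \<times> real \<Rightarrow> 'a \<times> real" where
 "gF x = (snd x / gb x) *\<^sub>R qb x + (0, ln (gb x) + \<rho>)"

lemma n0: "0 < n" using n_pos by simp

lemma C_nn: "0 \<le> C" and G_nn: "0 \<le> G"
proof -
 obtain w where w: "w \<in> W" using W_ne by blast
 show "0 \<le> C" using A_b2[OF n0 w] by linarith
 show "0 \<le> G" using A_b1[OF n0 w] norm_ge_zero[of "grad (l 0) w"] by linarith
qed

lemma lt_ge: "lam0 \<le> lt" unfolding lt_def lam_tilde_def using C_nn rho_pos by simp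
lemma lt_pos: "0 < lt" using lt_ge lam0_pos by linarith
lemma Gm_ge: "1 \<le> Gm" unfolding Gm_def using C_nn lam0_pos by simp
lemma Lg_eq: "Lg = Gm * (G / lam0 + C / lam0\<^sup>2)" unfolding Lg_def L_g_def Gm_def ..
lemma Lg_nn: "0 \<le> Lg" unfolding Lg_eq using Gm_ge G_nn C_nn lam0_pos by (intro mult_nonneg_nonneg add_nonneg_nonneg) auto
lemma Ln_nn: "0 \<le> Ln" unfolding Ln_def L_ng_def by (simp add: Let_def)
lemma LF_eq: "LF = lt * Lg\<^sup>2 + 2 * Lg + lt * Ln + 1 + lt" unfolding LF_def L_F_def lt_def Lg_def Ln_def by (simp add: Let_def)
lemma LF_ge: "1 \<le> LF" "lt * Lg\<^sup>2 + 2 * Lg + lt * Ln \<le> LF"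
proof -
 have "0 \<le> lt * Lg\<^sup>2" "0 \<le> lt * Ln" using lt_pos Ln_nn by auto
 thus "1 \<le> LF" "lt * Lg\<^sup>2 + 2 * Lg + lt * Ln \<le> LF" unfolding LF_eq using Lg_nn lt_pos by linarith+
qed

lemma XD: "x \<in> X \<Longrightarrow> fst x \<in> W" "x \<in> X \<Longrightarrow> lam0 \<le> snd x" "x \<in> X \<Longrightarrow> snd x \<le> lt" "x \<in> X \<Longrightarrow> 0 < snd x"
 unfolding X_def Xset_def using lam0_pos by auto

lemma X_times: "X = W \<times> {lam0..lt}" unfolding X_def Xset_def by auto
lemma X_convex: "convex X" unfolding X_times by (intro convex_Times W_convex convex_real_interval)
lemma X_closed: "closed X" unfolding X_times by (intro closed_Times W_closed closed_atLeastAtMost)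
lemma X_ne: "X \<noteq> {}" unfolding X_times using W_ne lt_ge by auto

lemma X_diam: "x \<in> X \<Longrightarrow> y \<in> X \<Longrightarrow> norm (x - y) \<le> 2 * R + 2 * lt"
proof -
 assume x: "x \<in> X" and y: "y \<in> X"
 have b: "norm z \<le> R + lt" if "z \<in> X" for z
 proof -
  have "norm z \<le> norm (fst z) + norm (snd z)" using sqrt_sum_squares_le_sum[of "norm (fst z)" "norm (snd z)"] by (cases z) (simp add: norm_Pair)
  thus ?thesis using A_a[OF XD(1)[OF that]] XD(3,4)[OF that] by simp
 qed
 show "norm (x - y) \<le> 2 * R + 2 * lt" using b[OF x] b[OF y] norm_triangle_ineq4[of x y] by linarith
qed

lemma l_bd: "i < n \<Longrightarrow> w \<in> W \<Longrightarrow> 0 \<le> l i w \<and> l i w \<le> C" using l_nonneg[of i w] A_b2[of i w] by auto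

lemma l_lip:
 assumes "i < n" "v \<in> W" "w \<in> W"
 shows "\<bar>l i v - l i w\<bar> \<le> G * norm (v - w)"
proof -
 have "norm (l i v - l i w) \<le> G * norm (v - w)"
 proof (rule differentiable_bound[OF W_convex _ _ assms(2,3)])
  fix z assume z: "z \<in> W"
  show "(l i has_derivative (\<lambda>h. grad (l i) z \<bullet> h)) (at z within W)"
   by (rule has_derivative_at_withinI[OF has_derivative_grad[OF l_diff[OF assms(1)]]])
  show "onorm (\<lambda>h. grad (l i) z \<bullet> h) \<le> G"
  proof (rule onorm_le)
   fix h
   have "norm (grad (l i) z \<bullet> h) \<le> norm (grad (l i) z) * norm h" using Cauchy_Schwarz_ineq2 by simp
   also have "\<dots> \<le> G * norm h" by (intro mult_right_mono A_b1[OF assms(1) z]) simp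
   finally show "norm (grad (l i) z \<bullet> h) \<le> G * norm h" .
  qed
 qed
 thus ?thesis by simp
qed

lemma gi_deriv:
 assumes "i < n" "snd x \<noteq> 0"
 shows "(gi l i has_derivative (\<lambda>h. gr i x \<bullet> h)) (at x)"
proof -
 have 1: "((\<lambda>x. l i (fst x)) has_derivative (\<lambda>h. grad (l i) (fst x) \<bullet> fst h)) (at x)"
  by (rule has_derivative_compose[OF has_derivative_fst[OF has_derivative_ident] has_derivative_grad[OF l_diff[OF assms(1)]]])
 have 2: "((\<lambda>x. snd x) has_derivative (\<lambda>h. snd h)) (at x)" by (rule has_derivative_snd[OF has_derivative_ident])
 have "((\<lambda>x. exp (l i (fst x) / snd x)) has_derivative (\<lambda>h. gr i x \<bullet> h)) (at x)"
  by (rule has_derivative_eq_rhs[OF has_derivative_exp[OF has_derivative_divide'[OF 1 2 assms(2)]]])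
   (use assms(2) in \<open>simp add: fun_eq_iff gr_def inner_prod_def field_simps power2_eq_square\<close>)
 thus ?thesis by (simp add: gi_def[abs_def])
qed

lemma grad_gi: "i < n \<Longrightarrow> x \<in> X \<Longrightarrow> grad (gi l i) x = gr i x"
 by (rule grad_eqI[OF gi_deriv]) (use XD(4)[of x] in auto)

lemma gi_bd:
 assumes "i < n" "x \<in> X"
 shows "1 \<le> gi l i x" "gi l i x \<le> Gm"
proof -
 note b = l_bd[OF assms(1) XD(1)[OF assms(2)]] and x = XD(2,4)[OF assms(2)]
 show "1 \<le> gi l i x" unfolding gi_def using b x by simp
 have "l i (fst x) / snd x \<le> C / lam0" using b x lam0_pos by (intro frac_le) auto
 thus "gi l i x \<le> Gm" unfolding gi_def Gm_def by simp
qed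

lemma gr_norm:
 assumes "i < n" "x \<in> X"
 shows "norm (gr i x) \<le> Lg"
proof -
 note b = l_bd[OF assms(1) XD(1)[OF assms(2)]] and x = XD(2,4)[OF assms(2)]
 have e: "0 < exp (l i (fst x) / snd x)" "exp (l i (fst x) / snd x) \<le> Gm" using gi_bd[OF assms] unfolding gi_def by auto
 have "norm (gr i x) \<le> norm (fst (gr i x)) + norm (snd (gr i x))"
  using sqrt_sum_squares_le_sum[of "norm (fst (gr i x))" "norm (snd (gr i x))"] by (cases "gr i x") (simp add: norm_Pair)
 also have "\<dots> = exp (l i (fst x) / snd x) / snd x * norm (grad (l i) (fst x)) + l i (fst x) * exp (l i (fst x) / snd x) / (snd x)\<^sup>2"
  unfolding gr_def using x b by (simp add: abs_mult)
 also have "\<dots> \<le> Gm / lam0 * G + C * Gm / lam0\<^sup>2"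
  using e x b lam0_pos A_b1[OF assms(1) XD(1)[OF assms(2)]] G_nn Gm_ge C_nn
  by (intro add_mono mult_mono frac_le power_mono) auto
 also have "\<dots> = Lg" unfolding Lg_eq by (simp add: algebra_simps)
 finally show ?thesis .
qed

lemma gi_lip:
 assumes i: "i < n" and x: "x \<in> X" and y: "y \<in> X"
 shows "\<bar>gi l i x - gi l i y\<bar> \<le> Lg * norm (x - y)"
proof -
 note bx = l_bd[OF i XD(1)[OF x]] and bz = l_bd[OF i XD(1)[OF y]]
 have "\<bar>gi l i x - gi l i y\<bar> \<le> \<bar>exp (l i (fst x) / snd x) - exp (l i (fst y) / snd x)\<bar> + \<bar>exp (l i (fst y) / snd x) - exp (l i (fst y) / snd y)\<bar>"
  unfolding gi_def by linarith
 also have "\<dots> \<le> Gm / lam0 * \<bar>l i (fst x) - l i (fst y)\<bar> + Gm * C / lam0\<^sup>2 * \<bar>snd x - snd y\<bar>"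
  unfolding Gm_def using bx bz XD(2)[OF x] XD(2)[OF y] lam0_pos by (intro add_mono exp_quot_lip(1,2)) auto
 also have "\<dots> \<le> Gm / lam0 * (G * norm (x - y)) + Gm * C / lam0\<^sup>2 * norm (x - y)"
 proof (intro add_mono mult_left_mono)
  have "\<bar>l i (fst x) - l i (fst y)\<bar> \<le> G * norm (fst (x - y))" using l_lip[OF i XD(1)[OF x] XD(1)[OF y]] by simp
  also have "\<dots> \<le> G * norm (x - y)" by (intro mult_left_mono norm_comp_le G_nn)
  finally show "\<bar>l i (fst x) - l i (fst y)\<bar> \<le> G * norm (x - y)" .
  show "\<bar>snd x - snd y\<bar> \<le> norm (x - y)" using norm_comp_le(2)[of "x - y"] by simp
 qed (use Gm_ge C_nn lam0_pos in auto)
 also have "\<dots> = Lg * norm (x - y)" unfolding Lg_eq by (simp add: algebra_simps)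
 finally show ?thesis .
qed

lemma cs2: "(a * u + b * v)\<^sup>2 \<le> (a\<^sup>2 + b\<^sup>2) * (u\<^sup>2 + v\<^sup>2)" for a b u v :: real
proof -
 have "0 \<le> (a * v - b * u)\<^sup>2" by simp
 thus ?thesis by (simp add: power2_eq_square algebra_simps)
qed

text \<open>The changes of the two components are bounded by the 2 by 2 matrix with rows (LA, LB)
  and (LC, LD) applied to the changes in w and lambda. Ln is its Frobenius norm, obtained row by row
  from \<open>cs2\<close>.\<close>

lemma gr_lip:
 assumes i: "i < n" and x: "x \<in> X" and y: "y \<in> X"
 shows "norm (gr i x - gr i y) \<le> Ln * norm (x - y)"
proof -
 define p q a b where "p = l i (fst x)" and "q = l i (fst y)" and "a = snd x" and "b = snd y"
 define u v where "u = norm (fst x - fst y)" and "v = \<bar>snd x - snd y\<bar>"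
 define gx gy where "gx = grad (l i) (fst x)" and "gy = grad (l i) (fst y)"
 have p: "0 \<le> p" "p \<le> C" and q: "0 \<le> q" "q \<le> C" unfolding p_def q_def using l_bd[OF i XD(1)[OF x]] l_bd[OF i XD(1)[OF y]] by auto
 have ab: "lam0 \<le> a" "lam0 \<le> b" unfolding a_def b_def using XD(2)[OF x] XD(2)[OF y] by auto
 have a0: "0 < a" using ab lam0_pos by linarith
 have pq: "\<bar>p - q\<bar> \<le> G * u" unfolding p_def q_def u_def by (rule l_lip[OF i XD(1)[OF x] XD(1)[OF y]])
 have gxy: "norm (gx - gy) \<le> L * u" unfolding gx_def gy_def u_def by (rule A_c[OF i XD(1)[OF x] XD(1)[OF y]])
 have gy: "norm gy \<le> G" unfolding gy_def by (rule A_b1[OF i XD(1)[OF y]])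
 have e: "exp (p / a) \<le> Gm" using gi_bd(2)[OF i x] unfolding gi_def p_def a_def .
 have uv: "u\<^sup>2 + v\<^sup>2 = (norm (x - y))\<^sup>2" unfolding u_def v_def using norm_prod_sq[of "x - y"] by simp
 define LA LB LC LD where "LA = Gm * (G\<^sup>2 / lam0\<^sup>2 + L / lam0)" and "LB = Gm * (C * G / lam0 ^ 3 + G / lam0\<^sup>2)"
  and "LC = Gm * (C * G + lam0 * G) / lam0 ^ 3" and "LD = Gm * (C\<^sup>2 + 2 * lam0 * C) / lam0 ^ 4"
 have Ln: "Ln = sqrt (LA\<^sup>2 + LB\<^sup>2 + LC\<^sup>2 + LD\<^sup>2)" unfolding Ln_def L_ng_def LA_def LB_def LC_def LD_def Gm_def by (simp add: Let_def)
 have f: "norm (fst (gr i x - gr i y)) \<le> LA * u + LB * v"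
 proof -
  have "fst (gr i x - gr i y) = (exp (p / a) / a) *\<^sub>R (gx - gy) + ((exp (p / a) - exp (q / a)) / a) *\<^sub>R gy + (exp (q / a) / a - exp (q / b) / b) *\<^sub>R gy"
   unfolding gr_def p_def q_def a_def b_def gx_def gy_def by (simp add: algebra_simps diff_divide_distrib)
  also have "norm \<dots> \<le> norm ((exp (p / a) / a) *\<^sub>R (gx - gy)) + norm (((exp (p / a) - exp (q / a)) / a) *\<^sub>R gy) + norm ((exp (q / a) / a - exp (q / b) / b) *\<^sub>R gy)"
   by (intro norm_triangle_le add_mono norm_triangle_ineq order_refl)
  also have "\<dots> = exp (p / a) / a * norm (gx - gy) + \<bar>exp (p / a) - exp (q / a)\<bar> / a * norm gy + \<bar>exp (q / a) / a - exp (q / b) / b\<bar> * norm gy"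
   using a0 by simp
  also have "\<dots> \<le> Gm / lam0 * (L * u) + (Gm / lam0 * (G * u)) / lam0 * G + (Gm * (C / lam0 ^ 3 + 1 / lam0\<^sup>2) * v) * G"
  proof (intro add_mono)
   have Lu: "0 \<le> L * u" using gxy norm_ge_zero[of "gx - gy"] by linarith
   show "exp (p / a) / a * norm (gx - gy) \<le> Gm / lam0 * (L * u)"
    using e gxy Lu ab lam0_pos Gm_ge by (intro mult_mono frac_le) auto
   have "\<bar>exp (p / a) - exp (q / a)\<bar> \<le> Gm / lam0 * \<bar>p - q\<bar>" unfolding Gm_def by (rule exp_quot_lip(1)[OF lam0_pos p q ab(1) ab(1)])
   also have "\<dots> \<le> Gm / lam0 * (G * u)" using pq Gm_ge lam0_pos by (intro mult_left_mono) auto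
   finally show "\<bar>exp (p / a) - exp (q / a)\<bar> / a * norm gy \<le> (Gm / lam0 * (G * u)) / lam0 * G"
    using ab gy lam0_pos G_nn Gm_ge by (intro mult_mono frac_le) (auto simp: u_def intro!: divide_nonneg_nonneg mult_nonneg_nonneg)
   have "\<bar>exp (q / a) / a - exp (q / b) / b\<bar> \<le> Gm * (C / lam0 ^ 3 + 1 / lam0\<^sup>2) * v"
    unfolding Gm_def v_def a_def[symmetric] b_def[symmetric] by (rule exp_quot_lip(3)[OF lam0_pos q q ab])
   thus "\<bar>exp (q / a) / a - exp (q / b) / b\<bar> * norm gy \<le> (Gm * (C / lam0 ^ 3 + 1 / lam0\<^sup>2) * v) * G"
    using gy by (intro mult_mono) auto
  qed
  also have "\<dots> = LA * u + LB * v" unfolding LA_def LB_def by (simp add: field_simps power2_eq_square)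
  finally show ?thesis .
 qed
 have s: "norm (snd (gr i x - gr i y)) \<le> LC * u + LD * v"
 proof -
  have "norm (snd (gr i x - gr i y)) = \<bar>(p * exp (p / a) / a\<^sup>2 - q * exp (q / a) / a\<^sup>2) + (q * exp (q / a) / a\<^sup>2 - q * exp (q / b) / b\<^sup>2)\<bar>"
   unfolding gr_def p_def q_def a_def b_def by (simp add: abs_minus_commute)
  also have "\<dots> \<le> \<bar>p * exp (p / a) / a\<^sup>2 - q * exp (q / a) / a\<^sup>2\<bar> + \<bar>q * exp (q / a) / a\<^sup>2 - q * exp (q / b) / b\<^sup>2\<bar>" by (rule abs_triangle_ineq)
  also have "\<dots> \<le> Gm * (C + lam0) / lam0 ^ 3 * \<bar>p - q\<bar> + Gm * (C\<^sup>2 + 2 * lam0 * C) / lam0 ^ 4 * v"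
   unfolding Gm_def v_def a_def[symmetric] b_def[symmetric]
   by (intro add_mono exp_quot_lip(4)[OF lam0_pos p q ab(1) ab(1)] exp_quot_lip(5)[OF lam0_pos q q ab])
  also have "\<dots> \<le> Gm * (C + lam0) / lam0 ^ 3 * (G * u) + Gm * (C\<^sup>2 + 2 * lam0 * C) / lam0 ^ 4 * v"
   using pq Gm_ge C_nn lam0_pos by (intro add_right_mono mult_left_mono) auto
  also have "\<dots> = LC * u + LD * v" unfolding LC_def LD_def by (simp add: field_simps)
  finally show ?thesis .
 qed
 have "(norm (gr i x - gr i y))\<^sup>2 \<le> (LA * u + LB * v)\<^sup>2 + (LC * u + LD * v)\<^sup>2"
  unfolding norm_prod_sq[of "gr i x - gr i y"] by (intro add_mono power_mono f s) auto
 also have "\<dots> \<le> (LA\<^sup>2 + LB\<^sup>2) * (u\<^sup>2 + v\<^sup>2) + (LC\<^sup>2 + LD\<^sup>2) * (u\<^sup>2 + v\<^sup>2)" by (intro add_mono cs2)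
 also have "\<dots> = (Ln * norm (x - y))\<^sup>2" unfolding uv Ln by (simp add: power_mult_distrib algebra_simps)
 finally show ?thesis by (rule power2_le_imp_le) (use Ln_nn in simp)
qed

lemma gb_mean: "gb x = (1 / real n) *\<^sub>R (\<Sum>i<n. gi l i x)" unfolding gb_def gbar_def by simp

lemma gb_bd:
 assumes "x \<in> X"
 shows "1 \<le> gb x" "gb x \<le> Gm"
proof -
 have "gb x = avg n (\<lambda>i. gi l i x)" unfolding gb_def gbar_def avg_def ..
 thus "1 \<le> gb x" "gb x \<le> Gm" using avg_ge[OF n0, of 1] avg_le[OF n0, of _ Gm] gi_bd[OF _ assms] by auto
qed

lemma ln_gb: "x \<in> X \<Longrightarrow> 0 \<le> ln (gb x) \<and> ln (gb x) \<le> C / lam0"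
proof -
 assume x: "x \<in> X"
 have "ln (gb x) \<le> ln Gm" using gb_bd[OF x] by simp
 thus ?thesis using gb_bd[OF x] unfolding Gm_def by simp
qed

lemma gb_lip: "x \<in> X \<Longrightarrow> y \<in> X \<Longrightarrow> \<bar>gb x - gb y\<bar> \<le> Lg * norm (x - y)"
 using mean_norm_le[OF n0, of "\<lambda>i. gi l i x - gi l i y"] gi_lip unfolding gb_mean by (simp add: sum_subtractf diff_divide_distrib)

lemma qb_norm: "x \<in> X \<Longrightarrow> norm (qb x) \<le> Lg"
 unfolding qb_def by (rule mean_norm_le[OF n0]) (rule gr_norm)

lemma qb_lip: "x \<in> X \<Longrightarrow> y \<in> X \<Longrightarrow> norm (qb x - qb y) \<le> Ln * norm (x - y)"
 unfolding qb_def scaleR_diff_right[symmetric] sum_subtractf[symmetric] by (rule mean_norm_le[OF n0]) (rule gr_lip)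

lemma gb_deriv:
 assumes "snd x \<noteq> 0"
 shows "(gb has_derivative (\<lambda>h. qb x \<bullet> h)) (at x)"
proof -
 have "((\<lambda>x. (1 / real n) *\<^sub>R (\<Sum>i<n. gi l i x)) has_derivative (\<lambda>h. (1 / real n) *\<^sub>R (\<Sum>i<n. gr i x \<bullet> h))) (at x)"
  by (intro has_derivative_scaleR_right has_derivative_sum gi_deriv) (use assms in auto)
 thus ?thesis unfolding gb_mean[abs_def] qb_def by (simp add: inner_sum_left)
qed

lemma Fo_deriv:
 assumes "x \<in> X"
 shows "(Fo has_derivative (\<lambda>h. gF x \<bullet> h)) (at x)"
proof -
 have g0: "0 < gb x" using gb_bd[OF assms] by linarith
 have 2: "((\<lambda>x. snd x) has_derivative (\<lambda>h. snd h)) (at x)" by (rule has_derivative_snd[OF has_derivative_ident])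
 have 1: "(gb has_derivative (\<lambda>h. qb x \<bullet> h)) (at x)" by (rule gb_deriv) (use XD(4)[OF assms] in simp)
 have "((\<lambda>x. snd x * ln (gb x) + snd x * \<rho>) has_derivative (\<lambda>h. gF x \<bullet> h)) (at x)"
  by (rule has_derivative_eq_rhs[OF has_derivative_add[OF has_derivative_mult[OF 2 has_derivative_ln[OF g0 1]] has_derivative_mult_left[OF 2]]])
   (use g0 in \<open>simp add: fun_eq_iff gF_def inner_prod_def field_simps\<close>)
 thus ?thesis unfolding Fo_def Fobj_def[abs_def] gb_def .
qed

lemma gF_norm: "x \<in> X \<Longrightarrow> norm (gF x) \<le> lt * Lg + C / lam0 + \<rho>"
proof -
 assume x: "x \<in> X"
 have "norm (gF x) \<le> norm ((snd x / gb x) *\<^sub>R qb x) + norm ((0::'a, ln (gb x) + \<rho>))" unfolding gF_def by (rule norm_triangle_ineq)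
 also have "norm ((0::'a, ln (gb x) + \<rho>)) = ln (gb x) + \<rho>" using ln_gb[OF x] rho_pos by (simp add: norm_Pair)
 also have "norm ((snd x / gb x) *\<^sub>R qb x) \<le> (lt / 1) * Lg"
  unfolding norm_scaleR using XD(3,4)[OF x] gb_bd(1)[OF x] qb_norm[OF x] lt_pos Lg_nn
  by (intro mult_mono) (auto intro!: frac_le[of lt, where w = 1, simplified])
 finally show ?thesis using ln_gb[OF x] by simp
qed

lemma ln_diff_le: "0 < a \<Longrightarrow> a \<le> x \<Longrightarrow> a \<le> y \<Longrightarrow> \<bar>ln x - ln y\<bar> \<le> \<bar>x - y\<bar> / a" for a x y :: real
proof -
 assume a: "0 < a" "a \<le> x" "a \<le> y"
 have "norm (ln x - ln y) \<le> 1 / a * norm (x - y)"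
  by (rule field_differentiable_bound[where S = "{a..}" and f' = inverse])
   (use a in \<open>auto intro!: derivative_eq_intros simp: divide_inverse\<close>)
 thus ?thesis by simp
qed

text \<open>Used with a = 1 for the true gradient in \<open>gF_lip\<close> and with a = 1/2 for the
  estimates in alive states in \<open>z_close\<close>.\<close>

lemma quot_close:
 fixes q q' :: "'a \<times> real"
 assumes "0 \<le> lam" "lam \<le> lt" "0 < a" "a \<le> s" "1 \<le> g" "norm q' \<le> Lg"
 shows "norm ((lam / s) *\<^sub>R q - (lam / g) *\<^sub>R q') \<le> lt / a * norm (q - q') + lt * Lg / a * \<bar>s - g\<bar>"
proof -
 have s: "0 < s" using assms by linarith
 have "(lam / s) *\<^sub>R q - (lam / g) *\<^sub>R q' = (lam / s) *\<^sub>R (q - q') + (lam * (1 / s - 1 / g)) *\<^sub>R q'"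
  by (simp add: algebra_simps)
 hence "norm ((lam / s) *\<^sub>R q - (lam / g) *\<^sub>R q') \<le> norm ((lam / s) *\<^sub>R (q - q')) + norm ((lam * (1 / s - 1 / g)) *\<^sub>R q')"
  by (metis norm_triangle_ineq)
 also have "\<dots> = lam / s * norm (q - q') + lam * \<bar>1 / s - 1 / g\<bar> * norm q'" using assms s by (simp add: abs_mult)
 also have "\<dots> \<le> lt / a * norm (q - q') + lt * (\<bar>s - g\<bar> / a) * Lg"
 proof (intro add_mono mult_mono)
  have "1 / s - 1 / g = (g - s) / (s * g)" using s assms by (simp add: field_simps)
  hence "\<bar>1 / s - 1 / g\<bar> = \<bar>s - g\<bar> / (s * g)" using s assms by (simp add: abs_mult abs_minus_commute)
  also have "\<dots> \<le> \<bar>s - g\<bar> / a" using assms s mult_mono[of a s 1 g] by (intro divide_left_mono) auto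
  finally show "\<bar>1 / s - 1 / g\<bar> \<le> \<bar>s - g\<bar> / a" .
  show "lam / s \<le> lt / a" using assms by (intro frac_le) auto
 qed (use assms lt_pos in auto)
 finally show ?thesis by (simp add: mult.commute mult.left_commute)
qed

text \<open>Moving the factor lambda, then the quotient, then the logarithm contributes
  \<open>Lg\<close>, \<open>lt * Ln + lt * Lg^2\<close> and \<open>Lg\<close>, the sum contained in
  LF.\<close>

lemma gF_lip:
 assumes x: "x \<in> X" and y: "y \<in> X"
 shows "norm (gF x - gF y) \<le> LF * norm (x - y)"
proof -
 define d where "d = norm (x - y)"
 have "gF x - gF y = ((snd x - snd y) / gb x) *\<^sub>R qb x + ((snd y / gb x) *\<^sub>R qb x - (snd y / gb y) *\<^sub>R qb y) + (0, ln (gb x) - ln (gb y))"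
  unfolding gF_def by (simp add: algebra_simps diff_divide_distrib prod_eq_iff)
 hence "norm (gF x - gF y) \<le> norm (((snd x - snd y) / gb x) *\<^sub>R qb x) + norm ((snd y / gb x) *\<^sub>R qb x - (snd y / gb y) *\<^sub>R qb y) + norm ((0::'a, ln (gb x) - ln (gb y)))"
  by (metis (no_types, lifting) norm_triangle_le norm_triangle_ineq add_right_mono)
 also have "\<dots> \<le> d * Lg + (lt * (Ln * d) + lt * Lg * (Lg * d)) + Lg * d"
 proof (intro add_mono)
  have "norm (((snd x - snd y) / gb x) *\<^sub>R qb x) = \<bar>snd x - snd y\<bar> / gb x * norm (qb x)" using gb_bd[OF x] by simp
  also have "\<dots> \<le> d / 1 * Lg"
   using gb_bd(1)[OF x] qb_norm[OF x] norm_comp_le(2)[of "x - y"] unfolding d_def by (intro mult_mono frac_le) auto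
  finally show "norm (((snd x - snd y) / gb x) *\<^sub>R qb x) \<le> d * Lg" by simp
  have "norm ((snd y / gb x) *\<^sub>R qb x - (snd y / gb y) *\<^sub>R qb y) \<le> lt / 1 * norm (qb x - qb y) + lt * Lg / 1 * \<bar>gb x - gb y\<bar>"
   using XD(3,4)[OF y] gb_bd(1)[OF x] gb_bd(1)[OF y] qb_norm[OF y] by (intro quot_close) auto
  also have "\<dots> \<le> lt / 1 * (Ln * d) + lt * Lg / 1 * (Lg * d)" unfolding d_def
   using qb_lip[OF x y] gb_lip[OF x y] lt_pos Lg_nn by (intro add_mono mult_left_mono) auto
  finally show "norm ((snd y / gb x) *\<^sub>R qb x - (snd y / gb y) *\<^sub>R qb y) \<le> lt * (Ln * d) + lt * Lg * (Lg * d)" by simp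
  have "norm ((0::'a, ln (gb x) - ln (gb y))) = \<bar>ln (gb x) - ln (gb y)\<bar>" by (simp add: norm_Pair)
  also have "\<dots> \<le> \<bar>gb x - gb y\<bar> / 1" using gb_bd(1)[OF x] gb_bd(1)[OF y] by (intro ln_diff_le) auto
  also have "\<dots> \<le> Lg * d" using gb_lip[OF x y] unfolding d_def by simp
  finally show "norm ((0::'a, ln (gb x) - ln (gb y))) \<le> Lg * d" .
 qed
 also have "\<dots> = (lt * Lg\<^sup>2 + 2 * Lg + lt * Ln) * d" by (simp add: algebra_simps power2_eq_square)
 also have "\<dots> \<le> LF * d" using LF_ge(2) unfolding d_def by (intro mult_right_mono) auto
 finally show ?thesis unfolding d_def .
qed

lemma Fo_mvt:
 assumes x: "x \<in> X" and y: "y \<in> X"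
 shows "\<exists>z\<in>X. norm (z - x) \<le> norm (y - x) \<and> Fo y - Fo x = gF z \<bullet> (y - x)"
proof -
 have inX: "x + t *\<^sub>R (y - x) \<in> X" if "0 \<le> t" "t \<le> 1" for t
  using convexD_alt[OF X_convex x y that] by (simp add: algebra_simps)
 have "\<exists>t\<in>{0..1}. Fo (x + 1 *\<^sub>R (y - x)) - Fo (x + 0 *\<^sub>R (y - x)) = gF (x + t *\<^sub>R (y - x)) \<bullet> ((1 - 0) *\<^sub>R (y - x))"
 proof (rule mvt_very_simple[where f = "\<lambda>t. Fo (x + t *\<^sub>R (y - x))" and f' = "\<lambda>t h. gF (x + t *\<^sub>R (y - x)) \<bullet> (h *\<^sub>R (y - x))"])
  fix t :: real assume t: "0 \<le> t" "t \<le> 1"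
  have 1: "((\<lambda>t. x + t *\<^sub>R (y - x)) has_derivative (\<lambda>h. h *\<^sub>R (y - x))) (at t within {0..1})"
   by (auto intro!: derivative_eq_intros)
  show "((\<lambda>t. Fo (x + t *\<^sub>R (y - x))) has_derivative (\<lambda>h. gF (x + t *\<^sub>R (y - x)) \<bullet> (h *\<^sub>R (y - x)))) (at t within {0..1})"
   by (rule has_derivative_compose[OF 1 Fo_deriv[OF inX[OF t]]])
 qed simp
 then obtain t where t: "0 \<le> t" "t \<le> 1" and e: "Fo y - Fo x = gF (x + t *\<^sub>R (y - x)) \<bullet> (y - x)" by auto
 have "norm (x + t *\<^sub>R (y - x) - x) \<le> norm (y - x)" using t by (simp add: mult_left_le_one_le)
 thus ?thesis using inX[OF t] e by blast
qed

text \<open>The mean value theorem gives LF in place of the sharp LF/2; the step size leaves room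
  for this, see \<open>et_LF\<close>.\<close>

lemma Fo_quad:
 assumes x: "x \<in> X" and y: "y \<in> X"
 shows "\<bar>Fo y - Fo x - gF x \<bullet> (y - x)\<bar> \<le> LF * (norm (y - x))\<^sup>2"
proof -
 obtain z where z: "z \<in> X" "norm (z - x) \<le> norm (y - x)" "Fo y - Fo x = gF z \<bullet> (y - x)" using Fo_mvt[OF x y] by blast
 have "\<bar>Fo y - Fo x - gF x \<bullet> (y - x)\<bar> = \<bar>(gF z - gF x) \<bullet> (y - x)\<bar>" unfolding z(3) by (simp add: inner_diff_left)
 also have "\<dots> \<le> norm (gF z - gF x) * norm (y - x)" by (rule Cauchy_Schwarz_ineq2)
 also have "\<dots> \<le> (LF * norm (y - x)) * norm (y - x)"
  using order_trans[OF gF_lip[OF z(1) x] mult_left_mono[OF z(2)]] LF_ge(1) by (intro mult_right_mono) auto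
 finally show ?thesis by (simp add: power2_eq_square)
qed

lemma Fo_lip:
 assumes x: "x \<in> X" and y: "y \<in> X"
 shows "\<bar>Fo x - Fo y\<bar> \<le> (lt * Lg + C / lam0 + \<rho>) * norm (x - y)"
proof -
 obtain z where z: "z \<in> X" "Fo x - Fo y = gF z \<bullet> (x - y)" using Fo_mvt[OF y x] by blast
 have "\<bar>Fo x - Fo y\<bar> \<le> norm (gF z) * norm (x - y)" unfolding z(2) by (rule Cauchy_Schwarz_ineq2)
 also have "\<dots> \<le> (lt * Lg + C / lam0 + \<rho>) * norm (x - y)" by (intro mult_right_mono gF_norm z) simp
 finally show ?thesis .
qed

lemma Fo_bd:
 assumes x: "x \<in> X"
 shows "lam0 * \<rho> \<le> Fo x" "Fo x \<le> lt * (C / lam0) + lt * \<rho>"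
proof -
 have "lam0 * \<rho> \<le> snd x * \<rho>" using XD(2)[OF x] rho_pos by (intro mult_right_mono) auto
 moreover have "0 \<le> snd x * ln (gb x)" using ln_gb[OF x] XD(4)[OF x] by simp
 ultimately show "lam0 * \<rho> \<le> Fo x" unfolding Fo_def Fobj_def gb_def by linarith
 have "snd x * ln (gb x) + snd x * \<rho> \<le> lt * (C / lam0) + lt * \<rho>"
  using ln_gb[OF x] XD(3,4)[OF x] rho_pos lt_pos by (intro add_mono mult_mono) auto
 thus "Fo x \<le> lt * (C / lam0) + lt * \<rho>" unfolding Fo_def Fobj_def gb_def .
qed

text \<open>The variational inequality says that nu lies in the normal cone of X at x, and gradient
  plus normal vector is a regular subgradient. Outside X the difference quotient is infinite;
  inside, the remainder is quadratic by \<open>Fo_quad\<close>.\<close>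

lemma dist0_le:
 assumes x: "x \<in> X" and nu: "\<And>y. y \<in> X \<Longrightarrow> \<nu> \<bullet> (y - x) \<le> 0"
 shows "dist0 (regular_subdiff (Fbar n l \<rho> X) x) \<le> ereal (norm (gF x + \<nu>))"
proof -
 have "gF x + \<nu> \<in> regular_subdiff (Fbar n l \<rho> X) x"
  unfolding regular_subdiff_def mem_Collect_eq le_Liminf_iff
 proof (intro allI impI)
  fix e :: ereal assume e: "e < 0"
  obtain d where d: "e < ereal (- d)" "0 < d"
  proof -
   obtain e' where "e < ereal e'" "ereal e' < 0" using ereal_dense2[OF e] by blast
   thus ?thesis using that[of "- e'"] by simp
  qed
  have "\<forall>\<^sub>F y in at x. dist y x < d / LF"
   using LF_ge(1) d unfolding eventually_at by (intro exI[of _ "d / LF"]) auto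
  moreover have "\<forall>\<^sub>F y in at x. y \<noteq> x" by (simp add: eventually_at_filter)
  ultimately show "\<forall>\<^sub>F y in at x. e < (Fbar n l \<rho> X y - Fbar n l \<rho> X x - ereal ((gF x + \<nu>) \<bullet> (y - x))) / ereal (norm (y - x))"
  proof eventually_elim
   case (elim y)
   have ny: "0 < norm (y - x)" using elim by simp
   show ?case
   proof (cases "y \<in> X")
    case False
    moreover have "e \<noteq> \<infinity>" using e by auto
    ultimately show ?thesis using x ny unfolding Fbar_def by simp
   next
    case True
    have "- (LF * (norm (y - x))\<^sup>2) \<le> Fo y - Fo x - (gF x + \<nu>) \<bullet> (y - x)"
     using Fo_quad[OF x True] nu[OF True] by (simp add: inner_add_left)
    hence "- (LF * norm (y - x)) \<le> (Fo y - Fo x - (gF x + \<nu>) \<bullet> (y - x)) / norm (y - x)"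
     using ny by (simp add: pos_le_divide_eq power2_eq_square mult.assoc)
    moreover have "LF * norm (y - x) < d" using elim LF_ge(1) by (simp add: dist_norm pos_less_divide_eq mult.commute)
    ultimately have "ereal (- d) < ereal ((Fo y - Fo x - (gF x + \<nu>) \<bullet> (y - x)) / norm (y - x))" by simp
    hence "e < ereal ((Fo y - Fo x - (gF x + \<nu>) \<bullet> (y - x)) / norm (y - x))" using d(1) by (rule less_trans[rotated])
    thus ?thesis using x True ny unfolding Fbar_def Fo_def by simp
   qed
  qed
 qed
 thus ?thesis unfolding dist0_def by (rule INF_lower2) simp
qed

end

section \<open>The algorithm as an error recursion\<close>

locale dro_run = dro l W n lam0 \<rho> R G C L
 for l :: "nat \<Rightarrow> 'a::euclidean_space \<Rightarrow> real" and W n lam0 \<rho> R G C L +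
 fixes \<sigma>2 \<alpha> :: real
 assumes s2: "0 < \<sigma>2" and al: "1 < \<alpha>"
begin

text \<open>\<open>\<sigma>2\<close> is the square of sigma, so \<open>\<sigma>2 powr (1/3)\<close>
  is sigma^(2/3). The parameters are those of the final statement, named so that they can be
  analysed separately.\<close>

definition kk :: real where "kk = \<alpha> * \<sigma>2 powr (1/3) / LF"
definition om :: real where "om = max (2 * \<sigma>2) ((16 * LF^2 * kk)^3)"
definition cc :: real where "cc = \<sigma>2 / (14 * LF * kk^3) + 130 * LF^4"
definition et :: "nat \<Rightarrow> real" where "et t = kk / (om + real t * \<sigma>2) powr (1/3)"
definition be :: "nat \<Rightarrow> real" where "be t = cc * (et t)^2"
definition rt :: "nat \<Rightarrow> real" where "rt t = (om + real t * \<sigma>2) powr (1/3)"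

lemma LF_pos: "0 < LF" using LF_ge(1) by linarith
lemma kk_pos: "0 < kk" unfolding kk_def using al s2 LF_pos by (intro divide_pos_pos mult_pos_pos) auto
lemma om_pos: "0 < om" unfolding om_def using s2 by simp
lemma et_rt: "et t = kk / rt t" unfolding et_def rt_def ..
lemma base_pos: "0 < om + real t * \<sigma>2" by (rule add_pos_nonneg) (use om_pos s2 in auto)
lemma rt_cube: "rt t ^ 3 = om + real t * \<sigma>2"
 unfolding rt_def using base_pos[of t] by (simp add: powr_power)
lemma rt_pos: "0 < rt t" unfolding rt_def using base_pos[of t] by simp
lemma rt_mono: "s \<le> t \<Longrightarrow> rt s \<le> rt t"
 unfolding rt_def using om_pos s2 by (intro powr_mono2 add_left_mono mult_right_mono) (auto simp: add_nonneg_nonneg)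
lemma et_pos: "0 < et t" unfolding et_rt using kk_pos rt_pos by simp

text \<open>om is at least the cube of \<open>16 * LF^2 * kk\<close>, so the cube root dominates
  this number from t = 0 on.\<close>

lemma et_le: "et t \<le> 1 / (16 * LF\<^sup>2)"
proof -
 have "(16 * LF\<^sup>2 * kk) ^ 3 \<le> rt t ^ 3" unfolding rt_cube om_def using s2 by (simp add: add_increasing2)
 hence "16 * LF\<^sup>2 * kk \<le> rt t" by (rule power_mono_iff[THEN iffD1, rotated 3]) (use rt_pos[of t] kk_pos in auto)
 thus ?thesis unfolding et_rt using rt_pos[of t] LF_pos by (simp add: field_simps)
qed

text \<open>The error recursion has N = LF; as LF is at least 1, the summand
  \<open>130 * LF ^ 4\<close> covers \<open>130 * N^2\<close>.\<close>

lemma cc_ge: "130 * LF\<^sup>2 \<le> cc"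
proof -
 have "LF\<^sup>2 * 1 \<le> LF\<^sup>2 * LF\<^sup>2" using one_le_power[OF LF_ge(1), of 2] by (intro mult_left_mono) auto
 moreover have "LF ^ 4 = LF\<^sup>2 * LF\<^sup>2" by (simp add: power4_eq_xxxx power2_eq_square)
 moreover have "0 \<le> \<sigma>2 / (14 * LF * kk ^ 3)" using s2 LF_pos kk_pos by simp
 ultimately show ?thesis unfolding cc_def by linarith
qed

text \<open>Inserting kk turns the first summand of cc into \<open>LF^2 / (14 * alpha^3)\<close>, at
  most \<open>LF ^ 4\<close>. So cc is at most \<open>131 * LF ^ 4\<close>, against eta^2 at most
  \<open>1 / (256 * LF ^ 4)\<close>.\<close>

lemma be_le1: "be t \<le> 1"
proof -
 have k3: "kk ^ 3 = \<alpha> ^ 3 * \<sigma>2 / LF ^ 3"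
  unfolding kk_def power_divide power_mult_distrib using s2 by (simp add: powr_power)
 have "\<sigma>2 / (14 * LF * kk ^ 3) = LF\<^sup>2 / (14 * \<alpha> ^ 3)"
  unfolding k3 using s2 LF_pos al by (simp add: field_simps power2_eq_square power3_eq_cube)
 also have "\<dots> \<le> LF\<^sup>2 / 1"
 proof (rule divide_left_mono)
  have "1 \<le> \<alpha> ^ 3" by (rule one_le_power) (use al in simp)
  thus "1 \<le> 14 * \<alpha> ^ 3" "0 < 14 * \<alpha> ^ 3 * 1" by linarith+
 qed simp
 also have "\<dots> \<le> LF ^ 4" using power_increasing[of 2 4 LF] LF_ge(1) by simp
 finally have "cc \<le> 131 * LF ^ 4" unfolding cc_def by simp
 hence "be t \<le> 131 * LF ^ 4 * (1 / (16 * LF\<^sup>2))\<^sup>2"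
  unfolding be_def using et_le[of t] et_pos[of t] cc_ge LF_pos by (intro mult_mono power_mono) auto
 also have "\<dots> = 131 / 256" using LF_pos by (simp add: field_simps power2_eq_square power4_eq_xxxx)
 finally show ?thesis by simp
qed

lemma et_LF: "LF \<le> 1 / et t" "LF \<le> 1 / (8 * et t)"
proof -
 have "16 * (LF\<^sup>2 * et t) \<le> 1" using et_le[of t] LF_pos by (simp add: field_simps)
 moreover have "LF * et t \<le> LF\<^sup>2 * et t" using LF_ge(1) et_pos[of t] by (simp add: power2_eq_square)
 moreover have "0 < LF * et t" using LF_pos et_pos[of t] by simp
 ultimately have "8 * (LF * et t) \<le> 1" "LF * et t \<le> 1" by linarith+
 thus "LF \<le> 1 / (8 * et t)" "LF \<le> 1 / et t" using et_pos[of t] by (simp_all add: field_simps)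
qed

text \<open>Difference of cubes: the cube of rt is linear in t with slope
  \<open>\<sigma>2\<close>.\<close>

lemma rt_diff: "rt (Suc t) - rt t = \<sigma>2 / ((rt t)\<^sup>2 + rt t * rt (Suc t) + (rt (Suc t))\<^sup>2)"
proof -
 define p where "p = (rt t)\<^sup>2 + rt t * rt (Suc t) + (rt (Suc t))\<^sup>2"
 have "0 < p" unfolding p_def using rt_pos[of t] rt_pos[of "Suc t"] by (intro add_pos_pos) auto
 moreover have "(rt (Suc t) - rt t) * p = rt (Suc t) ^ 3 - rt t ^ 3" unfolding p_def by (simp add: algebra_simps power2_eq_square power3_eq_cube)
 moreover have "rt (Suc t) ^ 3 - rt t ^ 3 = \<sigma>2" unfolding rt_cube by (simp add: algebra_simps)
 ultimately show ?thesis unfolding p_def[symmetric] by (simp add: eq_divide_eq)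
qed

lemma et_dec: "et (Suc t) \<le> et t"
 unfolding et_rt using rt_mono[of t "Suc t"] rt_pos kk_pos by (intro divide_left_mono) auto

lemma et_lo: "kk / (om + \<sigma>2) powr (1/3) * (real t + 1) powr (-1/3) \<le> et (Suc t)"
proof -
 have "om * 1 \<le> om * (real t + 1)" using om_pos by (intro mult_left_mono) auto
 hence "om + real (Suc t) * \<sigma>2 \<le> (om + \<sigma>2) * (real t + 1)" by (simp add: algebra_simps)
 hence "rt (Suc t) \<le> ((om + \<sigma>2) * (real t + 1)) powr (1/3)" unfolding rt_def using om_pos s2 by (intro powr_mono2) (auto simp: add_nonneg_nonneg)
 also have "\<dots> = (om + \<sigma>2) powr (1/3) * (real t + 1) powr (1/3)" using om_pos s2 by (simp add: powr_mult)
 finally have "kk / ((om + \<sigma>2) powr (1/3) * (real t + 1) powr (1/3)) \<le> et (Suc t)"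
  unfolding et_rt using rt_pos kk_pos om_pos s2 by (intro divide_left_mono) auto
 moreover have "(real t + 1) powr (-1/3) = 1 / (real t + 1) powr (1/3)" using powr_minus_divide[of "real t + 1" "1/3"] by simp
 ultimately show ?thesis by simp
qed

lemma et_hi: "et (Suc t) \<le> kk / \<sigma>2 powr (1/3) * (real t + 1) powr (-1/3)"
proof -
 have "\<sigma>2 powr (1/3) * (real t + 1) powr (1/3) = (\<sigma>2 * (real t + 1)) powr (1/3)" using s2 by (simp add: powr_mult)
 also have "\<dots> \<le> rt (Suc t)" unfolding rt_def using om_pos s2 by (intro powr_mono2) (auto simp: algebra_simps)
 finally have "et (Suc t) \<le> kk / (\<sigma>2 powr (1/3) * (real t + 1) powr (1/3))"
  unfolding et_rt using rt_pos kk_pos s2 by (intro divide_left_mono) auto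
 moreover have "(real t + 1) powr (-1/3) = 1 / (real t + 1) powr (1/3)" using powr_minus_divide[of "real t + 1" "1/3"] by simp
 ultimately show ?thesis by simp
qed

text \<open>t + 1 is at most 2 * (s + 1), well within the factor 8 = 2^3 that the cube root
  allows.\<close>

lemma et_half: "t \<le> 2 * s + 1 \<Longrightarrow> et (Suc s) \<le> 2 * et (Suc t)"
proof -
 assume "t \<le> 2 * s + 1"
 hence "real (Suc t) * \<sigma>2 \<le> (8 * real (Suc s)) * \<sigma>2" using s2 by (intro mult_right_mono) auto
 hence "real (Suc t) * \<sigma>2 \<le> 8 * (real (Suc s) * \<sigma>2)" by (simp only: mult.assoc)
 moreover have "b + a \<le> 8 * (b + d)" if "a \<le> 8 * d" "0 < b" for a b d :: real using that by simp
 ultimately have "om + real (Suc t) * \<sigma>2 \<le> 8 * (om + real (Suc s) * \<sigma>2)" using om_pos by blast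
 moreover have "(2 * rt (Suc s)) ^ 3 = 8 * (om + real (Suc s) * \<sigma>2)" unfolding power_mult_distrib rt_cube by simp
 ultimately have "rt (Suc t) ^ 3 \<le> (2 * rt (Suc s)) ^ 3" by (simp only: rt_cube)
 hence "rt (Suc t) \<le> 2 * rt (Suc s)" by (rule power_mono_iff[THEN iffD1, rotated 3]) (use rt_pos in \<open>auto simp: less_imp_le\<close>)
 hence "kk / (2 * rt (Suc s)) \<le> kk / rt (Suc t)" using rt_pos kk_pos by (intro divide_left_mono) auto
 thus ?thesis unfolding et_rt by simp
qed

lemma et_diff: "et t - et (Suc t) \<le> \<sigma>2 / (kk * (rt 0)\<^sup>2) * (et t)\<^sup>2"
proof -
 define x y z where "x = rt t" and "y = rt (Suc t)" and "z = rt 0"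
 have p: "0 < x" "0 < y" "0 < z" "z \<le> x" "z \<le> y" unfolding x_def y_def z_def using rt_pos rt_mono by auto
 have "y - x \<le> \<sigma>2 / (z * y)"
  unfolding x_def y_def rt_diff unfolding x_def[symmetric] y_def[symmetric]
 proof (rule divide_left_mono)
  have "z * y \<le> x * y" using p by (intro mult_right_mono) auto
  thus "z * y \<le> x\<^sup>2 + x * y + y\<^sup>2" by (simp add: add_increasing add_increasing2)
 qed (use p s2 in \<open>auto intro!: mult_pos_pos add_pos_pos\<close>)
 hence "kk * (y - x) / (x * y) \<le> kk * (\<sigma>2 / (z * y)) / (x * y)" using p kk_pos by (intro divide_right_mono mult_left_mono) auto
 also have "\<dots> = kk * \<sigma>2 / (x * z * (y * y))" using p by (simp add: field_simps)
 also have "\<dots> \<le> kk * \<sigma>2 / (x * z * (x * z))"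
 proof (rule divide_left_mono)
  have "x \<le> y" unfolding x_def y_def by (rule rt_mono) simp
  hence "x * z \<le> y * y" using p by (intro mult_mono) auto
  thus "x * z * (x * z) \<le> x * z * (y * y)" using p by (intro mult_left_mono) auto
 qed (use p kk_pos s2 in auto)
 also have "\<dots> = \<sigma>2 / (kk * z\<^sup>2) * (kk / x)\<^sup>2" using p kk_pos by (simp add: field_simps power2_eq_square)
 finally have "kk * (y - x) / (x * y) \<le> \<sigma>2 / (kk * z\<^sup>2) * (kk / x)\<^sup>2" .
 moreover have "kk / x - kk / y = kk * (y - x) / (x * y)" using p by (simp add: field_simps)
 ultimately show ?thesis unfolding et_rt x_def y_def z_def by simp
qed

text \<open>1/eta^2 is of order t^(2/3), so its increments are of order t^(-1/3), like eta. This
  provides the hypothesis of \<open>main_sum\<close>.\<close>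

lemma et_inv_diff: "1 / (et (Suc t))\<^sup>2 - 1 / (et t)\<^sup>2 \<le> 2 * \<sigma>2 / kk ^ 3 * et (Suc t)"
proof -
 define x y where "x = rt t" and "y = rt (Suc t)"
 define p where "p = x\<^sup>2 + x * y + y\<^sup>2"
 have xy: "0 < x" "0 < y" unfolding x_def y_def using rt_pos by auto
 have p: "0 < p" unfolding p_def using xy by (intro add_pos_pos) auto
 have d: "y - x = \<sigma>2 / p" unfolding p_def x_def y_def by (rule rt_diff)
 have le: "(x + y) * y \<le> 2 * p" unfolding p_def using xy by (simp add: power2_eq_square algebra_simps add_nonneg_nonneg)
 have "y\<^sup>2 - x\<^sup>2 = \<sigma>2 / p * (x + y)" unfolding d[symmetric] by (simp add: power2_eq_square algebra_simps)
 also have "\<dots> \<le> 2 * \<sigma>2 / y"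
 proof -
  have "\<sigma>2 * ((x + y) * y) \<le> \<sigma>2 * (2 * p)" using le s2 by (intro mult_left_mono) auto
  thus ?thesis using p xy by (simp add: field_simps)
 qed
 finally have "(y\<^sup>2 - x\<^sup>2) / kk\<^sup>2 \<le> (2 * \<sigma>2 / y) / kk\<^sup>2" by (intro divide_right_mono) auto
 moreover have "(2 * \<sigma>2 / y) / kk\<^sup>2 = 2 * \<sigma>2 / kk ^ 3 * (kk / y)" using kk_pos xy by (simp add: field_simps power2_eq_square power3_eq_cube)
 moreover have "1 / (kk / y)\<^sup>2 - 1 / (kk / x)\<^sup>2 = (y\<^sup>2 - x\<^sup>2) / kk\<^sup>2" using kk_pos xy by (simp add: power_divide diff_divide_distrib)
 ultimately show ?thesis unfolding et_rt x_def y_def by simp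
qed

section \<open>The search direction in error coordinates\<close>

definition ws :: real where "ws = lt * Lg + 1"
definition GF :: real where "GF = lt * Lg + C / lam0 + \<rho>"
text \<open>Up to a common factor 2, due to s being at least 1/2, the scalings lt and
  \<open>ws = lt * Lg + 1\<close> are the sensitivities of the direction to errors of the gradient
  and of the value estimate (\<open>z_close\<close>). With them Yi is still LF-Lipschitz
  (\<open>Yi_lip\<close>).\<close>

definition Yi :: "nat \<Rightarrow> 'a \<times> real \<Rightarrow> ('a \<times> real) \<times> real" where "Yi i x = (lt *\<^sub>R gr i x, ws * gi l i x)"
definition zd :: "'a \<times> real \<Rightarrow> 'a \<times> real \<Rightarrow> real \<Rightarrow> 'a \<times> real" where "zd x q s = (snd x / s) *\<^sub>R q + (0, ln s + \<rho>)"
text \<open>The direction recovered from the scaled error: \<open>qb + fst e / lt\<close> is the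
  estimate (v, u) and \<open>gb + snd e / ws\<close> is s; see \<open>nx_run\<close>.\<close>

definition zc :: "('a \<times> real) \<times> (('a \<times> real) \<times> real) \<Rightarrow> 'a \<times> real" where
 "zc p = zd (fst p) (qb (fst p) + (1 / lt) *\<^sub>R fst (snd p)) (gb (fst p) + snd (snd p) / ws)"
definition nx :: "nat \<Rightarrow> ('a \<times> real) \<times> (('a \<times> real) \<times> real) \<Rightarrow> 'a \<times> real" where
 "nx j p = closest_point X (fst p - et (Suc j) *\<^sub>R zc p)"
definition M0 :: real where "M0 = 2 * (lt * Lg) + \<rho>"
text \<open>Growth of order 3/2: one from the factor s / lambda, 1/2 from bounding the squared
  logarithm of s by a multiple of sqrt s. Any order below 2 would satisfy the growth condition of
  the recursion (\<open>rr_growth\<close>).\<close>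

definition rr :: "real \<Rightarrow> real" where "rr y = (2 * M0 + 8)\<^sup>2 / (2 * lam0) * ((y + Gm) * sqrt (y + Gm))"

lemma ws_pos: "1 \<le> ws" "0 < ws"
proof -
 show "1 \<le> ws" unfolding ws_def using lt_pos Lg_nn by simp
 thus "0 < ws" by linarith
qed
lemma GF_nn: "0 \<le> GF" unfolding GF_def using lt_pos Lg_nn C_nn lam0_pos rho_pos by (intro add_nonneg_nonneg) auto
lemma M0_nn: "0 \<le> M0" unfolding M0_def using lt_pos Lg_nn rho_pos by (intro add_nonneg_nonneg) auto

lemma nx_in: "nx j p \<in> X" unfolding nx_def by (rule closest_point_in_set[OF X_closed X_ne])

lemma pair_norm_sum: "norm (fst e) + \<bar>snd e\<bar> \<le> 2 * norm e" "(norm (fst e) + \<bar>snd e\<bar>)\<^sup>2 \<le> 2 * (norm e)\<^sup>2" for e :: "'b::real_normed_vector \<times> real"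
proof -
 show "norm (fst e) + \<bar>snd e\<bar> \<le> 2 * norm e" using norm_comp_le[of e] by simp
 have "(a + b)\<^sup>2 \<le> 2 * (a\<^sup>2 + b\<^sup>2)" for a b :: real using sum_squares_bound[of a b] by (simp add: power2_sum)
 thus "(norm (fst e) + \<bar>snd e\<bar>)\<^sup>2 \<le> 2 * (norm e)\<^sup>2" unfolding norm_prod_sq[of e] real_norm_def .
qed

context
 fixes x :: "'a \<times> real" and e :: "('a \<times> real) \<times> real"
 assumes x: "x \<in> X" and alive: "- 1/2 < e \<bullet> (0, 1 / ws)"
begin

lemma s_half: "1/2 \<le> gb x + snd e / ws"
proof -
 have "- 1/2 < snd e / ws" using alive by (simp add: inner_prod_def)
 thus ?thesis using gb_bd(1)[OF x] by linarith
qed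

lemma z_close: "norm (zc (x, e) - gF x) \<le> 2 * (norm (fst e) + \<bar>snd e\<bar>)"
proof -
 define q where "q = qb x + (1 / lt) *\<^sub>R fst e"
 define s where "s = gb x + snd e / ws"
 have s: "1/2 \<le> s" unfolding s_def by (rule s_half)
 have nq: "norm (q - qb x) = norm (fst e) / lt" unfolding q_def using lt_pos by simp
 have ns: "\<bar>s - gb x\<bar> = \<bar>snd e\<bar> / ws" unfolding s_def using ws_pos by simp
 have "zc (x, e) - gF x = ((snd x / s) *\<^sub>R q - (snd x / gb x) *\<^sub>R qb x) + (0, ln s - ln (gb x))"
  unfolding zc_def zd_def gF_def q_def s_def by (simp add: prod_eq_iff algebra_simps)
 hence "norm (zc (x, e) - gF x) \<le> norm ((snd x / s) *\<^sub>R q - (snd x / gb x) *\<^sub>R qb x) + norm ((0::'a, ln s - ln (gb x)))"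
  by (metis norm_triangle_ineq)
 also have "\<dots> \<le> (lt / (1/2) * norm (q - qb x) + lt * Lg / (1/2) * \<bar>s - gb x\<bar>) + \<bar>s - gb x\<bar> / (1/2)"
 proof (rule add_mono)
  show "norm ((snd x / s) *\<^sub>R q - (snd x / gb x) *\<^sub>R qb x) \<le> lt / (1/2) * norm (q - qb x) + lt * Lg / (1/2) * \<bar>s - gb x\<bar>"
   using XD(3,4)[OF x] s gb_bd(1)[OF x] qb_norm[OF x] by (intro quot_close) auto
  have "\<bar>ln s - ln (gb x)\<bar> \<le> \<bar>s - gb x\<bar> / (1/2)" using s gb_bd(1)[OF x] by (intro ln_diff_le) auto
  thus "norm ((0::'a, ln s - ln (gb x))) \<le> \<bar>s - gb x\<bar> / (1/2)" by (simp add: norm_Pair)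
 qed
 also have "\<dots> = 2 * norm (fst e) + 2 * (ws * \<bar>s - gb x\<bar>)" unfolding nq using lt_pos by (simp add: ws_def algebra_simps)
 also have "\<dots> = 2 * (norm (fst e) + \<bar>snd e\<bar>)" unfolding ns using ws_pos by simp
 finally show ?thesis .
qed

lemma z_close_sq: "(norm (zc (x, e) - gF x))\<^sup>2 \<le> 8 * (norm e)\<^sup>2"
proof -
 have "(norm (zc (x, e) - gF x))\<^sup>2 \<le> (2 * (norm (fst e) + \<bar>snd e\<bar>))\<^sup>2" by (intro power_mono z_close) simp
 also have "\<dots> = 4 * (norm (fst e) + \<bar>snd e\<bar>)\<^sup>2" unfolding power_mult_distrib by simp
 also have "\<dots> \<le> 4 * (2 * (norm e)\<^sup>2)" by (intro mult_left_mono pair_norm_sum) simp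
 finally show ?thesis by simp
qed

lemma z_norm: "norm (zc (x, e)) \<le> (GF + 4) * (1 + norm e)"
proof -
 have "norm (zc (x, e)) \<le> norm (gF x) + norm (zc (x, e) - gF x)" by (metis norm_triangle_sub)
 also have "\<dots> \<le> GF + 2 * (2 * norm e)"
 proof (rule add_mono)
  show "norm (gF x) \<le> GF" unfolding GF_def by (rule gF_norm[OF x])
  show "norm (zc (x, e) - gF x) \<le> 2 * (2 * norm e)" by (rule order_trans[OF z_close]) (intro mult_left_mono pair_norm_sum, simp)
 qed
 also have "\<dots> \<le> (GF + 4) * (1 + norm e)" using GF_nn by (simp add: algebra_simps)
 finally show ?thesis .
qed

text \<open>Obtuse angle property of the projection: the vector is normal to X at the new iterate.
  It serves both for the descent and, in \<open>stat_step\<close>, as the normal part of the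
  subgradient.\<close>

lemma proj: "y \<in> X \<Longrightarrow> (- zc (x, e) - (1 / et (Suc j)) *\<^sub>R (nx j (x, e) - x)) \<bullet> (y - nx j (x, e)) \<le> 0"
proof -
 assume y: "y \<in> X"
 define h where "h = et (Suc j)"
 have h: "0 < h" unfolding h_def by (rule et_pos)
 have "(x - h *\<^sub>R zc (x, e) - nx j (x, e)) \<bullet> (y - nx j (x, e)) \<le> 0"
  unfolding nx_def h_def fst_conv by (rule closest_point_dot[OF X_convex X_closed y])
 moreover have "- zc (x, e) - (1 / h) *\<^sub>R (nx j (x, e) - x) = (1 / h) *\<^sub>R (x - h *\<^sub>R zc (x, e) - nx j (x, e))"
  using h by (simp add: algebra_simps)
 ultimately show ?thesis unfolding h_def[symmetric] using h by (simp add: divide_nonpos_pos)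
qed

lemma z_dx: "zc (x, e) \<bullet> (nx j (x, e) - x) \<le> - (norm (nx j (x, e) - x))\<^sup>2 / et (Suc j)"
proof -
 define v where "v = nx j (x, e) - x"
 have m: "x - nx j (x, e) = - v" unfolding v_def by simp
 have "(- zc (x, e) - (1 / et (Suc j)) *\<^sub>R v) \<bullet> (- v) \<le> 0" using proj[OF x, of j] unfolding m v_def[symmetric] .
 thus ?thesis unfolding v_def[symmetric] by (simp add: inner_diff_left power2_norm_eq_inner)
qed

lemma dx_le: "norm (nx j (x, e) - x) \<le> et (Suc j) * (GF + 4) * (1 + norm e)"
proof -
 have "dist (nx j (x, e)) (closest_point X x) \<le> dist (x - et (Suc j) *\<^sub>R zc (x, e)) x"
  unfolding nx_def fst_conv by (rule closest_point_lipschitz[OF X_convex X_closed X_ne])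
 hence "norm (nx j (x, e) - x) \<le> et (Suc j) * norm (zc (x, e))"
  using closest_point_self[OF x] et_pos[of "Suc j"] by (simp add: dist_norm)
 also have "\<dots> \<le> et (Suc j) * ((GF + 4) * (1 + norm e))" using et_pos[of "Suc j"] z_norm by (intro mult_left_mono) auto
 finally show ?thesis by (simp add: mult.assoc)
qed

text \<open>-1 from the projection, +1/2 from Young's inequality for the direction error and +1/8
  from smoothness give -3/8; Young also contributes eta/2 times \<open>8 * |e|^2\<close>.\<close>

lemma descent:
 "Fo (nx j (x, e)) \<le> Fo x - 3/8 * (norm (nx j (x, e) - x))\<^sup>2 / et (Suc j) + 4 * et (Suc j) * (norm e)\<^sup>2"
proof -
 define h d \<Delta> where "h = et (Suc j)" and "d = norm (nx j (x, e) - x)" and "\<Delta> = nx j (x, e) - x"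
 have h: "0 < h" unfolding h_def by (rule et_pos)
 have q: "Fo (nx j (x, e)) \<le> Fo x + gF x \<bullet> \<Delta> + LF * d\<^sup>2" using Fo_quad[OF x nx_in[of j "(x, e)"]] unfolding d_def \<Delta>_def by linarith
 define a where "a = norm (zc (x, e) - gF x)"
 have "(gF x - zc (x, e)) \<bullet> \<Delta> \<le> a * d"
  using norm_cauchy_schwarz[of "gF x - zc (x, e)" \<Delta>] unfolding a_def d_def \<Delta>_def by (simp add: norm_minus_commute)
 moreover have "a * d \<le> d\<^sup>2 / (2 * h) + h / 2 * a\<^sup>2"
 proof -
  have "0 \<le> (d - h * a)\<^sup>2 / (2 * h)" using h by simp
  also have "\<dots> = d\<^sup>2 / (2 * h) + h / 2 * a\<^sup>2 - a * d" using h by (simp add: field_simps power2_eq_square)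
  finally show ?thesis by simp
 qed
 moreover have "h / 2 * a\<^sup>2 \<le> h / 2 * (8 * (norm e)\<^sup>2)" unfolding a_def using h z_close_sq by (intro mult_left_mono) auto
 moreover have "zc (x, e) \<bullet> \<Delta> \<le> - d\<^sup>2 / h" unfolding d_def \<Delta>_def h_def by (rule z_dx)
 moreover have "LF * d\<^sup>2 \<le> 1 / (8 * h) * d\<^sup>2" unfolding h_def by (intro mult_right_mono et_LF) simp
 moreover have "gF x \<bullet> \<Delta> = zc (x, e) \<bullet> \<Delta> + (gF x - zc (x, e)) \<bullet> \<Delta>" by (simp add: inner_diff_left)
 moreover have "d\<^sup>2 / (2 * h) = 1/2 * (d\<^sup>2 / h)" "1 / (8 * h) * d\<^sup>2 = 1/8 * (d\<^sup>2 / h)" "- d\<^sup>2 / h = - (d\<^sup>2 / h)" "3/8 * d\<^sup>2 / h = 3/8 * (d\<^sup>2 / h)"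
  "h / 2 * (8 * (norm e)\<^sup>2) = 4 * h * (norm e)\<^sup>2" by simp_all
 ultimately show ?thesis using q unfolding h_def[symmetric] d_def[symmetric] by linarith
qed

text \<open>The direction is \<open>(lambda / s) * eq + v\<close>, where eq is the unscaled gradient
  error and v contains the error only through s. The projection makes its product with the
  displacement at most - d^2 / eta; removing v by Young leaves half of this, so the displacement
  moves against eq up to a multiple of eta * s * |v|^2. The constant is (1/2) / lt times 1/2, since
  s is at least 1/2 and lambda at most lt.\<close>

lemma lin_drift:
 "e \<bullet> (((1 / lt) *\<^sub>R nx j (x, e), 0) - ((1 / lt) *\<^sub>R x, 0))
   \<le> - (1 / (4 * lt)) * (norm (nx j (x, e) - x))\<^sup>2 / et (Suc j) + et (Suc j) * rr (e \<bullet> (0, 1 / ws))"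
proof -
 define h d \<Delta> where "h = et (Suc j)" and "d = norm (nx j (x, e) - x)" and "\<Delta> = nx j (x, e) - x"
 define s where "s = gb x + snd e / ws"
 define v where "v = (snd x / s) *\<^sub>R qb x + (0, ln s + \<rho>)"
 define eq where "eq = (1 / lt) *\<^sub>R fst e"
 \<comment> \<open>Fourth root of s: \<open>ln s = 4 * ln w\<close> is at most \<open>8 * w\<close>
   in absolute value for s at least 1/2, so |v|^2 is of order sqrt s.\<close>
 define w where "w = sqrt (sqrt s)"
 define a where "a = norm v"
 have h: "0 < h" unfolding h_def by (rule et_pos)
 have s: "1/2 \<le> s" unfolding s_def by (rule s_half)
 have sx: "0 < snd x" "lam0 \<le> snd x" "snd x \<le> lt" using XD[OF x] by auto
 have w4: "w ^ 4 = s" "w\<^sup>2 = sqrt s" "0 < w"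
 proof -
  show "0 < w" "w\<^sup>2 = sqrt s" unfolding w_def using s by auto
  moreover have "w ^ 4 = (w\<^sup>2)\<^sup>2" by (simp add: power4_eq_xxxx power2_eq_square)
  ultimately show "w ^ 4 = s" using s by simp
 qed
 have w2: "1/2 \<le> w"
 proof (rule ccontr)
  assume "\<not> 1/2 \<le> w"
  hence "w ^ 4 < (1/2) ^ 4" using w4(3) by (intro power_strict_mono) auto
  thus False using w4(1) s by (simp add: power4_eq_xxxx)
 qed
 have lns: "\<bar>ln s\<bar> \<le> 8 * w"
 proof -
  have e4: "ln s = 4 * ln w" unfolding w4(1)[symmetric] using w4(3) by (simp add: ln_realpow)
  have "ln w \<le> w - 1" using w4(3) by (rule ln_le_minus_one)
  moreover have "- ln w \<le> 1 / w - 1" using ln_le_minus_one[of "1 / w"] w4(3) by (simp add: ln_div)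
  moreover have "1 / w \<le> 2" using w2 w4(3) by (simp add: divide_le_eq)
  ultimately show ?thesis unfolding e4 using w2 by simp
 qed
 have a: "a \<le> (2 * M0 + 8) * w"
 proof -
  have "a \<le> norm ((snd x / s) *\<^sub>R qb x) + norm ((0::'a, ln s + \<rho>))" unfolding a_def v_def by (rule norm_triangle_ineq)
  also have "norm ((snd x / s) *\<^sub>R qb x) \<le> (lt / (1/2)) * Lg"
   unfolding norm_scaleR using sx s qb_norm[OF x] lt_pos by (intro mult_mono) (auto intro!: frac_le[of lt, where w = "1/2", simplified])
  also have "norm ((0::'a, ln s + \<rho>)) \<le> 8 * w + \<rho>" using lns rho_pos by (simp add: norm_Pair)
  finally have "a \<le> M0 + 8 * w" unfolding M0_def by simp
  moreover have "M0 \<le> 2 * M0 * w" using mult_left_mono[OF w2, of "2 * M0"] M0_nn by simp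
  ultimately show ?thesis by (simp add: algebra_simps)
 qed
 have zeq: "zc (x, e) = (snd x / s) *\<^sub>R eq + v" unfolding zc_def zd_def v_def s_def eq_def by (simp add: algebra_simps)
 have "v \<bullet> \<Delta> \<ge> - (a * d)" using Cauchy_Schwarz_ineq2[of v \<Delta>] unfolding a_def d_def \<Delta>_def by linarith
 moreover have "a * d \<le> d\<^sup>2 / (2 * h) + h / 2 * a\<^sup>2"
 proof -
  have "0 \<le> (d - h * a)\<^sup>2 / (2 * h)" using h by simp
  also have "\<dots> = d\<^sup>2 / (2 * h) + h / 2 * a\<^sup>2 - a * d" using h by (simp add: field_simps power2_eq_square)
  finally show ?thesis by simp
 qed
 moreover have "zc (x, e) \<bullet> \<Delta> \<le> - d\<^sup>2 / h" unfolding d_def \<Delta>_def h_def by (rule z_dx)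
 moreover have "zc (x, e) \<bullet> \<Delta> = snd x / s * (eq \<bullet> \<Delta>) + v \<bullet> \<Delta>" unfolding zeq by (simp add: inner_add_left)
 moreover have "d\<^sup>2 / (2 * h) = 1/2 * (d\<^sup>2 / h)" "- d\<^sup>2 / h = - (d\<^sup>2 / h)" by simp_all
 ultimately have b: "snd x / s * (eq \<bullet> \<Delta>) \<le> - (1/2 * (d\<^sup>2 / h)) + h / 2 * a\<^sup>2" by linarith
 have "eq \<bullet> \<Delta> = s / snd x * (snd x / s * (eq \<bullet> \<Delta>))" using s sx by simp
 also have "\<dots> \<le> s / snd x * (- (1/2 * (d\<^sup>2 / h)) + h / 2 * a\<^sup>2)" using b s sx by (intro mult_left_mono) auto
 also have "\<dots> = - (s / snd x * (1/2 * (d\<^sup>2 / h))) + h * (s / snd x * a\<^sup>2 / 2)" by (simp add: algebra_simps)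
 also have "\<dots> \<le> - ((1/2) / lt * (1/2 * (d\<^sup>2 / h))) + h * rr (e \<bullet> (0, 1 / ws))"
 proof (intro add_mono le_imp_neg_le mult_mono mult_left_mono)
  show "1 / 2 / lt \<le> s / snd x" using s sx by (intro frac_le) auto
  have Y: "s \<le> e \<bullet> (0, 1 / ws) + Gm" "e \<bullet> (0, 1 / ws) = snd e / ws" unfolding s_def using gb_bd(2)[OF x] by (auto simp: inner_prod_def)
  have "s / snd x * a\<^sup>2 / 2 \<le> s / lam0 * ((2 * M0 + 8) * w)\<^sup>2 / 2"
   using sx s a lam0_pos unfolding a_def by (intro divide_right_mono mult_mono frac_le power_mono) auto
  also have "\<dots> = (2 * M0 + 8)\<^sup>2 / (2 * lam0) * (s * sqrt s)" unfolding power_mult_distrib w4(2) by (simp add: mult_ac)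
  also have "\<dots> \<le> rr (e \<bullet> (0, 1 / ws))" unfolding rr_def using Y(1) s lam0_pos by (intro mult_left_mono mult_mono) auto
  finally show "s / snd x * a\<^sup>2 / 2 \<le> rr (e \<bullet> (0, 1 / ws))" .
 qed (use h s sx in auto)
 finally have "eq \<bullet> \<Delta> \<le> - (1 / (4 * lt)) * d\<^sup>2 / h + h * rr (e \<bullet> (0, 1 / ws))" by simp
 moreover have "e \<bullet> (((1 / lt) *\<^sub>R nx j (x, e), 0) - ((1 / lt) *\<^sub>R x, 0)) = eq \<bullet> \<Delta>"
  unfolding eq_def \<Delta>_def by (simp add: inner_prod_def[of e] scaleR_diff_right[symmetric])
 ultimately show ?thesis unfolding h_def d_def by simp
qed

end

lemma rr_growth:
 assumes "0 < \<delta>"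
 shows "\<exists>K. \<forall>y\<ge>-1/2. rr y \<le> \<delta> * y\<^sup>2 + K"
proof -
 define K1 where "K1 = (2 * M0 + 8)\<^sup>2 / (2 * lam0)"
 have K1: "0 \<le> K1" unfolding K1_def using lam0_pos by simp
 define d where "d = \<delta> / (2 * (K1 + 1))"
 have d: "0 < d" unfolding d_def using assms K1 by simp
 have Kd: "K1 * d \<le> \<delta> / 2"
 proof -
  have "K1 * d \<le> (K1 + 1) * d" using d by (intro mult_right_mono) auto
  also have "\<dots> = \<delta> / 2" unfolding d_def using K1 by (simp add: field_simps)
  finally show ?thesis .
 qed
 have cub: "t ^ 3 \<le> d * t ^ 4 + 1 / d ^ 3" if "0 \<le> t" for t :: real
 proof (cases "1 \<le> d * t")
  case True
  have "t ^ 3 * 1 \<le> t ^ 3 * (d * t)" using True that by (intro mult_left_mono) auto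
  also have "\<dots> = d * t ^ 4" by (simp add: power3_eq_cube power4_eq_xxxx)
  finally show ?thesis using d by (simp add: add_increasing2)
 next
  case False
  hence "t \<le> 1 / d" using d by (simp add: field_simps)
  hence "t ^ 3 \<le> (1 / d) ^ 3" using that by (intro power_mono) auto
  thus ?thesis using d that by (simp add: power_divide add_increasing)
 qed
 show ?thesis
 proof (intro exI[of _ "\<delta> * Gm\<^sup>2 + K1 * (1 / d ^ 3)"] allI impI)
  fix y :: real assume y: "-1/2 \<le> y"
  define Z where "Z = y + Gm"
  have Z: "0 \<le> Z" unfolding Z_def using y Gm_ge by linarith
  have "Z * sqrt Z = sqrt Z ^ 3" "sqrt Z ^ 4 = Z\<^sup>2" using Z by (simp_all add: power3_eq_cube power4_eq_xxxx power2_eq_square)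
  hence "Z * sqrt Z \<le> d * Z\<^sup>2 + 1 / d ^ 3" using cub[of "sqrt Z"] Z by simp
  hence "rr y \<le> K1 * (d * Z\<^sup>2 + 1 / d ^ 3)" unfolding rr_def K1_def[symmetric] Z_def[symmetric] using K1 by (intro mult_left_mono)
  also have "\<dots> = (K1 * d) * Z\<^sup>2 + K1 * (1 / d ^ 3)" by (simp add: algebra_simps)
  also have "(K1 * d) * Z\<^sup>2 \<le> \<delta> / 2 * (2 * (y\<^sup>2 + Gm\<^sup>2))"
  proof (rule mult_mono[OF Kd])
   show "Z\<^sup>2 \<le> 2 * (y\<^sup>2 + Gm\<^sup>2)" using sum_squares_bound[of y Gm] unfolding Z_def by (simp add: power2_sum)
  qed (use assms in auto)
  finally show "rr y \<le> \<delta> * y\<^sup>2 + (\<delta> * Gm\<^sup>2 + K1 * (1 / d ^ 3))" by (simp add: algebra_simps)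
 qed
qed

lemma Yi_lip: "i < n \<Longrightarrow> x \<in> X \<Longrightarrow> y \<in> X \<Longrightarrow> norm (Yi i x - Yi i y) \<le> LF * norm (x - y)"
proof -
 assume i: "i < n" and x: "x \<in> X" and y: "y \<in> X"
 have "norm (Yi i x - Yi i y) \<le> norm (lt *\<^sub>R (gr i x - gr i y)) + norm (ws * (gi l i x - gi l i y))"
  using sqrt_sum_squares_le_sum[of "norm (lt *\<^sub>R (gr i x - gr i y))" "norm (ws * (gi l i x - gi l i y))"]
  unfolding Yi_def by (simp add: norm_Pair scaleR_diff_right[symmetric] right_diff_distrib[symmetric] del: real_norm_def norm_scaleR)
 also have "\<dots> = lt * norm (gr i x - gr i y) + ws * \<bar>gi l i x - gi l i y\<bar>" using lt_pos ws_pos by (simp add: abs_mult)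
 also have "\<dots> \<le> lt * (Ln * norm (x - y)) + ws * (Lg * norm (x - y))"
  using gr_lip[OF i x y] gi_lip[OF i x y] lt_pos ws_pos by (intro add_mono mult_left_mono) auto
 also have "\<dots> = (lt * Lg\<^sup>2 + Lg + lt * Ln) * norm (x - y)" unfolding ws_def by (simp add: algebra_simps power2_eq_square)
 also have "\<dots> \<le> LF * norm (x - y)" using LF_ge(2) Lg_nn by (intro mult_right_mono) auto
 finally show ?thesis .
qed

lemma Yi_bd: "i < n \<Longrightarrow> x \<in> X \<Longrightarrow> norm (Yi i x) \<le> lt * Lg + ws * Gm"
proof -
 assume i: "i < n" and x: "x \<in> X"
 have "norm (Yi i x) \<le> norm (lt *\<^sub>R gr i x) + norm (ws * gi l i x)"
  using sqrt_sum_squares_le_sum[of "norm (lt *\<^sub>R gr i x)" "norm (ws * gi l i x)"] unfolding Yi_def by (simp add: norm_Pair)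
 also have "\<dots> = lt * norm (gr i x) + ws * \<bar>gi l i x\<bar>" using lt_pos ws_pos by (simp add: abs_mult)
 also have "\<dots> \<le> lt * Lg + ws * Gm" using gr_norm[OF i x] gi_bd[OF i x] lt_pos ws_pos by (intro add_mono mult_left_mono) auto
 finally show ?thesis .
qed

lemma lin_lip': "norm (((1 / lt) *\<^sub>R x, 0::real) - ((1 / lt) *\<^sub>R y, 0)) = 1 / lt * norm (x - y)" for x y :: "'a \<times> real"
 using lt_pos by (simp add: norm_Pair scaleR_diff_right[symmetric])

text \<open>dir extracts s - g from e, and lin pairs the iterate with the gradient component, where
  the factor 1 / lt undoes its scaling. The additional 1 in the last constant lets it serve both as
  a bound and as a Lipschitz constant of lin.\<close>

sublocale st: storm n X Yi nx "\<lambda>j. et (Suc j)" "\<lambda>j. be (Suc j)" Fo "(0, 1 / ws)" "\<lambda>x. ((1 / lt) *\<^sub>R x, 0)" rr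
 "2 * R + 2 * lt" LF "lt * Lg + ws * Gm" cc "kk / (om + \<sigma>2) powr (1/3)" "kk / \<sigma>2 powr (1/3)" "\<sigma>2 / (kk * (rt 0)\<^sup>2)"
 "lam0 * \<rho>" "lt * (C / lam0) + lt * \<rho>" GF "GF + 4" "1 / (4 * lt)" "1 / lt * (R + lt + 1)"
proof
 obtain x0 where x0: "x0 \<in> X" using X_ne by blast
 have R0: "0 \<le> R" using A_a[OF XD(1)[OF x0]] norm_ge_zero[of "fst x0"] by linarith
 show "0 < n" by (rule n0)
 show "norm (x - y) \<le> 2 * R + 2 * lt" if "x \<in> X" "y \<in> X" for x y by (rule X_diam[OF that])
 show "nx t (x, e) \<in> X" for t x e by (rule nx_in)
 show "norm (Yi i x - Yi i y) \<le> LF * norm (x - y)" if "i < n" "x \<in> X" "y \<in> X" for i x y by (rule Yi_lip[OF that])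
 show "norm (Yi i x) \<le> lt * Lg + ws * Gm" if "i < n" "x \<in> X" for i x by (rule Yi_bd[OF that])
 show "1 \<le> LF" by (rule LF_ge)
 show "0 \<le> lt * Lg + ws * Gm" using lt_pos Lg_nn ws_pos Gm_ge by (intro add_nonneg_nonneg mult_nonneg_nonneg) auto
 show "130 * LF\<^sup>2 \<le> cc" by (rule cc_ge)
 show "0 < kk / (om + \<sigma>2) powr (1/3)" using kk_pos om_pos s2 by simp
 show "0 \<le> \<sigma>2 / (kk * (rt 0)\<^sup>2)" using kk_pos s2 by simp
 show "0 \<le> 2 * R + 2 * lt" using R0 lt_pos by simp
 show "kk / (om + \<sigma>2) powr (1/3) * (real t + 1) powr (-1/3) \<le> et (Suc t)" for t by (rule et_lo)
 show "et (Suc t) \<le> kk / \<sigma>2 powr (1/3) * (real t + 1) powr (-1/3)" for t by (rule et_hi)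
 show "et (Suc (Suc t)) \<le> et (Suc t)" for t by (rule et_dec)
 show "et (Suc s) \<le> 2 * et (Suc t)" if "t \<le> 2 * s + 1" for s t by (rule et_half[OF that])
 show "et (Suc t) - et (Suc (Suc t)) \<le> \<sigma>2 / (kk * (rt 0)\<^sup>2) * (et (Suc t))\<^sup>2" for t by (rule et_diff)
 show "be (Suc t) = cc * (et (Suc t))\<^sup>2" for t by (rule be_def)
 show "be (Suc t) \<le> 1" for t by (rule be_le1)
 show "0 < lam0 * \<rho>" using lam0_pos rho_pos by simp
 show "lam0 * \<rho> \<le> Fo x \<and> Fo x \<le> lt * (C / lam0) + lt * \<rho>" if "x \<in> X" for x using Fo_bd[OF that] by blast
 show "\<bar>Fo x - Fo y\<bar> \<le> GF * norm (x - y)" if "x \<in> X" "y \<in> X" for x y unfolding GF_def by (rule Fo_lip[OF that])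
 show "0 \<le> GF" by (rule GF_nn)
 show "0 \<le> GF + 4" using GF_nn by simp
 show "0 < 1 / (4 * lt)" using lt_pos by simp
 show "0 \<le> 1 / lt * (R + lt + 1)" using lt_pos R0 by simp
 show "norm (nx t (x, e) - x) \<le> et (Suc t) * (GF + 4) * (1 + norm e)" if "x \<in> X" "- 1/2 < e \<bullet> (0, 1 / ws)" for t x e
  by (rule dx_le[OF that])
 show "Fo (nx t (x, e)) \<le> Fo x - 3/8 * (norm (nx t (x, e) - x))\<^sup>2 / et (Suc t) + 4 * et (Suc t) * (norm e)\<^sup>2" if "x \<in> X" "- 1/2 < e \<bullet> (0, 1 / ws)" for t x e
  by (rule descent[OF that])
 show "e \<bullet> (((1 / lt) *\<^sub>R nx t (x, e), 0) - ((1 / lt) *\<^sub>R x, 0)) \<le> - (1 / (4 * lt)) * (norm (nx t (x, e) - x))\<^sup>2 / et (Suc t) + et (Suc t) * rr (e \<bullet> (0, 1 / ws))"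
  if "x \<in> X" "- 1/2 < e \<bullet> (0, 1 / ws)" for t x e by (rule lin_drift[OF that])
 show "\<exists>K. \<forall>y\<ge>-1/2. rr y \<le> \<delta> * y\<^sup>2 + K" if "0 < \<delta>" for \<delta> by (rule rr_growth[OF that])
 show "norm ((1 / lt) *\<^sub>R x, 0::real) \<le> 1 / lt * (R + lt + 1)" if "x \<in> X" for x
 proof -
  have "norm x \<le> norm (fst x) + norm (snd x)" using sqrt_sum_squares_le_sum[of "norm (fst x)" "norm (snd x)"] by (cases x) (simp add: norm_Pair)
  hence "norm x \<le> R + lt + 1" using A_a[OF XD(1)[OF that]] XD(3,4)[OF that] by simp
  hence "1 / lt * norm x \<le> 1 / lt * (R + lt + 1)" using lt_pos by (intro mult_left_mono) auto
  thus ?thesis using lt_pos by (simp add: norm_Pair)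
 qed
 show "norm (((1 / lt) *\<^sub>R x, 0::real) - ((1 / lt) *\<^sub>R y, 0)) \<le> 1 / lt * (R + lt + 1) * norm (x - y)" if "x \<in> X" "y \<in> X" for x y
  unfolding lin_lip' using lt_pos R0 by (intro mult_right_mono) (auto simp: field_simps)
qed

end

section \<open>Averaging over the draws\<close>

definition draws :: "nat \<Rightarrow> nat \<Rightarrow> nat list set" where
 "draws n T = {xs. length xs = T \<and> set xs \<subseteq> {..<n}}"

lemma card_draws: "card (draws n T) = n ^ T"
proof -
 have "draws n T = {xs. set xs \<subseteq> {..<n} \<and> length xs = T}" unfolding draws_def by auto
 thus ?thesis using card_lists_length_eq[of "{..<n}" T] by simp
qed

text \<open>The last entry is split off because draws are consumed from front to back: it enters
  only the last step.\<close>

lemma sum_draws_Suc: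
 fixes f :: "nat list \<Rightarrow> real"
 shows "(\<Sum>xs\<in>draws n (Suc T). f xs) = (\<Sum>xs\<in>draws n T. \<Sum>i<n. f (xs @ [i]))"
proof -
 have "(\<Sum>xs\<in>draws n T. \<Sum>i<n. f (xs @ [i])) = (\<Sum>(xs, i)\<in>draws n T \<times> {..<n}. f (xs @ [i]))"
  by (rule sum.cartesian_product)
 also have "\<dots> = (\<Sum>xs\<in>draws n (Suc T). f xs)"
 proof (rule sum.reindex_bij_witness[where i = "\<lambda>xs. (butlast xs, last xs)" and j = "\<lambda>(xs, i). xs @ [i]"])
  show "f (case a of (xs, i) \<Rightarrow> xs @ [i]) = (case a of (xs, i) \<Rightarrow> f (xs @ [i]))" for a by (cases a) simp
  show "(butlast b, last b) \<in> draws n T \<times> {..<n}" if "b \<in> draws n (Suc T)" for b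
  proof -
   have "b \<noteq> []" using that unfolding draws_def by auto
   hence "last b \<in> set b" by simp
   moreover have "set (butlast b) \<subseteq> set b" by (auto dest: in_set_butlastD)
   ultimately show ?thesis using that unfolding draws_def by auto
  qed
  show "(case (butlast b, last b) of (xs, i) \<Rightarrow> xs @ [i]) = b" if "b \<in> draws n (Suc T)" for b
  proof -
   have "b \<noteq> []" using that unfolding draws_def by auto
   thus ?thesis by simp
  qed
 qed (auto simp: draws_def)
 finally show ?thesis ..
qed

context dro_run begin

text \<open>State k in error coordinates, determined by the draws 0 to k: (v, u) is compared with
  the mean gradient qb, s with the mean gb.\<close>

definition run :: "('a \<times> real) \<Rightarrow> (nat \<Rightarrow> nat) \<Rightarrow> nat \<Rightarrow> ('a \<times> real) \<times> (('a \<times> real) \<times> real)" where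
 "run x1 idx k = (case ascdro n l \<rho> X et be x1 idx k of (x, v, u, s) \<Rightarrow> (x, (lt *\<^sub>R ((v, u) - qb x), ws * (s - gb x))))"

lemma Ybar_eq: "st.Ybar x = (lt *\<^sub>R qb x, ws * gb x)"
proof -
 have f: "fst (\<Sum>i<n. Yi i x) = (\<Sum>i<n. lt *\<^sub>R gr i x)" "snd (\<Sum>i<n. Yi i x) = (\<Sum>i<n. ws * gi l i x)"
  unfolding fst_sum snd_sum Yi_def by simp_all
 have "fst (st.Ybar x) = lt *\<^sub>R qb x"
  unfolding st.Ybar_def fst_scaleR f(1) qb_def by (simp only: scaleR_sum_right[symmetric] scaleR_scaleR mult.commute)
 moreover have "snd (st.Ybar x) = ws * gb x"
  unfolding st.Ybar_def snd_scaleR f(2) gb_mean by (simp add: sum_distrib_left[symmetric])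
 ultimately show ?thesis by (simp only: prod_eq_iff fst_conv snd_conv)
qed

lemma run_fst: "fst (run x1 idx k) = fst (ascdro n l \<rho> X et be x1 idx k)"
 unfolding run_def by (simp split: prod.split)

lemma run_0:
 assumes "x1 \<in> X" "idx 0 < n"
 shows "run x1 idx 0 = (x1, Yi (idx 0) x1 - st.Ybar x1)"
 unfolding run_def Ybar_eq Yi_def
 by (simp add: Let_def grad_gi[OF assms(2,1)] scaleR_diff_right right_diff_distrib prod_eq_iff)

lemma nx_run:
 assumes "ascdro n l \<rho> X et be x1 idx k = (x, v, u, s)"
 shows "nx k (run x1 idx k) = closest_point X (x - et (Suc k) *\<^sub>R ((snd x / s) *\<^sub>R v, snd x / s * u + ln s + \<rho>))"
proof -
 have r: "run x1 idx k = (x, (lt *\<^sub>R ((v, u) - qb x), ws * (s - gb x)))" unfolding run_def assms by simp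
 have q: "qb x + (1 / lt) *\<^sub>R (lt *\<^sub>R ((v, u) - qb x)) = (v, u)" using lt_pos by simp
 have g: "gb x + ws * (s - gb x) / ws = s" using ws_pos by simp
 show ?thesis unfolding r nx_def zc_def fst_conv snd_conv q g zd_def by (simp add: add.assoc)
qed

lemma run_Suc:
 assumes x: "fst (run x1 idx k) \<in> X" and i: "idx (Suc k) < n"
 shows "run x1 idx (Suc k) = st.step k (run x1 idx k) (idx (Suc k))"
proof -
 obtain y v u s where a: "ascdro n l \<rho> X et be x1 idx k = (y, v, u, s)" by (cases "ascdro n l \<rho> X et be x1 idx k") auto
 have y: "y \<in> X" using x unfolding run_fst a by simp
 define y' where "y' = nx k (run x1 idx k)"
 have y': "y' \<in> X" unfolding y'_def by (rule nx_in)
 have r: "run x1 idx k = (y, (lt *\<^sub>R ((v, u) - qb y), ws * (s - gb y)))" unfolding run_def a by simp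
 define b where "b = be (Suc k)"
 define j where "j = idx (Suc k)"
 note gg = grad_gi[OF i y] grad_gi[OF i y']
 have a': "ascdro n l \<rho> X et be x1 idx (Suc k) =
  (y', fst (gr j y') + (1 - b) *\<^sub>R (v - fst (gr j y)), snd (gr j y') + (1 - b) * (u - snd (gr j y)), gi l j y' + (1 - b) * (s - gi l j y))"
  unfolding ascdro.simps a Let_def prod.case nx_run[OF a, symmetric] y'_def[symmetric] gg b_def j_def by simp
 have vu: "(fst (gr j y') + (1 - b) *\<^sub>R (v - fst (gr j y)), snd (gr j y') + (1 - b) * (u - snd (gr j y))) = gr j y' + (1 - b) *\<^sub>R ((v, u) - gr j y)"
  by (simp add: prod_eq_iff)
 have "run x1 idx (Suc k) = (y', (lt *\<^sub>R (gr j y' + (1 - b) *\<^sub>R ((v, u) - gr j y) - qb y'), ws * (gi l j y' + (1 - b) * (s - gi l j y) - gb y')))"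
  unfolding run_def a' prod.case vu ..
 also have "\<dots> = st.step k (run x1 idx k) j"
  unfolding st.step_def st.xi_def y'_def[symmetric] b_def[symmetric] unfolding r Ybar_eq Yi_def
  by (simp add: scaleR_add_right scaleR_diff_right scaleR_left_diff_distrib algebra_simps)
 finally show ?thesis unfolding j_def .
qed

lemma ascdro_cong:
 "(\<And>j. j \<le> k \<Longrightarrow> idx j = idx' j) \<Longrightarrow> ascdro n l \<rho> X et be x1 idx k = ascdro n l \<rho> X et be x1 idx' k"
proof (induction k)
 case (Suc k)
 have "ascdro n l \<rho> X et be x1 idx k = ascdro n l \<rho> X et be x1 idx' k" using Suc by simp
 moreover have "idx (Suc k) = idx' (Suc k)" using Suc.prems by simp
 ultimately show ?case by (simp only: ascdro.simps)
qed (simp add: Let_def)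

lemma run_append: "k < length xs \<Longrightarrow> run x1 (\<lambda>k. (xs @ ys) ! k) k = run x1 (\<lambda>k. xs ! k) k"
 unfolding run_def by (subst ascdro_cong[where idx' = "\<lambda>k. xs ! k"]) (auto simp: nth_append)

lemma run_X:
 assumes "x1 \<in> X"
 shows "fst (run x1 idx k) \<in> X"
proof (cases k)
 case 0 thus ?thesis using assms unfolding run_fst by (simp add: Let_def)
next
 case (Suc j)
 obtain x v u s where a: "ascdro n l \<rho> X et be x1 idx j = (x, v, u, s)" by (cases "ascdro n l \<rho> X et be x1 idx j") auto
 have "fst (run x1 idx k) = nx j (run x1 idx j)" unfolding Suc run_fst nx_run[OF a] by (simp add: a Let_def)
 thus ?thesis using nx_in by simp
qed

lemma run_S: "x1 \<in> X \<Longrightarrow> run x1 idx k \<in> st.S"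
 using run_X[of x1 idx k] unfolding st.S_def by (cases "run x1 idx k") auto

lemma ascdro_x_Suc: "ascdro_x n l \<rho> X et be x1 idx (Suc (Suc k)) = nx k (run x1 idx k)"
proof -
 obtain x v u s where a: "ascdro n l \<rho> X et be x1 idx k = (x, v, u, s)" by (cases "ascdro n l \<rho> X et be x1 idx k") auto
 show ?thesis unfolding ascdro_x_def nx_run[OF a] by (simp add: a Let_def)
qed

definition start :: "'a \<times> real \<Rightarrow> nat \<Rightarrow> ('a \<times> real) \<times> (('a \<times> real) \<times> real)" where
 "start x1 i = (x1, Yi i x1 - st.Ybar x1)"

text \<open>Removing the last draw replaces phi by its one-step average \<open>A k phi\<close>;
  hence phi has to stay arbitrary in the induction.\<close>

lemma sum_run_last:
 assumes x1: "x1 \<in> X"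
 shows "(\<Sum>xs\<in>draws n (Suc k). \<phi> (run x1 (\<lambda>k. xs ! k) k)) = real n ^ Suc k * avg n (\<lambda>i. st.pr 0 k \<phi> (start x1 i))"
proof (induction k arbitrary: \<phi>)
 case 0
 have d0: "draws n 0 = {[]}" unfolding draws_def by auto
 have "(\<Sum>xs\<in>draws n (Suc 0). \<phi> (run x1 (\<lambda>k. xs ! k) 0)) = (\<Sum>i<n. \<phi> (run x1 (\<lambda>k. [i] ! k) 0))" unfolding sum_draws_Suc d0 by simp
 also have "\<dots> = (\<Sum>i<n. \<phi> (start x1 i))" unfolding start_def using run_0[OF x1] by (intro sum.cong) auto
 finally show ?case using n0 unfolding avg_def by simp
next
 case (Suc k)
 have "(\<Sum>xs\<in>draws n (Suc (Suc k)). \<phi> (run x1 (\<lambda>k. xs ! k) (Suc k)))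
   = (\<Sum>xs\<in>draws n (Suc k). \<Sum>i<n. \<phi> (run x1 (\<lambda>k. (xs @ [i]) ! k) (Suc k)))" by (rule sum_draws_Suc)
 also have "\<dots> = (\<Sum>xs\<in>draws n (Suc k). real n * st.A k \<phi> (run x1 (\<lambda>k. xs ! k) k))"
 proof (rule sum.cong[OF refl])
  fix xs assume "xs \<in> draws n (Suc k)"
  hence len: "length xs = Suc k" unfolding draws_def by simp
  have "\<phi> (run x1 (\<lambda>k. (xs @ [i]) ! k) (Suc k)) = \<phi> (st.step k (run x1 (\<lambda>k. xs ! k) k) i)" if "i < n" for i
  proof -
   have nth: "(xs @ [i]) ! Suc k = i" using len by (simp add: nth_append)
   have "run x1 (\<lambda>k. (xs @ [i]) ! k) (Suc k) = st.step k (run x1 (\<lambda>k. (xs @ [i]) ! k) k) ((xs @ [i]) ! Suc k)"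
    by (rule run_Suc[OF run_X[OF x1]]) (use nth that in simp)
   thus ?thesis unfolding nth run_append[of k xs x1 "[i]", unfolded len, OF lessI] by simp
  qed
  hence "(\<Sum>i<n. \<phi> (run x1 (\<lambda>k. (xs @ [i]) ! k) (Suc k))) = (\<Sum>i<n. \<phi> (st.step k (run x1 (\<lambda>k. xs ! k) k) i))" by simp
  thus "(\<Sum>i<n. \<phi> (run x1 (\<lambda>k. (xs @ [i]) ! k) (Suc k))) = real n * st.A k \<phi> (run x1 (\<lambda>k. xs ! k) k)"
   unfolding st.A_def avg_def using n0 by simp
 qed
 also have "\<dots> = real n * (real n ^ Suc k * avg n (\<lambda>i. st.pr 0 k (st.A k \<phi>) (start x1 i)))"
  unfolding sum_distrib_left[symmetric] Suc.IH ..
 also have "st.pr 0 k (st.A k \<phi>) = st.pr 0 (Suc k) \<phi>"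
  using st.pr_plus[of 0 k 1 \<phi>] by (intro ext) simp
 finally show ?case by simp
qed

text \<open>Draws after the k-th do not influence state k and contribute a factor n each.\<close>

lemma sum_run:
 assumes x1: "x1 \<in> X" and k: "k < T"
 shows "(\<Sum>xs\<in>draws n T. \<phi> (run x1 (\<lambda>k. xs ! k) k)) = real n ^ T * avg n (\<lambda>i. st.pr 0 k \<phi> (start x1 i))"
 using k
proof (induction T)
 case (Suc T)
 show ?case
 proof (cases "k = T")
  case True thus ?thesis using sum_run_last[OF x1] by simp
 next
  case False
  hence kT: "k < T" using Suc.prems by simp
  have "(\<Sum>xs\<in>draws n (Suc T). \<phi> (run x1 (\<lambda>k. xs ! k) k)) = (\<Sum>xs\<in>draws n T. \<Sum>i<n. \<phi> (run x1 (\<lambda>k. (xs @ [i]) ! k) k))" by (rule sum_draws_Suc)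
  also have "\<dots> = (\<Sum>xs\<in>draws n T. \<Sum>i<n. \<phi> (run x1 (\<lambda>k. xs ! k) k))"
   by (intro sum.cong refl arg_cong[where f = \<phi>] run_append) (use kT in \<open>auto simp: draws_def\<close>)
  also have "\<dots> = real n * (\<Sum>xs\<in>draws n T. \<phi> (run x1 (\<lambda>k. xs ! k) k))" by (simp add: sum_distrib_left)
  finally show ?thesis using Suc.IH[OF kT] by simp
 qed
qed simp

lemma ereal_sq_le: "0 \<le> a \<Longrightarrow> a \<le> ereal b \<Longrightarrow> b\<^sup>2 \<le> d \<Longrightarrow> a\<^sup>2 \<le> ereal d" for a :: ereal
proof -
 assume a: "0 \<le> a" "a \<le> ereal b" and d: "b\<^sup>2 \<le> d"
 obtain r where r: "a = ereal r" using a by (cases a) auto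
 have "r\<^sup>2 \<le> b\<^sup>2" using a unfolding r by (intro power_mono) auto
 thus ?thesis unfolding r using d by simp
qed

lemma dist0_nonneg: "0 \<le> dist0 A"
 unfolding dist0_def by (rule INF_greatest) simp

lemma stat_gen: "x \<in> X \<Longrightarrow> (dist0 (regular_subdiff (Fbar n l \<rho> X) x))\<^sup>2 \<le> ereal (GF\<^sup>2)"
proof -
 assume x: "x \<in> X"
 have "dist0 (regular_subdiff (Fbar n l \<rho> X) x) \<le> ereal (norm (gF x + 0))" by (rule dist0_le[OF x]) simp
 thus ?thesis by (rule ereal_sq_le[OF dist0_nonneg]) (use gF_norm[OF x] in \<open>auto simp: GF_def intro: power_mono\<close>)
qed

text \<open>The subgradient at the new iterate x' is gF(x') plus the normal vector left by the
  projection. This equals the change of gF, minus the direction error, minus the displacement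
  divided by eta; the change of gF is at most dx / eta because eta * LF is at most 1. In a dead
  state the gradient bound GF suffices.\<close>

lemma stat_step:
 assumes S: "sg \<in> st.S"
 shows "(dist0 (regular_subdiff (Fbar n l \<rho> X) (nx k sg)))\<^sup>2 \<le> ereal ((GF\<^sup>2 + 16) * st.cost k sg)"
proof (cases "st.alive (1/2) sg")
 case False
 have "(dist0 (regular_subdiff (Fbar n l \<rho> X) (nx k sg)))\<^sup>2 \<le> ereal (GF\<^sup>2)" by (rule stat_gen[OF nx_in])
 also have "\<dots> \<le> ereal ((GF\<^sup>2 + 16) * st.cost k sg)" unfolding st.cost_def using False by simp
 finally show ?thesis .
next
 case True
 obtain x e where sg: "sg = (x, e)" by (cases sg)
 have x: "x \<in> X" using S unfolding sg st.S_def by auto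
 have al: "- 1/2 < e \<bullet> (0, 1 / ws)" using True unfolding st.alive_def st.es_def sg by simp
 define h d where "h = et (Suc k)" and "d = norm (nx k (x, e) - x)"
 have h: "0 < h" unfolding h_def by (rule et_pos)
 define m where "m = norm (fst e) + \<bar>snd e\<bar>"
 define \<nu> where "\<nu> = - zc (x, e) - (1 / h) *\<^sub>R (nx k (x, e) - x)"
 have "dist0 (regular_subdiff (Fbar n l \<rho> X) (nx k (x, e))) \<le> ereal (norm (gF (nx k (x, e)) + \<nu>))"
  unfolding \<nu>_def h_def by (rule dist0_le[OF nx_in proj[OF x al]])
 moreover have "norm (gF (nx k (x, e)) + \<nu>) \<le> 2 * (d / h + m)"
 proof -
  have "gF (nx k (x, e)) + \<nu> = (gF (nx k (x, e)) - gF x) + (- (zc (x, e) - gF x)) + (- ((1 / h) *\<^sub>R (nx k (x, e) - x)))"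
   unfolding \<nu>_def by simp
  also have "norm \<dots> \<le> norm (gF (nx k (x, e)) - gF x) + norm (- (zc (x, e) - gF x)) + norm (- ((1 / h) *\<^sub>R (nx k (x, e) - x)))"
   by (intro norm_triangle_le add_mono norm_triangle_ineq order_refl)
  also have "\<dots> = norm (gF (nx k (x, e)) - gF x) + norm (zc (x, e) - gF x) + d / h"
   unfolding norm_minus_cancel d_def using h by simp
  also have "\<dots> \<le> 1 / h * d + 2 * m + d / h"
  proof (intro add_mono order_refl)
   have "norm (gF (nx k (x, e)) - gF x) \<le> LF * d" unfolding d_def by (rule gF_lip[OF nx_in x])
   also have "\<dots> \<le> 1 / h * d" using et_LF(1)[of "Suc k"] unfolding h_def d_def by (intro mult_right_mono) auto
   finally show "norm (gF (nx k (x, e)) - gF x) \<le> 1 / h * d" .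
   show "norm (zc (x, e) - gF x) \<le> 2 * m" unfolding m_def by (rule z_close[OF x al])
  qed
  finally show ?thesis by simp
 qed
 ultimately have "dist0 (regular_subdiff (Fbar n l \<rho> X) (nx k (x, e))) \<le> ereal (2 * (d / h + m))" by (meson ereal_less_eq(3) order_trans)
 hence "(dist0 (regular_subdiff (Fbar n l \<rho> X) (nx k (x, e))))\<^sup>2 \<le> ereal ((GF\<^sup>2 + 16) * st.cost k sg)"
 proof (rule ereal_sq_le[OF dist0_nonneg])
  have W: "st.W sg = (norm e)\<^sup>2" unfolding st.W_def sg by simp
  have c: "st.cost k sg = (d / h)\<^sup>2 + (norm e)\<^sup>2" unfolding st.cost_def W using True unfolding st.dx_def sg d_def h_def by (simp add: power_divide)
  have "(2 * (a + b))\<^sup>2 \<le> 16 * (a\<^sup>2 + w)" if "b\<^sup>2 \<le> 2 * w" for a b w :: real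
  proof -
   have "(2 * (a + b))\<^sup>2 = 4 * (a\<^sup>2 + b\<^sup>2 + 2 * a * b)" by (simp add: power_mult_distrib power2_sum)
   also have "\<dots> \<le> 4 * (a\<^sup>2 + 2 * w + (a\<^sup>2 + 2 * w))" using that sum_squares_bound[of a b] by (intro mult_left_mono) auto
   also have "\<dots> = 8 * a\<^sup>2 + 16 * w" by simp
   also have "\<dots> \<le> 16 * (a\<^sup>2 + w)" by simp
   finally show ?thesis .
  qed
  hence "(2 * (d / h + m))\<^sup>2 \<le> 16 * ((d / h)\<^sup>2 + (norm e)\<^sup>2)" using pair_norm_sum(2)[of e] unfolding m_def by blast
  also have "\<dots> \<le> (GF\<^sup>2 + 16) * ((d / h)\<^sup>2 + (norm e)\<^sup>2)" by (intro mult_right_mono) auto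
  finally show "(2 * (d / h + m))\<^sup>2 \<le> (GF\<^sup>2 + 16) * st.cost k sg" unfolding c .
 qed
 thus ?thesis unfolding sg .
qed

theorem stationarity_bound:
 assumes x1: "x1 \<in> X"
 shows "\<exists>K. \<forall>T::nat. T \<ge> 2 \<longrightarrow> expected_stationarity n l \<rho> X et be x1 T \<le> ereal (K * ln (real T) / real T powr (2/3))"
proof -
 define B where "B = lt * Lg + ws * Gm"
 have st: "start x1 i \<in> st.S" "norm (snd (start x1 i)) \<le> 2 * B" if "i < n" for i
 proof -
  show "start x1 i \<in> st.S" unfolding start_def st.S_def using x1 by simp
  have "norm (Yi i x1 - st.Ybar x1) \<le> B + B"
   unfolding B_def by (rule order_trans[OF norm_triangle_ineq4 add_mono[OF Yi_bd[OF that x1] st.Ybar_norm[OF x1]]])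
  thus "norm (snd (start x1 i)) \<le> 2 * B" unfolding start_def by simp
 qed
 have B0: "0 \<le> 2 * B" using st(2)[OF n0] norm_ge_zero[of "snd (start x1 0)"] by linarith
 have "0 \<le> 2 * \<sigma>2 / kk ^ 3" using s2 kk_pos by simp
 from st.main_sum[OF et_inv_diff this B0]
 obtain K where K: "0 \<le> K" and main: "\<And>T sg. 1 \<le> T \<Longrightarrow> sg \<in> st.S \<Longrightarrow> norm (snd sg) \<le> 2 * B \<Longrightarrow> (\<Sum>k<T. st.pr 0 k (st.cost k) sg) \<le> K * real T powr (1/3)"
  by blast
 define Q where "Q = GF\<^sup>2 + (GF\<^sup>2 + 16) * K"
 have Q: "0 \<le> Q" unfolding Q_def using K by (intro add_nonneg_nonneg mult_nonneg_nonneg) auto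
 have "expected_stationarity n l \<rho> X et be x1 T \<le> ereal (Q / ln 2 * ln (real T) / real T powr (2/3))" if T: "2 \<le> T" for T
 proof -
  obtain T' where T': "T = Suc T'" "1 \<le> T'" using T by (cases T) auto
  \<comment> \<open>tau = 1 is the given starting point, which no step precedes; for tau at least 2
    the point is the successor of state tau - 2.\<close>
  define b where "b xs \<tau> = (if \<tau> = 1 then GF\<^sup>2 else (GF\<^sup>2 + 16) * st.cost (\<tau> - 2) (run x1 (\<lambda>k. xs ! k) (\<tau> - 2)))" for xs \<tau>
  have le: "(dist0 (regular_subdiff (Fbar n l \<rho> X) (ascdro_x n l \<rho> X et be x1 (\<lambda>k. xs ! k) \<tau>)))\<^sup>2 \<le> ereal (b xs \<tau>)" if "\<tau> \<in> {1..T}" for xs \<tau>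
  proof (cases "\<tau> = 1")
   case True
   have "ascdro_x n l \<rho> X et be x1 (\<lambda>k. xs ! k) \<tau> = x1" unfolding ascdro_x_def True by (simp add: Let_def)
   thus ?thesis using stat_gen[OF x1] True unfolding b_def by simp
  next
   case False
   define k where "k = \<tau> - 2"
   have k: "\<tau> = Suc (Suc k)" unfolding k_def using that False by auto
   have "run x1 (\<lambda>k. xs ! k) k \<in> st.S" by (rule run_S[OF x1])
   from stat_step[OF this, of k] show ?thesis unfolding k ascdro_x_Suc b_def by simp
  qed
  have bs: "(\<Sum>\<tau>\<in>{1..T}. b xs \<tau>) = GF\<^sup>2 + (\<Sum>k<T'. (GF\<^sup>2 + 16) * st.cost k (run x1 (\<lambda>k. xs ! k) k))" for xs
  proof -
   have "{1..T} = insert 1 ((\<lambda>k. Suc (Suc k)) ` {..<T'})"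
   proof (intro set_eqI iffI)
    fix \<tau> assume t: "\<tau> \<in> {1..T}"
    show "\<tau> \<in> insert 1 ((\<lambda>k. Suc (Suc k)) ` {..<T'})"
    proof (cases "\<tau> = 1")
     case False
     hence "\<tau> = Suc (Suc (\<tau> - 2))" "\<tau> - 2 < T'" using t T' by auto
     thus ?thesis by blast
    qed simp
   qed (use T' in auto)
   moreover have "1 \<notin> (\<lambda>k. Suc (Suc k)) ` {..<T'}" by auto
   ultimately have "(\<Sum>\<tau>\<in>{1..T}. b xs \<tau>) = b xs 1 + (\<Sum>\<tau>\<in>(\<lambda>k. Suc (Suc k)) ` {..<T'}. b xs \<tau>)" by simp
   also have "(\<Sum>\<tau>\<in>(\<lambda>k. Suc (Suc k)) ` {..<T'}. b xs \<tau>) = (\<Sum>k<T'. b xs (Suc (Suc k)))" by (subst sum.reindex) (auto simp: inj_on_def)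
   finally show ?thesis unfolding b_def by simp
  qed
  define M where "M = (\<Sum>xs\<in>draws n T. \<Sum>\<tau>\<in>{1..T}. b xs \<tau>)"
  have pT: "real n ^ T > 0" using n0 by simp
  have M: "M \<le> real n ^ T * (Q * real T powr (1/3))"
  proof -
   have "M = real n ^ T * GF\<^sup>2 + (GF\<^sup>2 + 16) * (\<Sum>k<T'. \<Sum>xs\<in>draws n T. st.cost k (run x1 (\<lambda>k. xs ! k) k))"
    unfolding M_def bs sum.distrib sum_distrib_left[symmetric] by (subst sum.swap) (simp add: card_draws)
   also have "(\<Sum>k<T'. \<Sum>xs\<in>draws n T. st.cost k (run x1 (\<lambda>k. xs ! k) k)) = (\<Sum>k<T'. real n ^ T * avg n (\<lambda>i. st.pr 0 k (st.cost k) (start x1 i)))"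
    by (intro sum.cong refl sum_run[OF x1]) (use T' in auto)
   also have "\<dots> = real n ^ T * avg n (\<lambda>i. \<Sum>k<T'. st.pr 0 k (st.cost k) (start x1 i))"
    unfolding avg_def sum_distrib_left[symmetric] sum_divide_distrib[symmetric] by (subst sum.swap) simp
   also have "real n ^ T * GF\<^sup>2 + (GF\<^sup>2 + 16) * (real n ^ T * avg n (\<lambda>i. \<Sum>k<T'. st.pr 0 k (st.cost k) (start x1 i)))
     \<le> real n ^ T * GF\<^sup>2 + (GF\<^sup>2 + 16) * (real n ^ T * (K * real T' powr (1/3)))"
    using main[OF T'(2) st] pT by (intro add_left_mono mult_left_mono avg_le n0) auto
   also have "\<dots> = real n ^ T * (GF\<^sup>2 * 1 + (GF\<^sup>2 + 16) * K * real T' powr (1/3))" by (simp add: algebra_simps)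
   also have "\<dots> \<le> real n ^ T * (GF\<^sup>2 * real T powr (1/3) + (GF\<^sup>2 + 16) * K * real T powr (1/3))"
    using pT K T T' by (intro mult_left_mono add_mono powr_mono2 ge_one_powr_ge_zero mult_nonneg_nonneg) auto
   finally show ?thesis unfolding Q_def by (simp add: algebra_simps)
  qed
  have "expected_stationarity n l \<rho> X et be x1 T
    = ereal (1 / (real n ^ T * real T)) * (\<Sum>xs\<in>draws n T. \<Sum>\<tau>\<in>{1..T}. (dist0 (regular_subdiff (Fbar n l \<rho> X) (ascdro_x n l \<rho> X et be x1 (\<lambda>k. xs ! k) \<tau>)))\<^sup>2)"
   unfolding expected_stationarity_def draws_def ..
  also have "\<dots> \<le> ereal (1 / (real n ^ T * real T)) * (\<Sum>xs\<in>draws n T. \<Sum>\<tau>\<in>{1..T}. ereal (b xs \<tau>))"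
  proof (rule ereal_mult_left_mono)
   show "0 \<le> ereal (1 / (real n ^ T * real T))" unfolding zero_ereal_def ereal_less_eq(3) by simp
  qed (intro sum_mono le)
  also have "\<dots> = ereal (M / (real n ^ T * real T))" unfolding M_def by simp
  also have "\<dots> \<le> ereal (Q / ln 2 * ln (real T) / real T powr (2/3))"
  proof -
   have T0: "0 < real T" using T by simp
   have "M / (real n ^ T * real T) \<le> (real n ^ T * (Q * real T powr (1/3))) / (real n ^ T * real T)"
    using M pT T0 by (intro divide_right_mono) auto
   also have "\<dots> = Q * (real T powr (1/3) / real T powr 1)" using pT T0 by simp
   also have "\<dots> = Q * 1 / real T powr (2/3)" unfolding powr_diff[symmetric] using powr_minus_divide[of "real T" "2/3"] by simp
   \<comment> \<open>The bound reached is of order T^(-2/3); as T is at least 2, the factor ln T /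
     ln 2 is at least 1 and may be inserted.\<close>
   also have "\<dots> \<le> Q * (ln (real T) / ln 2) / real T powr (2/3)"
    using Q T by (intro divide_right_mono mult_left_mono) auto
   finally show ?thesis by simp
  qed
  finally show ?thesis .
 qed
 thus ?thesis by blast
qed

end

theorem theorem2:
  fixes l :: "nat \<Rightarrow> 'a::euclidean_space \<Rightarrow> real"
    and W :: "'a set" and n :: nat
    and lam0 \<rho> R G C L \<Delta> sg2 sng2 \<alpha> :: real
    and x1 :: "'a \<times> real"
  assumes n_pos: "n \<ge> 1"
    and W_ne: "W \<noteq> {}" and W_closed: "closed W" and W_convex: "convex W"
    and l_diff: "\<And>i w. i < n \<Longrightarrow> l i differentiable (at w)"
    and l_diff2: "\<And>i w. i < n \<Longrightarrow> grad (l i) differentiable (at w)"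
    and l_nonneg: "\<And>i w. i < n \<Longrightarrow> w \<in> W \<Longrightarrow> l i w \<ge> 0"
    and lam0_pos: "lam0 > 0" and rho_pos: "\<rho> > 0"
    and A_a: "\<And>w. w \<in> W \<Longrightarrow> norm w \<le> R"
    and A_b1: "\<And>i w. i < n \<Longrightarrow> w \<in> W \<Longrightarrow> norm (grad (l i) w) \<le> G"
    and A_b2: "\<And>i w. i < n \<Longrightarrow> w \<in> W \<Longrightarrow> \<bar>l i w\<bar> \<le> C"
    and A_c: "\<And>i w1 w2. i < n \<Longrightarrow> w1 \<in> W \<Longrightarrow> w2 \<in> W \<Longrightarrow>
               norm (grad (l i) w1 - grad (l i) w2) \<le> L * norm (w1 - w2)"
    and x1_in: "x1 \<in> Xset W lam0 (lam_tilde lam0 C \<rho>)"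
    and A_d: "\<And>w lam. w \<in> W \<Longrightarrow> lam \<ge> lam0 \<Longrightarrow>
               Fobj n l \<rho> x1 - Fobj n l \<rho> (w, lam) \<le> \<Delta>"
    and B_g: "\<And>x. x \<in> Xset W lam0 (lam_tilde lam0 C \<rho>) \<Longrightarrow>
               (\<Sum>i<n. \<bar>gi l i x - gbar n l x\<bar>^2) / real n \<le> sg2"
    and B_ng: "\<And>x. x \<in> Xset W lam0 (lam_tilde lam0 C \<rho>) \<Longrightarrow>
               (\<Sum>i<n. (norm (grad (gi l i) x - grad (gbar n l) x))^2) / real n \<le> sng2"
    and sigma_pos: "max sg2 sng2 > 0"
    and alpha_gt: "\<alpha> > 1"
  shows "let \<sigma>2 = max sg2 sng2;
             LF = L_F lam0 C G L \<rho>;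
             k = \<alpha> * \<sigma>2 powr (1/3) / LF;
             \<omega> = max (2 * \<sigma>2) ((16 * LF^2 * k)^3);
             c = \<sigma>2 / (14 * LF * k^3) + 130 * LF^4;
             \<eta> = (\<lambda>t::nat. k / (\<omega> + real t * \<sigma>2) powr (1/3));
             \<beta> = (\<lambda>t::nat. c * (\<eta> t)^2);
             X = Xset W lam0 (lam_tilde lam0 C \<rho>)
         in \<exists>K::real. \<forall>T::nat. T \<ge> 2 \<longrightarrow>
              expected_stationarity n l \<rho> X \<eta> \<beta> x1 T
                \<le> ereal (K * ln (real T) / real T powr (2/3))"
proof -
  interpret dro_run l W n lam0 \<rho> R G C L "max sg2 sng2" \<alpha>
    by unfold_locales (fact n_pos W_ne W_closed W_convex l_diff l_nonneg lam0_pos rho_pos A_a A_b1 A_b2 A_c sigma_pos alpha_gt)+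
  have "x1 \<in> X" unfolding X_def lt_def by (rule x1_in)
  from stationarity_bound[OF this] show ?thesis
    unfolding Let_def be_def[abs_def] et_def[abs_def] cc_def om_def kk_def X_def lt_def LF_def .
qed

end
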